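(* Let $1\le k\le n-1$, $\alpha>\frac1k$, and let $\psi$ be a positive smooth function on $\mathbb{S}^n$. Let $M_t$, $t\in[0,T)$, be a smooth, uniformly convex solution of the normalised flow (see context) with initial hypersurface $M_0$. Then there exist constants $C>0$ and $\gamma\in(0,1)$, depending on $n$, $k$, $M_0$, $\min\psi$ and $\|\psi\|_{C^1}$ (with $\alpha$ fixed), such that the support function $u(\cdot,t)$ of $M_t$ satisfies $$\frac{|\nabla u|^2}{u^{\gamma}}\le C\qquad\text{on }\mathbb{S}^n\times[0,T).$$
   Context: $g$, $\nabla$, $d\mu$ are the standard metric, Levi-Civita connection and volume measure on $\mathbb{S}^n$. The support function of a convex hypersurface $\mathcal{M}\subset\mathbb{R}^{n+1}$ is $u(x)=\max_{X\in\mathcal{M}}\langle X,x\rangle$, $x\in\mathbb{S}^n$. For a uniformly convex (all principal curvatures positive) closed hypersurface, the principal radii of curvature $\lambda$ are the eigenvalues of $\nabla^2u+ug$, which is positive-definite. $\sigma_k$ is the $k$-th elementary symmetric polynomial (of eigenvalues, for a matrix). The normalised flow is $$\partial_tX=\psi(\nu)\,\sigma_k(\lambda)^{\alpha}\,\nu-\eta(t)X,\qquad \eta(t)=\frac{1}{|\mathbb{S}^n|}\int_{\mathbb{S}^n}\psi\,\sigma_k(\nabla^2u+ug)^{1+\alpha}\,d\mu,$$ with $\nu$ the unit outward normal; equivalently, the support function satisfies $\partial_tu=\psi\,\sigma_k(\nabla^2u+ug)^{\alpha}-\eta(t)u$ on $\mathbb{S}^n$. The initial hypersurface $M_0$ is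 smooth, closed, uniformly convex, encloses the origin in its interior, and is normalised so that $\int_{\mathbb{S}^n}u\,\sigma_k(\nabla^2u+ug)\,d\mu=|\mathbb{S}^n|$ (this identity is then preserved along the flow). *)

theory Defs
  imports "HOL-Analysis.Analysis"
begin

section \<open>Smooth maps\<close>

text \<open>In finite dimension, \<open>f\<close> is \<open>C\<^sup>m\<^sup>+\<^sup>1\<close> on an open set iff it is differentiable there
  and all its directional derivatives are \<open>C\<^sup>m\<close>.\<close>

primrec Cm_on :: "nat \<Rightarrow> 'a::euclidean_space set \<Rightarrow> ('a \<Rightarrow> 'b::real_normed_vector) \<Rightarrow> bool" where
  "Cm_on 0 U f \<longleftrightarrow> continuous_on U f"
| "Cm_on (Suc m) U f \<longleftrightarrow> (\<forall>x\<in>U. f differentiable (at x)) \<and>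
     (\<forall>v. Cm_on m U (\<lambda>x. frechet_derivative f (at x) v))"

text \<open>On an arbitrary set (here a sphere, or a sphere times a time interval including its
  initial time) smoothness means existence of local smooth extensions.\<close>

definition smooth_on :: "'a::euclidean_space set \<Rightarrow> ('a \<Rightarrow> 'b::real_normed_vector) \<Rightarrow> bool" where
  "smooth_on S f \<longleftrightarrow> (\<forall>x\<in>S. \<exists>U g. open U \<and> x \<in> U \<and> (\<forall>m. Cm_on m U g) \<and> (\<forall>y\<in>S \<inter> U. g y = f y))"

section \<open>Calculus on the unit sphere\<close>

text \<open>With \<open>DIM('a) = n + 1\<close>, the set \<open>usphere :: 'a set\<close> is the unit \<open>n\<close>-sphere.
  Functions on it are functions on \<open>'a\<close> of which only the values on the sphere are used.\<close>

abbreviation usphere :: "'a::euclidean_space set" where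
  "usphere \<equiv> sphere 0 1"

definition tangent :: "'a::euclidean_space \<Rightarrow> 'a set" where
  "tangent x = {v. v \<bullet> x = 0}"

text \<open>The differential of \<open>f\<close> at a point \<open>x\<close> of the sphere, applied to a tangent vector \<open>v\<close>.
  Since \<open>sgn y = y /\<^sub>R norm y\<close>, it is computed through the extension of \<open>f\<close> which is constant
  along rays; it vanishes on the normal direction.\<close>

definition sph_deriv :: "('a::euclidean_space \<Rightarrow> 'b::real_normed_vector) \<Rightarrow> 'a \<Rightarrow> 'a \<Rightarrow> 'b" where
  "sph_deriv f x v = frechet_derivative (\<lambda>y. f (sgn y)) (at x) v"

definition sph_grad :: "('a::euclidean_space \<Rightarrow> real) \<Rightarrow> 'a \<Rightarrow> 'a" where
  "sph_grad f x = (\<Sum>b\<in>Basis. sph_deriv f x b *\<^sub>R b)"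

text \<open>The Levi-Civita connection of the induced metric: \<open>\<nabla>\<^sub>v W\<close> at \<open>x\<close> is the tangential part
  of the Euclidean derivative of the tangent field \<open>W\<close> in direction \<open>v\<close>.\<close>

definition sph_connection :: "('a::euclidean_space \<Rightarrow> 'a) \<Rightarrow> 'a \<Rightarrow> 'a \<Rightarrow> 'a" where
  "sph_connection W x v = sph_deriv W x v - (sph_deriv W x v \<bullet> x) *\<^sub>R x"

text \<open>The symmetric form \<open>\<nabla>\<^sup>2u + u g\<close> at \<open>x\<close>, as a self-adjoint endomorphism of the tangent
  space by means of \<open>g\<close>.\<close>

definition radii_op :: "('a::euclidean_space \<Rightarrow> real) \<Rightarrow> 'a \<Rightarrow> 'a \<Rightarrow> 'a" where
  "radii_op u x v = sph_connection (sph_grad u) x v + u x *\<^sub>R v"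

definition elem_sym :: "nat \<Rightarrow> 'i set \<Rightarrow> ('i \<Rightarrow> real) \<Rightarrow> real" where
  "elem_sym k I l = (\<Sum>J\<in>{J. J \<subseteq> I \<and> card J = k}. \<Prod>i\<in>J. l i)"

text \<open>The eigenvalues of \<open>\<nabla>\<^sup>2u + u g\<close> at \<open>x\<close> listed with multiplicity: \<open>(r, j)\<close> for
  \<open>j = 0, \<dots>, mult(r) - 1\<close>. Geometric multiplicity is the right one, the operator being
  self-adjoint; if \<open>r\<close> is not an eigenvalue, its eigenspace has dimension \<open>0\<close> and there is no
  entry \<open>(r, j)\<close>.\<close>

definition principal_radii :: "('a::euclidean_space \<Rightarrow> real) \<Rightarrow> 'a \<Rightarrow> (real \<times> nat) set" where
  "principal_radii u x = {(r, j). j < dim {v \<in> tangent x. radii_op u x v = r *\<^sub>R v}}"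

definition sigma_radii :: "nat \<Rightarrow> ('a::euclidean_space \<Rightarrow> real) \<Rightarrow> 'a \<Rightarrow> real" where
  "sigma_radii k u x = elem_sym k (principal_radii u x) fst"

text \<open>The standard measure of the unit sphere: the measure of a Borel set \<open>A\<close> is \<open>DIM('a)\<close> times
  the Lebesgue measure of the cone over \<open>A\<close> with apex \<open>0\<close>.\<close>

definition sphere_measure :: "'a::euclidean_space measure" where
  "sphere_measure = scale_measure (of_nat DIM('a))
     (distr (restrict_space lborel (cball 0 1 - {0})) (restrict_space borel usphere) sgn)"

definition sphere_area :: "'a::euclidean_space itself \<Rightarrow> real" where
  "sphere_area _ = measure (sphere_measure :: 'a measure) usphere"

definition C1_norm :: "('a::euclidean_space \<Rightarrow> real) \<Rightarrow> real" where
  "C1_norm f = (SUP x\<in>usphere. \<bar>f x\<bar>) + (SUP x\<in>usphere. norm (sph_grad f x))"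

section \<open>Uniformly convex hypersurfaces\<close>

definition support_fun :: "'a::euclidean_space set \<Rightarrow> 'a \<Rightarrow> real" where
  "support_fun M x = (SUP y\<in>M. y \<bullet> x)"

text \<open>The sphere being compact, an injective immersion is an embedding.\<close>

definition smooth_embedding :: "('a::euclidean_space \<Rightarrow> 'a) \<Rightarrow> bool" where
  "smooth_embedding F \<longleftrightarrow> smooth_on usphere F \<and> inj_on F usphere \<and>
     (\<forall>p\<in>usphere. \<forall>v\<in>tangent p. v \<noteq> 0 \<longrightarrow> sph_deriv F p v \<noteq> 0)"

text \<open>The unit normal at \<open>F p\<close> of the convex hypersurface parametrised by \<open>F\<close>, pointing away
  from the side on which the hypersurface lies.\<close>

definition outward_normal :: "('a::euclidean_space \<Rightarrow> 'a) \<Rightarrow> 'a \<Rightarrow> 'a" where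
  "outward_normal F p = (THE \<nu>. norm \<nu> = 1 \<and> (\<forall>v\<in>tangent p. sph_deriv F p v \<bullet> \<nu> = 0) \<and>
     (\<forall>q\<in>usphere. (F q - F p) \<bullet> \<nu> \<le> 0))"

text \<open>Principal curvatures are the eigenvalues of the Weingarten map \<open>dF v \<mapsto> d\<nu> v\<close>; round spheres
  have positive ones.\<close>

definition principal_curvature :: "('a::euclidean_space \<Rightarrow> 'a) \<Rightarrow> 'a \<Rightarrow> real \<Rightarrow> bool" where
  "principal_curvature F p \<kappa> \<longleftrightarrow>
     (\<exists>v\<in>tangent p. v \<noteq> 0 \<and> sph_deriv (outward_normal F) p v = \<kappa> *\<^sub>R sph_deriv F p v)"

text \<open>A closed convex hypersurface bounds a convex body, necessarily its convex hull; being
  diffeomorphic to a sphere, it may be parametrised by one.\<close>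

definition uniformly_convex_embedding :: "('a::euclidean_space \<Rightarrow> 'a) \<Rightarrow> bool" where
  "uniformly_convex_embedding F \<longleftrightarrow> smooth_embedding F \<and>
     F ` usphere = frontier (convex hull (F ` usphere)) \<and>
     (\<forall>p\<in>usphere. \<forall>\<kappa>. principal_curvature F p \<kappa> \<longrightarrow> \<kappa> > 0)"

definition uniformly_convex_hypersurface :: "'a::euclidean_space set \<Rightarrow> bool" where
  "uniformly_convex_hypersurface M \<longleftrightarrow> (\<exists>F. uniformly_convex_embedding F \<and> M = F ` usphere)"

section \<open>The normalised flow\<close>

text \<open>The interval \<open>[0, T)\<close>, where \<open>T = \<infinity>\<close> is allowed.\<close>

definition time_interval :: "ereal \<Rightarrow> real set" where
  "time_interval T = {t. 0 \<le> t \<and> ereal t < T}"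

definition flow_eta :: "nat \<Rightarrow> real \<Rightarrow> ('a::euclidean_space \<Rightarrow> real) \<Rightarrow> ('a \<Rightarrow> real) \<Rightarrow> real" where
  "flow_eta k \<alpha> \<psi> u =
     (LINT x|sphere_measure. \<psi> x * sigma_radii k u x powr (1 + \<alpha>)) / sphere_area TYPE('a)"

text \<open>The hypersurface at time \<open>t\<close> is \<open>X t ` usphere\<close>. Its principal radii at the point \<open>X t p\<close>
  are those computed from the support function at the outward unit normal \<open>\<nu>\<close> there.
  At \<open>t = 0\<close> the time derivative is one-sided.\<close>

definition normalised_flow ::
    "nat \<Rightarrow> real \<Rightarrow> ('a::euclidean_space \<Rightarrow> real) \<Rightarrow> ereal \<Rightarrow> (real \<Rightarrow> 'a \<Rightarrow> 'a) \<Rightarrow> bool" where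
  "normalised_flow k \<alpha> \<psi> T X \<longleftrightarrow>
     smooth_on (usphere \<times> time_interval T) (\<lambda>(p, t). X t p) \<and>
     (\<forall>t\<in>time_interval T. uniformly_convex_embedding (X t)) \<and>
     (\<forall>t\<in>time_interval T. \<forall>p\<in>usphere.
        let u = support_fun (X t ` usphere); \<nu> = outward_normal (X t) p in
        ((\<lambda>s. X s p) has_vector_derivative
           (\<psi> \<nu> * sigma_radii k u \<nu> powr \<alpha>) *\<^sub>R \<nu> - flow_eta k \<alpha> \<psi> u *\<^sub>R X t p)
          (at t within time_interval T))"

end

theory Submission
  imports Defs
begin

text \<open>Let \<open>q = |\<nabla>u|\<^sup>2\<close>, \<open>\<gamma> = 1/(n+2)\<close> and let \<open>b\<close> be a large constant. Suppose that the maximum over the sphere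
  of \<open>max (q / u\<^sup>\<gamma>) (b u\<^sup>2\<^sup>-\<^sup>\<gamma>)\<close> reaches a large constant for the first time. If \<open>q / u\<^sup>\<gamma>\<close> attains it, then
  \<open>q \<ge> b u\<^sup>2\<close> there, and the maximum principle shows that \<open>q / u\<^sup>\<gamma>\<close> is strictly decreasing in time.
  Otherwise \<open>u\<close> attains its maximum \<open>R\<close>, and \<open>q \<le> b R\<^sup>2\<^sup>-\<^sup>\<gamma> u\<^sup>\<gamma>\<close> forces the body to contain a ball of radius
  comparable to \<open>R\<close>. The Minkowski identities relative to the centre of this ball bound the integral of \<open>\<sigma>\<^sub>k\<close>
  from below by a multiple of \<open>R\<^sup>k\<close>, so that \<open>\<eta>\<close> is at least a multiple of \<open>R\<^bsup>k(1+\<alpha>)\<^esup>\<close>, while \<open>\<sigma>\<^sub>k\<^sup>\<alpha>\<close> is at most a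
  multiple of \<open>R\<^bsup>k\<alpha>\<^esup>\<close> at the maximum point of \<open>u\<close>. Hence \<open>u\<close> is strictly decreasing in time there. Both cases
  contradict the choice of the time. The support function is differentiated through its gradient, the position
  vector as a function of the normal, which is smooth by the inverse function theorem.\<close>

section \<open>Calculus of smooth maps\<close>

text \<open>The obstacle is that no upper bound for \<open>u\<close> is available in advance. The
  maximum principle for q / u^\<gamma> absorbs its lower order terms only where q dominates u^2. The
  competitor b u^(2-\<gamma>) = b u^2 / u^\<gamma> turns the remaining case into a statement about
  \<open>u\<close> alone: it increases with \<open>u\<close>, so \<open>u\<close> itself is maximal
  there, with a gradient bound in terms of that maximum. The normalising factor, an average over the
  whole hypersurface, then has to beat a speed at one point, and an inradius is what makes the
  average large. The exponent comes from summing second order inequalities over n principal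
  directions: the coefficient of q / u^2 has the right sign once \<gamma> (1 + n/2) < 1, and 1/(n+2)
  makes the left side 1/2. Covariant calculus is replaced by Euclidean calculus for the extension of
  \<open>u\<close> of degree one. Its Hessian kills the radial direction and restricts to \<nabla>^2
  u + u g on the tangent space, and its third derivative is symmetric, so that no curvature terms
  appear.\<close>

lemma Cm_on_differentiable: "Cm_on (Suc m) U f \<Longrightarrow> x \<in> U \<Longrightarrow> f differentiable (at x)"
  by simp

lemma Cm_on_Suc_frechet: "Cm_on (Suc m) U f \<Longrightarrow> Cm_on m U (\<lambda>x. frechet_derivative f (at x) v)"
  by simp

lemma Cm_on_has_derivative:
  "Cm_on (Suc m) U f \<Longrightarrow> x \<in> U \<Longrightarrow> (f has_derivative frechet_derivative f (at x)) (at x)"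
  using Cm_on_differentiable frechet_derivative_works by blast

lemma Cm_on_continuous: "Cm_on m U f \<Longrightarrow> continuous_on U f"
proof (cases m)
  case (Suc k)
  assume "Cm_on m U f"
  then show ?thesis
    unfolding Suc
    by (meson Cm_on_differentiable continuous_at_imp_continuous_on differentiable_imp_continuous_within)
qed auto

lemma Cm_on_subset: "Cm_on m U f \<Longrightarrow> V \<subseteq> U \<Longrightarrow> Cm_on m V f"
proof (induction m arbitrary: f)
  case 0 then show ?case by (auto intro: continuous_on_subset)
next
  case (Suc m) then show ?case by (auto simp: subset_iff)
qed

lemma Cm_on_Suc_lower: "Cm_on (Suc m) U f \<Longrightarrow> Cm_on m U f"
proof (induction m arbitrary: f)
  case 0 then show ?case using Cm_on_continuous by fastforce
next
  case (Suc m) then show ?case by (metis Cm_on.simps(2))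
qed

lemma Cm_on_cong:
  assumes "open U" "\<And>x. x \<in> U \<Longrightarrow> f x = g x" "Cm_on m U f"
  shows "Cm_on m U g"
  using assms(2,3)
proof (induction m arbitrary: f g)
  case 0 then show ?case using continuous_on_eq by fastforce
next
  case (Suc m)
  have fr: "frechet_derivative f (at x) = frechet_derivative g (at x)" if "x \<in> U" for x
    using Suc.prems that assms(1) by (intro frechet_derivative_transform_within_open) auto
  have "g differentiable (at x)" if "x \<in> U" for x
  proof -
    have "(f has_derivative frechet_derivative f (at x)) (at x)"
      using Cm_on_has_derivative[OF Suc.prems(2) that] .
    then have "(g has_derivative frechet_derivative f (at x)) (at x)"
      using Suc.prems(1) that assms(1) has_derivative_transform_within_open by blast
    then show ?thesis by (auto simp: differentiable_def)
  qed
  moreover have "Cm_on m U (\<lambda>x. frechet_derivative g (at x) v)" for v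
    using Suc.IH[of "\<lambda>x. frechet_derivative f (at x) v" "\<lambda>x. frechet_derivative g (at x) v"]
      fr Cm_on_Suc_frechet[OF Suc.prems(2)] by auto
  ultimately show ?case by simp
qed

text \<open>Derivatives at points of an open set are unique, so one computed by hand can replace the
  chosen \<open>frechet_derivative\<close>.\<close>

lemma Cm_on_SucI:
  assumes "open U" "\<And>x. x \<in> U \<Longrightarrow> (f has_derivative f' x) (at x)" "\<And>v. Cm_on m U (\<lambda>x. f' x v)"
  shows "Cm_on (Suc m) U f"
proof -
  have "f' x = frechet_derivative f (at x)" if "x \<in> U" for x
    using assms(2)[OF that] frechet_derivative_at by blast
  then have "Cm_on m U (\<lambda>x. frechet_derivative f (at x) v)" for v
    using Cm_on_cong[OF assms(1) _ assms(3)[of v]] by simp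
  then show ?thesis using assms(2) by (auto simp: differentiable_def)
qed

lemma Cm_on_local:
  assumes "\<And>x. x \<in> U \<Longrightarrow> \<exists>V. open V \<and> x \<in> V \<and> Cm_on m V f"
  shows "Cm_on m U f"
  using assms
proof (induction m arbitrary: f)
  case 0
  have "isCont f x" if "x \<in> U" for x
    using 0[OF that] continuous_on_eq_continuous_at by auto
  then show ?case by (simp add: continuous_at_imp_continuous_on)
next
  case (Suc m)
  have "f differentiable (at x)" if "x \<in> U" for x
    using Suc.prems[OF that] by auto
  moreover have "Cm_on m U (\<lambda>x. frechet_derivative f (at x) v)" for v
    by (rule Suc.IH) (use Suc.prems in fastforce)
  ultimately show ?case by simp
qed

lemma Cm_on_const [simp]: "open U \<Longrightarrow> Cm_on m U (\<lambda>x. c)"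
proof (induction m arbitrary: c)
  case (Suc m) then show ?case
    by (intro Cm_on_SucI[where f'="\<lambda>x v. 0"]) auto
qed simp

lemma Cm_on_bounded_linear:
  assumes "bounded_linear L" "open U" shows "Cm_on m U L"
proof (cases m)
  case 0 then show ?thesis
    using assms linear_continuous_on by auto
next
  case (Suc k) then show ?thesis
    using assms by (simp del: Cm_on.simps) (intro Cm_on_SucI[where f'="\<lambda>x. L"];
        auto simp: bounded_linear_imp_has_derivative)
qed

lemma Cm_on_id [simp]: "open U \<Longrightarrow> Cm_on m U (\<lambda>x. x)"
  by (rule Cm_on_bounded_linear[OF bounded_linear_ident])

lemma Cm_on_fst [simp]: "open U \<Longrightarrow> Cm_on m U fst"
  by (rule Cm_on_bounded_linear[OF bounded_linear_fst])

lemma Cm_on_snd [simp]: "open U \<Longrightarrow> Cm_on m U snd"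
  by (rule Cm_on_bounded_linear[OF bounded_linear_snd])

lemma Cm_on_linear_compose:
  assumes L: "bounded_linear L" and "open U" "Cm_on m U f"
  shows "Cm_on m U (\<lambda>x. L (f x))"
  using assms(3)
proof (induction m arbitrary: f)
  case 0 then show ?case
    by (simp add: L bounded_linear.continuous_on)
next
  case (Suc m)
  show ?case
  proof (rule Cm_on_SucI[where f'="\<lambda>x v. L (frechet_derivative f (at x) v)"])
    show "((\<lambda>x. L (f x)) has_derivative (\<lambda>v. L (frechet_derivative f (at x) v))) (at x)" if "x \<in> U" for x
      using bounded_linear.has_derivative[OF L Cm_on_has_derivative[OF Suc.prems that]] .
    show "Cm_on m U (\<lambda>x. L (frechet_derivative f (at x) v))" for v
      by (rule Suc.IH) (rule Cm_on_Suc_frechet[OF Suc.prems])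
  qed (rule assms)
qed

lemma Cm_on_add:
  assumes "open U" "Cm_on m U f" "Cm_on m U g"
  shows "Cm_on m U (\<lambda>x. f x + g x)"
  using assms(2,3)
proof (induction m arbitrary: f g)
  case 0 then show ?case by (simp add: continuous_on_add)
next
  case (Suc m)
  show ?case
  proof (rule Cm_on_SucI[where f'="\<lambda>x v. frechet_derivative f (at x) v + frechet_derivative g (at x) v"])
    show "((\<lambda>x. f x + g x) has_derivative (\<lambda>v. frechet_derivative f (at x) v + frechet_derivative g (at x) v)) (at x)"
      if "x \<in> U" for x
      using has_derivative_add[OF Cm_on_has_derivative[OF Suc.prems(1) that] Cm_on_has_derivative[OF Suc.prems(2) that]] .
    show "Cm_on m U (\<lambda>x. frechet_derivative f (at x) v + frechet_derivative g (at x) v)" for v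
      by (rule Suc.IH) (rule Cm_on_Suc_frechet[OF Suc.prems(1)], rule Cm_on_Suc_frechet[OF Suc.prems(2)])
  qed (rule assms)
qed

lemma Cm_on_sum:
  assumes "open U" "\<And>i. i \<in> I \<Longrightarrow> Cm_on m U (f i)"
  shows "Cm_on m U (\<lambda>x. \<Sum>i\<in>I. f i x)"
  using assms(2)
  by (induction I rule: infinite_finite_induct) (auto intro!: Cm_on_add assms(1) Cm_on_const)

lemma Cm_on_bilinear:
  assumes b: "bounded_bilinear b" and "open U" "Cm_on m U f" "Cm_on m U g"
  shows "Cm_on m U (\<lambda>x. b (f x) (g x))"
  using assms(3,4)
proof (induction m arbitrary: f g)
  case 0 then show ?case by (simp add: bounded_bilinear.continuous_on[OF b])
next
  case (Suc m)
  show ?case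
  proof (rule Cm_on_SucI[where f'="\<lambda>x v. b (f x) (frechet_derivative g (at x) v) + b (frechet_derivative f (at x) v) (g x)"])
    show "((\<lambda>x. b (f x) (g x)) has_derivative (\<lambda>v. b (f x) (frechet_derivative g (at x) v) + b (frechet_derivative f (at x) v) (g x))) (at x)"
      if "x \<in> U" for x
      using bounded_bilinear.FDERIV[OF b Cm_on_has_derivative[OF Suc.prems(1) that] Cm_on_has_derivative[OF Suc.prems(2) that]] .
    show "Cm_on m U (\<lambda>x. b (f x) (frechet_derivative g (at x) v) + b (frechet_derivative f (at x) v) (g x))" for v
      by (intro Cm_on_add Suc.IH assms(2) Cm_on_Suc_lower[OF Suc.prems(1)] Cm_on_Suc_lower[OF Suc.prems(2)]
          Cm_on_Suc_frechet[OF Suc.prems(1)] Cm_on_Suc_frechet[OF Suc.prems(2)])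
  qed (rule assms)
qed

lemmas Cm_on_inner = Cm_on_bilinear[OF bounded_bilinear_inner]
lemmas Cm_on_scaleR = Cm_on_bilinear[OF bounded_bilinear_scaleR]
lemmas Cm_on_mult = Cm_on_bilinear[OF bounded_bilinear_mult]

lemma Cm_on_minus:
  assumes "open U" "Cm_on m U f" shows "Cm_on m U (\<lambda>x. - f x)"
  using Cm_on_linear_compose[OF bounded_linear_minus[OF bounded_linear_ident] assms] .

lemma Cm_on_diff:
  assumes "open U" "Cm_on m U f" "Cm_on m U g" shows "Cm_on m U (\<lambda>x. f x - g x)"
  using Cm_on_add[OF assms(1,2) Cm_on_minus[OF assms(1,3)]] by simp

lemma linear_Basis_expansion:
  fixes L :: "'a::euclidean_space \<Rightarrow> 'b::real_normed_vector"
  assumes "linear L" shows "L w = (\<Sum>b\<in>Basis. (w \<bullet> b) *\<^sub>R L b)"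
proof -
  have "L w = L (\<Sum>b\<in>Basis. (w \<bullet> b) *\<^sub>R b)" by (simp add: euclidean_representation)
  also have "\<dots> = (\<Sum>b\<in>Basis. (w \<bullet> b) *\<^sub>R L b)"
    by (simp add: linear_sum[OF assms] linear_scale[OF assms])
  finally show ?thesis .
qed

text \<open>In the chain rule the derivative of \<open>g\<close> varies with both its base point and
  its direction. Expanding the direction in the basis leaves finitely many products, and the
  induction hypothesis applies to the partial derivatives of \<open>g\<close>.\<close>

lemma Cm_on_compose:
  fixes f :: "'a::euclidean_space \<Rightarrow> 'b::euclidean_space" and g :: "'b \<Rightarrow> 'c::real_normed_vector"
  assumes U: "open U" and V: "open V" and "f ` U \<subseteq> V" and "Cm_on m U f" "Cm_on m V g"
  shows "Cm_on m U (\<lambda>x. g (f x))"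
  using assms(4,5)
proof (induction m arbitrary: g)
  case 0 then show ?case using assms(3) by (auto intro: continuous_on_compose2)
next
  case (Suc m)
  note df = Cm_on_has_derivative[OF Suc.prems(1)]
  note dg = Cm_on_has_derivative[OF Suc.prems(2)]
  show ?case
  proof (rule Cm_on_SucI[OF U, where f'="\<lambda>x v. \<Sum>b\<in>Basis. (frechet_derivative f (at x) v \<bullet> b) *\<^sub>R frechet_derivative g (at (f x)) b"])
    show "((\<lambda>x. g (f x)) has_derivative (\<lambda>v. \<Sum>b\<in>Basis. (frechet_derivative f (at x) v \<bullet> b) *\<^sub>R frechet_derivative g (at (f x)) b)) (at x)"
      if x: "x \<in> U" for x
    proof -
      have "f x \<in> V" using assms(3) x by auto
      note d = dg[OF this]
      have "((\<lambda>x. g (f x)) has_derivative (\<lambda>v. frechet_derivative g (at (f x)) (frechet_derivative f (at x) v))) (at x)"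
        using has_derivative_compose[OF df[OF x] d] .
      then show ?thesis
        by (subst (asm) linear_Basis_expansion[OF has_derivative_linear[OF d]])
    qed
    show "Cm_on m U (\<lambda>x. \<Sum>b\<in>Basis. (frechet_derivative f (at x) v \<bullet> b) *\<^sub>R frechet_derivative g (at (f x)) b)" for v
      by (intro Cm_on_sum U Cm_on_scaleR Cm_on_inner Cm_on_const Cm_on_Suc_frechet[OF Suc.prems(1)]
          Suc.IH[where g="\<lambda>y. frechet_derivative g (at y) _"] Cm_on_Suc_lower[OF Suc.prems(1)] Cm_on_Suc_frechet[OF Suc.prems(2)])
  qed
qed

text \<open>The derivative of 1/|y| is a polynomial in y and 1/|y|, so the induction on the order of
  differentiability feeds on itself.\<close>

lemma Cm_on_inverse_norm: "Cm_on m (- {0::'a::euclidean_space}) (\<lambda>y. inverse (norm y))"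
proof (induction m)
  case 0 show ?case by (auto intro!: continuous_intros)
next
  case (Suc m)
  have o: "open (- {0::'a})" by auto
  show ?case
  proof (rule Cm_on_SucI[OF o, where f'="\<lambda>y v. - ((y \<bullet> v) * (inverse (norm y) * (inverse (norm y) * inverse (norm y))))"])
    fix y :: 'a assume "y \<in> - {0}"
    then have y: "y \<noteq> 0" by auto
    have "((\<lambda>y. inverse (norm y)) has_derivative (\<lambda>v. - (inverse (norm y) * (v \<bullet> sgn y) * inverse (norm y)))) (at y)"
      by (rule Deriv.has_derivative_inverse) (use y in \<open>auto intro!: has_derivative_norm\<close>)
    then show "((\<lambda>y. inverse (norm y)) has_derivative (\<lambda>v. - ((y \<bullet> v) * (inverse (norm y) * (inverse (norm y) * inverse (norm y)))))) (at y)"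
      by (rule has_derivative_eq_rhs) (auto simp: sgn_div_norm inner_commute fun_eq_iff)
  next
    fix v :: 'a
    show "Cm_on m (- {0}) (\<lambda>y. - ((y \<bullet> v) * (inverse (norm y) * (inverse (norm y) * inverse (norm y)))))"
      by (intro Cm_on_minus Cm_on_mult Cm_on_inner Cm_on_id Cm_on_const o Suc.IH)
  qed
qed

lemma Cm_on_sgn: "Cm_on m (- {0::'a::euclidean_space}) sgn"
proof -
  have "Cm_on m (- {0::'a}) (\<lambda>y. inverse (norm y) *\<^sub>R y)"
    by (intro Cm_on_scaleR Cm_on_inverse_norm Cm_on_id) auto
  then show ?thesis by (simp add: sgn_div_norm[abs_def])
qed

lemma Cm_on_norm: "Cm_on m (- {0::'a::euclidean_space}) norm"
proof -
  have o: "open (- {0::'a})" by auto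
  have "Cm_on m (- {0::'a}) (\<lambda>y. (y \<bullet> y) * inverse (norm y))"
    by (intro Cm_on_mult Cm_on_inner Cm_on_inverse_norm Cm_on_id o)
  then show ?thesis
    by (rule Cm_on_cong[OF o, rotated]) (auto simp: dot_square_norm power2_eq_square)
qed

lemma Cm_on_Pair:
  assumes "open U" "Cm_on m U f" "Cm_on m U g"
  shows "Cm_on m U (\<lambda>x. (f x, g x))"
proof -
  have "Cm_on m U (\<lambda>x. (f x, 0) + (0, g x))"
    by (intro Cm_on_add assms Cm_on_linear_compose[where L="\<lambda>u. (u,0)"] Cm_on_linear_compose[where L="\<lambda>u. (0,u)"]
        bounded_linear_Pair bounded_linear_ident bounded_linear_zero)
  then show ?thesis by simp
qed

text \<open>Both iterated derivatives are the limit of the second difference quotient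
  \<open>(f (x + sv + sw) - f (x + sv) - f (x + sw) + f x) / s\<^sup>2\<close>.\<close>

lemma frechet_derivative_symmetric:
  fixes f :: "'a::euclidean_space \<Rightarrow> real"
  assumes U: "open U" "x \<in> U" and f: "Cm_on (Suc (Suc m)) U f"
  shows "frechet_derivative (\<lambda>y. frechet_derivative f (at y) v) (at x) w
       = frechet_derivative (\<lambda>y. frechet_derivative f (at y) w) (at x) v"
proof -
  define D where "D v w y = frechet_derivative (\<lambda>y. frechet_derivative f (at y) v) (at y) w" for v w y
  have der: "(f has_derivative frechet_derivative f (at y)) (at y)" if "y \<in> U" for y
    using Cm_on_has_derivative[OF f that] .
  have der2: "((\<lambda>y. frechet_derivative f (at y) v) has_derivative (\<lambda>w. D v w y)) (at y)" if "y \<in> U" for y v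
    unfolding D_def using Cm_on_has_derivative[OF Cm_on_Suc_frechet[OF f] that] by simp
  have cont: "continuous_on U (D v w)" for v w
    unfolding D_def using Cm_on_continuous[OF Cm_on_Suc_frechet[OF Cm_on_Suc_frechet[OF f]]] by blast
  obtain r where r: "r > 0" "ball x r \<subseteq> U" using U openE by blast
  \<comment> \<open>The mean value theorem is applied to the second difference first in direction
    \<open>v\<close>, then in direction \<open>w\<close>. Both directions stay variable so that
    their roles can be exchanged.\<close>
  have key: "\<exists>\<xi> \<zeta>. 0 < \<xi> \<and> \<xi> < s \<and> 0 < \<zeta> \<and> \<zeta> < s \<and>
      f (x + s *\<^sub>R v + s *\<^sub>R w) - f (x + s *\<^sub>R v) - (f (x + s *\<^sub>R w) - f x) = s * s * D v w (x + \<xi> *\<^sub>R v + \<zeta> *\<^sub>R w)"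
    if s: "0 < s" "s * (norm v + norm w) < r" for s v w
  proof -
    have inU: "x + a *\<^sub>R v + b *\<^sub>R w \<in> U" if "0 \<le> a" "a \<le> s" "0 \<le> b" "b \<le> s" for a b
    proof -
      have "norm (a *\<^sub>R v + b *\<^sub>R w) \<le> a * norm v + b * norm w"
        using norm_triangle_ineq[of "a *\<^sub>R v" "b *\<^sub>R w"] that by simp
      also have "\<dots> \<le> s * norm v + s * norm w" by (intro add_mono mult_right_mono that) auto
      also have "\<dots> < r" using s by (simp add: algebra_simps)
      finally show ?thesis using r(2) by (auto simp: dist_norm subset_iff norm_minus_commute algebra_simps)
    qed
    have d1: "((\<lambda>\<tau>. f (x + \<tau> *\<^sub>R v + b *\<^sub>R w)) has_derivative (\<lambda>h. h * frechet_derivative f (at (x + a *\<^sub>R v + b *\<^sub>R w)) v)) (at a)"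
      if "0 \<le> a" "a \<le> s" "0 \<le> b" "b \<le> s" for a b
    proof -
      have "((\<lambda>\<tau>. x + \<tau> *\<^sub>R v + b *\<^sub>R w) has_derivative (\<lambda>h. h *\<^sub>R v)) (at a)"
        by (auto intro!: derivative_eq_intros)
      from has_derivative_compose[OF this der[OF inU[OF that]]]
      show ?thesis using linear_scale[OF has_derivative_linear[OF der[OF inU[OF that]]]] by simp
    qed
    have d2: "((\<lambda>\<tau>. frechet_derivative f (at (x + a *\<^sub>R v + \<tau> *\<^sub>R w)) v) has_derivative (\<lambda>h. h * D v w (x + a *\<^sub>R v + b *\<^sub>R w))) (at b)"
      if "0 \<le> a" "a \<le> s" "0 \<le> b" "b \<le> s" for a b
    proof -
      have "((\<lambda>\<tau>. x + a *\<^sub>R v + \<tau> *\<^sub>R w) has_derivative (\<lambda>h. h *\<^sub>R w)) (at b)"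
        by (auto intro!: derivative_eq_intros)
      from has_derivative_compose[OF this der2[OF inU[OF that]]]
      show ?thesis using linear_scale[OF has_derivative_linear[OF der2[OF inU[OF that]]]] by simp
    qed
    define g where "g \<tau> = f (x + \<tau> *\<^sub>R v + s *\<^sub>R w) - f (x + \<tau> *\<^sub>R v + 0 *\<^sub>R w)" for \<tau>
    have "(g has_derivative (\<lambda>h. h * frechet_derivative f (at (x + a *\<^sub>R v + s *\<^sub>R w)) v
        - h * frechet_derivative f (at (x + a *\<^sub>R v + 0 *\<^sub>R w)) v)) (at a within {0..s})" if "0 \<le> a" "a \<le> s" for a
      unfolding g_def using s that
      by (intro has_derivative_diff has_derivative_at_withinI[OF d1]) auto
    from mvt_simple[OF s(1) this] obtain \<xi> where \<xi>: "0 < \<xi>" "\<xi> < s" "g s - g 0 =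
       s * frechet_derivative f (at (x + \<xi> *\<^sub>R v + s *\<^sub>R w)) v
        - s * frechet_derivative f (at (x + \<xi> *\<^sub>R v + 0 *\<^sub>R w)) v" by auto
    have "((\<lambda>\<tau>. frechet_derivative f (at (x + \<xi> *\<^sub>R v + \<tau> *\<^sub>R w)) v) has_derivative (\<lambda>h. h * D v w (x + \<xi> *\<^sub>R v + b *\<^sub>R w))) (at b within {0..s})"
      if "0 \<le> b" "b \<le> s" for b using \<xi> that by (intro has_derivative_at_withinI[OF d2]) auto
    from mvt_simple[OF s(1) this] obtain \<zeta> where "0 < \<zeta>" "\<zeta> < s"
      "frechet_derivative f (at (x + \<xi> *\<^sub>R v + s *\<^sub>R w)) v - frechet_derivative f (at (x + \<xi> *\<^sub>R v + 0 *\<^sub>R w)) v = s * D v w (x + \<xi> *\<^sub>R v + \<zeta> *\<^sub>R w)"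
      by auto
    with \<xi> show ?thesis
      by (intro exI[of _ \<xi>] exI[of _ \<zeta>]) (simp add: g_def right_diff_distrib[symmetric])
  qed
  have eq: "D v w x = D w v x" 
  proof (rule ccontr)
    assume ne: "D v w x \<noteq> D w v x"
    define e where "e = \<bar>D v w x - D w v x\<bar> / 2"
    have e: "e > 0" using ne by (simp add: e_def)
    have "isCont (D v w) x" "isCont (D w v) x" using cont U continuous_on_eq_continuous_at by blast+
    then obtain d1 d2 where d: "d1 > 0" "\<And>y. dist y x < d1 \<Longrightarrow> dist (D v w y) (D v w x) < e"
      "d2 > 0" "\<And>y. dist y x < d2 \<Longrightarrow> dist (D w v y) (D w v x) < e"
      using e unfolding continuous_at_eps_delta by (metis dist_commute)
    define q where "q = min r (min d1 d2)"
    have q: "q > 0" using r d by (simp add: q_def)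
    \<comment> \<open>The 1 guards against v = w = 0. The parallelogram of size \<open>s\<close>
      stays in the ball of radius \<open>q\<close>, where both mixed derivatives are within
      \<open>e\<close> of their values at \<open>x\<close>.\<close>
    define s where "s = q / (2 * (norm v + norm w + 1))"
    have nn: "norm v + norm w + 1 > 0" by (smt (verit) norm_ge_zero)
    have s: "s > 0" using q nn by (simp add: s_def)
    have "s * (norm v + norm w) < s * (norm v + norm w + 1)" using s by simp
    also have "\<dots> = q/2" using nn by (simp add: s_def divide_simps)
    finally have sq: "s * (norm v + norm w) < q" using q by simp
    then have sr: "s * (norm v + norm w) < r" "s * (norm w + norm v) < r" by (auto simp: q_def add.commute)
    have close: "dist (x + a *\<^sub>R v + b *\<^sub>R w) x < q" if "0 < a" "a < s" "0 < b" "b < s" for a b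
    proof -
      have "norm (a *\<^sub>R v + b *\<^sub>R w) \<le> a * norm v + b * norm w"
        using norm_triangle_ineq[of "a *\<^sub>R v" "b *\<^sub>R w"] that by simp
      also have "\<dots> \<le> s * norm v + s * norm w" using that by (intro add_mono mult_right_mono) auto
      also have "\<dots> < q" using sq by (simp add: algebra_simps)
      finally show ?thesis by (simp add: dist_norm)
    qed
    obtain a b where ab: "0 < a" "a < s" "0 < b" "b < s" 
      "f (x + s *\<^sub>R v + s *\<^sub>R w) - f (x + s *\<^sub>R v) - (f (x + s *\<^sub>R w) - f x) = s * s * D v w (x + a *\<^sub>R v + b *\<^sub>R w)"
      using key[OF s sr(1)] by auto
    obtain a' b' where ab': "0 < a'" "a' < s" "0 < b'" "b' < s" 
      "f (x + s *\<^sub>R w + s *\<^sub>R v) - f (x + s *\<^sub>R w) - (f (x + s *\<^sub>R v) - f x) = s * s * D w v (x + a' *\<^sub>R w + b' *\<^sub>R v)"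
      using key[OF s sr(2)] by auto
    have "x + s *\<^sub>R w + s *\<^sub>R v = x + s *\<^sub>R v + s *\<^sub>R w" by (simp add: algebra_simps)
    then have "s * s * D v w (x + a *\<^sub>R v + b *\<^sub>R w) = s * s * D w v (x + a' *\<^sub>R w + b' *\<^sub>R v)"
      using ab(5) ab'(5) by (simp only:)
    then have "D v w (x + a *\<^sub>R v + b *\<^sub>R w) = D w v (x + b' *\<^sub>R v + a' *\<^sub>R w)"
      using s by (simp add: algebra_simps)
    moreover have "dist (D v w (x + a *\<^sub>R v + b *\<^sub>R w)) (D v w x) < e"
      using d(2) close[OF ab(1-4)] by (simp add: q_def)
    moreover have "dist (D w v (x + b' *\<^sub>R v + a' *\<^sub>R w)) (D w v x) < e"
      using d(4) close[OF ab'(3,4,1,2)] by (simp add: q_def)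
    ultimately have "dist (D v w x) (D w v x) < e + e"
      by (metis add_strict_mono dist_commute dist_triangle_lt)
    then show False by (simp add: e_def dist_real_def)
  qed
  then show ?thesis by (simp add: D_def)
qed

text \<open>Near its zero \<open>f\<close> is already of first order, so the variation of
  \<open>G\<close> enters at higher order and continuity of \<open>G\<close> suffices. This
  differentiates inverse operators before their differentiability is known.\<close>

lemma has_derivative_scaleR_vanishing:
  fixes f :: "'a::real_normed_vector \<Rightarrow> real" and G :: "'a \<Rightarrow> 'b::real_normed_vector"
  assumes f: "(f has_derivative f') (at x)" and f0: "f x = 0" and G: "isCont G x"
  shows "((\<lambda>y. f y *\<^sub>R G y) has_derivative (\<lambda>h. f' h *\<^sub>R G x)) (at x)"
proof -
  have "((\<lambda>y. f y *\<^sub>R (G y - G x)) has_derivative (\<lambda>h. 0)) (at x)"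
    unfolding has_derivative_at_alt
  proof (intro conjI allI impI)
    fix e :: real assume e: "e > 0"
    obtain K where K: "K > 0" "\<And>h. norm (f' h) \<le> norm h * K"
      using has_derivative_bounded_linear[OF f] bounded_linear.pos_bounded by blast
    obtain d1 where d1: "d1 > 0" "\<And>y. norm (y - x) < d1 \<Longrightarrow> norm (f y - f x - f' (y - x)) \<le> 1 * norm (y - x)"
      using f[unfolded has_derivative_at_alt] zero_less_one by metis
    obtain d2 where d2: "d2 > 0" "\<And>y. norm (y - x) < d2 \<Longrightarrow> norm (G y - G x) < e / (K + 1)"
      using G e K(1) unfolding continuous_at_eps_delta dist_norm by (metis add_pos_pos divide_pos_pos zero_less_one)
    show "\<exists>d>0. \<forall>y. norm (y - x) < d \<longrightarrow>
        norm (f y *\<^sub>R (G y - G x) - f x *\<^sub>R (G x - G x) - 0) \<le> e * norm (y - x)"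
    proof (intro exI[of _ "min d1 d2"] conjI allI impI)
      fix y assume y: "norm (y - x) < min d1 d2"
      have "norm (f y) \<le> norm (f y - f x - f' (y - x)) + norm (f' (y - x))"
        using norm_triangle_ineq[of "f y - f x - f' (y - x)" "f' (y - x)"] f0 by simp
      also have "\<dots> \<le> (K + 1) * norm (y - x)" using d1(2)[of y] K(2)[of "y - x"] y by (simp add: algebra_simps)
      finally have 1: "norm (f y) \<le> (K + 1) * norm (y - x)" .
      have "norm (f y *\<^sub>R (G y - G x)) = norm (f y) * norm (G y - G x)" by simp
      also have "\<dots> \<le> ((K + 1) * norm (y - x)) * (e / (K + 1))"
        using 1 d2(2)[of y] y K(1) by (intro mult_mono) auto
      finally show "norm (f y *\<^sub>R (G y - G x) - f x *\<^sub>R (G x - G x) - 0) \<le> e * norm (y - x)"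
        using K(1) by (simp add: f0 mult.commute)
    qed (use d1 d2 in auto)
  qed auto
  from has_derivative_add[OF this has_derivative_scaleR_left[OF f, of "G x"]]
  show ?thesis by (simp add: algebra_simps)
qed

text \<open>With a = M(x)^-1 v, the identity M(y)^-1 v = a - M(y)^-1 (M(y) a - M(x) a) writes the
  inverse as a constant minus M(y)^-1 applied to something that vanishes at \<open>x\<close>.
  Continuity comes first, from a lower bound c |w| for M(x) that survives as c/2 nearby; then the
  identity gives derivatives of every order by induction.\<close>

lemma
  fixes M :: "'a::euclidean_space \<Rightarrow> 'b::euclidean_space \<Rightarrow> 'b"
  assumes U: "open U" and lin: "\<And>y. y \<in> U \<Longrightarrow> linear (M y)" and inj: "\<And>y. y \<in> U \<Longrightarrow> inj (M y)"
  shows isCont_inverse_operator: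
      "(\<And>e y. y \<in> U \<Longrightarrow> isCont (\<lambda>y. M y e) y) \<Longrightarrow> x \<in> U \<Longrightarrow> isCont (\<lambda>y. inv (M y) v) x" (is "PROP ?c \<Longrightarrow> _ \<Longrightarrow> ?A x v")
    and Cm_on_inverse_operator:
      "(\<And>e. Cm_on m U (\<lambda>y. M y e)) \<Longrightarrow> Cm_on m U (\<lambda>y. inv (M y) v)"
proof -
  have surj: "M y (inv (M y) v) = v" if "y \<in> U" for y v
    using linear_injective_imp_surjective[OF lin[OF that] inj[OF that]] surj_f_inv_f by metis
  have left: "inv (M y) (M y v) = v" if "y \<in> U" for y v
    using inj[OF that] by simp
  have linv: "linear (inv (M y))" if "y \<in> U" for y
    using inj_linear_imp_inv_linear lin[OF that] inj[OF that] by blast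
  have A: "?A x v" if x: "x \<in> U" and cont: "\<And>e y. y \<in> U \<Longrightarrow> isCont (\<lambda>y. M y e) y" for x v
  proof -
    obtain c where c: "c > 0" "\<And>w. c * norm w \<le> norm (M x w)"
      using linear_inj_bounded_below_pos[OF lin inj] x by blast
    define S where "S y = (\<Sum>b\<in>Basis. norm (M y b - M x b))" for y
    have S: "(S \<longlongrightarrow> 0) (at x)"
    proof -
      have "((\<lambda>y. \<Sum>b\<in>Basis. norm (M y b - M x b)) \<longlongrightarrow> (\<Sum>b\<in>(Basis::'b set). norm (M x b - M x b))) (at x)"
        by (intro tendsto_intros) (use cont x in \<open>auto simp: isCont_def\<close>)
      then show ?thesis by (simp add: S_def[abs_def])
    qed
    have diff: "norm (M y w - M x w) \<le> S y * norm w" if y: "y \<in> U" for y w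
    proof -
      have "M y w - M x w = (\<Sum>b\<in>Basis. (w \<bullet> b) *\<^sub>R (M y b - M x b))"
        unfolding scaleR_diff_right sum_subtractf
        using linear_Basis_expansion[OF lin[OF y], of w] linear_Basis_expansion[OF lin[OF x], of w] by simp
      also have "norm \<dots> \<le> (\<Sum>b\<in>Basis. \<bar>w \<bullet> b\<bar> * norm (M y b - M x b))"
        by (rule order_trans[OF norm_sum]) simp
      also have "\<dots> \<le> (\<Sum>b\<in>Basis. norm w * norm (M y b - M x b))"
        by (intro sum_mono mult_right_mono Basis_le_norm) auto
      finally show ?thesis by (simp add: S_def sum_distrib_left mult.commute)
    qed
    have evU: "eventually (\<lambda>y. y \<in> U) (at x)" using U x by (simp add: eventually_at_in_open')
    have evS: "eventually (\<lambda>y. S y < c/2) (at x)" using order_tendstoD(2)[OF S, of "c/2"] c by simp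
    define a where "a = inv (M x) v"
    have bd: "eventually (\<lambda>y. norm (inv (M y) v - inv (M x) v) \<le> (2/c) * norm (M y a - M x a)) (at x)"
      using evU evS
    proof eventually_elim
      case (elim y)
      define w where "w = inv (M y) v - inv (M x) v"
      have "M y w = v - M y a" unfolding w_def a_def
        using linear_diff[OF lin[OF elim(1)]] surj[OF elim(1)] by simp
      also have "\<dots> = M x a - M y a" using surj[OF x] by (simp add: a_def)
      finally have e: "norm (M y w) = norm (M y a - M x a)" by (simp add: norm_minus_commute)
      have "c * norm w \<le> norm (M x w)" by (rule c)
      also have "\<dots> \<le> norm (M y w) + norm (M y w - M x w)" by norm
      also have "\<dots> \<le> norm (M y w) + c/2 * norm w"
        using diff[OF elim(1), of w] elim(2) by (smt (verit, best) mult_right_mono norm_ge_zero)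
      finally have "c/2 * norm w \<le> norm (M y w)" by (simp add: algebra_simps)
      then show ?case using c(1) e by (simp add: w_def[symmetric] field_simps)
    qed
    have "((\<lambda>y. (2/c) * norm (M y a - M x a)) \<longlongrightarrow> (2/c) * norm (M x a - M x a)) (at x)"
      by (intro tendsto_intros) (use cont x in \<open>auto simp: isCont_def\<close>)
    then have "((\<lambda>y. inv (M y) v - inv (M x) v) \<longlongrightarrow> 0) (at x)"
      using bd by (intro Lim_null_comparison[OF bd]) auto
    then show ?thesis by (simp add: isCont_def LIM_zero_iff)
  qed
  then show "PROP ?c \<Longrightarrow> x \<in> U \<Longrightarrow> ?A x v" by blast
  assume "\<And>e. Cm_on m U (\<lambda>y. M y e)"
  then show "Cm_on m U (\<lambda>y. inv (M y) v)"
  proof (induction m arbitrary: v)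
    case 0
    have "isCont (\<lambda>y. M y e) y" if "y \<in> U" for e y
      using Cm_on_continuous[OF 0] U that continuous_on_eq_continuous_at by blast
    from A[OF _ this] show ?case by (simp add: continuous_at_imp_continuous_on)
  next
    case (Suc m)
    note sm = Suc.prems
    have cont: "isCont (\<lambda>y. M y e) y" if "y \<in> U" for e y
      using Cm_on_continuous[OF sm] U that continuous_on_eq_continuous_at by blast
    define dM where "dM c y h = frechet_derivative (\<lambda>y. M y c) (at y) h" for c y h
    have dM: "((\<lambda>y. M y c) has_derivative dM c y) (at y)" if "y \<in> U" for y c
      unfolding dM_def using Cm_on_has_derivative[OF sm that] .
    have der: "((\<lambda>y. inv (M y) v) has_derivative
        (\<lambda>h. - (\<Sum>b\<in>Basis. ((\<Sum>c\<in>Basis. (inv (M x) v \<bullet> c) *\<^sub>R dM c x h) \<bullet> b) *\<^sub>R inv (M x) b))) (at x)"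
      if x: "x \<in> U" for x v
    proof -
      define a where "a = inv (M x) v"
      \<comment> \<open>The defect of \<open>a\<close> as a solution at \<open>y\<close>. It is
        expanded in the basis because smoothness of \<open>M\<close> is given on fixed
        vectors.\<close>
      define g where "g y = (\<Sum>c\<in>Basis. (a \<bullet> c) *\<^sub>R M y c) - M x a" for y
      have g: "g y = M y a - M x a" if "y \<in> U" for y
        unfolding g_def using linear_Basis_expansion[OF lin[OF that], of a] by simp
      have "(g has_derivative (\<lambda>h. (\<Sum>c\<in>Basis. (a \<bullet> c) *\<^sub>R dM c x h) - 0)) (at x)"
        unfolding g_def by (intro has_derivative_diff has_derivative_sum has_derivative_scaleR_right dM x has_derivative_const)
      then have "((\<lambda>y. g y \<bullet> b) has_derivative (\<lambda>h. (\<Sum>c\<in>Basis. (a \<bullet> c) *\<^sub>R dM c x h) \<bullet> b)) (at x)" for b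
        using has_derivative_inner_left by fastforce
      then have "((\<lambda>y. (g y \<bullet> b) *\<^sub>R inv (M y) b) has_derivative (\<lambda>h. ((\<Sum>c\<in>Basis. (a \<bullet> c) *\<^sub>R dM c x h) \<bullet> b) *\<^sub>R inv (M x) b)) (at x)" for b
        by (rule has_derivative_scaleR_vanishing) (use g[OF x] A[OF x cont] in auto)
      then have "((\<lambda>y. inv (M x) v - (\<Sum>b\<in>Basis. (g y \<bullet> b) *\<^sub>R inv (M y) b)) has_derivative
          (\<lambda>h. 0 - (\<Sum>b\<in>Basis. ((\<Sum>c\<in>Basis. (a \<bullet> c) *\<^sub>R dM c x h) \<bullet> b) *\<^sub>R inv (M x) b))) (at x)"
        by (intro has_derivative_diff has_derivative_sum has_derivative_const)
      moreover have "inv (M x) v - (\<Sum>b\<in>Basis. (g y \<bullet> b) *\<^sub>R inv (M y) b) = inv (M y) v" if "y \<in> U" for y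
      proof -
        have "(\<Sum>b\<in>Basis. (g y \<bullet> b) *\<^sub>R inv (M y) b) = inv (M y) (g y)"
          using linear_Basis_expansion[OF linv[OF that], of "g y"] by simp
        also have "\<dots> = a - inv (M y) v"
          unfolding g[OF that] using linear_diff[OF linv[OF that]] left[OF that] surj[OF x] by (simp add: a_def)
        finally show ?thesis by (simp add: a_def)
      qed
      ultimately show ?thesis unfolding a_def[symmetric]
        by (simp add: has_derivative_transform_within_open[OF _ U x])
    qed
    have dMs: "Cm_on m U (\<lambda>x. dM c x h)" for c h unfolding dM_def
      using Cm_on_Suc_frechet[OF sm] .
    show ?case
      by (rule Cm_on_SucI[OF U der])
        (assumption | intro Cm_on_minus Cm_on_sum Cm_on_scaleR Cm_on_inner Cm_on_const Suc.IH dMs U Cm_on_Suc_lower[OF sm])+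
  qed
qed

text \<open>The derivative of \<open>g\<close> at y is the inverse of the derivative of
  \<open>f\<close> at \<open>g y\<close>. If \<open>g\<close> is of class C^m, so is this
  expression, and \<open>g\<close> gains one order; continuity starts the bootstrap.\<close>

lemma Cm_on_inverse_function:
  fixes f g :: "'a::euclidean_space \<Rightarrow> 'a"
  assumes S: "open S" and T: "open T" and f: "\<And>m. Cm_on m S f"
    and g: "\<And>y. y \<in> T \<Longrightarrow> g y \<in> S" "\<And>y. y \<in> T \<Longrightarrow> f (g y) = y" and cont: "continuous_on T g"
    and inj: "\<And>x. x \<in> S \<Longrightarrow> inj (frechet_derivative f (at x))"
  shows "Cm_on m T g"
proof -
  define M where "M y = frechet_derivative f (at (g y))" for y
  have df: "(f has_derivative M y) (at (g y))" if "y \<in> T" for y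
    unfolding M_def using Cm_on_has_derivative[OF f g(1)[OF that]] .
  have lin: "linear (M y)" if "y \<in> T" for y using has_derivative_linear[OF df[OF that]] .
  have injM: "inj (M y)" if "y \<in> T" for y using inj[OF g(1)[OF that]] by (simp add: M_def)
  have dg: "(g has_derivative inv (M y)) (at y)" if y: "y \<in> T" for y
  proof (rule has_derivative_inverse_basic[OF df[OF y] _ _ _ T y g(2)])
    show "bounded_linear (inv (M y))"
      using inj_linear_imp_inv_linear[OF lin[OF y] injM[OF y]] linear_linear by blast
    show "inv (M y) \<circ> M y = id" using injM[OF y] by (simp add: fun_eq_iff)
    show "isCont g y" using cont T y continuous_on_eq_continuous_at by blast
  qed
  show ?thesis
  proof (induction m)
    case 0 show ?case using cont by simp
  next
    case (Suc m)
    have *: "Cm_on m T (\<lambda>y. inv (M y) v)" if "\<And>e. Cm_on m T (\<lambda>y. M y e)" for v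
      by (rule Cm_on_inverse_operator[OF T lin injM that])
    show ?case
    proof (rule Cm_on_SucI[OF T dg *])
      show "Cm_on m T (\<lambda>y. M y e)" for e unfolding M_def
        by (rule Cm_on_compose[OF T S _ Suc.IH Cm_on_Suc_frechet[OF f]]) (use g in auto)
    qed
  qed
qed

section \<open>The Gauss map of a uniformly convex hypersurface\<close>

lemma smooth_on_compose:
  fixes f :: "'a::euclidean_space \<Rightarrow> 'c::real_normed_vector" and h :: "'b::euclidean_space \<Rightarrow> 'a"
  assumes f: "smooth_on S f" and U: "open U" and h: "\<And>m. Cm_on m U h" and hS: "h ` U \<subseteq> S"
  shows "Cm_on m U (\<lambda>x. f (h x))"
proof (rule Cm_on_local)
  fix x assume x: "x \<in> U"
  then have "h x \<in> S" using hS by auto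
  then obtain V g where V: "open V" "h x \<in> V" "\<And>m. Cm_on m V g" "\<And>y. y \<in> S \<inter> V \<Longrightarrow> g y = f y"
    using f unfolding smooth_on_def by meson
  define W where "W = U \<inter> h -` V"
  have W: "open W" unfolding W_def
    using continuous_open_preimage[OF Cm_on_continuous[OF h] U V(1)] .
  have "Cm_on m W (\<lambda>x. g (h x))"
    by (rule Cm_on_compose[OF W V(1) _ Cm_on_subset[OF h] V(3)]) (auto simp: W_def)
  then have "Cm_on m W (\<lambda>x. f (h x))"
    by (rule Cm_on_cong[OF W, rotated]) (use V(4) hS in \<open>auto simp: W_def\<close>)
  then show "\<exists>V. open V \<and> x \<in> V \<and> Cm_on m V (\<lambda>x. f (h x))"
    using W x V(2) by (intro exI[of _ W]) (auto simp: W_def)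
qed

lemma smooth_on_imp_continuous_on:
  assumes "smooth_on S f" shows "continuous_on S f"
  unfolding continuous_on_eq_continuous_within
proof
  fix x assume x: "x \<in> S"
  then obtain V g where V: "open V" "x \<in> V" "\<And>m. Cm_on m V g" "\<And>y. y \<in> S \<inter> V \<Longrightarrow> g y = f y"
    using assms unfolding smooth_on_def by meson
  have "isCont g x" using Cm_on_continuous[OF V(3)] V continuous_on_eq_continuous_at by blast
  then have "continuous (at x within S) g" using continuous_at_imp_continuous_at_within by blast
  moreover have "eventually (\<lambda>y. g y = f y) (at x within S)"
    using V unfolding eventually_at_topological by blast
  ultimately show "continuous (at x within S) f"
    using x V by (simp add: continuous_within) (metis (mono_tags, lifting) IntI Lim_transform_eventually)
qed

lemma sgn_sphere: "y \<noteq> 0 \<Longrightarrow> sgn y \<in> usphere" 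
  by (simp add: norm_sgn)

lemma sgn_of_sphere: "norm p = 1 \<Longrightarrow> sgn p = p"
  by (simp add: sgn_div_norm)

lemma sgn_scaleR_pos: "c > 0 \<Longrightarrow> sgn (c *\<^sub>R (y::'a::real_normed_vector)) = sgn y"
  by (simp add: sgn_scaleR)

lemma has_derivative_along:
  assumes "(f has_derivative f') (at x)"
  shows "((\<lambda>s. f (x + s *\<^sub>R v)) has_vector_derivative f' v) (at 0)"
proof -
  have "((\<lambda>s::real. x + s *\<^sub>R v) has_derivative (\<lambda>h. h *\<^sub>R v)) (at 0)"
    by (auto intro!: derivative_eq_intros)
  from has_derivative_compose[OF this, of f f'] assms
  show ?thesis by (simp add: has_vector_derivative_def linear_scale[OF has_derivative_linear[OF assms]])
qed

text \<open>Homogeneity is information along rays; radial derivatives are read off from a function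
  \<open>g\<close> of one variable that agrees with \<open>f\<close> on the ray near the
  point.\<close>

lemma derivative_along_eqI:
  assumes f: "(f has_derivative f') (at x)" and "eventually (\<lambda>s::real. f (x + s *\<^sub>R v) = g s) (nhds 0)"
    and g: "(g has_vector_derivative d) (at 0)"
  shows "f' v = d"
proof -
  have "((\<lambda>s. f (x + s *\<^sub>R v)) has_vector_derivative d) (at 0)"
  proof -
    obtain e where e: "e > 0" "\<And>s. dist s 0 < e \<Longrightarrow> f (x + s *\<^sub>R v) = g s"
      using assms(2) unfolding eventually_nhds_metric by auto
    show ?thesis
      by (rule has_vector_derivative_transform_within[OF g e(1) UNIV_I]) (use e(2) in auto)
  qed
  then show ?thesis using has_derivative_along[OF f, of v] vector_derivative_unique_at by blast
qed

lemma ray_derivative: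
  assumes "((\<lambda>y. f (sgn y)) has_derivative f') (at p)" and p: "p \<noteq> 0"
  shows "f' p = 0"
proof (rule derivative_along_eqI[OF assms(1), where g="\<lambda>s. f (sgn p)"])
  have "eventually (\<lambda>s::real. s \<in> {-1<..}) (nhds 0)"
    by (intro eventually_nhds_in_open) auto
  then show "eventually (\<lambda>s::real. f (sgn (p + s *\<^sub>R p)) = f (sgn p)) (nhds 0)"
  proof eventually_elim
    case (elim s)
    have "p + s *\<^sub>R p = (1 + s) *\<^sub>R p" by (simp add: algebra_simps)
    then show ?case using elim by (simp add: sgn_scaleR)
  qed
qed auto

section \<open>The unit normal of a single hypersurface\<close>

locale convex_embedding =
  fixes F :: "'a::euclidean_space \<Rightarrow> 'a"
  assumes emb: "uniformly_convex_embedding F" and dim2: "2 \<le> DIM('a)"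
begin

lemma smooth: "smooth_on usphere F" and inj: "inj_on F usphere"
  and immersion: "\<And>p v. p \<in> usphere \<Longrightarrow> v \<in> tangent p \<Longrightarrow> v \<noteq> 0 \<Longrightarrow> sph_deriv F p v \<noteq> 0"
  and frontier: "F ` usphere = frontier (convex hull (F ` usphere))"
  and curvature: "\<And>p \<kappa>. p \<in> usphere \<Longrightarrow> principal_curvature F p \<kappa> \<Longrightarrow> \<kappa> > 0"
  using emb unfolding uniformly_convex_embedding_def smooth_embedding_def by blast+

lemma Cm_ext: "Cm_on m (- {0}) (\<lambda>y. F (sgn y))"
  by (rule smooth_on_compose[OF smooth]) (auto simp: Cm_on_sgn norm_sgn split: if_splits)

lemma cont: "continuous_on usphere F"
  using smooth smooth_on_imp_continuous_on by blast

lemma deriv: "y \<noteq> 0 \<Longrightarrow> ((\<lambda>y. F (sgn y)) has_derivative sph_deriv F y) (at y)"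
  using Cm_on_has_derivative[OF Cm_ext, of y] by (simp add: sph_deriv_def[abs_def])

lemma lin: "y \<noteq> 0 \<Longrightarrow> linear (sph_deriv F y)"
  using deriv has_derivative_linear by blast

lemma deriv_self: "p \<noteq> 0 \<Longrightarrow> sph_deriv F p p = 0"
  using ray_derivative[OF deriv] by blast

lemma deriv_kernel:
  assumes p: "p \<in> usphere" and "sph_deriv F p v = 0"
  shows "v = (v \<bullet> p) *\<^sub>R p"
proof -
  have p0: "p \<noteq> 0" and pp: "p \<bullet> p = 1" using p by (auto simp: dot_square_norm)
  have "sph_deriv F p (v - (v \<bullet> p) *\<^sub>R p) = 0"
    using linear_diff[OF lin[OF p0]] linear_scale[OF lin[OF p0]] deriv_self[OF p0] assms by simp
  moreover have "v - (v \<bullet> p) *\<^sub>R p \<in> tangent p" using pp by (simp add: tangent_def inner_diff_left)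
  ultimately show ?thesis using immersion[OF p] by force
qed

text \<open>Fermat's rule: the height in direction \<nu> has a maximum at \<open>p\<close>, so its
  differential vanishes.\<close>

lemma support_imp_normal:
  assumes p: "p \<in> usphere" and s: "\<And>q. q \<in> usphere \<Longrightarrow> (F q - F p) \<bullet> \<nu> \<le> 0"
  shows "sph_deriv F p v \<bullet> \<nu> = 0"
proof -
  have p0: "p \<noteq> 0" using p by auto
  have "((\<lambda>y. F (sgn y) \<bullet> \<nu>) has_derivative (\<lambda>v. sph_deriv F p v \<bullet> \<nu>)) (at p)"
    using has_derivative_inner_left[OF deriv[OF p0]] .
  then have "(\<lambda>v. sph_deriv F p v \<bullet> \<nu>) = (\<lambda>v. 0)"
  proof (rule differential_zero_maxmin[rotated 2])
    show "(\<forall>y\<in>-{0}. F (sgn y) \<bullet> \<nu> \<le> F (sgn p) \<bullet> \<nu>) \<or> (\<forall>y\<in>-{0}. F (sgn p) \<bullet> \<nu> \<le> F (sgn y) \<bullet> \<nu>)"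
      using s[OF sgn_sphere] p by (auto simp: sgn_of_sphere inner_diff_left)
  qed (use p0 in auto)
  then show ?thesis by metis
qed

lemma dim_range: assumes p: "p \<in> usphere" shows "dim (range (sph_deriv F p)) = DIM('a) - 1"
proof -
  have p0: "p \<noteq> 0" and pp: "p \<bullet> p = 1" using p by (auto simp: dot_square_norm)
  note l = lin[OF p0]
  have r: "range (sph_deriv F p) = sph_deriv F p ` tangent p"
  proof safe
    fix v
    have "sph_deriv F p v = sph_deriv F p (v - (v \<bullet> p) *\<^sub>R p)"
      using linear_diff[OF l] linear_scale[OF l] deriv_self[OF p0] by simp
    moreover have "v - (v \<bullet> p) *\<^sub>R p \<in> tangent p" using pp by (simp add: tangent_def inner_diff_left)
    ultimately show "sph_deriv F p v \<in> sph_deriv F p ` tangent p" by blast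
  qed auto
  have sub: "subspace (tangent p)" by (auto simp: subspace_def tangent_def inner_add_left)
  have "tangent p = {v. p \<bullet> v = 0}" by (auto simp: tangent_def inner_commute)
  then have dt: "dim (tangent p) = DIM('a) - 1" using dim_hyperplane[OF p0] by simp
  have "inj_on (sph_deriv F p) (span (tangent p))"
  proof (rule inj_onI)
    fix v w assume vw: "v \<in> span (tangent p)" "w \<in> span (tangent p)" "sph_deriv F p v = sph_deriv F p w"
    then have "v - w \<in> tangent p" using sub span_eq_iff subspace_diff by metis
    moreover have "sph_deriv F p (v - w) = 0" using linear_diff[OF l] vw by simp
    ultimately show "v = w" using immersion[OF p] by force
  qed
  then show ?thesis using dim_image_eq[OF l] r dt by metis
qed

text \<open>The differential of \<open>F\<close> has rank DIM - 1, its kernel being the radial line;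
  hence the normal space is a line, and \<nu> spans it.\<close>

lemma normal_line:
  assumes p: "p \<in> usphere" and \<nu>: "norm \<nu> = 1" "\<And>v. sph_deriv F p v \<bullet> \<nu> = 0" and w: "\<And>v. sph_deriv F p v \<bullet> w = 0"
  shows "w = (w \<bullet> \<nu>) *\<^sub>R \<nu>"
proof -
  let ?R = "range (sph_deriv F p)"
  have p0: "p \<noteq> 0" using p by auto
  have sR: "subspace ?R" using linear_subspace_image[OF lin[OF p0] subspace_UNIV] .
  have "dim {y. \<forall>x\<in>?R. orthogonal x y} + dim ?R = dim (UNIV :: 'a set)"
    using dim_subspace_orthogonal_to_vectors[OF sR subspace_UNIV] by simp
  then have d1: "dim {y. \<forall>x\<in>?R. orthogonal x y} = 1"
    using dim_range[OF p] dim2 by simp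
  let ?O = "{y. \<forall>x\<in>?R. orthogonal x y}"
  have \<nu>0: "\<nu> \<noteq> 0" using \<nu> by auto
  have sp: "span {\<nu>} = span ?O"
  proof (rule dim_eq_span[symmetric, THEN sym])
    show "{\<nu>} \<subseteq> ?O" using \<nu> by (auto simp: orthogonal_def)
    show "dim ?O \<le> dim {\<nu>}" using d1 \<nu>0 by simp
  qed
  have "w \<in> ?O" using w by (auto simp: orthogonal_def)
  then have "w \<in> span {\<nu>}" unfolding sp by (rule span_base)
  then obtain c where "w = c *\<^sub>R \<nu>" using span_breakdown_eq[of w \<nu> "{}"] by auto
  then show ?thesis using \<nu> by (simp add: dot_square_norm)
qed

text \<open>If the hypersurface lay in a hyperplane with normal \<nu>, a nonzero tangent vector
  \<open>w\<close> of the image would give a second height function. Where that height is largest,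
  both \<nu> and \<open>w\<close> are normal, although they are orthogonal; this contradicts
  \<open>normal_line\<close>.\<close>

lemma not_flat:
  assumes "norm \<nu> = 1" "\<And>q. q \<in> usphere \<Longrightarrow> F q \<bullet> \<nu> = c" shows False
proof -
  obtain p :: 'a where p: "p \<in> usphere" using vector_choose_size[of 1] by (auto simp: dist_norm)
  have p0: "p \<noteq> 0" using p by auto
  have "dim (tangent p) = DIM('a) - 1"
    using dim_hyperplane[OF p0] by (simp add: tangent_def inner_commute)
  then have "dim (tangent p) \<noteq> 0" using dim2 by simp
  then have "\<not> tangent p \<subseteq> {0}" by simp
  then obtain v where v: "v \<in> tangent p" "v \<noteq> 0" by blast
  define w where "w = sph_deriv F p v"
  have w: "w \<noteq> 0" using immersion[OF p v] by (simp add: w_def)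
  have "sph_deriv F p v \<bullet> \<nu> = 0"
    by (rule support_imp_normal[OF p]) (use assms(2) p in \<open>auto simp: inner_diff_left\<close>)
  then have w\<nu>: "w \<bullet> \<nu> = 0" by (simp add: w_def)
  have "continuous_on usphere (\<lambda>q. F q \<bullet> w)" by (intro continuous_intros cont)
  then obtain q where q: "q \<in> usphere" "\<And>r. r \<in> usphere \<Longrightarrow> F r \<bullet> w \<le> F q \<bullet> w"
    using continuous_attains_sup[of usphere "\<lambda>q. F q \<bullet> w"] p by auto
  have "sph_deriv F q u \<bullet> \<nu> = 0" for u
    by (rule support_imp_normal[OF q(1)]) (use assms(2) q in \<open>auto simp: inner_diff_left\<close>)
  moreover have "sph_deriv F q u \<bullet> w = 0" for u
    by (rule support_imp_normal[OF q(1)]) (use q(2) in \<open>auto simp: inner_diff_left\<close>)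
  ultimately have "w = (w \<bullet> \<nu>) *\<^sub>R \<nu>" using normal_line[OF q(1) assms(1)] by blast
  then show False using w w\<nu> by (metis scaleR_zero_left)
qed

text \<open>The normal line leaves only \<mu> = - \<nu> as an alternative, and two opposite
  supporting half-spaces would make the hypersurface flat.\<close>

lemma support_unique:
  assumes p: "p \<in> usphere" and \<nu>: "norm \<nu> = 1" "\<And>q. q \<in> usphere \<Longrightarrow> (F q - F p) \<bullet> \<nu> \<le> 0"
    and \<mu>: "norm \<mu> = 1" "\<And>q. q \<in> usphere \<Longrightarrow> (F q - F p) \<bullet> \<mu> \<le> 0"
  shows "\<mu> = \<nu>"
proof -
  have e: "\<mu> = (\<mu> \<bullet> \<nu>) *\<^sub>R \<nu>"
    by (rule normal_line[OF p \<nu>(1) support_imp_normal[OF p \<nu>(2)] support_imp_normal[OF p \<mu>(2)]])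
  then have "\<bar>\<mu> \<bullet> \<nu>\<bar> = 1" using \<mu>(1) \<nu>(1) by (metis norm_scaleR mult.right_neutral)
  then consider "\<mu> \<bullet> \<nu> = 1" | "\<mu> \<bullet> \<nu> = -1" by linarith
  then show ?thesis
  proof cases
    case 1 then show ?thesis using e by (metis scaleR_one)
  next
    case 2
    then have "\<mu> = - \<nu>" using e by (metis scaleR_minus1_left)
    then have "F q \<bullet> \<nu> = F p \<bullet> \<nu>" if "q \<in> usphere" for q
      using \<nu>(2)[OF that] \<mu>(2)[OF that] by (auto simp: inner_diff_left)
    then show ?thesis using not_flat[OF \<nu>(1)] by blast
  qed
qed

lemma support_exists:
  assumes p: "p \<in> usphere"
  obtains \<nu> where "norm \<nu> = 1" "\<And>q. q \<in> usphere \<Longrightarrow> (F q - F p) \<bullet> \<nu> \<le> 0"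
proof -
  let ?K = "convex hull (F ` usphere)"
  have cK: "compact ?K" using compact_convex_hull[OF compact_continuous_image[OF cont]] by simp
  have sub: "F q \<in> ?K" if "q \<in> usphere" for q using that by (simp add: hull_inc)
  have fr: "F p \<in> frontier ?K" using frontier p by blast
  obtain a where a: "a \<noteq> 0" "\<And>y. y \<in> ?K \<Longrightarrow> a \<bullet> F p \<le> a \<bullet> y"
  proof (cases "F p \<in> rel_interior ?K")
    case False
    then show ?thesis using supporting_hyperplane_rel_boundary[OF convex_convex_hull sub[OF p]] that by metis
  next
    \<comment> \<open>A frontier point can be a relative interior point only if the hull has empty
      interior. The hull then lies in a hyperplane, whose normal supports it with equality.\<close>
    case True
    then have "rel_interior ?K \<noteq> interior ?K" using fr by (auto simp: frontier_def)
    then have "interior ?K = {}" using rel_interior_interior rel_interior_nonempty_interior by blast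
    then obtain a b where "a \<noteq> 0" "?K \<subseteq> {x. a \<bullet> x = b}"
      using empty_interior_subset_hyperplane[OF convex_convex_hull] by metis
    then have "a \<bullet> y = b" if "y \<in> ?K" for y using that by blast
    then show ?thesis using that[of a] \<open>a \<noteq> 0\<close> sub[OF p] by simp
  qed
  show ?thesis
  proof (rule that[of "- sgn a"])
    show "norm (- sgn a) = 1" using a(1) by (simp add: norm_sgn)
    show "(F q - F p) \<bullet> (- sgn a) \<le> 0" if "q \<in> usphere" for q
      using a(2)[OF sub[OF that]] by (simp add: sgn_div_norm inner_diff_left inner_diff_right inner_commute zero_le_mult_iff)
  qed
qed

text \<open>Orthogonality to the tangent space follows from the support inequality, and
  \<open>support_unique\<close> leaves one candidate; so this inequality alone identifies the value
  of the definite description.\<close>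

lemma outward_normal_eqI:
  assumes p: "p \<in> usphere" and \<nu>: "norm \<nu> = 1" "\<And>q. q \<in> usphere \<Longrightarrow> (F q - F p) \<bullet> \<nu> \<le> 0"
  shows "outward_normal F p = \<nu>"
  unfolding outward_normal_def
proof (rule the_equality)
  show "norm \<nu> = 1 \<and> (\<forall>v\<in>tangent p. sph_deriv F p v \<bullet> \<nu> = 0) \<and> (\<forall>q\<in>usphere. (F q - F p) \<bullet> \<nu> \<le> 0)"
    by (intro conjI ballI \<nu> support_imp_normal[OF p \<nu>(2)])
  show "\<mu> = \<nu>" if "norm \<mu> = 1 \<and> (\<forall>v\<in>tangent p. sph_deriv F p v \<bullet> \<mu> = 0) \<and> (\<forall>q\<in>usphere. (F q - F p) \<bullet> \<mu> \<le> 0)" for \<mu>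
    by (rule support_unique[OF p \<nu> conjunct1[OF that] bspec[OF conjunct2[OF conjunct2[OF that]]]])
qed

lemma outward_normal:
  assumes p: "p \<in> usphere"
  shows norm_outward_normal: "norm (outward_normal F p) = 1"
    and outward_normal_le: "\<And>q. q \<in> usphere \<Longrightarrow> F q \<bullet> outward_normal F p \<le> F p \<bullet> outward_normal F p"
    and outward_normal_orth: "\<And>v. sph_deriv F p v \<bullet> outward_normal F p = 0"
proof -
  obtain \<nu> where \<nu>: "norm \<nu> = 1" "\<And>q. q \<in> usphere \<Longrightarrow> (F q - F p) \<bullet> \<nu> \<le> 0"
    using support_exists[OF p] by blast
  note e = outward_normal_eqI[OF p \<nu>]
  show "norm (outward_normal F p) = 1" using \<nu> e by simp
  show "F q \<bullet> outward_normal F p \<le> F p \<bullet> outward_normal F p" if "q \<in> usphere" for q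
    using \<nu>(2)[OF that] e by (simp add: inner_diff_left)
  show "sph_deriv F p v \<bullet> outward_normal F p = 0" for v
    using support_imp_normal[OF p \<nu>(2)] e by simp
qed

lemma outward_normal_iff:
  assumes p: "p \<in> usphere" and "norm \<nu> = 1"
  shows "outward_normal F p = \<nu> \<longleftrightarrow> (\<forall>q\<in>usphere. F q \<bullet> \<nu> \<le> F p \<bullet> \<nu>)"
  using outward_normal_eqI[OF assms] outward_normal_le[OF p] by (auto simp: inner_diff_left)

lemma outward_normal_surj:
  assumes x: "x \<in> usphere"
  obtains p where "p \<in> usphere" "outward_normal F p = x"
proof -
  have "continuous_on usphere (\<lambda>q. F q \<bullet> x)" by (intro continuous_intros cont)
  then obtain q where q: "q \<in> usphere" "\<And>r. r \<in> usphere \<Longrightarrow> F r \<bullet> x \<le> F q \<bullet> x"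
    using continuous_attains_sup[of usphere "\<lambda>q. F q \<bullet> x"] x by auto
  then show ?thesis using outward_normal_iff[OF q(1), of x] x that by auto
qed

text \<open>A tangent vector killed by the differential of the normal is a principal direction with
  curvature 0. Positivity of the principal curvatures thus makes the Gauss map an immersion.\<close>

lemma outward_normal_deriv_nonzero:
  assumes "p \<in> usphere" "v \<in> tangent p" "v \<noteq> 0"
  shows "sph_deriv (outward_normal F) p v \<noteq> 0"
proof
  assume "sph_deriv (outward_normal F) p v = 0"
  then have "principal_curvature F p 0" unfolding principal_curvature_def using assms by auto
  then show False using curvature[OF assms(1)] by blast
qed

text \<open>Two points with the same normal would span a segment of the hypersurface with that normal.\<close>

lemma outward_normal_inj:
  assumes li: "\<And>p. p \<in> usphere \<Longrightarrow> \<exists>r>0. inj_on (outward_normal F) (usphere \<inter> ball p r)"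
  shows "inj_on (outward_normal F) usphere"
proof (rule inj_onI, rule ccontr)
  fix p q assume pq: "p \<in> usphere" "q \<in> usphere" "outward_normal F p = outward_normal F q" "p \<noteq> q"
  define x where "x = outward_normal F p"
  have x: "norm x = 1" using norm_outward_normal[OF pq(1)] by (simp add: x_def)
  have x0: "x \<noteq> 0" using x by auto
  let ?K = "convex hull (F ` usphere)"
  have cK: "compact ?K" using compact_convex_hull[OF compact_continuous_image[OF cont]] by simp
  have le: "F r \<bullet> x \<le> F p \<bullet> x" if "r \<in> usphere" for r
    using outward_normal_le[OF pq(1) that] by (simp add: x_def)
  have "F p \<bullet> x \<le> F q \<bullet> x" using outward_normal_le[OF pq(2,1)] pq(3) by (simp add: x_def)
  then have eqh: "F q \<bullet> x = F p \<bullet> x" using le[OF pq(2)] by simp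
  have "?K \<subseteq> {y. x \<bullet> y \<le> F p \<bullet> x}"
    by (rule hull_minimal, use le in \<open>force simp: inner_commute\<close>, rule convex_halfspace_le)
  then have Kle: "y \<bullet> x \<le> F p \<bullet> x" if "y \<in> ?K" for y using that by (auto simp: inner_commute)
  define y where "y s = F p + s *\<^sub>R (F q - F p)" for s
  have yK: "y s \<in> ?K" if "0 \<le> s" "s \<le> 1" for s
  proof -
    have "y s = (1 - s) *\<^sub>R F p + s *\<^sub>R F q" by (simp add: y_def algebra_simps)
    then show ?thesis using that pq by (simp add: convexD_alt[OF convex_convex_hull] hull_inc)
  qed
  have yx: "y s \<bullet> x = F p \<bullet> x" for s by (simp add: y_def inner_add_left inner_diff_left eqh)
  have yF: "y s \<in> F ` usphere" if s: "0 \<le> s" "s \<le> 1" for s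
  proof -
    \<comment> \<open>The segment lies in the face of largest height in direction \<open>x\<close>;
      an interior point could be pushed further along \<open>x\<close>.\<close>
    have "y s \<notin> interior ?K"
    proof
      assume "y s \<in> interior ?K"
      then obtain e where e: "e > 0" "cball (y s) e \<subseteq> ?K" by (meson mem_interior_cball)
      have "y s + e *\<^sub>R x \<in> ?K" using e x by (auto simp: subset_iff dist_norm)
      from Kle[OF this] show False using e x by (simp add: inner_add_left yx dot_square_norm)
    qed
    then have "y s \<in> frontier ?K" using yK[OF s] by (simp add: frontier_def closure_closed[OF compact_imp_closed[OF cK]])
    then show ?thesis using frontier by blast
  qed
  define r where "r s = inv_into usphere F (y s)" for s
  have r: "r s \<in> usphere" "F (r s) = y s" if "0 \<le> s" "s \<le> 1" for s
    using inv_into_into[OF yF[OF that]] f_inv_into_f[OF yF[OF that]] by (auto simp: r_def)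
  have r0: "r 0 = p" using inv_into_f_f[OF inj pq(1)] by (simp add: r_def y_def)
  have nr: "outward_normal F (r s) = x" if "0 \<le> s" "s \<le> 1" for s
    using outward_normal_iff[OF r(1)[OF that] x] le r(2)[OF that] yx by auto
  \<comment> \<open>By compactness the inverse of the embedding is continuous, so it turns the
    segment into a path of points with normal \<open>x\<close> that starts at \<open>p\<close>.
    Local injectivity keeps this path at \<open>p\<close> for small \<open>s\<close>.\<close>
  have "continuous_on (F ` usphere) (inv_into usphere F)"
    by (rule continuous_on_inv[OF cont compact_sphere]) (use inj in auto)
  moreover have "continuous_on {0..1} y" unfolding y_def by (intro continuous_intros)
  ultimately have "continuous_on {0..1} r" unfolding r_def
    by (rule continuous_on_compose2) (use yF in auto)
  obtain \<rho> where \<rho>: "\<rho> > 0" "inj_on (outward_normal F) (usphere \<inter> ball p \<rho>)" using li[OF pq(1)] by auto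
  from \<open>continuous_on {0..1} r\<close> obtain d where d: "d > 0" "\<And>s. s \<in> {0..1} \<Longrightarrow> dist s 0 < d \<Longrightarrow> dist (r s) (r 0) < \<rho>"
    using \<rho>(1) unfolding continuous_on_iff by (metis atLeastAtMost_iff order_refl zero_le_one)
  define s where "s = min 1 (d/2)"
  have s: "0 < s" "s \<le> 1" "s < d" using d by (auto simp: s_def)
  have "r s = p"
    by (rule inj_onD[OF \<rho>(2)]) (use nr[of s] x_def s r[of s] d(2)[of s] r0 pq \<rho> in \<open>auto simp: dist_commute\<close>)
  then have "y s = F p" using r(2)[of s] s by simp
  then have "F q = F p" using s by (simp add: y_def)
  then show False using inj pq by (auto dest: inj_onD)
qed

end

lemma onorm_le_sum_Basis:
  fixes f :: "'a::euclidean_space \<Rightarrow> 'b::real_normed_vector"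
  assumes "linear f" shows "onorm f \<le> (\<Sum>b\<in>Basis. norm (f b))"
proof (rule onorm_le)
  fix x
  have "norm (f x) \<le> (\<Sum>b\<in>Basis. \<bar>x \<bullet> b\<bar> * norm (f b))"
    by (subst linear_Basis_expansion[OF assms]) (rule order_trans[OF norm_sum], simp)
  also have "\<dots> \<le> (\<Sum>b\<in>Basis. norm x * norm (f b))"
    by (intro sum_mono mult_right_mono Basis_le_norm) auto
  finally show "norm (f x) \<le> (\<Sum>b\<in>Basis. norm (f b)) * norm x" by (simp add: sum_distrib_left mult.commute)
qed

text \<open>Continuity of the derivative on each basis vector is enough, because the sum over the
  basis bounds the operator norm.\<close>

lemma Cm_on_locally_injective:
  fixes f :: "'a::euclidean_space \<Rightarrow> 'a"
  assumes S: "open S" "a \<in> S" and f: "Cm_on (Suc m) S f" and inj: "inj (frechet_derivative f (at a))"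
  shows "\<exists>r>0. ball a r \<subseteq> S \<and> inj_on f (ball a r)"
proof -
  define f' where "f' x = frechet_derivative f (at x)" for x
  have d: "(f has_derivative f' x) (at x)" if "x \<in> S" for x
    unfolding f'_def using Cm_on_has_derivative[OF f that] .
  have lin: "linear (f' x)" if "x \<in> S" for x using has_derivative_linear[OF d[OF that]] .
  have inj': "inj (f' a)" using inj by (simp add: f'_def)
  show ?thesis
  proof (rule has_derivative_locally_injective[OF S(2,1) _ _ d, of "inv (f' a)"])
    show "bounded_linear (inv (f' a))"
      using inj_linear_imp_inv_linear[OF lin[OF S(2)] inj'] linear_linear by blast
    show "inv (f' a) \<circ> f' a = id" using inj' by (simp add: fun_eq_iff)
    fix e :: real assume e: "e > 0"
    have c: "isCont (\<lambda>x. f' x b) a" for b unfolding f'_def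
      using Cm_on_continuous[OF Cm_on_Suc_frechet[OF f]] S continuous_on_eq_continuous_at by blast
    have cn: "((\<lambda>x. f' x b) \<longlongrightarrow> f' a b) (nhds a)" for b
      using c[of b] unfolding isCont_def tendsto_at_iff_tendsto_nhds[of "\<lambda>x. f' x b"] .
    have "((\<lambda>x. \<Sum>b\<in>Basis. norm (f' x b - f' a b)) \<longlongrightarrow> (\<Sum>b\<in>(Basis::'a set). norm (f' a b - f' a b))) (nhds a)"
      by (intro tendsto_intros) (rule cn)
    then have "eventually (\<lambda>x. (\<Sum>b\<in>Basis. norm (f' x b - f' a b)) < e) (nhds a)"
      using e by (intro order_tendstoD(2)[where a=e]) auto
    moreover have "eventually (\<lambda>x. x \<in> S) (nhds a)" using S by (rule eventually_nhds_in_open)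
    ultimately have "eventually (\<lambda>x. onorm (\<lambda>v. f' x v - f' a v) < e) (nhds a)"
    proof eventually_elim
      case (elim x)
      have "linear (\<lambda>v. f' x v - f' a v)" using linear_compose_sub lin S(2) elim(2) by blast
      from onorm_le_sum_Basis[OF this] show ?case using elim(1) by simp
    qed
    then show "\<exists>d>0. \<forall>x. dist a x < d \<longrightarrow> onorm (\<lambda>v. f' x v - f' a v) < e"
      unfolding eventually_nhds_metric by (auto simp: dist_commute)
  qed auto
qed

text \<open>An extension constant along rays is invariant under the scaling that carries
  \<open>y\<close> to \<open>sgn y\<close>, so the chain rule costs a factor 1/|y|.\<close>

lemma sph_deriv_radial:
  fixes f :: "'a::euclidean_space \<Rightarrow> 'b::real_normed_vector"
  assumes y: "y \<noteq> 0" and d: "((\<lambda>y. f (sgn y)) has_derivative sph_deriv f (sgn y)) (at (sgn y))"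
  shows "((\<lambda>y. f (sgn y)) has_derivative (\<lambda>v. sph_deriv f (sgn y) v /\<^sub>R norm y)) (at y)"
    and "sph_deriv f y v = sph_deriv f (sgn y) v /\<^sub>R norm y"
proof -
  have "((\<lambda>x. x /\<^sub>R norm y) has_derivative (\<lambda>v. v /\<^sub>R norm y)) (at y)"
    by (auto intro!: derivative_eq_intros)
  then have "((\<lambda>x. f (sgn (x /\<^sub>R norm y))) has_derivative (\<lambda>v. sph_deriv f (sgn y) (v /\<^sub>R norm y))) (at y)"
    by (rule has_derivative_compose) (use d in \<open>simp add: sgn_div_norm\<close>)
  moreover have "sgn (x /\<^sub>R norm y) = sgn x" for x :: 'a using y by (intro sgn_scaleR_pos) simp
  ultimately show D: "((\<lambda>y. f (sgn y)) has_derivative (\<lambda>v. sph_deriv f (sgn y) v /\<^sub>R norm y)) (at y)"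
    using linear_scale[OF has_derivative_linear[OF d]] by simp
  show "sph_deriv f y v = sph_deriv f (sgn y) v /\<^sub>R norm y"
    using fun_cong[OF frechet_derivative_at[OF D], of v] by (simp add: sph_deriv_def)
qed

lemma partial_fst_has_derivative:
  assumes "(f has_derivative f') (at (y, t))"
  shows "((\<lambda>y. f (y, t)) has_derivative (\<lambda>v. f' (v, 0))) (at y)"
proof -
  have "((\<lambda>y. (y, t)) has_derivative (\<lambda>v. (v, 0))) (at y)"
    by (auto intro!: derivative_eq_intros)
  from has_derivative_compose[OF this, of f f'] assms show ?thesis by simp
qed

lemma partial_snd_has_derivative:
  assumes "(f has_derivative f') (at (y, t))"
  shows "((\<lambda>t. f (y, t)) has_derivative (\<lambda>s. f' (0, s))) (at t)"
proof -
  have "((\<lambda>t. (y, t)) has_derivative (\<lambda>v. (0, v))) (at t)"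
    by (auto intro!: derivative_eq_intros)
  from has_derivative_compose[OF this, of f f'] assms show ?thesis by simp
qed

section \<open>Smooth families of hypersurfaces and their Gauss maps\<close>

locale convex_family =
  fixes X :: "real \<Rightarrow> 'a::euclidean_space \<Rightarrow> 'a" and I :: "real set"
  assumes smooth_family: "smooth_on (usphere \<times> I) (\<lambda>(p, t). X t p)"
    and convex_at: "\<And>t. t \<in> I \<Longrightarrow> uniformly_convex_embedding (X t)" and dim2: "2 \<le> DIM('a)"
begin

lemma embedding: "t \<in> I \<Longrightarrow> convex_embedding (X t)"
  by unfold_locales (auto simp: convex_at dim2)

lemma cont_family: "continuous_on (usphere \<times> I) (\<lambda>z. X (snd z) (fst z))"
  using smooth_on_imp_continuous_on[OF smooth_family] by (simp add: case_prod_beta')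

text \<open>To be a point of largest height is an intersection of closed conditions, one for each
  competitor \<open>q\<close>. With point, time and direction given by arbitrary continuous maps, it
  serves both the Gauss map and its inverse.\<close>

lemma closed_support_relation:
  fixes a b c :: "'z::t2_space \<Rightarrow> 'a" and \<tau> :: "'z \<Rightarrow> real"
  assumes "continuous_on A b" "b ` A \<subseteq> usphere" "continuous_on A \<tau>" "\<tau> ` A \<subseteq> I" "continuous_on A c"
  shows "closedin (top_of_set A) {z \<in> A. \<forall>q\<in>usphere. X (\<tau> z) q \<bullet> c z \<le> X (\<tau> z) (b z) \<bullet> c z}"
proof -
  have ne: "usphere \<noteq> ({}::'a set)"
    using vector_choose_size[of 1] by (auto simp: dist_norm)
  have cX: "continuous_on A (\<lambda>z. X (\<tau> z) (e z))" if "continuous_on A e" "e ` A \<subseteq> usphere" for e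
  proof -
    have "continuous_on A (\<lambda>z. (\<lambda>z. X (snd z) (fst z)) (e z, \<tau> z))"
      by (rule continuous_on_compose2[OF cont_family]) (use that assms in \<open>auto intro!: continuous_intros\<close>)
    then show ?thesis by simp
  qed
  have "{z \<in> A. \<forall>q\<in>usphere. X (\<tau> z) q \<bullet> c z \<le> X (\<tau> z) (b z) \<bullet> c z}
      = (\<Inter>q\<in>usphere. A \<inter> (\<lambda>z. X (\<tau> z) q \<bullet> c z - X (\<tau> z) (b z) \<bullet> c z) -` {..0})"
    using ne by auto
  also have "closedin (top_of_set A) \<dots>"
    by (intro closedin_INT ne continuous_closedin_preimage continuous_intros cX assms) auto
  finally show ?thesis .
qed

text \<open>The graph of the normal is the closed relation of support, and a map with closed graph
  into a compact space is continuous. No regularity of the normal is presupposed.\<close>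

lemma normal_continuous:
  "continuous_on (usphere \<times> I) (\<lambda>z. outward_normal (X (snd z)) (fst z))"
proof -
  let ?f = "\<lambda>z. outward_normal (X (snd z)) (fst z)"
  have f: "?f \<in> usphere \<times> I \<rightarrow> usphere"
    using convex_embedding.norm_outward_normal[OF embedding] by auto
  let ?A = "(usphere \<times> I) \<times> usphere :: (('a \<times> real) \<times> 'a) set"
  have iff: "(\<forall>q\<in>usphere. X t q \<bullet> \<nu> \<le> X t p \<bullet> \<nu>) \<longleftrightarrow> \<nu> = outward_normal (X t) p"
    if "t \<in> I" "norm p = 1" "norm \<nu> = 1" for t p \<nu>
    using convex_embedding.outward_normal_iff[OF embedding, of t p \<nu>] that by auto
  have "(\<lambda>x. (x, ?f x)) ` (usphere \<times> I) = {z \<in> ?A. snd z = ?f (fst z)}"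
    using f by (auto simp: image_iff Pi_iff)
  also have "\<dots> =
     {z \<in> ?A. \<forall>q\<in>usphere. X (snd (fst z)) q \<bullet> snd z \<le> X (snd (fst z)) (fst (fst z)) \<bullet> snd z}"
  proof (intro Collect_cong conj_cong refl)
    fix z assume "z \<in> ?A"
    then show "snd z = ?f (fst z) \<longleftrightarrow> (\<forall>q\<in>usphere. X (snd (fst z)) q \<bullet> snd z \<le> X (snd (fst z)) (fst (fst z)) \<bullet> snd z)"
      using iff[of "snd (fst z)" "fst (fst z)" "snd z"] by (simp add: mem_Times_iff)
  qed
  finally have "closedin (top_of_set ?A) ((\<lambda>x. (x, ?f x)) ` (usphere \<times> I))"
    by (simp only:) (rule closed_support_relation, auto intro!: continuous_intros)
  then show ?thesis
    using continuous_closed_graph_eq[OF compact_sphere f] by simp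
qed

end

text \<open>Derivatives in space and time are taken jointly on an open set, so the parameter set is
  open; a flow enters with its positive times.\<close>

locale open_convex_family = convex_family +
  assumes openI: "open I"
begin

abbreviation "\<Omega> \<equiv> (- {0::'a}) \<times> I"

lemma open_dom: "open \<Omega>"
  by (intro open_Times openI) auto

text \<open>Composition with \<open>sgn\<close> moves position and normal to an open subset of
  Euclidean space-time, where \<open>Cm_on\<close> and the inverse function theorem apply.\<close>

definition Y :: "'a \<times> real \<Rightarrow> 'a" where "Y z = X (snd z) (sgn (fst z))"
definition N :: "'a \<times> real \<Rightarrow> 'a" where "N z = outward_normal (X (snd z)) (sgn (fst z))"

lemma dom_simps: "z \<in> \<Omega> \<longleftrightarrow> fst z \<noteq> 0 \<and> snd z \<in> I"
  by (cases z) auto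

lemma Cm_proj: 
  shows "Cm_on m \<Omega> (\<lambda>z. sgn (fst z))" "Cm_on m \<Omega> (\<lambda>z. norm (fst z))"
  by (rule Cm_on_compose[OF open_dom _ _ Cm_on_fst[OF open_dom] Cm_on_sgn], auto)
     (rule Cm_on_compose[OF open_dom _ _ Cm_on_fst[OF open_dom] Cm_on_norm], auto)

lemma Cm_Y: "Cm_on m \<Omega> Y"
proof -
  have "Cm_on m \<Omega> (\<lambda>z. (\<lambda>(p, t). X t p) (sgn (fst z), snd z))"
    by (rule smooth_on_compose[OF smooth_family open_dom])
      (auto intro!: Cm_on_Pair Cm_proj open_dom Cm_on_snd simp: norm_sgn)
  then show ?thesis by (simp add: Y_def[abs_def])
qed

lemma Y_deriv: "z \<in> \<Omega> \<Longrightarrow> (Y has_derivative frechet_derivative Y (at z)) (at z)"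
  using Cm_on_has_derivative[OF Cm_Y] by blast

lemma Y_partial:
  assumes z: "z \<in> \<Omega>" shows "frechet_derivative Y (at z) (v, 0) = sph_deriv (X (snd z)) (fst z) v"
proof -
  have "((\<lambda>y. Y (y, snd z)) has_derivative (\<lambda>v. frechet_derivative Y (at z) (v, 0))) (at (fst z))"
    by (rule partial_fst_has_derivative) (use Y_deriv[OF z] in simp)
  from has_derivative_unique[OF this] show ?thesis
    using convex_embedding.deriv[OF embedding, of "snd z" "fst z"] z by (auto simp: dom_simps Y_def dest: fun_cong)
qed

lemma N_cont: "continuous_on \<Omega> N"
proof -
  have "continuous_on \<Omega> (\<lambda>z. (\<lambda>z. outward_normal (X (snd z)) (fst z)) (sgn (fst z), snd z))"
    by (rule continuous_on_compose2[OF normal_continuous])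
      (auto intro!: continuous_intros simp: norm_sgn)
  then show ?thesis by (simp add: N_def[abs_def])
qed

lemma N_facts:
  assumes z: "z \<in> \<Omega>"
  shows norm_N: "norm (N z) = 1" and N_orth: "sph_deriv (X (snd z)) (fst z) v \<bullet> N z = 0"
    and N_line: "(\<And>v. sph_deriv (X (snd z)) (fst z) v \<bullet> w = 0) \<Longrightarrow> w = (w \<bullet> N z) *\<^sub>R N z"
proof -
  interpret convex_embedding "X (snd z)" using embedding z by (simp add: dom_simps)
  have s: "sgn (fst z) \<in> usphere" "sgn (fst z) \<noteq> 0" using z by (auto simp: dom_simps norm_sgn sgn_zero_iff)
  show n: "norm (N z) = 1" unfolding N_def using norm_outward_normal[OF s(1)] .
  have r: "sph_deriv (X (snd z)) (fst z) v = sph_deriv (X (snd z)) (sgn (fst z)) v /\<^sub>R norm (fst z)" for v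
    using sph_deriv_radial(2)[OF _ deriv[OF s(2)]] z by (simp add: dom_simps)
  have o: "sph_deriv (X (snd z)) (sgn (fst z)) v \<bullet> N z = 0" for v
    unfolding N_def using outward_normal_orth[OF s(1)] .
  show "sph_deriv (X (snd z)) (fst z) v \<bullet> N z = 0" using o by (simp add: r)
  assume "\<And>v. sph_deriv (X (snd z)) (fst z) v \<bullet> w = 0"
  then have "sph_deriv (X (snd z)) (sgn (fst z)) v \<bullet> w = 0" for v using z by (auto simp: r dom_simps)
  from normal_line[OF s(1) n o this] show "w = (w \<bullet> N z) *\<^sub>R N z" .
qed

text \<open>Near a point with normal \<open>\<nu>\<^sub>0\<close> the normal is the direction of the solution \<open>w\<close> of the
  system \<open>(d\<^sub>yY)\<^sup>* w + \<langle>w, \<nu>\<^sub>0\<rangle> y = y\<close>, which depends smoothly on the point.\<close>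

lemma Cm_N: "Cm_on m \<Omega> N"
proof (rule Cm_on_local)
  fix z0 assume z0: "z0 \<in> \<Omega>"
  define \<nu>0 where "\<nu>0 = N z0"
  define W where "W = \<Omega> \<inter> (\<lambda>z. N z \<bullet> \<nu>0) -` {0<..}"
  have W: "open W" unfolding W_def
    by (rule continuous_open_preimage[OF _ open_dom]) (auto intro!: continuous_intros N_cont)
  have Wd: "W \<subseteq> \<Omega>" by (auto simp: W_def)
  define M where "M z w = (\<Sum>b\<in>Basis. (w \<bullet> frechet_derivative Y (at z) (b, 0)) *\<^sub>R b) + (w \<bullet> \<nu>0) *\<^sub>R fst z" for z w
  have lin: "linear (M z)" for z
    unfolding M_def by (rule linearI) (simp_all add: algebra_simps inner_add_left sum.distrib scaleR_sum_right)
  have MC: "Cm_on m W (\<lambda>z. M z e)" for e m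
    unfolding M_def
    by (rule Cm_on_subset[OF _ Wd])
       (intro Cm_on_add Cm_on_sum Cm_on_scaleR Cm_on_inner Cm_on_const Cm_on_fst open_dom Cm_on_Suc_frechet[OF Cm_Y])
  \<comment> \<open>\<open>Y\<close> is constant along rays, so the adjoint of its spatial
    derivative takes values orthogonal to \<open>fst z\<close>; the inner product with
    \<open>fst z\<close> isolates the rank one term.\<close>
  have My: "M z w \<bullet> fst z = (w \<bullet> \<nu>0) * (fst z \<bullet> fst z)" if z: "z \<in> W" for z w
  proof -
    have zd: "z \<in> \<Omega>" using z Wd by auto
    interpret convex_embedding "X (snd z)" using embedding zd by (simp add: dom_simps)
    have y0: "fst z \<noteq> 0" using zd by (simp add: dom_simps)
    have "(\<Sum>b\<in>Basis. (w \<bullet> frechet_derivative Y (at z) (b, 0)) *\<^sub>R b) \<bullet> fst z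
        = w \<bullet> (\<Sum>b\<in>Basis. (fst z \<bullet> b) *\<^sub>R sph_deriv (X (snd z)) (fst z) b)"
      by (simp add: inner_sum_left inner_sum_right Y_partial[OF zd] inner_commute mult.commute)
    also have "\<dots> = 0"
      using linear_Basis_expansion[OF lin[OF y0], of "fst z"] deriv_self[OF y0] by simp
    finally show ?thesis by (simp add: M_def inner_add_left)
  qed
  have orth: "sph_deriv (X (snd z)) (fst z) v \<bullet> w = 0"
    if z: "z \<in> W" and s: "(\<Sum>b\<in>Basis. (w \<bullet> frechet_derivative Y (at z) (b, 0)) *\<^sub>R b) = 0" for z w v
  proof -
    have zd: "z \<in> \<Omega>" using z Wd by auto
    interpret convex_embedding "X (snd z)" using embedding zd by (simp add: dom_simps)
    have y0: "fst z \<noteq> 0" using zd by (simp add: dom_simps)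
    have "sph_deriv (X (snd z)) (fst z) b \<bullet> w = 0" if b: "b \<in> Basis" for b
    proof -
      have "(\<Sum>b\<in>Basis. (w \<bullet> frechet_derivative Y (at z) (b, 0)) *\<^sub>R b) \<bullet> b = w \<bullet> frechet_derivative Y (at z) (b, 0)"
        using b by (simp add: inner_sum_left_Basis)
      then show ?thesis using s by (simp add: Y_partial[OF zd] inner_commute)
    qed
    then show ?thesis
      by (subst linear_Basis_expansion[OF lin[OF y0]]) (simp add: inner_sum_left)
  qed
  have inj: "inj (M z)" if z: "z \<in> W" for z
    unfolding linear_injective_0[OF lin]
  proof (intro allI impI)
    fix w assume w: "M z w = 0"
    have zd: "z \<in> \<Omega>" using z Wd by auto
    have "(w \<bullet> \<nu>0) * (fst z \<bullet> fst z) = 0" using My[OF z, of w] w by simp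
    then have w0: "w \<bullet> \<nu>0 = 0" using zd by (simp add: dom_simps)
    then have "(\<Sum>b\<in>Basis. (w \<bullet> frechet_derivative Y (at z) (b, 0)) *\<^sub>R b) = 0" using w by (simp add: M_def)
    from N_line[OF zd orth[OF z this]] have e: "w = (w \<bullet> N z) *\<^sub>R N z" by blast
    then have "(w \<bullet> N z) * (N z \<bullet> \<nu>0) = 0" using w0 by (metis inner_scaleR_left)
    moreover have "N z \<bullet> \<nu>0 > 0" using z by (auto simp: W_def)
    ultimately show "w = 0" using e by auto
  qed
  \<comment> \<open>This is \<open>inv (M z) (fst z)\<close>, expanded because smoothness of the
    inverse is known on fixed vectors.\<close>
  define w where "w z = (\<Sum>b\<in>Basis. (fst z \<bullet> b) *\<^sub>R inv (M z) b)" for z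
  have wC: "Cm_on m W w" for m
    unfolding w_def by (intro Cm_on_sum Cm_on_scaleR Cm_on_inner Cm_on_const Cm_on_fst W Cm_on_inverse_operator lin inj MC)
  have w: "w z \<noteq> 0" "sgn (w z) = N z" if z: "z \<in> W" for z
  proof -
    have zd: "z \<in> \<Omega>" using z Wd by auto
    have "w z = inv (M z) (fst z)" unfolding w_def
      by (rule linear_Basis_expansion[symmetric]) (rule inj_linear_imp_inv_linear[OF lin inj[OF z]])
    then have Mw: "M z (w z) = fst z"
      using linear_injective_imp_surjective[OF lin inj[OF z]] surj_f_inv_f by metis
    have "(w z \<bullet> \<nu>0) * (fst z \<bullet> fst z) = fst z \<bullet> fst z" using My[OF z, of "w z"] Mw by simp
    \<comment> \<open>The value 1 fixes the sign: on \<open>W\<close> the normal has a positive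
      product with \<open>\<nu>0\<close>, so the solution points outward.\<close>
    then have w1: "w z \<bullet> \<nu>0 = 1" using zd by (simp add: dom_simps)
    then have "(\<Sum>b\<in>Basis. (w z \<bullet> frechet_derivative Y (at z) (b, 0)) *\<^sub>R b) = 0" using Mw by (simp add: M_def)
    from N_line[OF zd orth[OF z this]] have e: "w z = (w z \<bullet> N z) *\<^sub>R N z" by blast
    then have "(w z \<bullet> N z) * (N z \<bullet> \<nu>0) = 1" using w1 by (metis inner_scaleR_left)
    moreover have "N z \<bullet> \<nu>0 > 0" using z by (auto simp: W_def)
    ultimately have "w z \<bullet> N z > 0" by (smt (verit) mult_nonpos_nonneg)
    then show "sgn (w z) = N z" using norm_N[OF zd] by (subst e) (simp add: sgn_scaleR_pos sgn_of_sphere)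
    show "w z \<noteq> 0" using w1 by auto
  qed
  have "Cm_on m W (\<lambda>z. sgn (w z))"
    by (rule Cm_on_compose[OF W _ _ wC Cm_on_sgn]) (use w in auto)
  then have "Cm_on m W N" by (rule Cm_on_cong[OF W, rotated]) (use w in auto)
  moreover have "z0 \<in> W" using z0 norm_N[OF z0] by (simp add: W_def \<nu>0_def dot_square_norm)
  ultimately show "\<exists>V. open V \<and> z0 \<in> V \<and> Cm_on m V N" using W by blast
qed

text \<open>The extension of the Gauss map of degree one, with time carried along. The radial factor
  gives domain and target equal dimension, so that the map can be inverted.\<close>

definition \<Psi> :: "'a \<times> real \<Rightarrow> 'a \<times> real" where "\<Psi> z = (norm (fst z) *\<^sub>R N z, snd z)"

lemma Cm_\<Psi>: "Cm_on m \<Omega> \<Psi>"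
  unfolding \<Psi>_def by (intro Cm_on_Pair Cm_on_scaleR Cm_proj Cm_N Cm_on_snd open_dom)

text \<open>A unit vector field is orthogonal to its derivative, which separates the two parts of
  the spatial derivative: the normal part forces a kernel direction to be tangent to the sphere, and
  positive curvature excludes tangent ones.\<close>

lemma \<Psi>_deriv_inj:
  assumes z: "z \<in> \<Omega>" shows "inj (frechet_derivative \<Psi> (at z))"
proof -
  obtain y t where zyt: "z = (y, t)" by (cases z)
  have y: "y \<noteq> 0" "t \<in> I" using z zyt by auto
  interpret convex_embedding "X t" using embedding y by simp
  define D where "D = frechet_derivative \<Psi> (at z)"
  define DN where "DN = frechet_derivative N (at z)"
  have dN: "(N has_derivative DN) (at z)" unfolding DN_def using Cm_on_has_derivative[OF Cm_N z] .
  have d: "(\<Psi> has_derivative D) (at z)" unfolding D_def using Cm_on_has_derivative[OF Cm_\<Psi> z] .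
  have "(\<Psi> has_derivative (\<lambda>h. (norm (fst z) *\<^sub>R DN h + (fst h \<bullet> sgn (fst z)) *\<^sub>R N z, snd h))) (at z)"
    unfolding \<Psi>_def
    by (rule has_derivative_Pair[OF has_derivative_scaleR[OF _ dN] has_derivative_snd[OF has_derivative_ident]])
       (rule has_derivative_compose[OF has_derivative_fst[OF has_derivative_ident] has_derivative_norm],
        use z in \<open>auto simp: dom_simps\<close>)
  then have De: "D = (\<lambda>h. (norm (fst z) *\<^sub>R DN h + (fst h \<bullet> sgn (fst z)) *\<^sub>R N z, snd h))"
    using d has_derivative_unique by blast
  have d1: "((\<lambda>z. N z \<bullet> N z) has_derivative (\<lambda>h. N z \<bullet> DN h + DN h \<bullet> N z)) (at z)"
    using has_derivative_inner[OF dN dN] .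
  have d2: "((\<lambda>z. N z \<bullet> N z) has_derivative (\<lambda>h. 0)) (at z)"
    by (rule has_derivative_transform_within_open[OF has_derivative_const[of 1] open_dom z])
       (simp add: norm_N dot_square_norm)
  have "N z \<bullet> DN h + DN h \<bullet> N z = 0" for h using fun_cong[OF has_derivative_unique[OF d1 d2]] .
  then have NDN: "DN h \<bullet> N z = 0" for h by (simp add: inner_commute)
  have "inj D" unfolding linear_injective_0[OF has_derivative_linear[OF d]]
  proof (intro allI impI)
    fix h assume h: "D h = 0"
    obtain v s where hv: "h = (v, s)" by (cases h)
    have s0: "s = 0" and e: "norm y *\<^sub>R DN h + (v \<bullet> sgn y) *\<^sub>R N z = 0"
      using h by (auto simp: De hv zyt prod_eq_iff)
    from arg_cong[OF e, of "\<lambda>u. u \<bullet> N z"] have v: "v \<bullet> sgn y = 0"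
      using NDN norm_N[OF z] by (simp add: inner_add_left dot_square_norm)
    then have "DN (v, 0) = 0" using e y hv s0 by simp
    have dNp: "((\<lambda>y. outward_normal (X t) (sgn y)) has_derivative (\<lambda>v. frechet_derivative N (at (y, t)) (v, 0))) (at y)" if "y \<noteq> 0" for y
      using partial_fst_has_derivative[OF Cm_on_has_derivative[OF Cm_N, of "(y,t)"]] y that by (simp add: N_def)
    then have "((\<lambda>y. outward_normal (X t) (sgn y)) has_derivative sph_deriv (outward_normal (X t)) y) (at y)" if "y \<noteq> 0" for y
      using dNp[OF that] frechet_derivative_at[OF dNp[OF that]] by (simp add: sph_deriv_def[abs_def])
    from sph_deriv_radial(1)[OF y(1) this] y(1)
    have "((\<lambda>y. outward_normal (X t) (sgn y)) has_derivative (\<lambda>v. sph_deriv (outward_normal (X t)) (sgn y) v /\<^sub>R norm y)) (at y)"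
      by (simp add: sgn_zero_iff)
    from has_derivative_unique[OF this dNp[OF y(1)]] have "sph_deriv (outward_normal (X t)) (sgn y) v /\<^sub>R norm y = DN (v, 0)"
      unfolding DN_def zyt by (rule fun_cong)
    then have "sph_deriv (outward_normal (X t)) (sgn y) v = 0" using \<open>DN (v, 0) = 0\<close> y by simp
    moreover have "v \<in> tangent (sgn y)" using v by (simp add: tangent_def)
    ultimately have "v = 0" using outward_normal_deriv_nonzero[of "sgn y" v] y by (auto simp: norm_sgn)
    then show "h = 0" by (simp add: hv s0 zero_prod_def)
  qed
  then show ?thesis by (simp add: D_def)
qed

text \<open>Local injectivity of \<Psi> restricts to the sphere, and
  \<open>outward_normal_inj\<close> makes it global.\<close>

lemma normal_inj: assumes t: "t \<in> I" shows "inj_on (outward_normal (X t)) usphere"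
proof -
  interpret convex_embedding "X t" using embedding t by simp
  show ?thesis
  proof (rule outward_normal_inj)
    fix p :: 'a assume p: "p \<in> usphere"
    then have z: "(p, t) \<in> \<Omega>" using t by auto
    obtain r where r: "r > 0" "inj_on \<Psi> (ball (p, t) r)"
      using Cm_on_locally_injective[OF open_dom z Cm_\<Psi> \<Psi>_deriv_inj[OF z]] by blast
    have "inj_on (outward_normal (X t)) (usphere \<inter> ball p r)"
    proof (rule inj_onI)
      fix a b assume ab: "a \<in> usphere \<inter> ball p r" "b \<in> usphere \<inter> ball p r" "outward_normal (X t) a = outward_normal (X t) b"
      then have "\<Psi> (a, t) = \<Psi> (b, t)" by (simp add: \<Psi>_def N_def sgn_of_sphere)
      moreover have "(a, t) \<in> ball (p, t) r" "(b, t) \<in> ball (p, t) r" using ab by (auto simp: dist_Pair_Pair)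
      ultimately show "a = b" using r(2) by (auto dest: inj_onD)
    qed
    then show "\<exists>r>0. inj_on (outward_normal (X t)) (usphere \<inter> ball p r)" using r by blast
  qed
qed

end

text \<open>A single hypersurface is treated as a constant family, so the results for families need
  no static counterpart.\<close>

lemma smooth_on_constant_family:
  fixes f :: "'a::euclidean_space \<Rightarrow> 'b::real_normed_vector"
  assumes "smooth_on S f" shows "smooth_on (S \<times> (UNIV::real set)) (\<lambda>(p, t). f p)"
  unfolding smooth_on_def
proof
  fix z :: "'a \<times> real" assume "z \<in> S \<times> UNIV"
  then obtain U g where U: "open U" "fst z \<in> U" "\<forall>m. Cm_on m U g" "\<forall>y\<in>S \<inter> U. g y = f y"
    using assms unfolding smooth_on_def by (metis mem_Times_iff)
  have o: "open (U \<times> (UNIV::real set))" using U by (simp add: open_Times)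
  have "Cm_on m (U \<times> (UNIV::real set)) (\<lambda>z. g (fst z))" for m
    by (rule Cm_on_compose[OF o U(1) _ Cm_on_fst[OF o]]) (use U in auto)
  then show "\<exists>V h. open V \<and> z \<in> V \<and> (\<forall>m. Cm_on m V h) \<and> (\<forall>y\<in>(S \<times> UNIV) \<inter> V. h y = (case y of (p, t) \<Rightarrow> f p))"
    using o U by (intro exI[of _ "U \<times> UNIV"] exI[of _ "\<lambda>z. g (fst z)"]) (auto simp: mem_Times_iff)
qed

lemma (in convex_embedding) outward_normal_bij: "bij_betw (outward_normal F) usphere usphere"
proof -
  interpret open_convex_family "\<lambda>t. F" UNIV
    by unfold_locales (auto simp: smooth_on_constant_family[OF smooth] emb dim2)
  show ?thesis unfolding bij_betw_def
  proof (intro conjI equalityI subsetI)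
    show "inj_on (outward_normal F) usphere" using normal_inj[of 0] by simp
    show "x \<in> usphere" if "x \<in> outward_normal F ` usphere" for x
      using that norm_outward_normal by auto
    show "x \<in> outward_normal F ` usphere" if "x \<in> usphere" for x
      using outward_normal_surj[OF that] by blast
  qed
qed

section \<open>The inverse Gauss map and the support function of a family\<close>

context convex_family
begin

definition gauss_inv :: "real \<Rightarrow> 'a \<Rightarrow> 'a" where
  "gauss_inv t = inv_into usphere (outward_normal (X t))"

text \<open>The point whose outward normal has the direction \<open>fst w\<close>. Being of degree
  zero, it can be the gradient of the support function extended with degree one.\<close>

definition Z :: "'a \<times> real \<Rightarrow> 'a" where
  "Z w = X (snd w) (gauss_inv (snd w) (sgn (fst w)))"

lemma gauss_inv:
  assumes "t \<in> I" "x \<in> usphere"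
  shows gauss_inv_sphere: "gauss_inv t x \<in> usphere" and normal_gauss_inv: "outward_normal (X t) (gauss_inv t x) = x"
proof -
  have "x \<in> outward_normal (X t) ` usphere"
    using convex_embedding.outward_normal_bij[OF embedding[OF assms(1)]] assms(2) by (simp only: bij_betw_def)
  then show "gauss_inv t x \<in> usphere" "outward_normal (X t) (gauss_inv t x) = x"
    unfolding gauss_inv_def by (rule inv_into_into, rule f_inv_into_f)
qed

lemma gauss_inv_eqI:
  assumes "t \<in> I" "p \<in> usphere" "outward_normal (X t) p = x"
  shows "gauss_inv t x = p"
  using convex_embedding.outward_normal_bij[OF embedding[OF assms(1)]] assms(2,3)
  unfolding gauss_inv_def bij_betw_def by (auto simp del: mem_sphere)

text \<open>The closed relation of support again, read with the normal as argument and the point as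
  value.\<close>

lemma gauss_inv_continuous:
  "continuous_on (usphere \<times> I) (\<lambda>z. gauss_inv (snd z) (fst z))"
proof -
  let ?f = "\<lambda>z. gauss_inv (snd z) (fst z)"
  have f: "?f \<in> usphere \<times> I \<rightarrow> usphere"
    using gauss_inv_sphere by (auto simp del: mem_sphere)
  let ?A = "(usphere \<times> I) \<times> usphere :: (('a \<times> real) \<times> 'a) set"
  have iff: "(\<forall>q\<in>usphere. X t q \<bullet> x \<le> X t p \<bullet> x) \<longleftrightarrow> p = gauss_inv t x"
    if "t \<in> I" "p \<in> usphere" "x \<in> usphere" for t p x
    using convex_embedding.outward_normal_iff[OF embedding, of t p x] that gauss_inv_eqI[OF that(1,2), of x]
      normal_gauss_inv[OF that(1,3)] by auto
  have "(\<lambda>x. (x, ?f x)) ` (usphere \<times> I) = {z \<in> ?A. snd z = ?f (fst z)}"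
    using f by (auto simp: image_iff Pi_iff)
  also have "\<dots> =
     {z \<in> ?A. \<forall>q\<in>usphere. X (snd (fst z)) q \<bullet> fst (fst z) \<le> X (snd (fst z)) (snd z) \<bullet> fst (fst z)}"
  proof (intro Collect_cong conj_cong refl)
    fix z assume "z \<in> ?A"
    then show "snd z = ?f (fst z) \<longleftrightarrow> (\<forall>q\<in>usphere. X (snd (fst z)) q \<bullet> fst (fst z) \<le> X (snd (fst z)) (snd z) \<bullet> fst (fst z))"
      using iff[of "snd (fst z)" "snd z" "fst (fst z)"] by (simp add: mem_Times_iff)
  qed
  finally have "closedin (top_of_set ?A) ((\<lambda>x. (x, ?f x)) ` (usphere \<times> I))"
    by (simp only:) (rule closed_support_relation, auto intro!: continuous_intros)
  then show ?thesis
    using continuous_closed_graph_eq[OF compact_sphere f] by simp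
qed

lemma Z_continuous: "continuous_on ((- {0}) \<times> I) Z"
proof -
  have g: "continuous_on ((- {0}) \<times> I) (\<lambda>w. gauss_inv (snd w) (sgn (fst w)))"
  proof -
    have "continuous_on ((- {0}) \<times> I) (\<lambda>w. (\<lambda>z. gauss_inv (snd z) (fst z)) (sgn (fst w), snd w))"
      by (rule continuous_on_compose2[OF gauss_inv_continuous]) (auto intro!: continuous_intros simp: norm_sgn)
    then show ?thesis by simp
  qed
  have "continuous_on ((- {0}) \<times> I) (\<lambda>w. (\<lambda>z. X (snd z) (fst z)) (gauss_inv (snd w) (sgn (fst w)), snd w))"
  proof (rule continuous_on_compose2[OF cont_family])
    show "continuous_on ((- {0}) \<times> I) (\<lambda>w. (gauss_inv (snd w) (sgn (fst w)), snd w))"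
      by (intro continuous_intros g)
    show "(\<lambda>w. (gauss_inv (snd w) (sgn (fst w)), snd w)) ` ((- {0}) \<times> I) \<subseteq> usphere \<times> I"
      using gauss_inv_sphere[OF _ sgn_sphere] by auto
  qed
  then show ?thesis by (simp add: Z_def[abs_def])
qed

lemma Z_max:
  assumes "t \<in> I" "p \<in> usphere" "x \<noteq> 0" shows "X t p \<bullet> x \<le> Z (x, t) \<bullet> x"
proof -
  have s: "sgn x \<in> usphere" using assms sgn_sphere by blast
  have "X t p \<bullet> sgn x \<le> Z (x, t) \<bullet> sgn x"
    using convex_embedding.outward_normal_le[OF embedding[OF assms(1)] gauss_inv_sphere[OF assms(1) s] assms(2)]
    by (simp add: Z_def normal_gauss_inv[OF assms(1) s])
  then show ?thesis using assms(3) by (simp add: sgn_div_norm)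
qed

lemma Z_in: "t \<in> I \<Longrightarrow> x \<noteq> 0 \<Longrightarrow> \<exists>p\<in>usphere. Z (x, t) = X t p"
  using gauss_inv_sphere sgn_sphere unfolding Z_def fst_conv snd_conv by blast

lemma support_fun_eq:
  assumes "t \<in> I" "x \<noteq> 0" shows "support_fun (X t ` usphere) x = Z (x, t) \<bullet> x"
  unfolding support_fun_def
proof (rule cSup_eq_maximum)
  show "Z (x, t) \<bullet> x \<in> (\<lambda>y. y \<bullet> x) ` X t ` usphere" using Z_in[OF assms] by auto
  show "y \<le> Z (x, t) \<bullet> x" if "y \<in> (\<lambda>y. y \<bullet> x) ` X t ` usphere" for y
    using that Z_max[OF assms(1) _ assms(2)] by auto
qed

lemma Z_radial: "c > 0 \<Longrightarrow> Z (c *\<^sub>R x, t) = Z (x, t)"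
  by (simp add: Z_def sgn_scaleR_pos)

text \<open>Each point maximises the height in its own normal direction; the two inequalities add
  up. This monotonicity later yields a nonnegative Hessian.\<close>

lemma Z_monotone:
  assumes "t \<in> I" "x \<noteq> 0" "y \<noteq> 0" shows "0 \<le> (Z (x, t) - Z (y, t)) \<bullet> (x - y)"
proof -
  obtain p q where pq: "p \<in> usphere" "Z (x, t) = X t p" "q \<in> usphere" "Z (y, t) = X t q"
    using Z_in assms by meson
  then show ?thesis using Z_max[OF assms(1) pq(3) assms(2)] Z_max[OF assms(1) pq(1) assms(3)]
    by (simp add: inner_diff_left inner_diff_right)
qed

end

context open_convex_family
begin

text \<open>The inverse of \<Psi>: it keeps norm and time and replaces a normal by its parameter
  point.\<close>

definition P :: "'a \<times> real \<Rightarrow> 'a \<times> real" where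
  "P w = (norm (fst w) *\<^sub>R gauss_inv (snd w) (sgn (fst w)), snd w)"

lemma P_facts:
  assumes w: "w \<in> \<Omega>"
  shows P_dom: "P w \<in> \<Omega>" and N_P: "N (P w) = sgn (fst w)" and \<Psi>_P: "\<Psi> (P w) = w" and Y_P: "Y (P w) = Z w"
    and norm_P: "norm (fst (P w)) = norm (fst w)"
proof -
  have t: "snd w \<in> I" and x: "fst w \<noteq> 0" using w by (auto simp: dom_simps)
  have s: "sgn (fst w) \<in> usphere" using x sgn_sphere by blast
  have g: "norm (gauss_inv (snd w) (sgn (fst w))) = 1" using gauss_inv_sphere[OF t s] by simp
  have sg: "sgn (norm (fst w) *\<^sub>R gauss_inv (snd w) (sgn (fst w))) = gauss_inv (snd w) (sgn (fst w))"
    using x g by (simp add: sgn_scaleR_pos sgn_of_sphere)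
  show "P w \<in> \<Omega>" using t x g unfolding dom_simps by (auto simp: P_def)
  show n: "N (P w) = sgn (fst w)" by (simp add: N_def P_def sg normal_gauss_inv[OF t s])
  show nn: "norm (fst (P w)) = norm (fst w)" using g by (simp add: P_def)
  show "\<Psi> (P w) = w" using n nn x by (simp add: \<Psi>_def sgn_div_norm P_def prod_eq_iff)
  show "Y (P w) = Z w" unfolding Y_def Z_def by (simp add: P_def sg)
qed

lemma P_continuous: "continuous_on \<Omega> P"
proof -
  have "continuous_on \<Omega> (\<lambda>w. (\<lambda>z. gauss_inv (snd z) (fst z)) (sgn (fst w), snd w))"
    by (rule continuous_on_compose2[OF gauss_inv_continuous]) (auto intro!: continuous_intros simp: norm_sgn)
  then have "continuous_on \<Omega> (\<lambda>w. gauss_inv (snd w) (sgn (fst w)))" by simp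
  then show ?thesis unfolding P_def[abs_def] by (intro continuous_intros)
qed

lemma Cm_P: "Cm_on m \<Omega> P"
  by (rule Cm_on_inverse_function[OF open_dom open_dom Cm_\<Psi> P_dom \<Psi>_P P_continuous \<Psi>_deriv_inj])

lemma Cm_Z: "Cm_on m \<Omega> Z"
proof -
  have "Cm_on m \<Omega> (\<lambda>w. Y (P w))"
    by (rule Cm_on_compose[OF open_dom open_dom _ Cm_P Cm_Y]) (use P_dom in blast)
  then show ?thesis by (rule Cm_on_cong[OF open_dom, rotated]) (simp add: Y_P)
qed

lemma Z_deriv: "w \<in> \<Omega> \<Longrightarrow> (Z has_derivative frechet_derivative Z (at w)) (at w)"
  using Cm_on_has_derivative[OF Cm_Z] by blast

lemma P_deriv: "w \<in> \<Omega> \<Longrightarrow> (P has_derivative frechet_derivative P (at w)) (at w)"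
  using Cm_on_has_derivative[OF Cm_P] by blast

lemma snd_DP:
  assumes w: "w \<in> \<Omega>" shows "snd (frechet_derivative P (at w) h) = snd h"
proof -
  have "((\<lambda>w. snd (P w)) has_derivative (\<lambda>h. snd (frechet_derivative P (at w) h))) (at w)"
    using has_derivative_snd[OF P_deriv[OF w]] .
  moreover have "((\<lambda>w. snd (P w)) has_derivative (\<lambda>h. snd h)) (at w)"
    unfolding P_def snd_conv by (rule has_derivative_snd[OF has_derivative_ident])
  ultimately show ?thesis by (rule fun_cong[OF has_derivative_unique])
qed

lemma DZ_eq:
  assumes w: "w \<in> \<Omega>"
  shows "frechet_derivative Z (at w) h = sph_deriv (X (snd w)) (fst (P w)) (fst (frechet_derivative P (at w) h))
     + snd h *\<^sub>R frechet_derivative Y (at (P w)) (0, 1)"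
proof -
  note d = has_derivative_compose[OF P_deriv[OF w] Y_deriv[OF P_dom[OF w]]]
  have "(Z has_derivative (\<lambda>h. frechet_derivative Y (at (P w)) (frechet_derivative P (at w) h))) (at w)"
    by (rule has_derivative_transform_within_open[OF d open_dom w]) (simp add: Y_P)
  then have "frechet_derivative Z (at w) h = frechet_derivative Y (at (P w)) (frechet_derivative P (at w) h)"
    by (rule fun_cong[OF frechet_derivative_at, symmetric])
  also have "frechet_derivative P (at w) h = (fst (frechet_derivative P (at w) h), 0) + snd h *\<^sub>R (0, 1)"
    using snd_DP[OF w, of h] by (simp add: prod_eq_iff)
  also have "frechet_derivative Y (at (P w)) \<dots> =
      frechet_derivative Y (at (P w)) (fst (frechet_derivative P (at w) h), 0) + snd h *\<^sub>R frechet_derivative Y (at (P w)) (0, 1)"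
    using has_derivative_linear[OF Y_deriv[OF P_dom[OF w]]] by (simp only: linear_add linear_scale)
  also have "frechet_derivative Y (at (P w)) (fst (frechet_derivative P (at w) h), 0) =
      sph_deriv (X (snd w)) (fst (P w)) (fst (frechet_derivative P (at w) h))"
    using Y_partial[OF P_dom[OF w]] by (simp add: P_def)
  finally show ?thesis .
qed

text \<open>Varying the normal moves the position tangentially, hence orthogonally to the normal
  \<open>fst w\<close>; only the velocity in time remains.\<close>

lemma DZ_inner:
  assumes w: "w \<in> \<Omega>"
  shows "frechet_derivative Z (at w) h \<bullet> fst w = snd h * (frechet_derivative Y (at (P w)) (0, 1) \<bullet> fst w)"
proof -
  have "sph_deriv (X (snd w)) (fst (P w)) v \<bullet> fst w = 0" for v
  proof -
    have "sph_deriv (X (snd w)) (fst (P w)) v \<bullet> sgn (fst w) = 0"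
      using N_orth[OF P_dom[OF w], of v] N_P[OF w] by (simp add: P_def)
    then show ?thesis using w by (simp add: sgn_div_norm dom_simps)
  qed
  then show ?thesis by (simp add: DZ_eq[OF w] inner_add_left)
qed

text \<open>A direction in which the position is stationary lifts to one killed by the differential
  of the immersion, hence to a radial one, and \<Psi> carries radial directions to radial
  directions. This is the nondegeneracy of the Hessian of the support function.\<close>

lemma DZ_kernel:
  assumes w: "w \<in> \<Omega>" and z: "frechet_derivative Z (at w) (v, 0) = 0"
  shows "\<exists>c. v = c *\<^sub>R fst w"
proof -
  have t: "snd w \<in> I" and x: "fst w \<noteq> 0" using w by (auto simp: dom_simps)
  interpret convex_embedding "X (snd w)" using embedding t by simp
  define p where "p = sgn (fst (P w))"
  have y0: "fst (P w) \<noteq> 0" using P_dom[OF w] by (simp add: dom_simps)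
  have p: "p \<in> usphere" "p \<noteq> 0" using y0 by (auto simp: p_def norm_sgn sgn_zero_iff)
  define e where "e = fst (frechet_derivative P (at w) (v, 0))"
  have "sph_deriv (X (snd w)) (fst (P w)) e = 0" using z by (simp add: DZ_eq[OF w] e_def)
  then have "sph_deriv (X (snd w)) p e = 0"
    using sph_deriv_radial(2)[OF y0 deriv, of e] y0 p by (simp add: p_def)
  then obtain c where e: "e = c *\<^sub>R p" using deriv_kernel[OF p(1)] by blast
  have eq: "frechet_derivative P (at w) (v, 0) = (e, 0)"
    using snd_DP[OF w, of "(v, 0)"] by (simp add: e_def prod_eq_iff)
  let ?D = "frechet_derivative \<Psi> (at (P w))"
  have d\<Psi>: "(\<Psi> has_derivative ?D) (at (P w))" using Cm_on_has_derivative[OF Cm_\<Psi> P_dom[OF w]] .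
  have "((\<lambda>w. w) has_derivative (\<lambda>h. ?D (frechet_derivative P (at w) h))) (at w)"
    by (rule has_derivative_transform_within_open[OF has_derivative_compose[OF P_deriv[OF w] d\<Psi>] open_dom w])
       (simp add: \<Psi>_P)
  then have "?D (frechet_derivative P (at w) h) = h" for h
    using fun_cong[OF has_derivative_unique[OF _ has_derivative_ident], of _ w h] by blast
  from this[of "(v, 0)"] have "?D (e, 0) = (v, 0)" unfolding eq .
  moreover have "?D (e, 0) = c *\<^sub>R ?D (p, 0)"
    using linear_scale[OF has_derivative_linear[OF d\<Psi>], of c "(p, 0)"] e by simp
  moreover have "?D (p, 0) = (N (P w), 0)"
  proof (rule derivative_along_eqI[OF d\<Psi>, where g="\<lambda>s. ((norm (fst w) + s) *\<^sub>R N (P w), snd w)"])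
    have "eventually (\<lambda>s::real. s \<in> {- norm (fst w)<..}) (nhds 0)"
      using x by (intro eventually_nhds_in_open) auto
    then show "eventually (\<lambda>s. \<Psi> (P w + s *\<^sub>R (p, 0)) = ((norm (fst w) + s) *\<^sub>R N (P w), snd w)) (nhds 0)"
    proof eventually_elim
      case (elim s)
      have sn: "snd (P w) = snd w" by (simp add: P_def)
      have "fst (P w) = norm (fst w) *\<^sub>R p" using x norm_P[OF w] by (simp add: p_def sgn_div_norm)
      then have 1: "P w + s *\<^sub>R (p, 0) = ((norm (fst w) + s) *\<^sub>R p, snd w)"
        by (simp add: prod_eq_iff scaleR_add_left sn)
      have 2: "sgn ((norm (fst w) + s) *\<^sub>R p) = p" "norm ((norm (fst w) + s) *\<^sub>R p) = norm (fst w) + s"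
        using elim p(1) by (simp_all add: sgn_scaleR_pos sgn_of_sphere)
      have "N (P w) = outward_normal (X (snd w)) p" unfolding N_def sn p_def ..
      then show ?case unfolding 1 \<Psi>_def N_def fst_conv snd_conv 2 by simp
    qed
    show "((\<lambda>s. ((norm (fst w) + s) *\<^sub>R N (P w), snd w)) has_vector_derivative (N (P w), 0)) (at 0)"
      by (auto intro!: derivative_eq_intros simp: has_vector_derivative_def)
  qed
  ultimately have "v = c *\<^sub>R sgn (fst w)" by (simp add: N_P[OF w])
  then have "v = (c / norm (fst w)) *\<^sub>R fst w" by (simp add: sgn_div_norm divide_inverse)
  then show ?thesis by blast
qed

definition U :: "'a \<times> real \<Rightarrow> real" where "U w = Z w \<bullet> fst w"

lemma Cm_U: "Cm_on m \<Omega> U"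
  unfolding U_def[abs_def] by (intro Cm_on_inner Cm_Z Cm_on_fst open_dom)

text \<open>The envelope principle: by \<open>DZ_inner\<close> the spatial derivative of
  \<open>Z\<close> drops out of the product rule, so \<open>Z\<close> is the spatial gradient of
  \<open>U\<close>.\<close>

lemma U_deriv:
  assumes w: "w \<in> \<Omega>"
  shows "(U has_derivative (\<lambda>h. Z w \<bullet> fst h + snd h * (frechet_derivative Y (at (P w)) (0, 1) \<bullet> fst w))) (at w)"
  unfolding U_def[abs_def]
  by (rule has_derivative_eq_rhs[OF has_derivative_inner[OF Z_deriv[OF w] has_derivative_fst[OF has_derivative_ident]]])
     (simp add: DZ_inner[OF w])

lemma U_space_deriv:
  assumes "t \<in> I" "y \<noteq> 0" shows "((\<lambda>y. U (y, t)) has_derivative (\<lambda>v. Z (y, t) \<bullet> v)) (at y)"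
  using partial_fst_has_derivative[OF U_deriv[of "(y, t)"]] assms by simp

text \<open>At a fixed normal the point realising the support function may slide along the
  hypersurface, but that motion is tangential. So the velocity of the parameter point currently
  there gives the derivative.\<close>

lemma U_time_deriv:
  assumes t: "t \<in> I" and y: "y \<noteq> 0"
    and V: "((\<lambda>s. X s (gauss_inv t (sgn y))) has_vector_derivative V) (at t)"
  shows "((\<lambda>s. U (y, s)) has_real_derivative V \<bullet> y) (at t)"
proof -
  have w: "(y, t) \<in> \<Omega>" using assms by auto
  have s: "sgn y \<in> usphere" using y sgn_sphere by blast
  obtain q where q: "P (y, t) = (q, t)" "sgn q = gauss_inv t (sgn y)"
    using y gauss_inv_sphere[OF t s] by (simp add: P_def sgn_scaleR_pos sgn_of_sphere)
  have "((\<lambda>s. Y (q, s)) has_derivative (\<lambda>s. frechet_derivative Y (at (q, t)) (0, s))) (at t)"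
    using partial_snd_has_derivative[OF Y_deriv[OF P_dom[OF w], unfolded q]] .
  moreover have "((\<lambda>s. Y (q, s)) has_derivative (\<lambda>s. s *\<^sub>R V)) (at t)"
    using V by (simp add: Y_def q has_vector_derivative_def)
  ultimately have "frechet_derivative Y (at (q, t)) (0, 1) = 1 *\<^sub>R V"
    by (rule fun_cong[OF has_derivative_unique])
  then have "((\<lambda>s. U (y, s)) has_derivative (\<lambda>s. s * (V \<bullet> y))) (at t)"
    using partial_snd_has_derivative[OF U_deriv[OF w]] by (simp add: q)
  then show ?thesis by (simp add: has_field_derivative_def mult_commute_abs)
qed

lemma U_support: "t \<in> I \<Longrightarrow> y \<noteq> 0 \<Longrightarrow> U (y, t) = support_fun (X t ` usphere) y"
  by (simp add: U_def support_fun_eq)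

end

section \<open>Homogeneous functions and their Hessians\<close>

text \<open>Built from the values of \<open>L\<close> on the basis, so that smoothness with values
  in the operators follows from smoothness of each value.\<close>

definition blin :: "('a::euclidean_space \<Rightarrow> 'b::real_normed_vector) \<Rightarrow> 'a \<Rightarrow>\<^sub>L 'b" where
  "blin L = (\<Sum>c\<in>Basis. blinfun_scaleR_left (L c) o\<^sub>L blinfun_inner_left c)"

lemma blin_apply: assumes "linear L" shows "blin L v = L v"
proof -
  have "blin L v = (\<Sum>c\<in>Basis. (v \<bullet> c) *\<^sub>R L c)"
    by (simp add: blin_def blinfun.sum_left inner_commute)
  also have "\<dots> = L v" by (rule linear_Basis_expansion[OF assms, symmetric])
  finally show ?thesis .
qed

lemma Cm_on_blin:
  assumes "open U" "\<And>v. Cm_on m U (\<lambda>y. L y v)" shows "Cm_on m U (\<lambda>y. blin (L y))"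
  unfolding blin_def
  by (intro Cm_on_sum Cm_on_linear_compose[where L="\<lambda>w. blinfun_scaleR_left w o\<^sub>L _"] assms
      bounded_linear_compose[OF bounded_bilinear.bounded_linear_left[OF bounded_bilinear_blinfun_compose] bounded_linear_blinfun_scaleR_left])

text \<open>A function of degree one with gradient \<open>z\<close>, Hessian \<open>A\<close> and
  third derivative \<open>B\<close>. With the derivatives as parameters, moving the origin gives
  another instance with the same \<open>A\<close> and \<open>B\<close>.\<close>

locale homogeneous_C3 =
  fixes U :: "'a::euclidean_space \<Rightarrow> real" and z :: "'a \<Rightarrow> 'a" and A :: "'a \<Rightarrow> 'a \<Rightarrow>\<^sub>L 'a"
    and B :: "'a \<Rightarrow> 'a \<Rightarrow>\<^sub>L ('a \<Rightarrow>\<^sub>L 'a)"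
  assumes dU: "\<And>y. y \<noteq> 0 \<Longrightarrow> (U has_derivative (\<lambda>v. z y \<bullet> v)) (at y)"
    and dz: "\<And>y. y \<noteq> 0 \<Longrightarrow> (z has_derivative A y) (at y)"
    and dA: "\<And>y. y \<noteq> 0 \<Longrightarrow> (A has_derivative B y) (at y)"
    and CA: "Cm_on (Suc 0) (- {0}) A"
    and z_radial: "\<And>y c. y \<noteq> 0 \<Longrightarrow> c > 0 \<Longrightarrow> z (c *\<^sub>R y) = z y"
    and U_z: "\<And>y. y \<noteq> 0 \<Longrightarrow> U y = z y \<bullet> y"
    and symA: "\<And>y v w. y \<noteq> 0 \<Longrightarrow> A y v \<bullet> w = A y w \<bullet> v"
    and symB: "\<And>y v w. y \<noteq> 0 \<Longrightarrow> B y v w = B y w v"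

text \<open>Both symmetries are the commutation of mixed derivatives, applied to \<open>U\<close>
  for the Hessian and to each component of \<open>z\<close> for the third derivative.\<close>

lemma homogeneous_C3I:
  fixes U :: "'a::euclidean_space \<Rightarrow> real" and z :: "'a \<Rightarrow> 'a"
  defines "A \<equiv> \<lambda>y. blin (frechet_derivative z (at y))"
  assumes dU: "\<And>y. y \<noteq> 0 \<Longrightarrow> (U has_derivative (\<lambda>v. z y \<bullet> v)) (at y)"
    and z: "\<And>m. Cm_on m (- {0}) z"
    and z_radial: "\<And>y c. y \<noteq> 0 \<Longrightarrow> c > 0 \<Longrightarrow> z (c *\<^sub>R y) = z y"
    and U_z: "\<And>y. y \<noteq> 0 \<Longrightarrow> U y = z y \<bullet> y"
  shows "homogeneous_C3 U z A (\<lambda>y. blin (frechet_derivative A (at y)))"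
proof -
  have o: "open (- {0::'a})" by auto
  have dz: "(z has_derivative frechet_derivative z (at y)) (at y)" if "y \<noteq> 0" for y
    using Cm_on_has_derivative[OF z] that by simp
  have Av: "blinfun_apply (A y) = frechet_derivative z (at y)" if "y \<noteq> 0" for y
    unfolding A_def using blin_apply[OF has_derivative_linear[OF dz[OF that]]] by blast
  have CA: "Cm_on m (- {0}) A" for m
    unfolding A_def by (intro Cm_on_blin o Cm_on_Suc_frechet[OF z])
  have dA: "(A has_derivative frechet_derivative A (at y)) (at y)" if "y \<noteq> 0" for y
    using Cm_on_has_derivative[OF CA] that by simp
  let ?B = "\<lambda>y. blin (frechet_derivative A (at y))"
  have Bv: "blinfun_apply (?B y) = frechet_derivative A (at y)" if "y \<noteq> 0" for y
    using blin_apply[OF has_derivative_linear[OF dA[OF that]]] by blast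
  have CU: "Cm_on m (- {0}) U" for m
  proof -
    have "Cm_on (Suc m) (- {0}) U"
      by (rule Cm_on_SucI[OF o dU]) (auto intro!: Cm_on_inner Cm_on_const z o)
    then show ?thesis using Cm_on_Suc_lower by blast
  qed
  have fU: "frechet_derivative U (at y) v = z y \<bullet> v" if "y \<noteq> 0" for y v
    using fun_cong[OF frechet_derivative_at[OF dU[OF that]], of v] by simp
  show ?thesis
  proof
    show "(U has_derivative (\<bullet>) (z y)) (at y)" if "y \<noteq> 0" for y using dU[OF that] .
    show "(z has_derivative blinfun_apply (A y)) (at y)" if "y \<noteq> 0" for y using dz[OF that] Av[OF that] by simp
    show "(A has_derivative blinfun_apply (?B y)) (at y)" if "y \<noteq> 0" for y using dA[OF that] Bv[OF that] by simp
    show "Cm_on (Suc 0) (- {0}) A" by (rule CA)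
    show "A y v \<bullet> w = A y w \<bullet> v" if y: "y \<noteq> 0" for y v w
    proof -
      have "((\<lambda>y. frechet_derivative U (at y) w) has_derivative (\<lambda>v. A y v \<bullet> w)) (at y)" for w
        by (rule has_derivative_transform_within_open[OF _ o])
           (use y has_derivative_inner_left[OF dz[OF y], of w] in \<open>auto simp: fU Av[OF y]\<close>)
      from fun_cong[OF frechet_derivative_at[OF this]] have "A y v \<bullet> w = frechet_derivative (\<lambda>y. frechet_derivative U (at y) w) (at y) v" for v w .
      then show ?thesis using frechet_derivative_symmetric[OF o _ CU, of y w v] y by simp
    qed
    show "?B y v w = ?B y w v" if y: "y \<noteq> 0" for y v w
    proof (rule euclidean_eqI)
      fix e :: 'a
      let ?f = "\<lambda>y. z y \<bullet> e"
      have Cf: "Cm_on m (- {0}) ?f" for m by (intro Cm_on_inner z o Cm_on_const)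
      have ff: "frechet_derivative ?f (at y) v = A y v \<bullet> e" if "y \<noteq> 0" for y v
        using fun_cong[OF frechet_derivative_at[OF has_derivative_inner_left[OF dz[OF that], of e]]] Av[OF that] by simp
      have "((\<lambda>y. A y w \<bullet> e) has_derivative (\<lambda>v. ?B y v w \<bullet> e)) (at y)" for w
        unfolding Bv[OF y]
        by (intro has_derivative_inner_left bounded_linear.has_derivative[OF blinfun.bounded_linear_left] dA y)
      then have "((\<lambda>y. frechet_derivative ?f (at y) w) has_derivative (\<lambda>v. ?B y v w \<bullet> e)) (at y)" for w
        by (rule has_derivative_transform_within_open[OF _ o]) (use y in \<open>auto simp: ff\<close>)
      from fun_cong[OF frechet_derivative_at[OF this]]
      have "?B y v w \<bullet> e = frechet_derivative (\<lambda>y. frechet_derivative ?f (at y) w) (at y) v" for v w .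
      then show "?B y v w \<bullet> e = ?B y w v \<bullet> e" using frechet_derivative_symmetric[OF o _ Cf, of y w v] y by simp
    qed
  qed (use z_radial U_z in auto)
qed

section \<open>Elementary symmetric functions\<close>

lemma elem_sym_0 [simp]: "finite I \<Longrightarrow> elem_sym 0 I l = 1"
proof -
  assume "finite I"
  then have "{J. J \<subseteq> I \<and> card J = 0} = {{}}" by (auto simp: finite_subset)
  then show ?thesis by (simp add: elem_sym_def)
qed

lemma elem_sym_insert:
  assumes I: "finite I" "i \<notin> I"
  shows "elem_sym (Suc k) (insert i I) l = elem_sym (Suc k) I l + l i * elem_sym k I l"
proof -
  let ?A = "{J. J \<subseteq> I \<and> card J = Suc k}" and ?B = "{J. J \<subseteq> I \<and> card J = k}"
  have fin: "finite ?A" "finite ?B" using I by (auto intro: finite_subset[OF _ finite_Pow_iff[THEN iffD2, OF I(1)]])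
  have e: "{J. J \<subseteq> insert i I \<and> card J = Suc k} = ?A \<union> insert i ` ?B"
  proof (intro equalityI subsetI)
    fix J assume "J \<in> {J. J \<subseteq> insert i I \<and> card J = Suc k}"
    then have J: "J \<subseteq> insert i I" "card J = Suc k" by auto
    show "J \<in> ?A \<union> insert i ` ?B"
    proof (cases "i \<in> J")
      case True
      then have "J = insert i (J - {i})" "card (J - {i}) = k" using J by auto
      then show ?thesis using J by blast
    qed (use J in auto)
  next
    fix J assume "J \<in> ?A \<union> insert i ` ?B"
    then show "J \<in> {J. J \<subseteq> insert i I \<and> card J = Suc k}"
    proof
      assume "J \<in> insert i ` ?B"
      then obtain K where K: "J = insert i K" "K \<subseteq> I" "card K = k" by auto
      then have "finite K" "i \<notin> K" using I finite_subset by auto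
      then show ?thesis using K by auto
    qed auto
  qed
  have "inj_on (insert i) ?B" using I(2) by (intro inj_onI) (metis (mono_tags, lifting) insert_ident mem_Collect_eq subsetD)
  then have "(\<Sum>J\<in>insert i ` ?B. prod l J) = (\<Sum>J\<in>?B. prod l (insert i J))"
    by (simp add: sum.reindex)
  also have "\<dots> = (\<Sum>J\<in>?B. l i * prod l J)"
    using I by (intro sum.cong refl prod.insert) (auto intro: finite_subset)
  finally show ?thesis unfolding elem_sym_def e
    using I fin by (subst sum.union_disjoint) (auto simp: sum_distrib_left)
qed

lemma elem_sym_empty: "elem_sym (Suc k) {} l = 0"
proof -
  have "{J :: 'a set. J \<subseteq> {} \<and> card J = Suc k} = {}" by auto
  then show ?thesis by (simp add: elem_sym_def)
qed

lemma elem_sym_remove: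
  assumes "finite I" "i \<in> I"
  shows "elem_sym (Suc k) I l = elem_sym (Suc k) (I - {i}) l + l i * elem_sym k (I - {i}) l"
  using elem_sym_insert[of "I - {i}" i k l] assms by (simp add: insert_absorb)

lemma elem_sym_insert_zero:
  assumes "finite I" "i \<notin> I" "l i = 0" shows "elem_sym k (insert i I) l = elem_sym k I l"
  using elem_sym_insert[OF assms(1,2)] assms by (cases k) auto

lemma insert_Diff_swap: "a \<notin> I \<Longrightarrow> i \<in> I \<Longrightarrow> insert a I - {i} = insert a (I - {i})"
  by auto

text \<open>Every set of size k + 1 arises once for each of its elements; this is Euler's identity
  for a homogeneous polynomial.\<close>

lemma sum_elem_sym_mult:
  assumes "finite I"
  shows "(\<Sum>i\<in>I. l i * elem_sym k (I - {i}) l) = real (Suc k) * elem_sym (Suc k) I l"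
  using assms
proof (induction I arbitrary: k rule: finite_induct)
  case empty then show ?case by (simp add: elem_sym_empty)
next
  case (insert a I)
  have "(\<Sum>i\<in>insert a I. l i * elem_sym k (insert a I - {i}) l)
     = l a * elem_sym k I l + (\<Sum>i\<in>I. l i * elem_sym k (insert a (I - {i})) l)"
    using insert(1,2) by (simp add: insert_Diff_swap cong: sum.cong)
  also have "\<dots> = real (Suc k) * elem_sym (Suc k) (insert a I) l"
  proof (cases k)
    case 0
    then show ?thesis using insert.IH[of 0] insert(1,2) by (simp add: elem_sym_insert)
  next
    case (Suc m)
    have "(\<Sum>i\<in>I. l i * elem_sym (Suc m) (insert a (I - {i})) l)
        = (\<Sum>i\<in>I. l i * elem_sym (Suc m) (I - {i}) l) + l a * (\<Sum>i\<in>I. l i * elem_sym m (I - {i}) l)"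
      using insert(1,2) by (simp add: elem_sym_insert sum.distrib sum_distrib_left algebra_simps)
    then show ?thesis unfolding Suc insert.IH
      using insert(1,2) by (simp add: elem_sym_insert algebra_simps)
  qed
  finally show ?case .
qed

lemma elem_sym_nonneg: "(\<And>i. i \<in> I \<Longrightarrow> 0 \<le> l i) \<Longrightarrow> 0 \<le> elem_sym k I l"
  unfolding elem_sym_def by (intro sum_nonneg prod_nonneg) auto

lemma elem_sym_const: "finite I \<Longrightarrow> elem_sym k I (\<lambda>_. c) = real (card I choose k) * c ^ k"
  unfolding elem_sym_def by (simp add: n_subsets)

lemma elem_sym_mono:
  assumes "\<And>i. i \<in> I \<Longrightarrow> 0 \<le> l i" "\<And>i. i \<in> I \<Longrightarrow> l i \<le> m i"
  shows "elem_sym k I l \<le> elem_sym k I m"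
  unfolding elem_sym_def using assms by (intro sum_mono prod_mono) auto

lemma elem_sym_pos:
  assumes "finite I" "\<And>i. i \<in> I \<Longrightarrow> 0 < l i" "k \<le> card I"
  shows "0 < elem_sym k I l"
proof -
  obtain J where "J \<subseteq> I" "card J = k" using assms obtain_subset_with_card_n by metis
  moreover have "finite {J. J \<subseteq> I \<and> card J = k}"
    using assms(1) by (auto intro: finite_subset[OF _ finite_Pow_iff[THEN iffD2, OF assms(1)]])
  ultimately show ?thesis unfolding elem_sym_def
    using assms(2) by (intro sum_pos prod_pos) auto
qed

lemma elem_sym_reindex:
  assumes h: "bij_betw h I K" and l: "\<And>i. i \<in> I \<Longrightarrow> m (h i) = l i"
  shows "elem_sym k K m = elem_sym k I l"
proof -
  have inj: "inj_on h I" and K: "K = h ` I" using h by (auto simp: bij_betw_def)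
  have "{J. J \<subseteq> K \<and> card J = k} = image h ` {J. J \<subseteq> I \<and> card J = k}"
    unfolding K using inj by (auto simp: subset_image_iff card_image inj_on_subset image_iff)
  moreover have "inj_on (image h) {J. J \<subseteq> I \<and> card J = k}"
    using inj_on_image_Pow[OF inj] by (rule inj_on_subset) auto
  ultimately have "elem_sym k K m = (\<Sum>J\<in>{J. J \<subseteq> I \<and> card J = k}. prod m (h ` J))"
    by (simp add: elem_sym_def sum.reindex)
  also have "\<dots> = (\<Sum>J\<in>{J. J \<subseteq> I \<and> card J = k}. prod l J)"
  proof (rule sum.cong[OF refl])
    fix J assume "J \<in> {J. J \<subseteq> I \<and> card J = k}"
    then have J: "J \<subseteq> I" by auto
    then have "prod m (h ` J) = prod (m \<circ> h) J" using inj by (simp add: prod.reindex inj_on_subset)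
    also have "\<dots> = prod l J" using J l by (intro prod.cong) auto
    finally show "prod m (h ` J) = prod l J" .
  qed
  finally show ?thesis by (simp add: elem_sym_def)
qed

text \<open>After both indices are split off, the term with the product of \<open>l i\<close> and
  \<open>l j\<close> is common to both sides, and the rest compares \<open>l i\<close> with
  \<open>l j\<close> times a nonnegative factor. It is the monotonicity that the weights of the
  linearised speed need.\<close>

lemma elem_sym_remove_mono:
  assumes I: "finite I" "i \<in> I" "j \<in> I" and l: "\<And>i. i \<in> I \<Longrightarrow> 0 \<le> l i" "l i \<le> l j"
  shows "l i * elem_sym k (I - {i}) l \<le> l j * elem_sym k (I - {j}) l"
proof (cases "i = j \<or> k = 0")
  case True
  then show ?thesis using I l by auto
next
  case False
  then obtain m where k: "k = Suc m" by (cases k) auto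
  define K where "K = I - {i} - {j}"
  have Kj: "K = I - {j} - {i}" by (auto simp: K_def)
  have 1: "elem_sym k (I - {i}) l = elem_sym k K l + l j * elem_sym m K l"
    unfolding k K_def using I False by (intro elem_sym_remove) auto
  have 2: "elem_sym k (I - {j}) l = elem_sym k K l + l i * elem_sym m K l"
    unfolding k Kj using I False by (intro elem_sym_remove) auto
  have "0 \<le> elem_sym k K l" using l by (intro elem_sym_nonneg) (auto simp: K_def)
  then have "l i * elem_sym k K l \<le> l j * elem_sym k K l" using l(2) by (rule mult_right_mono[rotated])
  then show ?thesis unfolding 1 2 by (simp add: algebra_simps)
qed

section \<open>Symmetric functions and Newton tensors of operators\<close>

definition op_trace :: "('a::euclidean_space \<Rightarrow>\<^sub>L 'a) \<Rightarrow> real" where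
  "op_trace A = (\<Sum>b\<in>Basis. A b \<bullet> b)"

lemma trace_add: "op_trace (A + B) = op_trace A + op_trace B"
  and trace_scaleR: "op_trace (c *\<^sub>R A) = c * op_trace A"
  by (simp_all add: op_trace_def blinfun.add_left inner_add_left sum.distrib
      blinfun.diff_left blinfun.scaleR_left inner_diff_left sum_subtractf sum_distrib_left)

lemma trace_sum: "op_trace (\<Sum>i\<in>I. f i) = (\<Sum>i\<in>I. op_trace (f i))"
proof -
  have "op_trace 0 = 0" by (simp add: op_trace_def)
  then show ?thesis by (induction I rule: infinite_finite_induct) (simp_all add: trace_add)
qed

lemma bounded_linear_trace: "bounded_linear op_trace"
  unfolding op_trace_def[abs_def]
  by (intro bounded_linear_sum bounded_linear_inner_left_comp blinfun.bounded_linear_left)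

lemma trace_compose_commute:
  fixes A B :: "'a::euclidean_space \<Rightarrow>\<^sub>L 'a"
  shows "op_trace (A o\<^sub>L B) = op_trace (B o\<^sub>L A)"
proof -
  have "op_trace (A o\<^sub>L B) = (\<Sum>b\<in>Basis. \<Sum>c\<in>Basis. (B b \<bullet> c) * (A c \<bullet> b))" for A B :: "'a \<Rightarrow>\<^sub>L 'a"
  proof -
    have "A (B b) \<bullet> b = (\<Sum>c\<in>Basis. (B b \<bullet> c) * (A c \<bullet> b))" for b
    proof -
      have "A (B b) = A (\<Sum>c\<in>Basis. (B b \<bullet> c) *\<^sub>R c)" by (simp add: euclidean_representation)
      then show ?thesis by (simp add: blinfun.sum_right blinfun.scaleR_right inner_sum_left)
    qed
    then show ?thesis by (simp add: op_trace_def)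
  qed
  note e = this
  show ?thesis unfolding e[of A B] e[of B A] by (subst sum.swap) (simp add: mult.commute)
qed

primrec opow :: "('a::real_normed_vector \<Rightarrow>\<^sub>L 'a) \<Rightarrow> nat \<Rightarrow> ('a \<Rightarrow>\<^sub>L 'a)" where
  "opow A 0 = id_blinfun"
| "opow A (Suc j) = A o\<^sub>L opow A j"

text \<open>The Newton tensors, with \<sigma> of order k + 1 entering as the trace of
  \<open>A\<close> times the previous tensor, over k + 1. No eigenvalues occur, so
  \<open>newton\<close> and \<open>sig\<close> are polynomial in \<open>A\<close> and can be
  differentiated directly.\<close>

primrec newton :: "nat \<Rightarrow> ('a::euclidean_space \<Rightarrow>\<^sub>L 'a) \<Rightarrow> ('a \<Rightarrow>\<^sub>L 'a)" where
  "newton 0 A = id_blinfun"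
| "newton (Suc k) A = (op_trace (A o\<^sub>L newton k A) / real (Suc k)) *\<^sub>R id_blinfun - (A o\<^sub>L newton k A)"

definition sig :: "nat \<Rightarrow> ('a::euclidean_space \<Rightarrow>\<^sub>L 'a) \<Rightarrow> real" where
  "sig k A = (case k of 0 \<Rightarrow> 1 | Suc j \<Rightarrow> op_trace (A o\<^sub>L newton j A) / real (Suc j))"

lemma sig_0 [simp]: "sig 0 A = 1" by (simp add: sig_def)
lemma sig_Suc: "real (Suc k) * sig (Suc k) A = op_trace (A o\<^sub>L newton k A)" by (simp add: sig_def)
lemma newton_Suc: "newton (Suc k) A = sig (Suc k) A *\<^sub>R id_blinfun - (A o\<^sub>L newton k A)"
  by (simp add: sig_def)

declare newton.simps(2) [simp del]

lemma blinfun_compose_simps: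
  "(A + B) o\<^sub>L C = (A o\<^sub>L C) + (B o\<^sub>L C)" "A o\<^sub>L (B + C) = (A o\<^sub>L B) + (A o\<^sub>L C)"
  "(A - B) o\<^sub>L C = (A o\<^sub>L C) - (B o\<^sub>L C)" "A o\<^sub>L (B - C) = (A o\<^sub>L B) - (A o\<^sub>L C)"
  "(c *\<^sub>R A) o\<^sub>L C = c *\<^sub>R (A o\<^sub>L C)" "A o\<^sub>L (c *\<^sub>R C) = c *\<^sub>R (A o\<^sub>L C)"
  "id_blinfun o\<^sub>L C = C" "A o\<^sub>L id_blinfun = A"
  by (rule blinfun_eqI; simp add: blinfun.bilinear_simps)+

lemma blinfun_compose_assoc: "(A o\<^sub>L B) o\<^sub>L C = A o\<^sub>L (B o\<^sub>L C)"
  by (rule blinfun_eqI) simp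

lemma blinfun_compose_sum_right: "A o\<^sub>L (\<Sum>i\<in>I. f i) = (\<Sum>i\<in>I. A o\<^sub>L f i)"
  by (rule blinfun_eqI) (simp add: blinfun.sum_left blinfun.sum_right)

lemma opow_add: "opow A i o\<^sub>L opow A j = opow A (i + j)"
  by (induction i) (simp_all add: blinfun_compose_simps blinfun_compose_assoc)

lemma newton_commute: "newton k A o\<^sub>L A = A o\<^sub>L newton k A"
  by (induction k) (simp_all add: newton_Suc blinfun_compose_simps blinfun_compose_assoc)

lemma newton_expand: "newton k A = (\<Sum>j\<le>k. ((-1) ^ j * sig (k - j) A) *\<^sub>R opow A j)"
proof (induction k)
  case (Suc k)
  show ?case
    by (subst sum.atMost_Suc_shift)
       (simp add: newton_Suc Suc blinfun_compose_sum_right blinfun_compose_simps sum_negf[symmetric])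
qed simp

lemma sig_Suc_expand: "real (Suc k) * sig (Suc k) A = (\<Sum>j\<le>k. (-1) ^ j * sig (k - j) A * op_trace (opow A (Suc j)))"
  unfolding sig_Suc newton_expand by (simp add: blinfun_compose_sum_right blinfun_compose_simps trace_sum trace_scaleR)

text \<open>Newton's identities differentiated: \<open>s\<close> stands for the elementary symmetric
  functions, \<open>p\<close> for the power traces, \<open>d\<close> for the derivative of
  \<open>s\<close>, and (j + 1) q_j for that of the power trace of order j + 1.\<close>

lemma newton_derivation_recursion:
  fixes s p q d :: "nat \<Rightarrow> real"
  assumes s: "\<And>k. real (Suc k) * s (Suc k) = (\<Sum>j\<le>k. (-1) ^ j * s (k - j) * p (Suc j))"
    and d0: "d 0 = 0"
    and d: "\<And>k. real (Suc k) * d (Suc k) = (\<Sum>j\<le>k. (-1) ^ j * (d (k - j) * p (Suc j) + s (k - j) * (real (Suc j) * q j)))"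
  shows "d (Suc k) = (\<Sum>j\<le>k. (-1) ^ j * s (k - j) * q j)"
proof (induction k rule: less_induct)
  case (less k)
  have dk: "d (k - j) = (\<Sum>i<k - j. (-1) ^ i * s (k - Suc j - i) * q i)" if "j \<le> k" for j
  proof (cases "k - j")
    case (Suc m)
    then have "d (k - j) = (\<Sum>i\<le>m. (-1) ^ i * s (m - i) * q i)" using less[of m] that by simp
    moreover have "m = k - Suc j" using Suc by simp
    ultimately show ?thesis using Suc by (simp add: lessThan_Suc_atMost)
  qed (simp add: d0)
  have "(\<Sum>j\<le>k. (-1) ^ j * (d (k - j) * p (Suc j)))
      = (\<Sum>j\<le>k. \<Sum>i<k - j. (-1) ^ j * ((-1) ^ i * s (k - Suc j - i) * q i) * p (Suc j))"
    by (rule sum.cong) (simp_all add: dk sum_distrib_left sum_distrib_right mult.assoc)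
  also have "\<dots> = (\<Sum>(j, i)\<in>Sigma {..k} (\<lambda>j. {..<k - j}). (-1) ^ j * ((-1) ^ i * s (k - Suc j - i) * q i) * p (Suc j))"
    by (simp add: sum.Sigma)
  \<comment> \<open>The pairs with i + j < k form a symmetric index set; after the exchange the
    inner sum is the recursion for \<open>s\<close>.\<close>
  also have "\<dots> = (\<Sum>(i, j)\<in>Sigma {..k} (\<lambda>i. {..<k - i}). (-1) ^ j * ((-1) ^ i * s (k - Suc j - i) * q i) * p (Suc j))"
    by (rule sum.reindex_bij_witness[of _ "\<lambda>(i, j). (j, i)" "\<lambda>(i, j). (j, i)"]) auto
  also have "\<dots> = (\<Sum>i\<le>k. \<Sum>j<k - i. (-1) ^ j * ((-1) ^ i * s (k - Suc j - i) * q i) * p (Suc j))"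
    by (simp add: sum.Sigma)
  also have "\<dots> = (\<Sum>i\<le>k. (-1) ^ i * q i * (real (k - i) * s (k - i)))"
  proof (rule sum.cong[OF refl])
    fix i assume "i \<in> {..k}"
    show "(\<Sum>j<k - i. (-1) ^ j * ((-1) ^ i * s (k - Suc j - i) * q i) * p (Suc j)) = (-1) ^ i * q i * (real (k - i) * s (k - i))"
    proof (cases "k - i")
      case (Suc m)
      have "(\<Sum>j<k - i. (-1) ^ j * ((-1) ^ i * s (k - Suc j - i) * q i) * p (Suc j))
          = (-1) ^ i * q i * (\<Sum>j\<le>m. (-1) ^ j * s (m - j) * p (Suc j))"
      proof -
        have "k - Suc j - i = m - j" for j using Suc by simp
        then show ?thesis using Suc by (simp add: sum_distrib_left lessThan_Suc_atMost mult_ac)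
      qed
      then show ?thesis unfolding s[symmetric] Suc .
    qed simp
  qed
  finally have 1: "(\<Sum>j\<le>k. (-1) ^ j * (d (k - j) * p (Suc j))) = (\<Sum>i\<le>k. (-1) ^ i * q i * (real (k - i) * s (k - i)))" .
  have "real (Suc k) * d (Suc k) = (\<Sum>j\<le>k. (-1) ^ j * (d (k - j) * p (Suc j))) + (\<Sum>j\<le>k. (-1) ^ j * (s (k - j) * (real (Suc j) * q j)))"
    unfolding d by (simp add: distrib_left sum.distrib)
  \<comment> \<open>One weight comes from the recursion for \<open>s\<close>, the other from the
    power traces; they add up to the factor k + 1 on the left.\<close>
  also have "\<dots> = (\<Sum>j\<le>k. (-1) ^ j * q j * s (k - j) * (real (k - j) + real (Suc j)))"
    unfolding 1 by (simp add: sum.distrib[symmetric] algebra_simps)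
  also have "\<dots> = (\<Sum>j\<le>k. real (Suc k) * ((-1) ^ j * s (k - j) * q j))"
    by (rule sum.cong) (auto simp: of_nat_diff algebra_simps)
  also have "\<dots> = real (Suc k) * (\<Sum>j\<le>k. (-1) ^ j * s (k - j) * q j)" by (simp only: sum_distrib_left)
  finally show ?case by (simp only: mult_cancel_left of_nat_eq_0_iff nat.distinct(2) simp_thms)
qed

text \<open>\<open>A\<close> need not commute with its derivative, but under the trace cyclic
  permutation collects the factors. The additional power \<open>i\<close> inside the trace carries
  the induction.\<close>

lemma trace_opow_derivative:
  assumes A: "(A has_derivative A') (at y)"
  obtains D where "((\<lambda>y. opow (A y) j) has_derivative D) (at y)"
    "\<And>i h. op_trace (opow (A y) i o\<^sub>L D h) = (if j = 0 then 0 else real j * op_trace (opow (A y) (i + j - 1) o\<^sub>L A' h))"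
proof (induction j arbitrary: thesis)
  case 0
  show ?case by (rule 0[of "\<lambda>h. 0"]) (simp_all add: op_trace_def)
next
  case (Suc j)
  obtain D where D: "((\<lambda>y. opow (A y) j) has_derivative D) (at y)"
    "\<And>i h. op_trace (opow (A y) i o\<^sub>L D h) = (if j = 0 then 0 else real j * op_trace (opow (A y) (i + j - 1) o\<^sub>L A' h))"
    using Suc.IH by blast
  show ?case
  proof (rule Suc.prems)
    show "((\<lambda>y. opow (A y) (Suc j)) has_derivative (\<lambda>h. (A y o\<^sub>L D h) + (A' h o\<^sub>L opow (A y) j))) (at y)"
      using bounded_bilinear.FDERIV[OF bounded_bilinear_blinfun_compose A D(1)] by simp
    fix i h
    have "opow (A y) i o\<^sub>L (A y o\<^sub>L D h) = opow (A y) (Suc i) o\<^sub>L D h"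
      using opow_add[of "A y" i 1] by (simp add: blinfun_compose_assoc[symmetric] blinfun_compose_simps)
    moreover have "op_trace (opow (A y) i o\<^sub>L (A' h o\<^sub>L opow (A y) j)) = op_trace (opow (A y) (i + j) o\<^sub>L A' h)"
      using trace_compose_commute[of "opow (A y) i o\<^sub>L A' h" "opow (A y) j"] opow_add[of "A y" j i]
      by (simp add: blinfun_compose_assoc[symmetric] add.commute)
    ultimately show "op_trace (opow (A y) i o\<^sub>L ((A y o\<^sub>L D h) + (A' h o\<^sub>L opow (A y) j))) =
        (if Suc j = 0 then 0 else real (Suc j) * op_trace (opow (A y) (i + Suc j - 1) o\<^sub>L A' h))"
      using D(2)[of "Suc i" h] by (simp add: blinfun_compose_simps trace_add algebra_simps)
  qed
qed

lemma newton_differentiable: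
  fixes A :: "'a::real_normed_vector \<Rightarrow> 'b::euclidean_space \<Rightarrow>\<^sub>L 'b"
  assumes A: "A differentiable (at y)"
  shows "(\<lambda>y. newton k (A y)) differentiable (at y)" "(\<lambda>y. sig k (A y)) differentiable (at y)"
proof -
  obtain A' where A': "(A has_derivative A') (at y)" using A by (auto simp: differentiable_def)
  have AN: "(\<lambda>y. A y o\<^sub>L newton k (A y)) differentiable (at y)" if "(\<lambda>y. newton k (A y)) differentiable (at y)" for k
    using that bounded_bilinear.FDERIV[OF bounded_bilinear_blinfun_compose A'] unfolding differentiable_def by blast
  have S: "(\<lambda>y. sig (Suc k) (A y)) differentiable (at y)" if N: "(\<lambda>y. newton k (A y)) differentiable (at y)" for k
  proof -
    obtain D where "((\<lambda>y. A y o\<^sub>L newton k (A y)) has_derivative D) (at y)"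
      using AN[OF N] by (auto simp: differentiable_def)
    from has_derivative_mult_right[OF bounded_linear.has_derivative[OF bounded_linear_trace this], of "1 / real (Suc k)"]
    show ?thesis unfolding sig_def by (auto simp: differentiable_def)
  qed
  show N: "(\<lambda>y. newton k (A y)) differentiable (at y)" for k
  proof (induction k)
    case (Suc k)
    have I: "(\<lambda>y. f y *\<^sub>R (id_blinfun :: 'b \<Rightarrow>\<^sub>L 'b)) differentiable (at y)" if "f differentiable (at y)" for f :: "'a \<Rightarrow> real"
      using that has_derivative_scaleR_left unfolding differentiable_def by blast
    show ?case unfolding newton_Suc
      by (intro differentiable_diff AN Suc I S)
  qed simp
  show "(\<lambda>y. sig k (A y)) differentiable (at y)"
    using S[OF N] by (cases k) auto
qed

text \<open>Newton's identities express \<open>sig\<close> through power traces, whose derivatives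
  are explicit; the recursion reassembles these into the trace against the Newton tensor.\<close>

lemma sig_has_derivative:
  assumes A: "(A has_derivative A') (at y)"
  shows "((\<lambda>y. sig (Suc k) (A y)) has_derivative (\<lambda>h. op_trace (newton k (A y) o\<^sub>L A' h))) (at y)"
proof -
  define d where "d k h = frechet_derivative (\<lambda>y. sig k (A y)) (at y) h" for k h
  have d: "((\<lambda>y. sig k (A y)) has_derivative d k) (at y)" for k
    unfolding d_def using newton_differentiable(2) A frechet_derivative_works differentiable_def by blast
  have p: "((\<lambda>y. op_trace (opow (A y) (Suc j))) has_derivative (\<lambda>h. real (Suc j) * op_trace (opow (A y) j o\<^sub>L A' h))) (at y)" for j
  proof -
    obtain D where D: "((\<lambda>y. opow (A y) (Suc j)) has_derivative D) (at y)"
      "\<And>i h. op_trace (opow (A y) i o\<^sub>L D h) = (if Suc j = 0 then 0 else real (Suc j) * op_trace (opow (A y) (i + Suc j - 1) o\<^sub>L A' h))"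
      using trace_opow_derivative[OF A] by blast
    have "op_trace (D h) = real (Suc j) * op_trace (opow (A y) j o\<^sub>L A' h)" for h
      using D(2)[of 0 h] by (simp add: blinfun_compose_simps)
    then show ?thesis using bounded_linear.has_derivative[OF bounded_linear_trace D(1)] by simp
  qed
  have "d (Suc k) h = (\<Sum>j\<le>k. (-1) ^ j * sig (k - j) (A y) * op_trace (opow (A y) j o\<^sub>L A' h))" for h
  proof (rule newton_derivation_recursion[where p="\<lambda>j. op_trace (opow (A y) j)" and d="\<lambda>k. d k h"])
    show "real (Suc k) * sig (Suc k) (A y) = (\<Sum>j\<le>k. (- 1) ^ j * sig (k - j) (A y) * op_trace (opow (A y) (Suc j)))" for k
      by (rule sig_Suc_expand)
    show "d 0 h = 0" unfolding d_def by simp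
    fix k
    have 1: "((\<lambda>y. real (Suc k) * sig (Suc k) (A y)) has_derivative (\<lambda>h. real (Suc k) * d (Suc k) h)) (at y)"
      by (rule has_derivative_mult_right[OF d])
    have "((\<lambda>y. \<Sum>j\<le>k. (-1) ^ j * sig (k - j) (A y) * op_trace (opow (A y) (Suc j))) has_derivative
      (\<lambda>h. \<Sum>j\<le>k. (-1) ^ j * sig (k - j) (A y) * (real (Suc j) * op_trace (opow (A y) j o\<^sub>L A' h))
          + (-1) ^ j * d (k - j) h * op_trace (opow (A y) (Suc j)))) (at y)"
      by (intro has_derivative_sum has_derivative_mult has_derivative_mult_right d p)
    then have 2: "((\<lambda>y. real (Suc k) * sig (Suc k) (A y)) has_derivative
      (\<lambda>h. \<Sum>j\<le>k. (-1) ^ j * sig (k - j) (A y) * (real (Suc j) * op_trace (opow (A y) j o\<^sub>L A' h))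
          + (-1) ^ j * d (k - j) h * op_trace (opow (A y) (Suc j)))) (at y)"
      unfolding sig_Suc_expand .
    have "real (Suc k) * d (Suc k) h = (\<Sum>j\<le>k. (-1) ^ j * sig (k - j) (A y) * (real (Suc j) * op_trace (opow (A y) j o\<^sub>L A' h))
          + (-1) ^ j * d (k - j) h * op_trace (opow (A y) (Suc j)))"
      using fun_cong[OF has_derivative_unique[OF 1 2]] .
    also have "\<dots> = (\<Sum>j\<le>k. (-1) ^ j * (d (k - j) h * op_trace (opow (A y) (Suc j)) + sig (k - j) (A y) * (real (Suc j) * op_trace (opow (A y) j o\<^sub>L A' h))))"
      by (rule sum.cong) (simp_all add: algebra_simps)
    finally show "real (Suc k) * d (Suc k) h = \<dots>" .
  qed
  moreover have "op_trace (newton k (A y) o\<^sub>L A' h) = (\<Sum>j\<le>k. (-1) ^ j * sig (k - j) (A y) * op_trace (opow (A y) j o\<^sub>L A' h))" for h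
  proof -
    have "newton k (A y) o\<^sub>L A' h = (\<Sum>j\<le>k. ((-1) ^ j * sig (k - j) (A y)) *\<^sub>R (opow (A y) j o\<^sub>L A' h))"
      by (rule blinfun_eqI) (simp add: newton_expand blinfun.sum_left blinfun.scaleR_left)
    then show ?thesis by (simp add: trace_sum trace_scaleR)
  qed
  ultimately have "d (Suc k) = (\<lambda>h. op_trace (newton k (A y) o\<^sub>L A' h))" by auto
  then show ?thesis using d[of "Suc k"] by simp
qed

section \<open>Orthonormal eigenbases\<close>

definition orthonormal_basis :: "'a::euclidean_space set \<Rightarrow> bool" where
  "orthonormal_basis E \<longleftrightarrow> pairwise orthogonal E \<and> (\<forall>e\<in>E. norm e = 1) \<and> span E = UNIV"

lemma orthonormal_basis:
  fixes E :: "'a::euclidean_space set"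
  assumes "orthonormal_basis E"
  shows orthonormal_basis_finite: "finite E"
    and orthonormal_expansion: "v = (\<Sum>e\<in>E. (v \<bullet> e) *\<^sub>R e)"
    and orthonormal_inner: "v \<bullet> w = (\<Sum>e\<in>E. (v \<bullet> e) * (w \<bullet> e))"
    and trace_orthonormal: "op_trace A = (\<Sum>e\<in>E. A e \<bullet> e)"
    and card_orthonormal: "card E = DIM('a)"
proof -
  have po: "pairwise orthogonal E" and n: "\<And>e. e \<in> E \<Longrightarrow> norm e = 1" and sp: "span E = (UNIV :: 'a set)"
    using assms by (auto simp: orthonormal_basis_def)
  have ind: "independent E" using pairwise_orthogonal_independent[OF po] n by force
  then show fin: "finite E" using independent_bound by blast
  show "card E = DIM('a)" using dim_eq_card_independent[OF ind] dim_span[of E] sp by simp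
  have ee: "e \<bullet> f = (if e = f then 1 else 0)" if "e \<in> E" "f \<in> E" for e f
    using po n that by (auto simp: pairwise_def orthogonal_def dot_square_norm)
  show exp: "v = (\<Sum>e\<in>E. (v \<bullet> e) *\<^sub>R e)" for v :: 'a
  proof -
    let ?w = "v - (\<Sum>e\<in>E. (v \<bullet> e) *\<^sub>R e)"
    have "?w \<bullet> f = 0" if "f \<in> E" for f
      using fin that by (simp add: inner_diff_left inner_sum_left ee if_distrib[of "\<lambda>x. _ * x"] cong: if_cong)
    then have o: "orthogonal ?w f" if "f \<in> E" for f using that by (simp only: orthogonal_def)
    have "?w \<in> span E" by (simp only: sp UNIV_I)
    then have "orthogonal ?w ?w" using o by (rule orthogonal_to_span)
    then have "?w = 0" by (simp only: orthogonal_self)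
    then show ?thesis by (rule eq_iff_diff_eq_0[THEN iffD2])
  qed
  show inn: "v \<bullet> w = (\<Sum>e\<in>E. (v \<bullet> e) * (w \<bullet> e))" for v w :: 'a
  proof -
    have "v \<bullet> w = (\<Sum>e\<in>E. (v \<bullet> e) *\<^sub>R e) \<bullet> w" by (rule arg_cong[OF exp[of v], of "\<lambda>u. u \<bullet> w"])
    also have "\<dots> = (\<Sum>e\<in>E. (v \<bullet> e) * (w \<bullet> e))" by (simp add: inner_sum_left inner_commute[of w])
    finally show ?thesis .
  qed
  show "op_trace A = (\<Sum>e\<in>E. A e \<bullet> e)"
  proof -
    have "(\<Sum>e\<in>E. A e \<bullet> e) = (\<Sum>e\<in>E. \<Sum>b\<in>Basis. (e \<bullet> b) * (A b \<bullet> e))"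
    proof (rule sum.cong[OF refl])
      fix e
      have "A e \<bullet> e = A (\<Sum>b\<in>Basis. (e \<bullet> b) *\<^sub>R b) \<bullet> e" by (simp only: euclidean_representation)
      also have "\<dots> = (\<Sum>b\<in>Basis. (e \<bullet> b) * (A b \<bullet> e))"
        by (simp add: blinfun.sum_right blinfun.scaleR_right inner_sum_left)
      finally show "A e \<bullet> e = (\<Sum>b\<in>Basis. (e \<bullet> b) * (A b \<bullet> e))" .
    qed
    also have "\<dots> = (\<Sum>b\<in>Basis. \<Sum>e\<in>E. (A b \<bullet> e) * (b \<bullet> e))"
      by (subst sum.swap) (simp add: inner_commute mult.commute)
    also have "\<dots> = op_trace A" by (simp only: op_trace_def inn[symmetric])
    finally show ?thesis by simp
  qed
qed

text \<open>The induction alternates between both claims: the next Newton tensor has on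
  \<open>e\<close> the eigenvalue \<sigma>(E) - L(e) \<sigma>(E - e), which is \<sigma> of the other
  eigenvalues once \<open>e\<close> is split off.\<close>

lemma newton_eigenbasis:
  fixes A :: "'a::euclidean_space \<Rightarrow>\<^sub>L 'a"
  assumes E: "orthonormal_basis E" and A: "\<And>e. e \<in> E \<Longrightarrow> A e = L e *\<^sub>R e"
  shows newton_eigenvector: "e \<in> E \<Longrightarrow> newton k A e = elem_sym k (E - {e}) L *\<^sub>R e"
    and sig_eigenvalues: "sig k A = elem_sym k E L"
proof -
  note fin = orthonormal_basis_finite[OF E]
  have n: "e \<bullet> e = 1" if "e \<in> E" for e using E that by (auto simp: orthonormal_basis_def dot_square_norm)
  have S: "sig (Suc k) A = elem_sym (Suc k) E L" if N: "\<And>e. e \<in> E \<Longrightarrow> newton k A e = elem_sym k (E - {e}) L *\<^sub>R e" for k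
  proof -
    have "real (Suc k) * sig (Suc k) A = (\<Sum>e\<in>E. L e * elem_sym k (E - {e}) L)"
      unfolding sig_Suc trace_orthonormal[OF E] by (simp add: N A n blinfun.scaleR_right mult.commute)
    also have "\<dots> = real (Suc k) * elem_sym (Suc k) E L" by (rule sum_elem_sym_mult[OF fin])
    finally show ?thesis by (simp only: mult_cancel_left of_nat_eq_0_iff nat.distinct(2) simp_thms)
  qed
  show N: "newton k A e = elem_sym k (E - {e}) L *\<^sub>R e" if "e \<in> E" for k e
    using that
  proof (induction k arbitrary: e)
    case 0 then show ?case using fin by simp
  next
    case (Suc k)
    have "newton (Suc k) A e = (elem_sym (Suc k) E L - L e * elem_sym k (E - {e}) L) *\<^sub>R e"
      using S[OF Suc.IH] Suc A
      by (simp add: newton_Suc blinfun.diff_left blinfun.scaleR_left blinfun.scaleR_right scaleR_diff_left mult.commute)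
    then show ?case using elem_sym_remove[OF fin Suc.prems, of k L] by simp
  qed
  show "sig k A = elem_sym k E L"
    using S[OF N] fin by (cases k) auto
qed

text \<open>An eigenvector is found by maximising the quadratic form on the unit sphere of \<open>V\<close>.\<close>

lemma spectral_theorem_subspace:
  fixes A :: "'a::euclidean_space \<Rightarrow>\<^sub>L 'a"
  assumes sym: "\<And>v w. A v \<bullet> w = A w \<bullet> v"
    and V: "subspace V" and inv: "\<And>v. v \<in> V \<Longrightarrow> A v \<in> V"
  shows "\<exists>E. pairwise orthogonal E \<and> (\<forall>e\<in>E. norm e = 1) \<and> span E = V \<and> (\<forall>e\<in>E. A e = (A e \<bullet> e) *\<^sub>R e)"
  using V inv
proof (induction "dim V" arbitrary: V rule: less_induct)
  case less
  note V = less.prems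
  show ?case
  proof (cases "V \<subseteq> {0}")
    case True
    then have "V = {0}" using subspace_0[OF V(1)] by blast
    then show ?thesis by (intro exI[of _ "{}"]) (auto simp: pairwise_def)
  next
    case False
    define S where "S = V \<inter> sphere 0 1"
    have cS: "compact S" unfolding S_def by (intro closed_Int_compact closed_subspace V compact_sphere)
    obtain w where w: "w \<in> V" "w \<noteq> 0" using False by blast
    have "sgn w \<in> S" using w V(1) by (simp add: S_def sgn_div_norm subspace_scale)
    then have neS: "S \<noteq> {}" by blast
    have "continuous_on S (\<lambda>v. A v \<bullet> v)" by (intro continuous_intros)
    then obtain v0 where v0: "v0 \<in> S" "\<And>v. v \<in> S \<Longrightarrow> A v \<bullet> v \<le> A v0 \<bullet> v0"
      using continuous_attains_sup[OF cS neS, of "\<lambda>v. A v \<bullet> v"] by auto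
    define l where "l = A v0 \<bullet> v0"
    have v0V: "v0 \<in> V" and n0: "norm v0 = 1" "v0 \<bullet> v0 = 1" using v0 by (auto simp: S_def dot_square_norm)
    have q: "A v \<bullet> v \<le> l * (v \<bullet> v)" if v: "v \<in> V" for v
    proof (cases "v = 0")
      case False
      then have "sgn v \<in> S" using v V(1) by (simp add: S_def sgn_div_norm subspace_scale)
      from v0(2)[OF this] have "A (sgn v) \<bullet> sgn v \<le> l" by (simp add: l_def)
      then have "(A v \<bullet> v) / (norm v)\<^sup>2 \<le> l"
        by (simp add: sgn_div_norm blinfun.scaleR_right power2_eq_square field_simps)
      then show ?thesis using False by (simp add: divide_le_eq dot_square_norm)
    qed simp
    have lin: "(l *\<^sub>R v0 - A v0) \<bullet> h = 0" if h: "h \<in> V" for h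
    proof (rule ccontr)
      define c where "c = (l *\<^sub>R v0 - A v0) \<bullet> h"
      define d where "d = l * (h \<bullet> h) - A h \<bullet> h"
      assume "(l *\<^sub>R v0 - A v0) \<bullet> h \<noteq> 0"
      then have c: "c \<noteq> 0" by (simp add: c_def)
      have d: "d \<ge> 0" using q[OF h] by (simp add: d_def)
      \<comment> \<open>Close to the minimiser -c/d of 2 t c + t^2 d; the added 1 covers d = 0 and
        still leaves a negative value.\<close>
      define t where "t = - c / (d + 1)"
      have "v0 + t *\<^sub>R h \<in> V" using V(1) v0V h by (simp add: subspace_add subspace_scale)
      from q[OF this] have "0 \<le> l * ((v0 + t *\<^sub>R h) \<bullet> (v0 + t *\<^sub>R h)) - A (v0 + t *\<^sub>R h) \<bullet> (v0 + t *\<^sub>R h)" by simp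
      also have "\<dots> = 2 * t * c + t * t * d"
        using sym[of h v0] n0(2)
        by (simp add: c_def d_def blinfun.add_right blinfun.scaleR_right inner_add_left inner_add_right inner_diff_left
            inner_commute[of h v0] l_def algebra_simps)
      also have "\<dots> = t * c - t * t"
      proof -
        have "t * (d + 1) = - c" using d by (simp add: t_def)
        then have td: "t * d = - c - t" by (simp add: distrib_left)
        have "2 * t * c + t * t * d = 2 * t * c + t * (t * d)" by simp
        then show ?thesis unfolding td by (simp add: algebra_simps)
      qed
      also have "t * c = - (c * c) / (d + 1)" by (simp add: t_def)
      also have "\<dots> - t * t < 0"
      proof -
        have "c * c > 0" using c by (metis not_real_square_gt_zero)
        then have "- (c * c) / (d + 1) < 0" using d by (intro divide_neg_pos) auto
        then show ?thesis by (smt (verit) zero_le_square)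
      qed
      finally show False by simp
    qed
    have "l *\<^sub>R v0 - A v0 \<in> V" using V v0V by (simp add: subspace_diff subspace_scale)
    from lin[OF this] have Av0: "A v0 = l *\<^sub>R v0" by simp
    define V' where "V' = {v \<in> V. v \<bullet> v0 = 0}"
    have V': "subspace V'" using V(1) by (auto simp: V'_def subspace_def inner_add_left)
    have inv': "A v \<in> V'" if "v \<in> V'" for v
      using that V(2) sym[of v v0] by (simp add: V'_def Av0 inner_commute)
    have "v0 \<notin> V'" using n0 by (simp add: V'_def)
    moreover have "V' \<subseteq> V" by (auto simp: V'_def)
    ultimately have "V' \<subset> V" using v0V by blast
    moreover have "span V' = V'" "span V = V" using V' V(1) by (simp_all only: span_eq_iff)
    ultimately have "span V' \<subset> span V" by (simp only:)
    then have "dim V' < dim V" by (rule dim_psubset)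
    from less.hyps[OF this V' inv'] obtain E where E: "pairwise orthogonal E" "\<forall>e\<in>E. norm e = 1" "span E = V'"
      "\<forall>e\<in>E. A e = (A e \<bullet> e) *\<^sub>R e" by blast
    have EV': "E \<subseteq> V'" using E(3) span_superset by blast
    have sp: "span (insert v0 E) = V"
    proof
      show "span (insert v0 E) \<subseteq> V" using EV' v0V V(1) by (intro span_minimal) (auto simp: V'_def)
      show "V \<subseteq> span (insert v0 E)"
      proof
        fix v assume v: "v \<in> V"
        have "v - (v \<bullet> v0) *\<^sub>R v0 \<in> V'" using v v0V V(1) n0 by (simp add: V'_def subspace_diff subspace_scale inner_diff_left)
        then have "v - (v \<bullet> v0) *\<^sub>R v0 \<in> span E" using E(3) by simp
        then show "v \<in> span (insert v0 E)" using span_breakdown_eq by blast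
      qed
    qed
    show ?thesis
    proof (intro exI[of _ "insert v0 E"] conjI)
      show "pairwise orthogonal (insert v0 E)"
        using E(1) EV' by (auto simp: pairwise_insert orthogonal_def V'_def inner_commute)
      show "\<forall>e\<in>insert v0 E. A e = (A e \<bullet> e) *\<^sub>R e" using E(4) Av0 n0 by simp
    qed (use E n0 sp in auto)
  qed
qed

lemma subspace_tangent: "subspace (tangent x)"
  by (auto simp: subspace_def tangent_def inner_add_left)

section \<open>The geometry of the sphere in terms of the homogeneous extension\<close>

context homogeneous_C3
begin

lemma A_self: assumes y: "y \<noteq> 0" shows "A y y = 0"
proof (rule derivative_along_eqI[OF dz[OF y], where g="\<lambda>s. z y"])
  have "eventually (\<lambda>s::real. s \<in> {-1<..}) (nhds 0)"
    by (intro eventually_nhds_in_open) auto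
  then show "eventually (\<lambda>s::real. z (y + s *\<^sub>R y) = z y) (nhds 0)"
  proof eventually_elim
    case (elim s)
    have "y + s *\<^sub>R y = (1 + s) *\<^sub>R y" by (simp add: algebra_simps)
    then show ?case using elim z_radial[OF y, of "1 + s"] by simp
  qed
qed auto

lemma A_inner_self: "y \<noteq> 0 \<Longrightarrow> A y v \<bullet> y = 0"
  using symA[of y v y] A_self by simp

lemma A_inner_self': "y \<noteq> 0 \<Longrightarrow> y \<bullet> A y v = 0"
  by (subst inner_commute) (rule A_inner_self)

lemma A_scale: assumes y: "y \<noteq> 0" and c: "c > 0" shows "A (c *\<^sub>R y) = A y /\<^sub>R c"
proof -
  have "((\<lambda>y. c *\<^sub>R y) has_derivative (\<lambda>v. c *\<^sub>R v)) (at y)" by (auto intro!: derivative_eq_intros)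
  from has_derivative_compose[OF this dz] y c
  have "((\<lambda>y. z (c *\<^sub>R y)) has_derivative (\<lambda>v. A (c *\<^sub>R y) (c *\<^sub>R v))) (at y)" by simp
  then have "(z has_derivative (\<lambda>v. A (c *\<^sub>R y) (c *\<^sub>R v))) (at y)"
    by (rule has_derivative_transform_within_open[of _ _ _ _ "- {0}"]) (use y c z_radial in auto)
  from fun_cong[OF has_derivative_unique[OF this dz[OF y]]]
  have "A (c *\<^sub>R y) (c *\<^sub>R v) = A y v" for v .
  then have "c *\<^sub>R A (c *\<^sub>R y) v = A y v" for v by (simp add: blinfun.scaleR_right)
  then have "A (c *\<^sub>R y) v = (A y /\<^sub>R c) v" for v using c by (simp add: blinfun.scaleR_left vector_fraction_eq_iff) (metis left_inverse less_irrefl scaleR_one scaleR_scaleR)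
  then show ?thesis by (rule blinfun_eqI)
qed

lemma dA_apply: "y \<noteq> 0 \<Longrightarrow> ((\<lambda>y. A y v) has_derivative (\<lambda>h. B y h v)) (at y)"
  using bounded_linear.has_derivative[OF blinfun.bounded_linear_left dA] .

lemma B_self: assumes y: "y \<noteq> 0" shows "B y h y = - A y h"
proof -
  have 1: "((\<lambda>y. A y y) has_derivative (\<lambda>h. A y h + B y h y)) (at y)"
    using bounded_bilinear.FDERIV[OF bounded_bilinear_blinfun_apply dA[OF y] has_derivative_ident] .
  have 2: "((\<lambda>y. A y y) has_derivative (\<lambda>h. 0)) (at y)"
    by (rule has_derivative_transform_within_open[OF has_derivative_const[of 0], of "- {0}"]) (use y A_self in auto)
  from fun_cong[OF has_derivative_unique[OF 1 2], of h] show ?thesis by (simp add: eq_neg_iff_add_eq_0 add.commute)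
qed

lemma B_sym_inner: assumes y: "y \<noteq> 0" shows "B y h v \<bullet> w = B y h w \<bullet> v"
proof -
  have 1: "((\<lambda>y. A y v \<bullet> w) has_derivative (\<lambda>h. B y h v \<bullet> w)) (at y)" for v w
    by (intro has_derivative_inner_left dA_apply y)
  have "((\<lambda>y. A y w \<bullet> v) has_derivative (\<lambda>h. B y h v \<bullet> w)) (at y)"
    by (rule has_derivative_transform_within_open[OF 1, of "- {0}"]) (use y symA in auto)
  from fun_cong[OF has_derivative_unique[OF this 1]] show ?thesis .
qed

lemma z_sgn: "y \<noteq> 0 \<Longrightarrow> z (sgn y) = z y"
  using z_radial[of y "inverse (norm y)"] by (simp add: sgn_div_norm)

lemma U_sgn: "y \<noteq> 0 \<Longrightarrow> U (sgn y) = z y \<bullet> sgn y"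
  using U_z[of "sgn y"] z_sgn by (simp add: sgn_zero_iff)

lemma sgn_has_derivative:
  assumes y: "(y::'a) \<noteq> 0" shows "(sgn has_derivative (\<lambda>v. (v - (v \<bullet> sgn y) *\<^sub>R sgn y) /\<^sub>R norm y)) (at y)"
proof -
  have "((\<lambda>y. inverse (norm y)) has_derivative (\<lambda>v. - (inverse (norm y) * (v \<bullet> sgn y) * inverse (norm y)))) (at y)"
    by (rule Deriv.has_derivative_inverse) (use y in \<open>auto intro!: has_derivative_norm\<close>)
  from has_derivative_scaleR[OF this has_derivative_ident]
  show ?thesis unfolding sgn_div_norm[abs_def]
    by (rule has_derivative_eq_rhs) (auto simp: fun_eq_iff algebra_simps)
qed

lemma sph_grad_eq:
  assumes u: "\<And>y. y \<in> usphere \<Longrightarrow> u y = U y" and y: "y \<noteq> 0"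
  shows "sph_grad u (sgn y) = z y - (z y \<bullet> sgn y) *\<^sub>R sgn y"
proof -
  define x where "x = sgn y"
  have x: "norm x = 1" "x \<noteq> 0" "sgn x = x" using y by (auto simp: x_def norm_sgn sgn_zero_iff sgn_of_sphere)
  have zx: "z x = z y" using z_sgn[OF y] by (simp add: x_def)
  have "((\<lambda>y. z y \<bullet> sgn y) has_derivative (\<lambda>v. z x \<bullet> ((v - (v \<bullet> sgn x) *\<^sub>R sgn x) /\<^sub>R norm x) + A x v \<bullet> sgn x)) (at x)"
    by (intro has_derivative_inner dz sgn_has_derivative x)
  then have "((\<lambda>y. z y \<bullet> sgn y) has_derivative (\<lambda>v. (z x - (z x \<bullet> x) *\<^sub>R x) \<bullet> v)) (at x)"
    by (rule has_derivative_eq_rhs) (auto simp: fun_eq_iff x A_inner_self A_inner_self' inner_diff_right inner_diff_left inner_commute)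
  then have "((\<lambda>y. u (sgn y)) has_derivative (\<lambda>v. (z x - (z x \<bullet> x) *\<^sub>R x) \<bullet> v)) (at x)"
    by (rule has_derivative_transform_within_open[of _ _ _ _ "- {0}"])
       (use x u U_sgn in \<open>auto simp: norm_sgn\<close>)
  from fun_cong[OF frechet_derivative_at[OF this]]
  have "sph_deriv u x v = (z x - (z x \<bullet> x) *\<^sub>R x) \<bullet> v" for v by (simp add: sph_deriv_def)
  then show ?thesis unfolding sph_grad_def x_def[symmetric] zx[symmetric]
    by (simp add: euclidean_representation)
qed

text \<open>The spherical gradient is \<open>z\<close> minus its radial part u x. Its derivative
  along \<open>v\<close> is A v minus u v minus a radial term; the connection removes the radial
  term, and u g cancels - u v.\<close>

lemma radii_op_eq:
  assumes u: "\<And>y. y \<in> usphere \<Longrightarrow> u y = U y" and x: "x \<in> usphere" and v: "v \<in> tangent x"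
  shows "radii_op u x v = A x v"
proof -
  have x1: "norm x = 1" "x \<noteq> 0" "sgn x = x" "x \<bullet> x = 1" using x by (auto simp: sgn_of_sphere dot_square_norm)
  have v0: "v \<bullet> x = 0" using v by (simp add: tangent_def)
  have "((\<lambda>y. z y \<bullet> sgn y) has_derivative (\<lambda>v. z x \<bullet> ((v - (v \<bullet> sgn x) *\<^sub>R sgn x) /\<^sub>R norm x) + A x v \<bullet> sgn x)) (at x)"
    by (intro has_derivative_inner dz sgn_has_derivative x1)
  from has_derivative_diff[OF dz[OF x1(2)] has_derivative_scaleR[OF this sgn_has_derivative[OF x1(2)]]]
  have "((\<lambda>y. z y - (z y \<bullet> sgn y) *\<^sub>R sgn y) has_derivative (\<lambda>v. A x v - ((z x \<bullet> sgn x) *\<^sub>R ((v - (v \<bullet> sgn x) *\<^sub>R sgn x) /\<^sub>R norm x) +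
     (z x \<bullet> ((v - (v \<bullet> sgn x) *\<^sub>R sgn x) /\<^sub>R norm x) + A x v \<bullet> sgn x) *\<^sub>R sgn x))) (at x)" .
  then have "((\<lambda>y. sph_grad u (sgn y)) has_derivative (\<lambda>v. A x v - ((z x \<bullet> sgn x) *\<^sub>R ((v - (v \<bullet> sgn x) *\<^sub>R sgn x) /\<^sub>R norm x) +
     (z x \<bullet> ((v - (v \<bullet> sgn x) *\<^sub>R sgn x) /\<^sub>R norm x) + A x v \<bullet> sgn x) *\<^sub>R sgn x))) (at x)"
    by (rule has_derivative_transform_within_open[of _ _ _ _ "- {0}"]) (use x1 sph_grad_eq[OF u] in auto)
  from fun_cong[OF frechet_derivative_at[OF this], of v]
  have "sph_deriv (sph_grad u) x v = A x v - ((z x \<bullet> x) *\<^sub>R v + (z x \<bullet> v) *\<^sub>R x)"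
    by (simp add: sph_deriv_def x1 v0 A_inner_self)
  moreover have "u x = z x \<bullet> x" using u[OF x] U_z x1 by simp
  ultimately show ?thesis
    by (simp add: radii_op_def sph_connection_def inner_diff_left inner_add_left v0 x1 A_inner_self)
qed

lemma eigenbasis:
  assumes x: "x \<in> usphere"
  obtains E where "orthonormal_basis (insert x E)" "x \<notin> E" "span E = tangent x" "\<And>e. e \<in> E \<Longrightarrow> A x e = (A x e \<bullet> e) *\<^sub>R e"
    "E \<subseteq> tangent x" "finite E" "card E = DIM('a) - 1"
proof -
  have x1: "norm x = 1" "x \<noteq> 0" "x \<bullet> x = 1" using x by (auto simp: dot_square_norm)
  have "A x v \<in> tangent x" for v using A_inner_self[OF x1(2)] by (simp add: tangent_def)
  then obtain E where E: "pairwise orthogonal E" "\<forall>e\<in>E. norm e = 1" "span E = tangent x" "\<forall>e\<in>E. A x e = (A x e \<bullet> e) *\<^sub>R e"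
    using spectral_theorem_subspace[of "A x" "tangent x"] symA[OF x1(2)] subspace_tangent by metis
  have Et: "E \<subseteq> tangent x" using E(3) span_superset by blast
  have xE: "x \<notin> E" using Et x1 by (auto simp: tangent_def)
  have sp: "span (insert x E) = UNIV"
  proof (intro UNIV_eq_I[symmetric])
    fix v
    have "v - (v \<bullet> x) *\<^sub>R x \<in> span E" unfolding E(3) using x1 by (simp add: tangent_def inner_diff_left)
    then show "v \<in> span (insert x E)" using span_breakdown_eq by blast
  qed
  have o: "orthonormal_basis (insert x E)" unfolding orthonormal_basis_def
    using E x1 sp Et by (auto simp: pairwise_insert orthogonal_def tangent_def inner_commute)
  have f: "finite E" using orthonormal_basis_finite[OF o] by simp
  have "card E = DIM('a) - 1" using card_orthonormal[OF o] f xE by simp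
  then show ?thesis using that[OF o xE E(3)] E(4) Et f by blast
qed

text \<open>The eigenspace of r is spanned by the members of \<open>E\<close> with eigenvalue r.
  Numbering these within each eigenvalue matches \<open>E\<close> with the multiset
  \<open>principal_radii\<close>. For \<open>sig\<close> the radial vector only adds an eigenvalue
  0.\<close>

lemma sigma_radii_eq:
  assumes u: "\<And>y. y \<in> usphere \<Longrightarrow> u y = U y" and x: "x \<in> usphere"
    and E: "orthonormal_basis (insert x E)" "x \<notin> E" "span E = tangent x" "\<And>e. e \<in> E \<Longrightarrow> A x e = (A x e \<bullet> e) *\<^sub>R e"
  shows "sigma_radii k u x = elem_sym k E (\<lambda>e. A x e \<bullet> e)" and "sig k (A x) = elem_sym k E (\<lambda>e. A x e \<bullet> e)"
proof -
  let ?l = "\<lambda>e. A x e \<bullet> e"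
  have x1: "norm x = 1" "x \<noteq> 0" using x by auto
  have fin: "finite E" using orthonormal_basis_finite[OF E(1)] by simp
  have Ax: "A x e = ?l e *\<^sub>R e" if "e \<in> insert x E" for e using that E(4) A_self[OF x1(2)] by auto
  have "sig k (A x) = elem_sym k (insert x E) ?l" by (rule sig_eigenvalues[OF E(1) Ax])
  also have "\<dots> = elem_sym k E ?l" by (rule elem_sym_insert_zero[OF fin E(2)]) (simp add: A_self[OF x1(2)])
  finally show "sig k (A x) = elem_sym k E ?l" .
  have po: "pairwise orthogonal E" and n: "\<And>e. e \<in> E \<Longrightarrow> norm e = 1"
    using E(1) by (auto simp: orthonormal_basis_def pairwise_insert)
  have ind: "independent E" using pairwise_orthogonal_independent[OF po] n by force
  have Et: "E \<subseteq> tangent x" using E(3) span_superset by blast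
  have dim: "dim {v \<in> tangent x. radii_op u x v = r *\<^sub>R v} = card {e \<in> E. ?l e = r}" for r
  proof -
    let ?Er = "{e \<in> E. ?l e = r}"
    have sp: "{v \<in> tangent x. radii_op u x v = r *\<^sub>R v} = span ?Er"
    proof (intro equalityI subsetI)
      fix v assume v: "v \<in> {v \<in> tangent x. radii_op u x v = r *\<^sub>R v}"
      then have vt: "v \<in> tangent x" and Av: "A x v = r *\<^sub>R v" using radii_op_eq[OF u x] by auto
      have vx: "v \<bullet> x = 0" using vt by (simp add: tangent_def)
      have "v \<bullet> e = 0" if "e \<in> E" "?l e \<noteq> r" for e
      proof -
        have "r * (v \<bullet> e) = A x v \<bullet> e" by (simp add: Av)
        also have "\<dots> = A x e \<bullet> v" by (rule symA[OF x1(2)])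
        also have "\<dots> = ?l e * (v \<bullet> e)" using arg_cong[OF E(4)[OF that(1)], of "\<lambda>w. w \<bullet> v"] by (simp add: inner_commute)
        finally show ?thesis using that(2) by simp
      qed
      then have "(\<Sum>e\<in>insert x E. (v \<bullet> e) *\<^sub>R e) = (\<Sum>e\<in>?Er. (v \<bullet> e) *\<^sub>R e)"
        using fin E(2) vx by (intro sum.mono_neutral_cong_right) auto
      then have "v = (\<Sum>e\<in>?Er. (v \<bullet> e) *\<^sub>R e)" using orthonormal_expansion[OF E(1), of v] by simp
      moreover have "(\<Sum>e\<in>?Er. (v \<bullet> e) *\<^sub>R e) \<in> span ?Er" by (intro span_sum span_scale span_base)
      ultimately show "v \<in> span ?Er" by simp
    next
      fix v assume "v \<in> span ?Er"
      moreover have "subspace {v \<in> tangent x. A x v = r *\<^sub>R v}"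
        using subspace_tangent[of x] by (auto simp: subspace_def blinfun.add_right blinfun.scaleR_right algebra_simps)
      moreover have "?Er \<subseteq> {v \<in> tangent x. A x v = r *\<^sub>R v}"
        using Et E(4) by auto
      ultimately have "v \<in> {v \<in> tangent x. A x v = r *\<^sub>R v}" using span_minimal by blast
      then show "v \<in> {v \<in> tangent x. radii_op u x v = r *\<^sub>R v}" using radii_op_eq[OF u x] by auto
    qed
    have "independent ?Er" using ind by (rule independent_mono) auto
    then show ?thesis unfolding sp dim_span by (rule dim_eq_card_independent)
  qed
  have ex: "\<exists>g. bij_betw g {e \<in> E. ?l e = r} {..<card {e \<in> E. ?l e = r}}" for r
    using ex_bij_betw_finite_nat[of "{e \<in> E. ?l e = r}"] fin by (simp add: atLeast0LessThan)
  define g where "g r = (SOME g. bij_betw g {e \<in> E. ?l e = r} {..<card {e \<in> E. ?l e = r}})" for r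
  have g: "bij_betw (g r) {e \<in> E. ?l e = r} {..<card {e \<in> E. ?l e = r}}" for r
    unfolding g_def by (rule someI_ex[OF ex])
  define h where "h e = (?l e, g (?l e) e)" for e
  have "bij_betw h E (principal_radii u x)"
    unfolding bij_betw_def
  proof (intro conjI inj_onI equalityI subsetI)
    fix e f assume ef: "e \<in> E" "f \<in> E" "h e = h f"
    have l: "?l e = ?l f" using ef(3) unfolding h_def prod.inject by (rule conjunct1)
    have "g (?l e) e = g (?l f) f" using ef(3) unfolding h_def prod.inject by (rule conjunct2)
    with l have "g (?l e) e = g (?l e) f" by (simp only:)
    then show "e = f"
      by (rule inj_onD[OF bij_betw_imp_inj_on[OF g[of "?l e"]]]) (use ef l in simp_all)
  next
    fix p assume "p \<in> h ` E"
    then obtain e where e: "e \<in> E" "p = h e" by blast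
    have "g (?l e) e \<in> {..<card {e' \<in> E. ?l e' = ?l e}}"
      by (rule bij_betwE[OF g[of "?l e"], THEN bspec]) (use e(1) in simp)
    then show "p \<in> principal_radii u x" by (simp add: e(2) h_def principal_radii_def dim)
  next
    fix p assume p: "p \<in> principal_radii u x"
    obtain r j where rj: "p = (r, j)" by (cases p)
    then have "j \<in> {..<card {e \<in> E. ?l e = r}}" using p by (simp add: principal_radii_def dim)
    then have "j \<in> g r ` {e \<in> E. ?l e = r}" using bij_betw_imp_surj_on[OF g[of r]] by (simp only:)
    then obtain e where "e \<in> {e \<in> E. ?l e = r}" "g r e = j" by blast
    then show "p \<in> h ` E" by (auto simp: h_def rj)
  qed
  then show "sigma_radii k u x = elem_sym k E ?l"
    unfolding sigma_radii_def by (rule elem_sym_reindex) (simp add: h_def)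
qed

lemma sigma_radii_sig:
  assumes u: "\<And>y. y \<in> usphere \<Longrightarrow> u y = U y" and x: "x \<in> usphere"
  shows "sigma_radii k u x = sig k (A x)"
  by (rule eigenbasis[OF x], subst sigma_radii_eq[OF u x], assumption+, subst sigma_radii_eq[OF u x], assumption+) (rule refl)

end

section \<open>A Minkowski identity\<close>

lemma integrable_compact_support:
  fixes f :: "'a::euclidean_space \<Rightarrow> real"
  assumes K: "compact K" and c: "continuous_on K f" and z: "\<And>y. y \<notin> K \<Longrightarrow> f y = 0"
  shows "integrable lborel f"
proof -
  have "(\<lambda>y. indicator K y *\<^sub>R f y) = f" using z by (auto simp: fun_eq_iff indicator_def)
  then show ?thesis using borel_integrable_compact[OF K c] by simp
qed

lemma lborel_integral_translate:
  fixes f :: "'a::euclidean_space \<Rightarrow> real"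
  assumes f: "f \<in> borel_measurable borel"
  shows "(LINT y|lborel. f (c + y)) = (LINT y|lborel. f y)"
    and "integrable lborel (\<lambda>y. f (c + y)) \<longleftrightarrow> integrable lborel f"
proof -
  have m: "(+) c \<in> lborel \<rightarrow>\<^sub>M borel" by simp
  show "(LINT y|lborel. f (c + y)) = (LINT y|lborel. f y)"
    using integral_distr[OF m f] by (simp add: lborel_distr_plus)
  show "integrable lborel (\<lambda>y. f (c + y)) \<longleftrightarrow> integrable lborel f"
    using integrable_distr_eq[OF m f] by (simp add: lborel_distr_plus)
qed

text \<open>Translation invariance makes every difference quotient integrate to 0, and dominated
  convergence passes to the derivative.\<close>

lemma integral_directional_derivative_zero:
  fixes h :: "'a::euclidean_space \<Rightarrow> real"
  assumes h: "\<And>y. (h has_derivative D y) (at y)" and c: "continuous_on UNIV (\<lambda>y. D y b)"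
    and z: "\<And>y. r < norm y \<Longrightarrow> h y = 0"
  shows "integrable lborel (\<lambda>y. D y b)" and "(LINT y|lborel. D y b) = 0"
proof -
  have ch: "continuous_on UNIV h" using h has_derivative_continuous continuous_at_imp_continuous_on by blast
  have mh: "h \<in> borel_measurable borel" using ch by (rule borel_measurable_continuous_onI)
  have Dz: "D y b = 0" if "r < norm y" for y
  proof -
    have o: "open {y::'a. r < norm y}" by (intro open_Collect_less continuous_intros)
    have "(h has_derivative (\<lambda>v. 0)) (at y)"
      by (rule has_derivative_transform_within_open[OF has_derivative_const[of 0] o]) (use z that in auto)
    from fun_cong[OF has_derivative_unique[OF h this]] show ?thesis .
  qed
  show iD: "integrable lborel (\<lambda>y. D y b)"
    by (rule integrable_compact_support[of "cball 0 r"]) (use c Dz in \<open>auto intro: continuous_on_subset\<close>)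
  have ih: "integrable lborel h"
    by (rule integrable_compact_support[of "cball 0 r"]) (use ch z in \<open>auto intro: continuous_on_subset\<close>)
  \<comment> \<open>The translations have length at most |b|, so all difference quotients vanish
    outside this ball.\<close>
  define K where "K = cball (0::'a) (r + norm b)"
  obtain M where M: "\<And>y. \<bar>D y b\<bar> \<le> M" "M \<ge> 0"
  proof -
    have "bounded ((\<lambda>y. D y b) ` cball 0 r)"
      by (intro compact_imp_bounded compact_continuous_image continuous_on_subset[OF c]) auto
    then obtain M where "M > 0" "\<And>y. y \<in> cball 0 r \<Longrightarrow> \<bar>D y b\<bar> \<le> M" unfolding bounded_pos by auto
    then have "\<bar>D y b\<bar> \<le> M" for y using Dz[of y] by (cases "norm y \<le> r") auto
    then show ?thesis by (rule that) (use \<open>M > 0\<close> in simp)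
  qed
  define s where "s i = 1 / real (Suc i)" for i
  define q where "q i y = real (Suc i) * (h (s i *\<^sub>R b + y) - h y)" for i y
  have line: "((\<lambda>t. h (t *\<^sub>R b + y)) has_real_derivative D (t *\<^sub>R b + y) b) (at t)" for t y
  proof -
    have "((\<lambda>t. t *\<^sub>R b + y) has_derivative (\<lambda>k. k *\<^sub>R b)) (at t)" by (auto intro!: derivative_eq_intros)
    from has_derivative_compose[OF this h] show ?thesis
      using linear_scale[OF has_derivative_linear[OF h]] by (simp add: has_field_derivative_def mult_commute_abs)
  qed
  have bq: "\<bar>q i y\<bar> \<le> M * indicator K y" for i y
  proof -
    have s0: "0 < s i" "s i \<le> 1" "real (Suc i) * s i = 1" by (auto simp: s_def)
    obtain t where "0 < t" "t < s i" "h (s i *\<^sub>R b + y) - h (0 *\<^sub>R b + y) = (s i - 0) * D (t *\<^sub>R b + y) b"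
      using MVT2[OF s0(1) line] by blast
    then have "q i y = D (t *\<^sub>R b + y) b" using s0(3) unfolding q_def by (simp add: mult.assoc[symmetric])
    then have 1: "\<bar>q i y\<bar> \<le> M" using M by simp
    have "q i y = 0" if "y \<notin> K"
    proof -
      have y: "r + norm b < norm y" using that by (simp add: K_def)
      have "norm (s i *\<^sub>R b) \<le> norm b" using s0 by (simp add: mult_left_le_one_le)
      then have "r < norm (s i *\<^sub>R b + y)" using y norm_triangle_ineq4[of "s i *\<^sub>R b + y" "s i *\<^sub>R b"] by simp
      moreover have "r < norm y" using y norm_ge_zero[of b] by linarith
      ultimately show ?thesis by (simp add: q_def z)
    qed
    then show ?thesis using 1 by (auto simp: indicator_def)
  qed
  have q0: "(LINT y|lborel. q i y) = 0" for i
  proof -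
    have "(LINT y|lborel. q i y) = real (Suc i) * ((LINT y|lborel. h (s i *\<^sub>R b + y)) - (LINT y|lborel. h y))"
      unfolding q_def using ih lborel_integral_translate(2)[OF mh, of "s i *\<^sub>R b"] by (simp add: Bochner_Integration.integral_diff)
    then show ?thesis using lborel_integral_translate(1)[OF mh, of "s i *\<^sub>R b"] by simp
  qed
  have lim: "(\<lambda>i. q i y) \<longlonglongrightarrow> D y b" for y
  proof -
    have "((\<lambda>t. (h (t *\<^sub>R b + y) - h y) / t) \<longlongrightarrow> D y b) (at 0)"
      using line[of y 0] by (simp add: has_field_derivative_iff)
    moreover have "filterlim s (at 0) sequentially"
      unfolding filterlim_at using LIMSEQ_inverse_real_of_nat by (auto simp: s_def[abs_def] inverse_eq_divide)
    ultimately have "(\<lambda>i. (h (s i *\<^sub>R b + y) - h y) / s i) \<longlonglongrightarrow> D y b" by (rule filterlim_compose)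
    then show ?thesis by (simp add: q_def s_def mult.commute)
  qed
  have "(\<lambda>i. LINT y|lborel. q i y) \<longlonglongrightarrow> (LINT y|lborel. D y b)"
  proof (rule integral_dominated_convergence[where w="\<lambda>y. M * indicator K y"])
    show "(\<lambda>y. D y b) \<in> borel_measurable lborel" using iD by auto
    have mt: "(\<lambda>y. h (c + y)) \<in> borel_measurable lborel" for c
      using measurable_compose[of "(+) c" lborel borel h borel] mh by simp
    show "q i \<in> borel_measurable lborel" for i unfolding q_def using mt[of "s i *\<^sub>R b"] mh by auto
    have "emeasure lborel K < \<infinity>" unfolding K_def by (rule emeasure_lborel_cball_finite)
    then show "integrable lborel (\<lambda>y. M * indicator K y)" by (intro integrable_mult_right) (simp add: K_def)
  qed (use lim bq in auto)
  then have "(\<lambda>i. 0) \<longlonglongrightarrow> (LINT y|lborel. D y b)" unfolding q0 .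
  then show "(LINT y|lborel. D y b) = 0" by (rule LIMSEQ_unique[OF _ tendsto_const])
qed

lemma divergence_theorem_compact_support:
  fixes V :: "'a::euclidean_space \<Rightarrow> 'a"
  assumes V: "Cm_on (Suc 0) UNIV V" and z: "\<And>y. r < norm y \<Longrightarrow> V y = 0"
  shows "(LINT y|lborel. (\<Sum>b\<in>Basis. frechet_derivative V (at y) b \<bullet> b)) = 0"
proof -
  have D: "((\<lambda>y. V y \<bullet> b) has_derivative (\<lambda>v. frechet_derivative V (at y) v \<bullet> b)) (at y)" for y b
    by (intro has_derivative_inner_left Cm_on_has_derivative[OF V]) auto
  have c: "continuous_on UNIV (\<lambda>y. frechet_derivative V (at y) b \<bullet> b)" for b
    using Cm_on_Suc_frechet[OF V] by (intro continuous_intros) simp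
  have z': "V y \<bullet> b = 0" if "r < norm y" for y b using z[OF that] by simp
  note i = integral_directional_derivative_zero[OF D c z']
  show ?thesis using i by (subst Bochner_Integration.integral_sum) auto
qed

text \<open>A cutoff of class C^1 supported in the shell 1/2 \<le> |y| \<le> 1, away from the origin
  where \<open>sgn\<close> is singular. The 1/4 is the square of the inner radius, and squaring the
  positive part makes it differentiable.\<close>

definition bump :: "'a::euclidean_space \<Rightarrow> real" where
  "bump y = (max 0 ((y \<bullet> y - 1/4) * (1 - y \<bullet> y)))\<^sup>2"

lemma bump_nonneg: "0 \<le> bump y" by (simp add: bump_def)

lemma bump_eq_0: assumes "norm y < 1/2 \<or> 1 < norm y" shows "bump y = 0"
proof -
  have e: "y \<bullet> y = norm y * norm y" by (simp add: dot_square_norm power2_eq_square)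
  have "(y \<bullet> y - 1/4) * (1 - y \<bullet> y) \<le> 0"
    using assms
  proof
    assume a: "norm y < 1/2"
    then have "norm y * norm y \<le> 1/2 * (1/2)" by (intro mult_mono) auto
    then show ?thesis unfolding e by (intro mult_nonpos_nonneg) auto
  next
    assume a: "1 < norm y"
    then have "1 * 1 \<le> norm y * norm y" by (intro mult_mono) auto
    then show ?thesis unfolding e by (intro mult_nonneg_nonpos) auto
  qed
  then show ?thesis by (simp add: bump_def)
qed

lemma bump_le_1: "bump y \<le> 1"
proof (cases "norm y < 1/2 \<or> 1 < norm y")
  case False
  have e: "y \<bullet> y = norm y * norm y" by (simp add: dot_square_norm power2_eq_square)
  have "norm y * norm y \<le> 1 * 1" using False by (intro mult_mono) auto
  then have "0 \<le> 1 - y \<bullet> y" "1 - y \<bullet> y \<le> 1" "y \<bullet> y - 1/4 \<le> 1" by (auto simp: e)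
  then have "(y \<bullet> y - 1/4) * (1 - y \<bullet> y) \<le> 1 * 1"
    by (smt (verit) mult_left_le mult_right_mono)
  then have "max 0 ((y \<bullet> y - 1/4) * (1 - y \<bullet> y)) \<le> 1" by simp
  then show ?thesis unfolding bump_def by (intro power_le_one) auto
qed (simp add: bump_eq_0)

lemma pos_part_square_deriv: "((\<lambda>t::real. (max 0 t)\<^sup>2) has_real_derivative 2 * max 0 t) (at t)"
proof -
  consider "t > 0" | "t < 0" | "t = 0" by linarith
  then show ?thesis
  proof cases
    case 1
    have "((\<lambda>t::real. t\<^sup>2) has_real_derivative 2 * t) (at t)" by (auto intro!: derivative_eq_intros)
    then have "((\<lambda>t::real. (max 0 t)\<^sup>2) has_real_derivative 2 * t) (at t)"
      by (rule DERIV_cong_ev[THEN iffD1, rotated -1]) (use 1 eventually_nhds_in_open[of "{0<..}" t] in \<open>auto elim!: eventually_mono\<close>)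
    then show ?thesis using 1 by simp
  next
    case 2
    have "((\<lambda>t::real. 0::real) has_real_derivative 0) (at t)" by simp
    then have "((\<lambda>t::real. (max 0 t)\<^sup>2) has_real_derivative 0) (at t)"
      by (rule DERIV_cong_ev[THEN iffD1, rotated -1]) (use 2 eventually_nhds_in_open[of "{..<0}" t] in \<open>auto elim!: eventually_mono\<close>)
    then show ?thesis using 2 by simp
  next
    case 3
    have "((\<lambda>h::real. (max 0 h)\<^sup>2 / h) \<longlongrightarrow> 0) (at 0)"
    proof (rule Lim_null_comparison)
      show "eventually (\<lambda>h::real. norm ((max 0 h)\<^sup>2 / h) \<le> \<bar>h\<bar>) (at 0)"
        by (rule always_eventually) (auto simp: max_def power2_eq_square)
      show "((\<lambda>h::real. \<bar>h\<bar>) \<longlongrightarrow> 0) (at 0)" using tendsto_rabs[OF tendsto_ident_at, of "0::real" UNIV] by simp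
    qed
    then show ?thesis using 3 by (simp add: has_field_derivative_iff)
  qed
qed

definition bump_slope :: "'a::euclidean_space \<Rightarrow> real" where
  "bump_slope y = 2 * max 0 ((y \<bullet> y - 1/4) * (1 - y \<bullet> y)) * (5/2 - 4 * (y \<bullet> y))"

lemma bump_deriv: "(bump has_derivative (\<lambda>v. bump_slope y * (y \<bullet> v))) (at y)"
proof -
  have "((\<lambda>y. (y \<bullet> y - 1/4) * (1 - y \<bullet> y)) has_derivative (\<lambda>v. (5/2 - 4 * (y \<bullet> y)) * (y \<bullet> v))) (at y)"
    by (auto intro!: derivative_eq_intros simp: fun_eq_iff inner_commute algebra_simps)
  from has_derivative_compose[OF this pos_part_square_deriv[unfolded has_field_derivative_def]]
  show ?thesis unfolding bump_def[abs_def] bump_slope_def by (simp add: mult.assoc)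
qed

lemma Cm_bump: "Cm_on (Suc 0) UNIV bump"
  by (rule Cm_on_SucI[OF open_UNIV bump_deriv]) (auto simp: bump_slope_def intro!: continuous_intros)

lemma newton_self:
  fixes A :: "'a::euclidean_space \<Rightarrow>\<^sub>L 'a"
  assumes "A y = 0" shows "newton k A y = sig k A *\<^sub>R y"
  by (induction k) (simp_all add: newton_Suc blinfun.diff_left blinfun.scaleR_left blinfun.scaleR_right assms)

lemma newton_sym:
  fixes A :: "'a::euclidean_space \<Rightarrow>\<^sub>L 'a"
  assumes "\<And>v w. A v \<bullet> w = A w \<bullet> v" shows "newton k A v \<bullet> w = newton k A w \<bullet> v"
proof (induction k arbitrary: v w)
  case (Suc k)
  have "A (newton k A v) \<bullet> w = newton k A v \<bullet> A w" using assms by (metis inner_commute)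
  also have "\<dots> = newton k A (A w) \<bullet> v" by (rule Suc)
  also have "\<dots> = A (newton k A w) \<bullet> v" using arg_cong[OF newton_commute[of k A], of "\<lambda>B. blinfun_apply B w"] by simp
  finally show ?case by (simp add: newton_Suc blinfun.diff_left blinfun.scaleR_left inner_diff_left inner_diff_right inner_commute)
qed (simp add: inner_commute)

lemma newton_scale: "newton k (c *\<^sub>R A) = c ^ k *\<^sub>R newton k A"
  by (induction k) (simp_all add: newton.simps(2) blinfun_compose_simps trace_scaleR scaleR_diff_right mult_ac)

lemma sig_scale: "sig k (c *\<^sub>R A) = c ^ k * sig k A"
  by (cases k) (simp_all add: sig_def newton_scale blinfun_compose_simps trace_scaleR mult_ac)

section \<open>Newton tensors of a Hessian\<close>

context homogeneous_C3
begin

lemma A_sgn: "y \<noteq> 0 \<Longrightarrow> A (sgn y) = norm y *\<^sub>R A y"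
  using A_scale[of y "inverse (norm y)"] by (simp add: sgn_div_norm)

lemma sig_A_sgn: "y \<noteq> 0 \<Longrightarrow> sig k (A (sgn y)) = norm y ^ k * sig k (A y)"
  by (simp add: A_sgn sig_scale)

lemma U_sgn_norm: "y \<noteq> 0 \<Longrightarrow> U (sgn y) = U y / norm y"
  using U_sgn[of y] U_z[of y] by (simp add: sgn_div_norm divide_inverse)

lemma Cm_newton:
  shows "Cm_on (Suc 0) (- {0}) (\<lambda>y. newton k (A y))" and "Cm_on (Suc 0) (- {0}) (\<lambda>y. sig k (A y))"
proof -
  have o: "open (- {0::'a})" by auto
  note comp = Cm_on_bilinear[OF bounded_bilinear_blinfun_compose o CA]
  have S: "Cm_on (Suc 0) (- {0}) (\<lambda>y. sig (Suc k) (A y))" if "Cm_on (Suc 0) (- {0}) (\<lambda>y. newton k (A y))" for k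
  proof -
    have "Cm_on (Suc 0) (- {0}) (\<lambda>y. (1 / real (Suc k)) * op_trace (A y o\<^sub>L newton k (A y)))"
      by (intro Cm_on_mult o Cm_on_const Cm_on_linear_compose[OF bounded_linear_trace] comp that)
    then show ?thesis by (simp add: sig_def del: Cm_on.simps)
  qed
  show N: "Cm_on (Suc 0) (- {0}) (\<lambda>y. newton k (A y))" for k
  proof (induction k)
    case 0 show ?case using Cm_on_const[OF o] by (simp del: Cm_on.simps)
  next
    case (Suc k)
    show ?case unfolding newton_Suc
      by (intro Cm_on_diff Cm_on_scaleR o Cm_on_const comp Suc S)
  qed
  show "Cm_on (Suc 0) (- {0}) (\<lambda>y. sig k (A y))"
    using S[OF N] Cm_on_const[OF o] by (cases k) (simp_all del: Cm_on.simps)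
qed

abbreviation "DN k y \<equiv> frechet_derivative (\<lambda>y. newton k (A y)) (at y)"

lemma newton_deriv: "y \<noteq> 0 \<Longrightarrow> ((\<lambda>y. newton k (A y)) has_derivative DN k y) (at y)"
  using Cm_on_has_derivative[OF Cm_newton(1)] by simp

text \<open>By symmetry of the third derivative, the derivative of \<sigma> along \<open>w\<close>
  equals the trace of the Newton tensor against the contracted third derivative. These terms cancel,
  and the remaining one is the induction hypothesis.\<close>

lemma newton_divergence_free: "y \<noteq> 0 \<Longrightarrow> (\<Sum>b\<in>Basis. DN k y b w \<bullet> b) = 0"
proof (induction k arbitrary: w)
  case 0 then show ?case by simp
next
  case (Suc k)
  note y = Suc.prems
  let ?S' = "\<lambda>h. op_trace (newton k (A y) o\<^sub>L B y h)"
  have dS: "((\<lambda>y. sig (Suc k) (A y)) has_derivative ?S') (at y)" by (rule sig_has_derivative[OF dA[OF y]])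
  have "((\<lambda>y. sig (Suc k) (A y) *\<^sub>R id_blinfun - (newton k (A y) o\<^sub>L A y)) has_derivative
     (\<lambda>h. ?S' h *\<^sub>R id_blinfun - ((newton k (A y) o\<^sub>L B y h) + (DN k y h o\<^sub>L A y)))) (at y)"
    by (intro has_derivative_diff has_derivative_scaleR_left dS
        bounded_bilinear.FDERIV[OF bounded_bilinear_blinfun_compose newton_deriv[OF y] dA[OF y]])
  then have "((\<lambda>y. newton (Suc k) (A y)) has_derivative
     (\<lambda>h. ?S' h *\<^sub>R id_blinfun - ((newton k (A y) o\<^sub>L B y h) + (DN k y h o\<^sub>L A y)))) (at y)"
    unfolding newton_Suc newton_commute[symmetric] .
  from fun_cong[OF frechet_derivative_at[OF this], symmetric]
  have e: "DN (Suc k) y h = ?S' h *\<^sub>R id_blinfun - ((newton k (A y) o\<^sub>L B y h) + (DN k y h o\<^sub>L A y))" for h .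
  have "DN (Suc k) y h w = ?S' h *\<^sub>R w - (newton k (A y) (B y h w) + DN k y h (A y w))" for h
    unfolding e by (simp add: blinfun.diff_left blinfun.add_left blinfun.scaleR_left)
  then have "(\<Sum>b\<in>Basis. DN (Suc k) y b w \<bullet> b)
      = (\<Sum>b\<in>Basis. ?S' b * (w \<bullet> b)) - (\<Sum>b\<in>Basis. newton k (A y) (B y b w) \<bullet> b) - (\<Sum>b\<in>Basis. DN k y b (A y w) \<bullet> b)"
    by (simp add: inner_diff_left inner_add_left sum_subtractf sum.distrib)
  also have "(\<Sum>b\<in>Basis. ?S' b * (w \<bullet> b)) = ?S' w"
    using linear_Basis_expansion[OF has_derivative_linear[OF dS], of w] by (simp add: mult.commute)
  also have "(\<Sum>b\<in>Basis. newton k (A y) (B y b w) \<bullet> b) = (\<Sum>b\<in>Basis. newton k (A y) (B y w b) \<bullet> b)"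
    using symB[OF y] by simp
  also have "\<dots> = ?S' w" by (simp add: op_trace_def)
  finally show ?case using Suc.IH[OF y] by simp
qed

end

lemma Cm_norm_power: "Cm_on m (- {0::'a::euclidean_space}) (\<lambda>y. norm y ^ k)"
proof (induction k)
  case 0 show ?case unfolding power_0 by (rule Cm_on_const) auto
next
  case (Suc k)
  show ?case unfolding power_Suc by (intro Cm_on_mult Cm_on_norm Suc) auto
qed

context homogeneous_C3
begin

lemma Cm_z: "Cm_on (Suc 0) (- {0}) z"
proof (rule Cm_on_SucI[OF _ dz])
  show "Cm_on 0 (- {0}) (\<lambda>y. A y v)" for v
    by (rule Cm_on_bilinear[OF bounded_bilinear_blinfun_apply _ Cm_on_Suc_lower[OF CA] Cm_on_const]) auto
qed auto

lemma Cm_U1: "Cm_on (Suc 0) (- {0}) U"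
  by (rule Cm_on_SucI[OF _ dU]) (auto intro!: Cm_on_inner[OF _ Cm_on_Suc_lower[OF Cm_z]] Cm_on_const simp del: Cm_on.simps)

text \<open>The divergence of \<open>bump y |y|\<^sup>j\<^sup>+\<^sup>1 (T\<^sub>j DU - |y|\<^sup>-\<^sup>2 \<sigma>\<^sub>j U y)\<close>, \<open>T\<^sub>j\<close> being the Newton tensor of the Hessian;
  the radial correction removes the derivatives of the cutoff.\<close>

lemma minkowski_identity:
  "(LINT y|lborel. bump y * (real (Suc j) * sig (Suc j) (A (sgn y))
      - (real DIM('a) - real (Suc j)) * (U (sgn y) * sig j (A (sgn y))))) = 0"
proof -
  define f1 where "f1 y = bump y * norm y ^ Suc j" for y :: 'a
  \<comment> \<open>\<open>Om\<close> has degree 0, its factors having degrees j + 1, - j, 1 and -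
    2. Hence the radial derivative of \<open>W\<close> sees the cutoff alone.\<close>
  define Om where "Om y = norm y ^ Suc j * (sig j (A y) * U y * (inverse (norm y) * inverse (norm y)))" for y
  define W where "W y = bump y * Om y" for y
  define V where "V y = f1 y *\<^sub>R newton j (A y) (z y) - W y *\<^sub>R y" for y
  have o: "open (- {0::'a})" by auto
  have Cb: "Cm_on (Suc 0) (- {0}) bump" using Cm_on_subset[OF Cm_bump] by blast
  have CW: "Cm_on (Suc 0) (- {0}) W" unfolding W_def Om_def
    by (intro Cm_on_mult o Cb Cm_norm_power Cm_newton Cm_U1 Cm_on_inverse_norm)
  have CV0: "Cm_on (Suc 0) (- {0}) V" unfolding V_def f1_def
    by (intro Cm_on_diff Cm_on_scaleR Cm_on_mult o Cb CW Cm_norm_power Cm_on_id Cm_z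
        Cm_on_bilinear[OF bounded_bilinear_blinfun_apply o Cm_newton(1)])
  \<comment> \<open>The vanishing cutoff carries the field smoothly across the origin, where its
    ingredients are singular.\<close>
  have V0: "V y = 0" if "y \<in> ball 0 (1/2)" for y
    using that bump_eq_0[of y] by (simp add: V_def f1_def W_def)
  have CV: "Cm_on (Suc 0) UNIV V"
  proof (rule Cm_on_local)
    fix y :: 'a
    show "\<exists>S. open S \<and> y \<in> S \<and> Cm_on (Suc 0) S V"
    proof (cases "y = 0")
      case True
      have "Cm_on (Suc 0) (ball 0 (1/2)) V"
        by (rule Cm_on_cong[OF open_ball _ Cm_on_const[OF open_ball, of _ 0 "1/2" 0]]) (simp add: V0)
      then show ?thesis using True by (intro exI[of _ "ball 0 (1/2)"]) auto
    qed (use CV0 in \<open>auto intro!: exI[of _ "- {0}"] simp del: Cm_on.simps\<close>)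
  qed
  have Vz: "V y = 0" if "1 < norm y" for y using that bump_eq_0[of y] by (simp add: V_def f1_def W_def)
  have div: "(\<Sum>b\<in>Basis. frechet_derivative V (at y) b \<bullet> b) = bump y * (real (Suc j) * sig (Suc j) (A (sgn y))
      - (real DIM('a) - real (Suc j)) * (U (sgn y) * sig j (A (sgn y))))" for y
  proof (cases "y \<in> ball 0 (1/2)")
    case True
    have "(V has_derivative (\<lambda>v. 0)) (at y)"
      by (rule has_derivative_transform_within_open[OF has_derivative_const[of 0] open_ball True]) (simp add: V0)
    then have "frechet_derivative V (at y) b = 0" for b using fun_cong[OF frechet_derivative_at, of V "\<lambda>v. 0" y b] by simp
    then show ?thesis using True bump_eq_0[of y] by simp
  next
    case False
    then have y: "y \<noteq> 0" by auto
    define r where "r = norm y"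
    have r: "r > 0" using y by (simp add: r_def)
    have yy: "y \<bullet> y = r * r" by (simp add: r_def dot_square_norm power2_eq_square)
    define T where "T = newton j (A y)"
    define c where "c = bump y * (real (Suc j) * r ^ j / r) + bump_slope y * r ^ Suc j"
    define W' where "W' = frechet_derivative W (at y)"
    have dW: "(W has_derivative W') (at y)" unfolding W'_def using Cm_on_has_derivative[OF CW] y by simp
    have dn: "((\<lambda>y. norm y ^ Suc j) has_derivative (\<lambda>v. real (Suc j) * (v \<bullet> sgn y) * r ^ j)) (at y)"
      using has_derivative_power[OF has_derivative_norm[OF y], of "Suc j"] by (simp add: r_def)
    have df1: "(f1 has_derivative (\<lambda>v. c * (y \<bullet> v))) (at y)"
      unfolding f1_def
      by (rule has_derivative_eq_rhs[OF has_derivative_mult[OF bump_deriv dn]])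
         (use r in \<open>auto simp: fun_eq_iff c_def sgn_div_norm r_def[symmetric] inner_commute field_simps\<close>)
    have dTz: "((\<lambda>y. newton j (A y) (z y)) has_derivative (\<lambda>v. T (A y v) + DN j y v (z y))) (at y)"
      unfolding T_def
      by (rule bounded_bilinear.FDERIV[OF bounded_bilinear_blinfun_apply newton_deriv[OF y] dz[OF y]])
    have "(V has_derivative (\<lambda>v. (f1 y *\<^sub>R (T (A y v) + DN j y v (z y)) + (c * (y \<bullet> v)) *\<^sub>R T (z y))
        - (W y *\<^sub>R v + W' v *\<^sub>R y))) (at y)"
      unfolding V_def T_def
      by (intro has_derivative_diff has_derivative_scaleR df1 dTz[unfolded T_def] dW has_derivative_ident)
    from fun_cong[OF frechet_derivative_at[OF this], symmetric]
    have dV: "frechet_derivative V (at y) v = (f1 y *\<^sub>R (T (A y v) + DN j y v (z y)) + (c * (y \<bullet> v)) *\<^sub>R T (z y))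
        - (W y *\<^sub>R v + W' v *\<^sub>R y)" for v .
    have t1: "(\<Sum>b\<in>Basis. T (A y b) \<bullet> b) = real (Suc j) * sig (Suc j) (A y)"
      unfolding sig_Suc T_def using newton_commute[of j "A y"] by (simp add: op_trace_def flip: blinfun_apply_blinfun_compose)
    have t2: "(\<Sum>b\<in>Basis. DN j y b (z y) \<bullet> b) = 0" by (rule newton_divergence_free[OF y])
    have t3: "(\<Sum>b\<in>Basis. (y \<bullet> b) * (T (z y) \<bullet> b)) = sig j (A y) * U y"
    proof -
      have "(\<Sum>b\<in>Basis. (y \<bullet> b) * (T (z y) \<bullet> b)) = y \<bullet> T (z y)" by (rule euclidean_inner[symmetric])
      also have "\<dots> = T (z y) \<bullet> y" by (rule inner_commute)
      also have "\<dots> = T y \<bullet> z y" unfolding T_def by (rule newton_sym) (rule symA[OF y])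
      also have "T y = sig j (A y) *\<^sub>R y" unfolding T_def by (rule newton_self[OF A_self[OF y]])
      finally show ?thesis using U_z[OF y] by (simp add: inner_commute)
    qed
    have t4: "(\<Sum>b\<in>Basis. W' b * (y \<bullet> b)) = W' y"
      using linear_Basis_expansion[OF has_derivative_linear[OF dW], of y] by (simp add: mult.commute)
    have t5: "W' y = bump_slope y * (y \<bullet> y) * Om y"
    proof (rule derivative_along_eqI[OF dW, where g="\<lambda>s. bump (y + s *\<^sub>R y) * Om y"])
      have "eventually (\<lambda>s::real. s \<in> {-1<..}) (nhds 0)"
        by (intro eventually_nhds_in_open) auto
      then show "eventually (\<lambda>s::real. W (y + s *\<^sub>R y) = bump (y + s *\<^sub>R y) * Om y) (nhds 0)"
      proof eventually_elim
        case (elim s)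
        define a where "a = 1 + s"
        have a: "a > 0" using elim by (simp add: a_def)
        have e: "y + s *\<^sub>R y = a *\<^sub>R y" by (simp add: a_def algebra_simps)
        have "sig j (A (a *\<^sub>R y)) = (inverse a) ^ j * sig j (A y)"
          using A_scale[OF y a] sig_scale[of j "inverse a" "A y"] by simp
        moreover have "U (a *\<^sub>R y) = a * U y" using U_z[of "a *\<^sub>R y"] U_z[OF y] z_radial[OF y a] a y by simp
        ultimately have "Om (a *\<^sub>R y) = Om y" using a unfolding Om_def
          by (simp add: power_mult_distrib field_simps power_inverse)
        then show ?case unfolding W_def e by simp
      qed
      have "((\<lambda>s. bump (y + s *\<^sub>R y)) has_vector_derivative bump_slope y * (y \<bullet> y)) (at 0)"
        by (rule has_derivative_along[OF bump_deriv])
      then show "((\<lambda>s. bump (y + s *\<^sub>R y) * Om y) has_vector_derivative bump_slope y * (y \<bullet> y) * Om y) (at 0)"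
        by (simp add: has_real_derivative_iff_has_vector_derivative[symmetric] DERIV_cmult_right)
    qed
    have "(\<Sum>b\<in>Basis. frechet_derivative V (at y) b \<bullet> b) =
      (\<Sum>b\<in>Basis. f1 y * (T (A y b) \<bullet> b) + f1 y * (DN j y b (z y) \<bullet> b) + c * ((y \<bullet> b) * (T (z y) \<bullet> b))
         - (W y * (b \<bullet> b) + W' b * (y \<bullet> b)))"
      unfolding dV by (simp add: inner_diff_left inner_add_left algebra_simps)
    also have "\<dots> = f1 y * (real (Suc j) * sig (Suc j) (A y)) + c * (sig j (A y) * U y) - (W y * real DIM('a) + W' y)"
      by (simp add: sum_subtractf sum.distrib sum_distrib_left[symmetric] t1 t2 t3 t4 inner_Basis)
    also have "\<dots> = bump y * (real (Suc j) * (r ^ Suc j * sig (Suc j) (A y))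
      - (real DIM('a) - real (Suc j)) * (U y / r * (r ^ j * sig j (A y))))"
      unfolding t5 f1_def W_def Om_def c_def r_def[symmetric] yy using r by (simp add: field_simps)
    also have "\<dots> = bump y * (real (Suc j) * sig (Suc j) (A (sgn y))
      - (real DIM('a) - real (Suc j)) * (U (sgn y) * sig j (A (sgn y))))"
      unfolding sig_A_sgn[OF y] U_sgn_norm[OF y] r_def ..
    finally show ?thesis .
  qed
  show ?thesis using divergence_theorem_compact_support[OF CV Vz] unfolding div .
qed

end

text \<open>By polar coordinates a fixed multiple of the integral over the sphere. Minkowski's
  identities hold for it as a volume integral, and a one-sided comparison carries the resulting
  bound over to \<open>sphere_measure\<close>.\<close>

definition bump_integral :: "('a::euclidean_space \<Rightarrow> real) \<Rightarrow> real" where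
  "bump_integral f = (LINT y|lborel. bump y * f (sgn y))"

lemma bump_integrable:
  fixes f :: "'a::euclidean_space \<Rightarrow> real"
  assumes "continuous_on usphere f" shows "integrable lborel (\<lambda>y. bump y * f (sgn y))"
proof -
  let ?K = "cball 0 1 - ball (0::'a) (1/2)"
  have "continuous_on ?K sgn" by (intro continuous_intros) auto
  then have "continuous_on ?K (\<lambda>y. f (sgn y))"
    by (rule continuous_on_compose2[OF assms]) (auto simp: norm_sgn)
  moreover have "continuous_on ?K bump" using Cm_on_continuous[OF Cm_bump] continuous_on_subset by blast
  ultimately have c: "continuous_on ?K (\<lambda>y. bump y * f (sgn y))" by (intro continuous_intros)
  have "compact ?K" by (intro compact_diff) auto
  then show ?thesis
    by (rule integrable_compact_support[OF _ c]) (use bump_eq_0 in \<open>auto simp: not_le\<close>)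
qed

lemma bump_integral_mono:
  assumes "continuous_on usphere f" "continuous_on usphere g" "\<And>x. x \<in> usphere \<Longrightarrow> f x \<le> g x"
  shows "bump_integral f \<le> bump_integral g"
  unfolding bump_integral_def
proof (rule integral_mono[OF bump_integrable bump_integrable])
  fix y :: 'a
  show "bump y * f (sgn y) \<le> bump y * g (sgn y)"
    using assms(3)[of "sgn y"] bump_nonneg[of y] bump_eq_0[of y]
    by (cases "y = 0") (auto simp: norm_sgn mult_left_mono)
qed (use assms in auto)

lemma bump_integral_cmult: "bump_integral (\<lambda>x. c * f x) = c * bump_integral f"
  unfolding bump_integral_def by (simp add: mult.left_commute)

lemma bump_integral_add:
  assumes "continuous_on usphere f" "continuous_on usphere g"
  shows "bump_integral (\<lambda>x. f x + g x) = bump_integral f + bump_integral g"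
  unfolding bump_integral_def using bump_integrable[OF assms(1)] bump_integrable[OF assms(2)]
  by (simp add: distrib_left)

lemma bump_integral_1_pos: "0 < bump_integral (\<lambda>_::'a::euclidean_space. 1)"
proof -
  have i: "integrable lborel (bump :: 'a \<Rightarrow> real)" using bump_integrable[of "\<lambda>_. 1"] by simp
  obtain b :: 'a where b: "b \<in> Basis" using nonempty_Basis by blast
  let ?y = "(3/4) *\<^sub>R b"
  have "bump ?y > 0" using b by (simp add: bump_def max_def power2_eq_square)
  have cb: "continuous_on UNIV (bump :: 'a \<Rightarrow> real)" using Cm_on_continuous[OF Cm_bump] .
  have o: "open {y :: 'a. bump y > 0}" using cb by (intro open_Collect_less) auto
  have "(LINT y|lborel. bump (y :: 'a)) \<noteq> 0"
  proof
    assume "(LINT y|lborel. bump (y :: 'a)) = 0"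
    then have "AE y in lborel. bump (y :: 'a) = 0"
      using integral_nonneg_eq_0_iff_AE[OF i AE_I2[OF bump_nonneg]] by simp
    then have "emeasure lborel {y :: 'a. bump y > 0} = 0"
      using o by (subst AE_iff_measurable[symmetric, where P="\<lambda>y. \<not> bump y > 0"]) (auto elim!: eventually_mono)
    then have "{y :: 'a. bump y > 0} \<in> null_sets lborel" using o by auto
    then have "negligible {y :: 'a. bump y > 0}"
      unfolding negligible_iff_null_sets by (rule null_sets_completionI)
    then have "{y :: 'a. bump y > 0} = {}" using open_not_negligible[OF o] by blast
    then show False using \<open>bump ?y > 0\<close> by blast
  qed
  moreover have "(LINT y|lborel. bump (y :: 'a)) \<ge> 0" by (rule Bochner_Integration.integral_nonneg) (rule bump_nonneg)
  ultimately show ?thesis by (simp add: bump_integral_def)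
qed

text \<open>For nonnegative functions the factor DIM of the scaled measure can be taken out through
  the nonnegative integral.\<close>

lemma sphere_integral:
  fixes f :: "'a::euclidean_space \<Rightarrow> real"
  assumes c: "continuous_on usphere f" and f0: "\<And>x. x \<in> usphere \<Longrightarrow> 0 \<le> f x"
  defines "D \<equiv> cball 0 1 - {0::'a}"
  shows "(LINT x|sphere_measure. f x) = real DIM('a) * (LINT y|lborel. indicator D y * f (sgn y))"
    and "integrable lborel (\<lambda>y. indicator D y * f (sgn y))"
proof -
  have D: "D \<in> sets lborel" by (simp add: D_def)
  have m1: "sgn \<in> restrict_space lborel D \<rightarrow>\<^sub>M restrict_space borel usphere"
  proof (rule measurable_restrict_space2)
    show "sgn \<in> space (restrict_space lborel D) \<rightarrow> usphere" by (auto simp: space_restrict_space D_def norm_sgn)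
    show "sgn \<in> borel_measurable (restrict_space lborel D)"
      by (intro measurable_restrict_space1) measurable
  qed
  have m2: "f \<in> borel_measurable (restrict_space borel usphere)"
    by (rule borel_measurable_continuous_on_restrict[OF c])
  let ?d = "distr (restrict_space lborel D) (restrict_space borel usphere) sgn"
  have sp: "space ?d = usphere" by (simp add: space_restrict_space)
  have m3: "f \<in> borel_measurable ?d" using m2 by simp
  have "(LINT x|sphere_measure. f x) = enn2real (\<integral>\<^sup>+ x. ennreal (f x) \<partial>sphere_measure)"
  proof (rule integral_eq_nn_integral)
    show "f \<in> borel_measurable sphere_measure" unfolding sphere_measure_def D_def[symmetric] using m3 by simp
    show "AE x in sphere_measure. 0 \<le> f x"
      by (rule AE_I2) (use f0 in \<open>auto simp: sphere_measure_def space_scale_measure space_restrict_space\<close>)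
  qed
  also have "(\<integral>\<^sup>+ x. ennreal (f x) \<partial>sphere_measure) = of_nat DIM('a) * (\<integral>\<^sup>+ x. ennreal (f x) \<partial>?d)"
    unfolding sphere_measure_def D_def[symmetric] by (rule nn_integral_scale_measure) (use m3 in simp)
  also have "enn2real \<dots> = real DIM('a) * enn2real (\<integral>\<^sup>+ x. ennreal (f x) \<partial>?d)"
    by (simp add: enn2real_mult)
  also have "enn2real (\<integral>\<^sup>+ x. ennreal (f x) \<partial>?d) = (LINT x|?d. f x)"
  proof (rule integral_eq_nn_integral[symmetric, OF m3])
    show "AE x in ?d. 0 \<le> f x" by (rule AE_I2) (use f0 sp in auto)
  qed
  also have "\<dots> = (LINT y|restrict_space lborel D. f (sgn y))" by (rule integral_distr[OF m1 m2])
  also have "\<dots> = (LINT y|lborel. indicator D y *\<^sub>R f (sgn y))" by (rule integral_restrict_space) (use D in simp)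
  finally show "(LINT x|sphere_measure. f x) = real DIM('a) * (LINT y|lborel. indicator D y * f (sgn y))" by simp
  have mm: "(\<lambda>y. indicator D y * f (sgn y)) \<in> borel_measurable lborel"
    using measurable_comp[OF m1 m2] D
    by (subst (asm) borel_measurable_restrict_space_iff) (auto simp: comp_def mult.commute)
  obtain M where M: "M > 0" "\<And>x. x \<in> usphere \<Longrightarrow> \<bar>f x\<bar> \<le> M"
    using compact_imp_bounded[OF compact_continuous_image[OF c compact_sphere]] unfolding bounded_pos by auto
  have "emeasure lborel (cball 0 1 :: 'a set) < \<infinity>" by (rule emeasure_lborel_cball_finite)
  then have "integrable lborel (\<lambda>y. M * indicator (cball 0 1 :: 'a set) y)" by (intro integrable_mult_right) simp
  then show "integrable lborel (\<lambda>y. indicator D y * f (sgn y))"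
    by (rule Bochner_Integration.integrable_bound[OF _ mm])
       (use M in \<open>auto simp: indicator_def D_def norm_sgn\<close>)
qed

lemma sphere_integral_mono:
  fixes f :: "'a::euclidean_space \<Rightarrow> real"
  assumes "continuous_on usphere f" "\<And>x. x \<in> usphere \<Longrightarrow> 0 \<le> f x" "continuous_on usphere g" "\<And>x. x \<in> usphere \<Longrightarrow> f x \<le> g x"
  shows "(LINT x|sphere_measure. f x) \<le> (LINT x|sphere_measure. g x)"
proof -
  have g0: "0 \<le> g x" if "x \<in> usphere" for x using assms(2,4)[OF that] by linarith
  have "(LINT x|sphere_measure. f x) = real DIM('a) * (LINT y|lborel. indicator (cball 0 1 - {0}) y * f (sgn y))"
    by (rule sphere_integral(1)[OF assms(1,2)])
  also have "\<dots> \<le> real DIM('a) * (LINT y|lborel. indicator (cball 0 1 - {0}) y * g (sgn y))"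
    by (rule mult_left_mono[OF integral_mono[OF sphere_integral(2)[OF assms(1,2)] sphere_integral(2)[OF assms(3) g0]]])
       (use assms(4) in \<open>auto simp: indicator_def norm_sgn\<close>)
  also have "\<dots> = (LINT x|sphere_measure. g x)"
    by (rule sphere_integral(1)[OF assms(3) g0, symmetric])
  finally show ?thesis .
qed

text \<open>The cutoff is at most 1 and vanishes outside the unit ball, and the factor DIM in
  \<open>sphere_measure\<close> is at least 1.\<close>

lemma bump_integral_le_sphere:
  fixes f :: "'a::euclidean_space \<Rightarrow> real"
  assumes c: "continuous_on usphere f" and f0: "\<And>x. x \<in> usphere \<Longrightarrow> 0 \<le> f x"
  shows "bump_integral f \<le> (LINT x|sphere_measure. f x)"
proof -
  have "bump_integral f \<le> (LINT y|lborel. indicator (cball 0 1 - {0}) y * f (sgn y))"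
    unfolding bump_integral_def
  proof (rule integral_mono[OF bump_integrable[OF c] sphere_integral(2)[OF c f0]])
    fix y :: 'a
    show "bump y * f (sgn y) \<le> indicator (cball 0 1 - {0}) y * f (sgn y)"
      using f0[of "sgn y"] bump_le_1[of y] bump_eq_0[of y]
      by (cases "y = 0") (auto simp: norm_sgn indicator_def intro: mult_left_le_one_le bump_nonneg)
  qed
  also have "\<dots> \<le> real DIM('a) * (LINT y|lborel. indicator (cball 0 1 - {0}) y * f (sgn y))"
  proof -
    have "0 \<le> (LINT y|lborel. indicator (cball 0 1 - {0}) y * f (sgn y))"
      using f0 by (intro Bochner_Integration.integral_nonneg) (auto simp: indicator_def norm_sgn)
    moreover have "1 \<le> real DIM('a)" using DIM_positive[where 'a='a] by linarith
    ultimately show ?thesis by (metis mult_right_mono mult_1)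
  qed
  also have "\<dots> = (LINT x|sphere_measure. f x)" by (rule sphere_integral(1)[OF c f0, symmetric])
  finally show ?thesis .
qed

lemma sphere_area_integral: "sphere_area TYPE('a::euclidean_space) = (LINT x|(sphere_measure :: 'a measure). 1)"
  by (simp add: sphere_area_def sphere_measure_def space_scale_measure space_restrict_space)

lemma sphere_area_pos: "0 < sphere_area TYPE('a::euclidean_space)"
  unfolding sphere_area_integral
  by (rule less_le_trans[OF bump_integral_1_pos bump_integral_le_sphere]) auto

context homogeneous_C3
begin

lemma continuous_sig: "continuous_on usphere (\<lambda>x. sig k (A x))"
  using Cm_on_continuous[OF Cm_newton(2)] by (rule continuous_on_subset) auto

lemma continuous_U: "continuous_on usphere U"
  using Cm_on_continuous[OF Cm_U1] by (rule continuous_on_subset) auto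

lemma bump_integral_minkowski:
  "real (Suc j) * bump_integral (\<lambda>x. sig (Suc j) (A x)) = (real DIM('a) - real (Suc j)) * bump_integral (\<lambda>x. U x * sig j (A x))"
proof -
  have i: "integrable lborel (\<lambda>y. bump y * sig (Suc j) (A (sgn y)))" "integrable lborel (\<lambda>y. bump y * (U (sgn y) * sig j (A (sgn y))))"
    using bump_integrable[OF continuous_sig] bump_integrable[OF continuous_on_mult[OF continuous_U continuous_sig]] by auto
  have "(LINT y|lborel. real (Suc j) * (bump y * sig (Suc j) (A (sgn y))) - (real DIM('a) - real (Suc j)) * (bump y * (U (sgn y) * sig j (A (sgn y))))) = 0"
    using minkowski_identity[of j] by (simp add: algebra_simps)
  then show ?thesis unfolding bump_integral_def
    using i by (simp add: Bochner_Integration.integral_diff)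
qed

text \<open>Starting from \<sigma>_0 = 1, each Minkowski identity with U \<ge> \<rho> raises the
  order by one and contributes the factor \<rho> (n - j) / (j + 1), where n = DIM - 1; these factors
  multiply to the binomial coefficient and the power of \<rho>.\<close>

lemma bump_integral_sig_ge:
  assumes U: "\<And>x. x \<in> usphere \<Longrightarrow> \<rho> \<le> U x" and \<rho>: "0 \<le> \<rho>"
    and S: "\<And>j x. x \<in> usphere \<Longrightarrow> 0 \<le> sig j (A x)" and k: "k \<le> DIM('a) - 1"
  shows "real ((DIM('a) - 1) choose k) * \<rho> ^ k * bump_integral (\<lambda>_::'a. 1) \<le> bump_integral (\<lambda>x. sig k (A x))"
  using k
proof (induction k)
  case (Suc j)
  let ?n = "DIM('a) - 1"
  have nj: "real DIM('a) - real (Suc j) = real (?n - j)" using Suc.prems by (simp add: of_nat_diff)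
  have "real (Suc j) * (real (?n choose Suc j) * \<rho> ^ Suc j * bump_integral (\<lambda>_::'a. 1))
     = real (?n - j) * \<rho> * (real (?n choose j) * \<rho> ^ j * bump_integral (\<lambda>_::'a. 1))"
  proof -
    have "Suc j * (?n choose Suc j) = (?n - j) * (?n choose j)" by (simp only: binomial_absorption binomial_absorb_comp)
    then have "real (Suc j) * real (?n choose Suc j) = real (?n - j) * real (?n choose j)" by (metis of_nat_mult)
    then show ?thesis by (simp add: algebra_simps)
  qed
  also have "\<dots> \<le> real (?n - j) * \<rho> * bump_integral (\<lambda>x. sig j (A x))"
    using Suc \<rho> by (intro mult_left_mono) auto
  also have "\<dots> = real (?n - j) * bump_integral (\<lambda>x. \<rho> * sig j (A x))" by (simp add: bump_integral_cmult)
  also have "\<dots> \<le> real (?n - j) * bump_integral (\<lambda>x. U x * sig j (A x))"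
    using U S by (intro mult_left_mono bump_integral_mono continuous_intros continuous_sig continuous_U mult_right_mono) auto
  also have "\<dots> = real (Suc j) * bump_integral (\<lambda>x. sig (Suc j) (A x))"
    unfolding bump_integral_minkowski nj ..
  finally show ?case by (simp only: mult_le_cancel_left_pos of_nat_0_less_iff zero_less_Suc)
qed simp

text \<open>Moving the origin to \<open>p\<close> subtracts a linear function, which the Hessian
  does not see. Minkowski's identities can thus use support distances from the centre of a large
  ball while \<sigma> stays the same.\<close>

lemma translate: "homogeneous_C3 (\<lambda>y. U y - p \<bullet> y) (\<lambda>y. z y - p) A B"
proof
  show "((\<lambda>y. U y - p \<bullet> y) has_derivative (\<bullet>) (z y - p)) (at y)" if "y \<noteq> 0" for y
    using has_derivative_diff[OF dU[OF that] has_derivative_inner_right[OF has_derivative_ident, of p]]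
    by (simp add: inner_diff_left[abs_def])
  show "((\<lambda>y. z y - p) has_derivative blinfun_apply (A y)) (at y)" if "y \<noteq> 0" for y
    using has_derivative_diff[OF dz[OF that] has_derivative_const[of p]] by simp
qed (use dA CA z_radial U_z symA symB in \<open>auto simp: inner_diff_left\<close>)

end

section \<open>The maximum principle\<close>

lemma second_derivative_test_max:
  fixes G :: "real \<Rightarrow> real"
  assumes e: "e > 0" and G: "\<And>s. \<bar>s\<bar> < e \<Longrightarrow> (G has_real_derivative G' s) (at s)"
    and max: "\<And>s. \<bar>s\<bar> < e \<Longrightarrow> G s \<le> G 0" and G'': "(G' has_real_derivative d) (at 0)"
  shows "G' 0 = 0" "d \<le> 0"
proof -
  show G'0: "G' 0 = 0"
    by (rule DERIV_local_max[OF G e]) (use e max in auto)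
  show "d \<le> 0"
  proof (rule ccontr)
    assume "\<not> d \<le> 0"
    then obtain \<delta> where \<delta>: "\<delta> > 0" "\<And>h. h > 0 \<Longrightarrow> h < \<delta> \<Longrightarrow> G' 0 < G' (0 + h)"
      using DERIV_pos_inc_right[OF G''] by auto
    define h where "h = min \<delta> e / 2"
    have h: "0 < h" "h < \<delta>" "h < e" using \<delta> e by (auto simp: h_def)
    obtain t where t: "0 < t" "t < h" "G h - G 0 = (h - 0) * G' t"
      using MVT2[OF h(1), of G G'] G h by force
    have "G' t > 0" using \<delta>(2)[of t] t h G'0 by simp
    then have "h * G' t > 0" using h by simp
    then have "G h > G 0" using t by simp
    then show False using max[of h] h by simp
  qed
qed

text \<open>Summed with the weights \<open>c\<close> of the linearised speed, the second order conditions at a maximum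
  of \<open>|\<nabla>u|\<^sup>2 / u\<^sup>\<gamma>\<close> give a negative sign: eigenvalues above \<open>\<lambda>\<^sub>0 = u + \<gamma>q/(2u)\<close> are harmless because
  of the quadratic term, and those below contribute at most as much as \<open>\<lambda>\<^sub>0\<close> itself.\<close>

lemma gradient_maximum_algebra:
  fixes L c Z D :: "'e \<Rightarrow> real" and u q \<gamma> :: real
  assumes E: "finite E" "card E = n" and u: "u > 0" and \<gamma>: "\<gamma> = 1 / (real n + 2)"
    and L: "\<And>e. e \<in> E \<Longrightarrow> L e > 0" and c: "\<And>e. e \<in> E \<Longrightarrow> c e > 0"
    and mono: "\<And>e f. e \<in> E \<Longrightarrow> f \<in> E \<Longrightarrow> L e \<le> L f \<Longrightarrow> L e * c e \<le> L f * c f"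
    and q: "q = (\<Sum>e\<in>E. (Z e)\<^sup>2)" and big: "q \<ge> (6 * real n + 9) * u\<^sup>2"
    and first: "\<And>e. e \<in> E \<Longrightarrow> 2 * (L e - u) * Z e / q = \<gamma> * Z e / u"
    and second: "\<And>e. e \<in> E \<Longrightarrow> (2 * (L e - u)\<^sup>2 - 2 * (Z e)\<^sup>2 + 2 * D e) / q - (\<gamma> * Z e / u)\<^sup>2
        - \<gamma> * (L e - u) / u + \<gamma> * (Z e)\<^sup>2 / u\<^sup>2 \<le> 0"
  shows "(\<Sum>e\<in>E. c e * (2 * D e / q)) < 0"
proof -
  have g: "\<gamma> > 0" "\<gamma> * (real n + 2) = 1" using \<gamma> by auto
  have "(6 * real n + 9) * u\<^sup>2 > 0" using u by (intro mult_pos_pos) auto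
  then have q0: "q > 0" using big by linarith
  \<comment> \<open>The eigenvalue that the first order condition forces in every direction in which
    the gradient has a component.\<close>
  define l where "l = u + \<gamma> * q / (2 * u)"
  have l0: "l > 0" using u g q0 by (simp add: l_def add_pos_pos)
  have Zl: "L e = l" if "e \<in> E" "Z e \<noteq> 0" for e
  proof -
    have "2 * (L e - u) / q = \<gamma> / u" 
    proof -
      have "Z e * (2 * (L e - u) / q) = Z e * (\<gamma> / u)" using first[OF that(1)] by (simp add: mult_ac)
      then show ?thesis using that(2) by (metis mult_left_cancel)
    qed
    then show ?thesis using u q0 by (simp add: l_def field_simps)
  qed
  obtain e0 where e0: "e0 \<in> E" "Z e0 \<noteq> 0"
  proof (cases "\<exists>e\<in>E. Z e \<noteq> 0")
    case False
    then have "q = 0" using q by simp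
    then show ?thesis using q0 by simp
  qed (use that in auto)
  define s where "s = c e0"
  have s: "s > 0" using c e0 by (simp add: s_def)
  have Lc: "L e * c e \<le> l * s" if "e \<in> E" "L e \<le> l" for e
    using mono[OF that(1) e0(1)] that Zl[OF e0] by (simp add: s_def)
  \<comment> \<open>Equal eigenvalues have equal weights, by \<open>mono\<close> applied both ways;
    all directions seen by the gradient share the weight \<open>s\<close>.\<close>
  have cs: "c e = s" if "e \<in> E" "Z e \<noteq> 0" for e
  proof -
    have Le: "L e = L e0" using Zl that e0 by simp
    have "L e0 * c e \<le> L e0 * c e0" using mono[OF that(1) e0(1)] by (simp only: Le order_refl simp_thms)
    moreover have "L e0 * c e0 \<le> L e0 * c e" using mono[OF e0(1) that(1)] by (simp only: Le order_refl simp_thms)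
    ultimately have "L e0 * c e = L e0 * c e0" by (rule order_antisym)
    then show ?thesis using L[OF e0(1)] by (simp add: s_def)
  qed
  have cZ: "(\<Sum>e\<in>E. c e * (Z e)\<^sup>2) = s * q"
    unfolding q sum_distrib_left by (rule sum.cong) (use cs in auto)
  \<comment> \<open>The part of the second order condition that depends on the eigenvalue only, with
    the terms in \<open>Z\<close> taken out.\<close>
  define t where "t e = \<gamma> * (L e - u) / u - 2 * (L e - u)\<^sup>2 / q" for e
  have ct: "c e * t e \<le> \<gamma> * s * l / u" if e: "e \<in> E" for e
  proof (cases "L e \<ge> l")
    case True
    have Lu: "L e - u \<ge> \<gamma> * q / (2 * u)" using True by (simp add: l_def)
    have "\<gamma> * q / (2 * u) \<ge> 0" using g q0 u by simp
    then have Lu0: "L e - u \<ge> 0" using Lu by linarith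
    have "\<gamma> / u \<le> 2 * (L e - u) / q" using Lu q0 u by (simp add: field_simps)
    then have "(L e - u) * (\<gamma> / u - 2 * (L e - u) / q) \<le> 0" using Lu0 by (intro mult_nonneg_nonpos) auto
    moreover have "t e = (L e - u) * (\<gamma> / u - 2 * (L e - u) / q)"
    proof -
      define d where "d = L e - u"
      show ?thesis unfolding t_def d_def[symmetric]
        by (simp add: right_diff_distrib power2_eq_square mult_ac)
    qed
    ultimately have "t e \<le> 0" by simp
    then have "c e * t e \<le> 0" using c[OF e] by (simp add: mult_le_0_iff)
    also have "\<dots> \<le> \<gamma> * s * l / u" using g s l0 u by simp
    finally show ?thesis .
  next
    case False
    have "t e \<le> \<gamma> * (L e - u) / u" using q0 by (simp add: t_def)
    also have "\<dots> \<le> \<gamma> * L e / u" using g u by (simp add: divide_right_mono)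
    finally have "c e * t e \<le> c e * (\<gamma> * L e / u)" using c[OF e] by (intro mult_left_mono) auto
    also have "\<dots> = (\<gamma> / u) * (L e * c e)" by simp
    also have "\<dots> \<le> (\<gamma> / u) * (l * s)" using Lc[OF e] False g u by (intro mult_left_mono) auto
    finally show ?thesis by (simp add: mult_ac)
  qed
  have D: "2 * D e / q \<le> (2 / q + (\<gamma>\<^sup>2 - \<gamma>) / u\<^sup>2) * (Z e)\<^sup>2 + t e" if e: "e \<in> E" for e
  proof -
    have "(2 * (L e - u)\<^sup>2 - 2 * (Z e)\<^sup>2 + 2 * D e) / q = 2 * (L e - u)\<^sup>2 / q - 2 * (Z e)\<^sup>2 / q + 2 * D e / q"
      by (simp add: add_divide_distrib diff_divide_distrib)
    moreover have "(\<gamma> * Z e / u)\<^sup>2 = \<gamma>\<^sup>2 * (Z e)\<^sup>2 / u\<^sup>2" by (simp add: power_mult_distrib power_divide)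
    moreover have "(2 / q + (\<gamma>\<^sup>2 - \<gamma>) / u\<^sup>2) * (Z e)\<^sup>2 = 2 * (Z e)\<^sup>2 / q + (\<gamma>\<^sup>2 * (Z e)\<^sup>2 / u\<^sup>2 - \<gamma> * (Z e)\<^sup>2 / u\<^sup>2)"
      by (simp add: distrib_right diff_divide_distrib left_diff_distrib)
    ultimately show ?thesis using second[OF e] by (simp add: t_def)
  qed
  have "(\<Sum>e\<in>E. c e * (2 * D e / q)) \<le> (\<Sum>e\<in>E. c e * ((2 / q + (\<gamma>\<^sup>2 - \<gamma>) / u\<^sup>2) * (Z e)\<^sup>2 + t e))"
    using D c by (intro sum_mono mult_left_mono) (auto intro: less_imp_le)
  also have "\<dots> = (2 / q + (\<gamma>\<^sup>2 - \<gamma>) / u\<^sup>2) * (\<Sum>e\<in>E. c e * (Z e)\<^sup>2) + (\<Sum>e\<in>E. c e * t e)"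
  proof -
    define K where "K = (2 / q + (\<gamma>\<^sup>2 - \<gamma>) / u\<^sup>2)"
    show ?thesis unfolding K_def[symmetric] by (simp add: distrib_left sum.distrib sum_distrib_left mult_ac)
  qed
  also have "\<dots> \<le> (2 / q + (\<gamma>\<^sup>2 - \<gamma>) / u\<^sup>2) * (s * q) + real n * (\<gamma> * s * l / u)"
    unfolding cZ using sum_mono[OF ct, of E "\<lambda>e. e"] E by simp
  also have "\<dots> = s * (2 + real n * \<gamma> - \<gamma> * (q / u\<^sup>2) * (1 - \<gamma> * (1 + real n / 2)))"
    using q0 u by (simp add: l_def power2_eq_square field_simps)
  \<comment> \<open>Here the choice of \<gamma> enters: half of the good term - \<gamma> q / u^2
    survives.\<close>
  also have "\<gamma> * (1 + real n / 2) = 1/2" using g by (simp add: algebra_simps)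
  also have "s * (2 + real n * \<gamma> - \<gamma> * (q / u\<^sup>2) * (1 - 1/2)) < 0"
  proof -
    have "6 * real n + 9 \<le> q / u\<^sup>2" using big u by (simp add: pos_le_divide_eq)
    then have le: "\<gamma> * (6 * real n + 9) \<le> \<gamma> * (q / u\<^sup>2)" using g by (intro mult_left_mono) auto
    \<comment> \<open>The constant 6 n + 9 is one more than 2 (3 n + 4), the amount needed to cancel
      the remaining terms.\<close>
    have "2 + real n * \<gamma> = \<gamma> * (3 * real n + 4)" using g(2) by (simp add: algebra_simps)
    also have "\<dots> < \<gamma> * (6 * real n + 9) / 2" using g by simp
    also have "\<dots> \<le> \<gamma> * (q / u\<^sup>2) / 2" using le by (rule divide_right_mono) simp
    finally have "2 + real n * \<gamma> - \<gamma> * (q / u\<^sup>2) * (1 - 1/2) < 0" by simp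
    then show ?thesis using s by (simp add: mult_pos_neg)
  qed
  finally show ?thesis .
qed

section \<open>A spatial maximum of |\<nabla>u|^2 / u^\<gamma>\<close>

context homogeneous_C3
begin

text \<open>On the sphere \<open>z\<close> is the orthogonal sum of \<nabla>u and u x, so this is
  |\<nabla>u|^2 by Pythagoras.\<close>

definition grad_sq :: "'a \<Rightarrow> real" where "grad_sq y = z y \<bullet> z y - (U y)\<^sup>2"

text \<open>Along the great circle through \<open>x\<close> in a principal direction
  \<open>e\<close>, ordinary derivatives of the logarithm of the quotient replace covariant ones.
  The third derivative enters through \<open>B\<close> in the direction \<zeta> of the gradient, the
  same term as in the derivative of the speed.\<close>

lemma great_circle_test:
  assumes x: "norm x = 1" and e: "norm e = 1" "e \<bullet> x = 0" "A x e = l *\<^sub>R e"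
    and u: "\<And>y. y \<in> usphere \<Longrightarrow> U y > 0" and q0: "grad_sq x > 0"
    and max: "\<And>y. y \<in> usphere \<Longrightarrow> grad_sq y / U y powr \<gamma> \<le> grad_sq x / U x powr \<gamma>"
  defines "q \<equiv> grad_sq x" and "Ze \<equiv> z x \<bullet> e" and "\<zeta> \<equiv> z x - U x *\<^sub>R x"
  shows "2 * (l - U x) * Ze / q = \<gamma> * Ze / U x"
    and "(2 * (l - U x)\<^sup>2 - 2 * Ze\<^sup>2 + 2 * (B x \<zeta> e \<bullet> e)) / q - (\<gamma> * Ze / U x)\<^sup>2
        - \<gamma> * (l - U x) / U x + \<gamma> * Ze\<^sup>2 / (U x)\<^sup>2 \<le> 0"
proof -
  have x0: "x \<noteq> 0" and xx: "x \<bullet> x = 1" and ee: "e \<bullet> e = 1" "x \<bullet> e = 0" using x e by (auto simp: dot_square_norm inner_commute)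
  define c where "c s = cos s *\<^sub>R x + sin s *\<^sub>R e" for s
  define c' where "c' s = - sin s *\<^sub>R x + cos s *\<^sub>R e" for s
  have nc: "norm (c s) = 1" for s
  proof -
    have "c s \<bullet> c s = 1" using xx ee e(2) sin_cos_squared_add2[of s]
      by (simp add: c_def inner_add_left inner_add_right algebra_simps power2_eq_square)
    then show ?thesis by (simp add: norm_eq_sqrt_inner)
  qed
  then have c0: "c s \<noteq> 0" and cS: "c s \<in> usphere" for s by (metis norm_zero zero_neq_one, simp)
  have c00: "c 0 = x" "c' 0 = e" by (simp_all add: c_def c'_def)
  have dc: "(c has_vector_derivative c' s) (at s)" for s
    unfolding c_def c'_def by (auto intro!: derivative_eq_intros simp: has_vector_derivative_def fun_eq_iff algebra_simps)
  have dc': "(c' has_vector_derivative - c s) (at s)" for s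
    unfolding c_def c'_def by (auto intro!: derivative_eq_intros simp: has_vector_derivative_def fun_eq_iff algebra_simps)
  have dZ: "((\<lambda>s. z (c s)) has_vector_derivative A (c s) (c' s)) (at s)" for s
    using vector_derivative_diff_chain_within[OF dc[of s], of z "A (c s)"] dz[OF c0[of s]]
    by (auto simp: o_def intro: has_derivative_at_withinI)
  have dA1: "((\<lambda>s. A (c s)) has_vector_derivative B (c s) (c' s)) (at s)" for s
    using vector_derivative_diff_chain_within[OF dc[of s], of A "B (c s)"] dA[OF c0[of s]]
    by (auto simp: o_def intro: has_derivative_at_withinI)
  have vin: "((\<lambda>s. f s \<bullet> g s) has_real_derivative (f s \<bullet> g' + f' \<bullet> g s)) (at s)"
    if "(f has_vector_derivative f') (at s)" "(g has_vector_derivative g') (at s)" for f g :: "real \<Rightarrow> 'a" and f' g' s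
    using bounded_bilinear.has_vector_derivative[OF bounded_bilinear_inner that]
    by (simp add: has_real_derivative_iff_has_vector_derivative)
  define u1 where "u1 s = z (c s) \<bullet> c' s" for s
  have du: "((\<lambda>s. U (c s)) has_real_derivative u1 s) (at s)" for s
  proof -
    have "((\<lambda>s. z (c s) \<bullet> c s) has_real_derivative u1 s) (at s)"
      using vin[OF dZ dc] A_inner_self[OF c0] by (simp add: u1_def)
    then show ?thesis using U_z[OF c0] by simp
  qed
  define q1 where "q1 s = 2 * (z (c s) \<bullet> A (c s) (c' s)) - 2 * (U (c s) * u1 s)" for s
  have dq: "((\<lambda>s. grad_sq (c s)) has_real_derivative q1 s) (at s)" for s
    unfolding grad_sq_def
    by (rule derivative_eq_intros vin dZ du refl)+ (simp add: q1_def inner_commute power2_eq_square)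
  define u2 where "u2 = l - U x"
  have du1: "(u1 has_real_derivative u2) (at 0)"
    unfolding u1_def
    by (rule DERIV_cong[OF vin[OF dZ dc']]) (simp add: c00 e(3) ee u2_def U_z[OF x0])
  define d3 where "d3 = B x \<zeta> e \<bullet> e"
  have dAc: "((\<lambda>s. A (c s) (c' s)) has_vector_derivative B x e e) (at 0)"
    using bounded_bilinear.has_vector_derivative[OF bounded_bilinear_blinfun_apply dA1[of 0] dc'[of 0]]
    by (simp add: c00 A_self[OF x0] blinfun.minus_right)
  \<comment> \<open>Differentiating A y y = 0 gives B h y = - A h, so the radial part of
    \<open>z\<close> yields a second order term; symmetry moves the tangential part \<zeta> into the
    first slot.\<close>
  have zB: "z x \<bullet> B x e e = - (U x * l) + d3"
  proof -
    have "z x = \<zeta> + U x *\<^sub>R x" by (simp add: \<zeta>_def)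
    then have "z x \<bullet> B x e e = B x e e \<bullet> \<zeta> + U x * (B x e e \<bullet> x)"
      by (simp only: inner_add_left inner_add_right inner_scaleR_left inner_scaleR_right inner_commute[of _ "B x e e"])
    also have "B x e e \<bullet> x = B x e x \<bullet> e" by (rule B_sym_inner[OF x0])
    also have "\<dots> = - l" using B_self[OF x0, of e] by (simp add: e(3) ee inner_minus_left)
    also have "B x e e \<bullet> \<zeta> = B x e \<zeta> \<bullet> e" by (rule B_sym_inner[OF x0])
    also have "\<dots> = d3" using symB[OF x0, of e \<zeta>] by (simp add: d3_def)
    finally show ?thesis by simp
  qed
  define q2 where "q2 = 2 * (l - U x)\<^sup>2 - 2 * Ze\<^sup>2 + 2 * d3"
  have dq1: "(q1 has_real_derivative q2) (at 0)"
  proof -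
    have "((\<lambda>s. 2 * (z (c s) \<bullet> A (c s) (c' s)) - 2 * (U (c s) * u1 s)) has_real_derivative
        2 * (z (c 0) \<bullet> B x e e + A (c 0) (c' 0) \<bullet> A (c 0) (c' 0)) - 2 * (u1 0 * u1 0 + u2 * U (c 0))) (at 0)"
      by (intro DERIV_diff DERIV_cmult vin[OF dZ dAc] DERIV_mult du du1)
    moreover have "2 * (z (c 0) \<bullet> B x e e + A (c 0) (c' 0) \<bullet> A (c 0) (c' 0)) - 2 * (u1 0 * u1 0 + u2 * U (c 0)) = q2"
      by (simp add: c00 e(3) ee zB q2_def u2_def u1_def Ze_def power2_eq_square algebra_simps)
    ultimately show ?thesis unfolding q1_def[abs_def] by simp
  qed
  have u10: "u1 0 = Ze" by (simp add: u1_def c00 Ze_def)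
  have q10: "q1 0 = 2 * (l - U x) * Ze"
    by (simp add: q1_def c00 e(3) u10 Ze_def algebra_simps)
  have U0: "U (c s) > 0" for s using u[OF cS] .
  \<comment> \<open>The logarithm needs a nonzero gradient, which is ensured only near the maximum
    point.\<close>
  have "continuous_on UNIV (\<lambda>s. grad_sq (c s))"
    using dq DERIV_isCont continuous_at_imp_continuous_on by blast
  then have "open {s. 0 < grad_sq (c s)}" by (intro open_Collect_less) auto
  moreover have "0 \<in> {s. 0 < grad_sq (c s)}" using q0 by (simp add: c00)
  ultimately obtain \<epsilon> where \<epsilon>: "\<epsilon> > 0" "ball 0 \<epsilon> \<subseteq> {s. 0 < grad_sq (c s)}" using openE by blast
  then have qpos: "grad_sq (c s) > 0" if "\<bar>s\<bar> < \<epsilon>" for s using that by (auto simp: dist_real_def subset_iff)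
  define G where "G s = ln (grad_sq (c s)) - \<gamma> * ln (U (c s))" for s
  define G' where "G' s = q1 s / grad_sq (c s) - \<gamma> * (u1 s / U (c s))" for s
  have dG: "(G has_real_derivative G' s) (at s)" if "\<bar>s\<bar> < \<epsilon>" for s
    unfolding G_def G'_def
    by (rule DERIV_cong[OF DERIV_diff[OF DERIV_chain2[OF DERIV_ln_divide[OF qpos[OF that]] dq]
          DERIV_cmult[OF DERIV_chain2[OF DERIV_ln_divide[OF U0] du]]]]) simp
  have mG: "G s \<le> G 0" if s: "\<bar>s\<bar> < \<epsilon>" for s
  proof -
    have G: "G s = ln (grad_sq (c s) / U (c s) powr \<gamma>)" if "\<bar>s\<bar> < \<epsilon>" for s
      using qpos[OF that] U0[of s] by (simp add: G_def ln_div ln_powr)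
    have "0 < grad_sq (c s) / U (c s) powr \<gamma>" using qpos[OF s] U0[of s] by simp
    moreover have "grad_sq (c s) / U (c s) powr \<gamma> \<le> grad_sq (c 0) / U (c 0) powr \<gamma>" using max[OF cS] by (simp add: c00)
    ultimately have "ln (grad_sq (c s) / U (c s) powr \<gamma>) \<le> ln (grad_sq (c 0) / U (c 0) powr \<gamma>)" by (intro ln_mono) auto
    then show ?thesis using G[OF s] G[of 0] \<epsilon> by simp
  qed
  define g2 where "g2 = (q2 * q - q1 0 * q1 0) / (q * q) - \<gamma> * ((u2 * U x - Ze * Ze) / (U x * U x))"
  have dG': "(G' has_real_derivative g2) (at 0)"
    unfolding G'_def[abs_def]
    by (rule DERIV_cong[OF DERIV_diff[OF DERIV_divide[OF dq1 dq] DERIV_cmult[OF DERIV_divide[OF du1 du]]]])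
       (use q0 U0[of 0] in \<open>simp_all add: c00 g2_def q_def u10\<close>)
  note t = second_derivative_test_max[OF \<epsilon>(1) dG mG dG']
  have 1: "q1 0 / q = \<gamma> * Ze / U x" using t(1) by (simp add: G'_def c00 q_def u10)
  then show "2 * (l - U x) * Ze / q = \<gamma> * Ze / U x" by (simp add: q10)
  have "g2 = q2 / q - (q1 0 / q)\<^sup>2 - \<gamma> * u2 / U x + \<gamma> * Ze\<^sup>2 / (U x)\<^sup>2"
    using q0 U0[of 0] by (simp add: g2_def q_def c00 field_simps power2_eq_square)
  then show "(2 * (l - U x)\<^sup>2 - 2 * Ze\<^sup>2 + 2 * (B x \<zeta> e \<bullet> e)) / q - (\<gamma> * Ze / U x)\<^sup>2
        - \<gamma> * (l - U x) / U x + \<gamma> * Ze\<^sup>2 / (U x)\<^sup>2 \<le> 0"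
    using t(2) unfolding 1 q2_def u2_def d3_def by simp
qed

lemma sig_sgn_has_derivative:
  assumes x: "norm x = 1"
  shows "((\<lambda>y. sig (Suc j) (A (sgn y))) has_derivative
     (\<lambda>v. op_trace (newton j (A x) o\<^sub>L B x v) + real (Suc j) * (v \<bullet> x) * sig (Suc j) (A x))) (at x)"
proof -
  have x0: "x \<noteq> 0" using x by auto
  have dn: "((\<lambda>y. norm y ^ Suc j) has_derivative (\<lambda>v. real (Suc j) * (v \<bullet> sgn x) * norm x ^ j)) (at x)"
    using has_derivative_power[OF has_derivative_norm[OF x0], of "Suc j"] by simp
  have "((\<lambda>y. norm y ^ Suc j * sig (Suc j) (A y)) has_derivative
     (\<lambda>v. op_trace (newton j (A x) o\<^sub>L B x v) + real (Suc j) * (v \<bullet> x) * sig (Suc j) (A x))) (at x)"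
    by (rule has_derivative_eq_rhs[OF has_derivative_mult[OF dn sig_has_derivative[OF dA[OF x0]]]])
       (simp add: x sgn_of_sphere fun_eq_iff)
  then show ?thesis
    by (rule has_derivative_transform_within_open[of _ _ _ _ "- {0}"]) (use x0 sig_A_sgn[of _ "Suc j"] in auto)
qed

text \<open>The left side is the time derivative of ln (q / u^\<gamma>) under u_t = F - \<eta> u.
  The second order conditions, weighted by the derivatives of \<sigma>_k in the eigenvalues, make
  the third order part negative, and the derivative of \<psi> is absorbed by the speed term.\<close>

lemma gradient_estimate_at_max:
  fixes k n :: nat
  assumes n: "n = DIM('a) - 1" and k: "1 \<le> k" "k \<le> n" and x: "x \<in> usphere"
    and pos: "\<And>v. v \<in> tangent x \<Longrightarrow> v \<noteq> 0 \<Longrightarrow> A x v \<bullet> v > 0"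
    and u: "\<And>y. y \<in> usphere \<Longrightarrow> U y > 0" and \<gamma>: "\<gamma> = 1 / (real n + 2)"
    and max: "\<And>y. y \<in> usphere \<Longrightarrow> grad_sq y / U y powr \<gamma> \<le> grad_sq x / U x powr \<gamma>"
    and big: "grad_sq x \<ge> (6 * real n + 9) * (U x)\<^sup>2" "grad_sq x \<ge> (2 * \<Lambda> / (m * \<gamma>))\<^sup>2 * (U x)\<^sup>2"
    and m: "m > 0" "m \<le> \<psi> x" and \<Lambda>: "\<Lambda> \<ge> 0" and \<alpha>: "\<alpha> > 0" and \<eta>: "\<eta> \<ge> 0"
    and d\<psi>: "((\<lambda>y. \<psi> (sgn y)) has_derivative \<psi>') (at x)" "\<And>v. \<psi>' v \<le> \<Lambda> * norm v"
    and F: "\<And>y. y \<noteq> 0 \<Longrightarrow> F y = \<psi> (sgn y) * sig k (A (sgn y)) powr \<alpha>"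
    and dF: "(F has_derivative F') (at x)"
  shows "2 * F' (z x - U x *\<^sub>R x) / grad_sq x - 2 * \<eta> - \<gamma> * (F x - \<eta> * U x) / U x < 0"
proof -
  have x1: "norm x = 1" "x \<noteq> 0" "x \<bullet> x = 1" "sgn x = x" using x by (auto simp: dot_square_norm sgn_of_sphere)
  define \<zeta> where "\<zeta> = z x - U x *\<^sub>R x"
  define q where "q = grad_sq x"
  obtain j where j: "k = Suc j" using k by (cases k) auto
  obtain E where E: "orthonormal_basis (insert x E)" "x \<notin> E" "span E = tangent x" "\<And>e. e \<in> E \<Longrightarrow> A x e = (A x e \<bullet> e) *\<^sub>R e"
    "E \<subseteq> tangent x" "finite E" "card E = DIM('a) - 1"
    using eigenbasis[OF x] by blast
  define L where "L e = A x e \<bullet> e" for e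
  define Z where "Z e = z x \<bullet> e" for e
  define D where "D e = B x \<zeta> e \<bullet> e" for e
  define c where "c e = elem_sym j (E - {e}) L" for e
  have eE: "norm e = 1" "e \<bullet> x = 0" "e \<noteq> 0" if "e \<in> E" for e
    using E(1,5) that by (auto simp: orthonormal_basis_def tangent_def)
  have Lpos: "L e > 0" if "e \<in> E" for e unfolding L_def using pos[of e] eE[OF that] E(5) that by auto
  have cpos: "c e > 0" if "e \<in> E" for e unfolding c_def
    using E(6,7) that n k j Lpos by (intro elem_sym_pos) auto
  have U0: "U x > 0" using u[OF x] .
  have "(6 * real n + 9) * (U x)\<^sup>2 > 0" using U0 by (intro mult_pos_pos) auto
  then have q0: "q > 0" using big(1) by (simp add: q_def)
  have zx: "z x \<bullet> x = U x" using U_z[OF x1(2)] by simp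
  have \<zeta>x: "\<zeta> \<bullet> x = 0" using x1 zx by (simp add: \<zeta>_def inner_diff_left)
  have n\<zeta>: "norm \<zeta> = sqrt q"
  proof -
    have xz: "x \<bullet> z x = U x" using zx by (simp only: inner_commute)
    have "\<zeta> \<bullet> \<zeta> = q"
      by (simp add: \<zeta>_def q_def grad_sq_def inner_diff_left inner_diff_right power2_eq_square x1(3) zx xz)
    then show ?thesis by (simp add: norm_eq_sqrt_inner)
  qed
  have qZ: "q = (\<Sum>e\<in>E. (Z e)\<^sup>2)"
    using orthonormal_inner[OF E(1), of "z x" "z x"] E(2,6) zx
    by (simp add: q_def grad_sq_def Z_def power2_eq_square)
  have test: "2 * (L e - U x) * Z e / q = \<gamma> * Z e / U x"
      "(2 * (L e - U x)\<^sup>2 - 2 * (Z e)\<^sup>2 + 2 * D e) / q - (\<gamma> * Z e / U x)\<^sup>2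
        - \<gamma> * (L e - U x) / U x + \<gamma> * (Z e)\<^sup>2 / (U x)\<^sup>2 \<le> 0" if e: "e \<in> E" for e
  proof -
    have "A x e = L e *\<^sub>R e" unfolding L_def by (rule E(4)[OF e])
    note t = great_circle_test[OF x1(1) eE(1,2)[OF e] this u q0[unfolded q_def] max]
    show "2 * (L e - U x) * Z e / q = \<gamma> * Z e / U x" using t(1) by (simp add: Z_def q_def)
    show "(2 * (L e - U x)\<^sup>2 - 2 * (Z e)\<^sup>2 + 2 * D e) / q - (\<gamma> * Z e / U x)\<^sup>2
        - \<gamma> * (L e - U x) / U x + \<gamma> * (Z e)\<^sup>2 / (U x)\<^sup>2 \<le> 0" using t(2) by (simp add: Z_def q_def D_def \<zeta>_def)
  qed
  have alg: "(\<Sum>e\<in>E. c e * (2 * D e / q)) < 0"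
  proof (rule gradient_maximum_algebra[OF E(6) _ U0 \<gamma> Lpos cpos _ qZ big(1)[folded q_def] test])
    show "card E = n" using E(7) n by simp
    show "L e * c e \<le> L f * c f" if "e \<in> E" "f \<in> E" "L e \<le> L f" for e f
      unfolding c_def using elem_sym_remove_mono[OF E(6) that(1,2), of L j] Lpos that(3) by (auto intro: less_imp_le)
  qed
  define s where "s = sig k (A x)"
  have s: "s > 0"
  proof -
    have "s = elem_sym k E L" unfolding s_def L_def by (rule sigma_radii_eq(2)[OF refl x E(1-4)])
    then show ?thesis using E(6,7) n k Lpos by (simp add: elem_sym_pos)
  qed
  \<comment> \<open>In the eigenbasis the Newton tensor is diagonal with the weights
    \<open>c e\<close>; the radial vector contributes nothing, since the third derivative maps it to
    a tangent vector.\<close>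
  have tr: "op_trace (newton j (A x) o\<^sub>L B x \<zeta>) = (\<Sum>e\<in>E. c e * D e)"
  proof -
    let ?L = "\<lambda>e. A x e \<bullet> e"
    have AL: "A x e = ?L e *\<^sub>R e" if "e \<in> insert x E" for e using that E(4) A_self[OF x1(2)] by auto
    have ns: "newton j (A x) v \<bullet> w = newton j (A x) w \<bullet> v" for v w by (rule newton_sym) (rule symA[OF x1(2)])
    have "op_trace (newton j (A x) o\<^sub>L B x \<zeta>) = (\<Sum>e\<in>insert x E. newton j (A x) e \<bullet> B x \<zeta> e)"
      unfolding trace_orthonormal[OF E(1)] using ns by simp
    also have "\<dots> = newton j (A x) x \<bullet> B x \<zeta> x + (\<Sum>e\<in>E. newton j (A x) e \<bullet> B x \<zeta> e)"
      using E(2,6) by simp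
    also have "newton j (A x) x \<bullet> B x \<zeta> x = 0"
      unfolding newton_self[OF A_self[OF x1(2)]] B_self[OF x1(2)] using A_inner_self'[OF x1(2)] by simp
    also have "(\<Sum>e\<in>E. newton j (A x) e \<bullet> B x \<zeta> e) = (\<Sum>e\<in>E. c e * D e)"
    proof (rule sum.cong[OF refl])
      fix e assume e: "e \<in> E"
      have "newton j (A x) e = elem_sym j (insert x E - {e}) ?L *\<^sub>R e"
        by (rule newton_eigenvector[OF E(1) AL]) (use e in auto)
      also have "insert x E - {e} = insert x (E - {e})" using E(2) e by auto
      also have "elem_sym j (insert x (E - {e})) ?L = c e"
        unfolding c_def L_def using E(2,6) A_self[OF x1(2)] by (subst elem_sym_insert_zero) auto
      finally show "newton j (A x) e \<bullet> B x \<zeta> e = c e * D e" by (simp add: D_def inner_commute)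
    qed
    finally show ?thesis by simp
  qed
  have ds: "((\<lambda>y. sig k (A (sgn y)) powr \<alpha>) has_derivative
     (\<lambda>v. \<alpha> * s powr (\<alpha> - 1) * (op_trace (newton j (A x) o\<^sub>L B x v) + real k * (v \<bullet> x) * s))) (at x)"
  proof -
    have "((\<lambda>r. r powr \<alpha>) has_derivative (\<lambda>h. \<alpha> * s powr (\<alpha> - 1) * h)) (at (sig k (A (sgn x))))"
      using has_real_derivative_powr[OF s, of \<alpha>] by (simp add: has_field_derivative_def x1 s_def)
    from has_derivative_compose[OF sig_sgn_has_derivative[OF x1(1), of j, folded j] this]
    show ?thesis by (simp add: s_def)
  qed
  have dF2: "(F has_derivative (\<lambda>v. \<psi> x * (\<alpha> * s powr (\<alpha> - 1) * (op_trace (newton j (A x) o\<^sub>L B x v) + real k * (v \<bullet> x) * s)) + \<psi>' v * s powr \<alpha>)) (at x)"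
  proof (rule has_derivative_transform_within_open[of _ _ _ _ "- {0}"])
    show "((\<lambda>y. \<psi> (sgn y) * sig k (A (sgn y)) powr \<alpha>) has_derivative
      (\<lambda>v. \<psi> x * (\<alpha> * s powr (\<alpha> - 1) * (op_trace (newton j (A x) o\<^sub>L B x v) + real k * (v \<bullet> x) * s)) + \<psi>' v * s powr \<alpha>)) (at x)"
      using has_derivative_mult[OF d\<psi>(1) ds] by (simp add: x1 s_def)
  qed (use F x1 in auto)
  have "F' \<zeta> = \<psi> x * (\<alpha> * s powr (\<alpha> - 1)) * (\<Sum>e\<in>E. c e * D e) + \<psi>' \<zeta> * s powr \<alpha>"
    using fun_cong[OF has_derivative_unique[OF dF dF2], of \<zeta>] by (simp add: tr \<zeta>x)
  then have "2 * F' \<zeta> / q = \<psi> x * (\<alpha> * s powr (\<alpha> - 1)) * (\<Sum>e\<in>E. c e * (2 * D e / q)) + 2 * \<psi>' \<zeta> * s powr \<alpha> / q"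
    by (simp add: sum_distrib_left sum_divide_distrib add_divide_distrib distrib_left mult_ac)
  also have "\<dots> < 2 * \<psi>' \<zeta> * s powr \<alpha> / q"
    using alg m \<alpha> s by (simp add: mult_pos_neg)
  also have "\<dots> \<le> \<gamma> * F x / U x"
  proof -
    have g: "\<gamma> > 0" using \<gamma> by simp
    \<comment> \<open>The second part of \<open>big\<close> makes sqrt q so large that the
      contribution 2 \<Lambda> sqrt q / q of the gradient of \<psi> is at most \<gamma> \<psi> /
      u.\<close>
    have "2 * \<Lambda> / (m * \<gamma>) * U x \<le> sqrt q"
      by (rule real_le_rsqrt) (use big(2) in \<open>simp only: power_mult_distrib q_def\<close>)
    then have "2 * \<Lambda> * U x \<le> sqrt q * (m * \<gamma>)" using m g by (simp add: field_simps)
    also have "\<dots> \<le> sqrt q * (\<psi> x * \<gamma>)" using m g q0 by (intro mult_left_mono mult_right_mono) auto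
    finally have a: "2 * \<Lambda> * U x * sqrt q \<le> sqrt q * (\<psi> x * \<gamma>) * sqrt q" using q0 by (intro mult_right_mono) auto
    have "2 * \<Lambda> * sqrt q * U x = 2 * \<Lambda> * U x * sqrt q" by (simp only: mult_ac)
    also note a
    also have "sqrt q * (\<psi> x * \<gamma>) * sqrt q = \<psi> x * \<gamma> * (sqrt q * sqrt q)" by (simp only: mult_ac)
    also have "sqrt q * sqrt q = q" using q0 by simp
    finally have 1: "2 * \<Lambda> * sqrt q * U x \<le> \<psi> x * \<gamma> * q" .
    have "\<psi>' \<zeta> \<le> \<Lambda> * sqrt q" using d\<psi>(2)[of \<zeta>] n\<zeta> by simp
    then have "2 * \<psi>' \<zeta> * U x \<le> 2 * (\<Lambda> * sqrt q) * U x" using U0 by (intro mult_right_mono) auto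
    then have "2 * \<psi>' \<zeta> * U x \<le> \<gamma> * \<psi> x * q" using 1 by (simp add: mult_ac)
    then have "2 * \<psi>' \<zeta> / q \<le> \<gamma> * \<psi> x / U x" using q0 U0 by (simp add: field_simps)
    then have "2 * \<psi>' \<zeta> / q * s powr \<alpha> \<le> \<gamma> * \<psi> x / U x * s powr \<alpha>" by (rule mult_right_mono) simp
    then show ?thesis using F[OF x1(2)] by (simp add: x1 s_def mult_ac)
  qed
  finally have "2 * F' \<zeta> / q < \<gamma> * F x / U x" .
  moreover have "\<gamma> * (F x - \<eta> * U x) / U x = \<gamma> * F x / U x - \<gamma> * \<eta>" using U0 by (simp add: field_simps)
  \<comment> \<open>The normalisation contributes (\<gamma> - 2) \<eta>, which has the favourable
    sign.\<close>
  moreover have "\<gamma> * \<eta> \<le> 2 * \<eta>" using \<gamma> \<eta> by (intro mult_right_mono) (auto simp: divide_le_eq)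
  ultimately show ?thesis unfolding \<zeta>_def q_def by linarith
qed

end

text \<open>Young's inequality; the left side is the tangent of x^(1+a) at \<open>s\<close>.
  Integrating it amounts to Jensen's inequality with a slope chosen in advance.\<close>

lemma powr_ge_tangent:
  fixes x s a :: real
  assumes x: "x > 0" and s: "s > 0" and a: "a > 0"
  shows "(1 + a) * s powr a * x - a * s powr (1 + a) \<le> x powr (1 + a)"
proof -
  have "(x powr (1 + a)) powr (1 / (1 + a)) * (s powr (1 + a)) powr (a / (1 + a)) \<le> 1 / (1 + a) * x powr (1 + a) + a / (1 + a) * s powr (1 + a)"
    using x s a by (intro Youngs_inequality_0) (auto simp: field_simps)
  then have "x * s powr a \<le> (x powr (1 + a) + a * s powr (1 + a)) / (1 + a)"
    using x s a by (simp add: powr_powr add_divide_distrib)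
  then have "x * s powr a * (1 + a) \<le> x powr (1 + a) + a * s powr (1 + a)"
    using a by (simp add: le_divide_eq)
  then show ?thesis by (simp add: algebra_simps)
qed

section \<open>Convex bodies: maximum of the support function, inradius and normalising
  factor\<close>

locale definite_C3 = homogeneous_C3 +
  assumes support: "\<And>x y. x \<noteq> 0 \<Longrightarrow> y \<noteq> 0 \<Longrightarrow> z y \<bullet> x \<le> U x"
    and definite: "\<And>x v. x \<in> usphere \<Longrightarrow> v \<in> tangent x \<Longrightarrow> v \<noteq> 0 \<Longrightarrow> A x v \<bullet> v > 0"
begin

lemma positive_eigenbasis:
  assumes x: "x \<in> usphere"
  obtains E where "finite E" "card E = DIM('a) - 1" "orthonormal_basis (insert x E)" "E \<subseteq> tangent x"
    "sig k (A x) = elem_sym k E (\<lambda>e. A x e \<bullet> e)" "\<And>e. e \<in> E \<Longrightarrow> A x e \<bullet> e > 0"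
proof -
  obtain E where E: "orthonormal_basis (insert x E)" "x \<notin> E" "span E = tangent x" "\<And>e. e \<in> E \<Longrightarrow> A x e = (A x e \<bullet> e) *\<^sub>R e"
    "E \<subseteq> tangent x" "finite E" "card E = DIM('a) - 1"
    using eigenbasis[OF x] by blast
  have pos: "A x e \<bullet> e > 0" if "e \<in> E" for e
  proof (rule definite[OF x])
    have "norm e = 1" using E(1) that by (simp add: orthonormal_basis_def)
    then show "e \<noteq> 0" by auto
    show "e \<in> tangent x" using E(5) that by blast
  qed
  have "sig k (A x) = elem_sym k E (\<lambda>e. A x e \<bullet> e)" by (rule sigma_radii_eq(2)[OF refl x E(1-4)])
  then show ?thesis using that E pos by blast
qed

lemma sig_pos:
  assumes x: "x \<in> usphere" and k: "k \<le> DIM('a) - 1" shows "sig k (A x) > 0"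
proof -
  obtain E where E: "finite E" "card E = DIM('a) - 1" "orthonormal_basis (insert x E)" "E \<subseteq> tangent x"
    and sg: "sig k (A x) = elem_sym k E (\<lambda>e. A x e \<bullet> e)" and pos: "\<And>e. e \<in> E \<Longrightarrow> A x e \<bullet> e > 0"
    using positive_eigenbasis[OF x, of k] by blast
  show ?thesis unfolding sg using E k pos by (intro elem_sym_pos) auto
qed

lemma sig_nonneg:
  assumes x: "x \<in> usphere" shows "sig k (A x) \<ge> 0"
proof -
  obtain E where E: "finite E" "card E = DIM('a) - 1" "orthonormal_basis (insert x E)" "E \<subseteq> tangent x"
    and sg: "sig k (A x) = elem_sym k E (\<lambda>e. A x e \<bullet> e)" and pos: "\<And>e. e \<in> E \<Longrightarrow> A x e \<bullet> e > 0"
    using positive_eigenbasis[OF x, of k] by blast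
  show ?thesis unfolding sg by (intro elem_sym_nonneg less_imp_le pos)
qed

text \<open>At a maximum of \<open>u\<close> the spherical Hessian is nonpositive, so every
  principal radius is at most \<open>u\<close>.\<close>

lemma sig_le_at_max:
  assumes x: "x \<in> usphere" and max: "\<And>y. y \<in> usphere \<Longrightarrow> U y \<le> U x"
  shows "sig k (A x) \<le> real ((DIM('a) - 1) choose k) * U x ^ k"
proof -
  have x1: "norm x = 1" "x \<noteq> 0" "x \<bullet> x = 1" using x by (auto simp: dot_square_norm)
  obtain E where E: "finite E" "card E = DIM('a) - 1" "orthonormal_basis (insert x E)" "E \<subseteq> tangent x"
    and sg: "sig k (A x) = elem_sym k E (\<lambda>e. A x e \<bullet> e)" and pos: "\<And>e. e \<in> E \<Longrightarrow> A x e \<bullet> e > 0"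
    using positive_eigenbasis[OF x, of k] by blast
  have U0: "U x \<ge> 0"
  proof -
    have "U (- x) \<le> U x" by (rule max) (use x in simp)
    moreover have "- U x \<le> U (- x)" using support[of "- x" x] U_z[OF x1(2)] x1 by simp
    ultimately show ?thesis by linarith
  qed
  have le: "A x e \<bullet> e \<le> U x" if e: "e \<in> E" for e
  proof -
    have ee: "norm e = 1" "e \<bullet> x = 0" "e \<bullet> e = 1" "x \<bullet> e = 0"
      using E(3,4) e by (auto simp: orthonormal_basis_def tangent_def dot_square_norm inner_commute)
    define c where "c t = x + t *\<^sub>R e" for t
    have cc: "c t \<bullet> c t = 1 + t * t" for t by (simp add: c_def inner_add_left inner_add_right x1 ee)
    have c0: "c t \<noteq> 0" for t
    proof
      assume "c t = 0"
      then have "1 + t * t = 0" using cc[of t] by simp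
      then show False using zero_le_square[of t] by linarith
    qed
    have dc: "(c has_derivative (\<lambda>h. h *\<^sub>R e)) (at t)" for t
      unfolding c_def by (auto intro!: derivative_eq_intros)
    have dU: "((\<lambda>t. U (c t)) has_real_derivative z (c t) \<bullet> e) (at t)" for t
      using has_derivative_compose[OF dc dU[OF c0]] by (simp add: has_field_derivative_def mult_commute_abs)
    have "((\<lambda>t. z (c t)) has_derivative (\<lambda>h. A (c 0) (h *\<^sub>R e))) (at 0)"
      using has_derivative_compose[OF dc dz[OF c0]] by simp
    from has_derivative_inner_left[OF this, of e]
    have dz': "((\<lambda>t. z (c t) \<bullet> e) has_real_derivative A x e \<bullet> e) (at 0)"
      by (simp add: has_field_derivative_def mult_commute_abs blinfun.scaleR_right c_def)
    \<comment> \<open>The line x + t e replaces the great circle: homogeneity bounds U (c t) by U x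
      |c t|, and sqrt (1 + t^2) \<le> 1 + t^2 / 2 gives a comparison function with second derivative
      \<open>U x\<close>.\<close>
    define G where "G t = U (c t) - U x * (1 + t * t / 2)" for t
    have mG: "G t \<le> G 0" for t
    proof -
      have "U (c t) = U (sgn (c t)) * norm (c t)" using U_sgn_norm[OF c0] c0 by simp
      also have "\<dots> \<le> U x * norm (c t)" using max[OF sgn_sphere[OF c0]] by (intro mult_right_mono) auto
      also have "\<dots> \<le> U x * (1 + t * t / 2)"
      proof (rule mult_left_mono[OF _ U0])
        have "norm (c t) \<le> sqrt ((1 + t * t / 2)\<^sup>2)"
          unfolding norm_eq_sqrt_inner cc by (rule real_sqrt_le_mono) (use zero_le_square[of "t * t"] in \<open>simp add: power2_eq_square algebra_simps\<close>)
        moreover have "1 + t * t / 2 \<ge> 0" using zero_le_square[of t] by linarith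
        ultimately show "norm (c t) \<le> 1 + t * t / 2" by simp
      qed
      finally show ?thesis by (simp add: G_def c_def)
    qed
    have dG: "(G has_real_derivative (z (c t) \<bullet> e - U x * t)) (at t)" for t
    proof -
      have "((\<lambda>t::real. 1 + t * t / 2) has_real_derivative t) (at t)" by (auto intro!: derivative_eq_intros)
      from DERIV_diff[OF dU DERIV_cmult[OF this]] show ?thesis unfolding G_def .
    qed
    have dG': "((\<lambda>t. z (c t) \<bullet> e - U x * t) has_real_derivative (A x e \<bullet> e - U x)) (at 0)"
      by (rule DERIV_diff[OF dz' DERIV_cmult_Id])
    have "A x e \<bullet> e - U x \<le> 0"
      by (rule second_derivative_test_max(2)[OF zero_less_one dG mG dG'])
    then show ?thesis by simp
  qed
  have "sig k (A x) \<le> elem_sym k E (\<lambda>_. U x)"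
    unfolding sg by (intro elem_sym_mono less_imp_le pos le)
  then show ?thesis using elem_sym_const[OF E(1)] E(2) by simp
qed

text \<open>Criticality on the sphere kills the tangential part of z - p, so only a multiple of
  \<open>x\<close> is left.\<close>

lemma critical_point_translate:
  assumes x: "x \<in> usphere" and min: "\<And>y. y \<in> usphere \<Longrightarrow> U x - p \<bullet> x \<le> U y - p \<bullet> y"
  shows "z x = p + (U x - p \<bullet> x) *\<^sub>R x"
proof -
  have x1: "norm x = 1" "x \<noteq> 0" "x \<bullet> x = 1" "sgn x = x" using x by (auto simp: dot_square_norm sgn_of_sphere)
  have "((\<lambda>y. U (sgn y) - p \<bullet> sgn y) has_derivative (\<lambda>v. z x \<bullet> (v - (v \<bullet> x) *\<^sub>R x) - p \<bullet> (v - (v \<bullet> x) *\<^sub>R x))) (at x)"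
    using has_derivative_diff[OF has_derivative_compose[OF sgn_has_derivative[OF x1(2)], of U "(\<bullet>) (z x)"]
        has_derivative_inner_right[OF sgn_has_derivative[OF x1(2)], of p]] dU[OF x1(2)] by (simp add: x1)
  then have "(\<lambda>v. z x \<bullet> (v - (v \<bullet> x) *\<^sub>R x) - p \<bullet> (v - (v \<bullet> x) *\<^sub>R x)) = (\<lambda>v. 0)"
  proof (rule differential_zero_maxmin[rotated 2])
    show "(\<forall>y\<in>-{0}. U (sgn y) - p \<bullet> sgn y \<le> U (sgn x) - p \<bullet> sgn x) \<or> (\<forall>y\<in>-{0}. U (sgn x) - p \<bullet> sgn x \<le> U (sgn y) - p \<bullet> sgn y)"
      using min[OF sgn_sphere] by (simp add: x1)
  qed (use x1 in auto)
  from fun_cong[OF this]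
  have z0: "(z x - p) \<bullet> (v - (v \<bullet> x) *\<^sub>R x) = 0" for v by (simp add: inner_diff_left)
  define w where "w = z x - p - ((z x - p) \<bullet> x) *\<^sub>R x"
  have wx: "w \<bullet> x = 0" by (simp add: w_def inner_diff_left x1(3))
  have "w \<bullet> w = (z x - p) \<bullet> w - ((z x - p) \<bullet> x) * (x \<bullet> w)"
    by (simp only: w_def inner_diff_left inner_scaleR_left)
  also have "\<dots> = (z x - p) \<bullet> (w - (w \<bullet> x) *\<^sub>R x)" using wx by (simp add: inner_commute)
  also have "\<dots> = 0" by (rule z0)
  finally have "w = 0" by simp
  moreover have "(z x - p) \<bullet> x = U x - p \<bullet> x" using U_z[OF x1(2)] by (simp add: inner_diff_left)
  ultimately show ?thesis by (simp add: w_def algebra_simps)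
qed

text \<open>If \<open>|\<nabla>u|\<^sup>2 \<le> b R\<^sup>2\<^sup>-\<^sup>\<gamma> u\<^sup>\<gamma>\<close>, where \<open>R = U x0\<close> is the maximum, then the body with support function \<open>U\<close>, which
  contains the segment from \<open>0\<close> to \<open>R x0\<close>, also contains a ball of radius comparable to \<open>R\<close> centred at its midpoint.\<close>

lemma inradius_ge:
  assumes x0: "x0 \<in> usphere" and max: "\<And>y. y \<in> usphere \<Longrightarrow> U y \<le> U x0"
    and u: "\<And>y. y \<in> usphere \<Longrightarrow> U y > 0" and \<gamma>: "\<gamma> > 0" and b: "b > 0"
    and g: "\<And>y. y \<in> usphere \<Longrightarrow> grad_sq y / U y powr \<gamma> \<le> b * U x0 powr (2 - \<gamma>)"
    and y: "y \<in> usphere"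
  shows "min (1/4) ((3 / (16 * b)) powr (1 / \<gamma>) / 2) * U x0 \<le> U y - ((U x0 / 2) *\<^sub>R x0) \<bullet> y"
proof -
  define R where "R = U x0"
  have R: "R > 0" using u[OF x0] by (simp add: R_def)
  have x01: "norm x0 = 1" "x0 \<noteq> 0" "x0 \<bullet> x0 = 1" using x0 by (auto simp: dot_square_norm)
  \<comment> \<open>The maximum R of the support function bounds the norm of this point, and its
    component along \<open>x0\<close> is R; equality in Cauchy-Schwarz puts it at R x0.\<close>
  have zx0: "z x0 = R *\<^sub>R x0"
  proof (cases "z x0 = 0")
    case True
    then show ?thesis using U_z[OF x01(2)] R by (simp add: R_def)
  next
    case False
    have "norm (z x0) = z x0 \<bullet> sgn (z x0)" using False by (simp add: sgn_div_norm dot_square_norm power2_eq_square)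
    also have "\<dots> \<le> U (sgn (z x0))" by (rule support) (use False x01 in \<open>auto simp: sgn_zero_iff\<close>)
    also have "\<dots> \<le> R" unfolding R_def by (rule max[OF sgn_sphere[OF False]])
    finally have n: "norm (z x0) \<le> R" .
    have "(z x0 - R *\<^sub>R x0) \<bullet> (z x0 - R *\<^sub>R x0) = (norm (z x0))\<^sup>2 - R * R"
      using U_z[OF x01(2)] x01(3)
      by (simp add: inner_diff_left inner_diff_right R_def[symmetric] dot_square_norm[symmetric] inner_commute[of x0 "z x0"])
    also have "\<dots> \<le> 0" using n power_mono[OF n, of 2] by (simp add: power2_eq_square)
    finally have "(z x0 - R *\<^sub>R x0) \<bullet> (z x0 - R *\<^sub>R x0) \<le> 0" .
    then show ?thesis by (metis eq_iff_diff_eq_0 inner_gt_zero_iff not_le)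
  qed
  define p where "p = (R / 2) *\<^sub>R x0"
  have "continuous_on usphere (\<lambda>y. U y - p \<bullet> y)" by (intro continuous_intros continuous_U)
  then obtain x1 where x1: "x1 \<in> usphere" "\<And>y. y \<in> usphere \<Longrightarrow> U x1 - p \<bullet> x1 \<le> U y - p \<bullet> y"
    using continuous_attains_inf[of usphere "\<lambda>y. U y - p \<bullet> y"] x0 by auto
  have n1: "x1 \<bullet> x1 = 1" "x1 \<noteq> 0" using x1(1) by (auto simp: dot_square_norm)
  \<comment> \<open>The distance from the midpoint to the nearest supporting hyperplane, with normal
    \<open>x1\<close>.\<close>
  define m1 where "m1 = U x1 - p \<bullet> x1"
  define c where "c = x0 \<bullet> x1"
  have z1: "z x1 = p + m1 *\<^sub>R x1" unfolding m1_def by (rule critical_point_translate[OF x1])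
  have U1: "U x1 = R / 2 * c + m1" by (simp add: m1_def p_def c_def)
  have pp: "p \<bullet> p = R * R / 4" "p \<bullet> x1 = R / 2 * c" "x1 \<bullet> p = R / 2 * c"
    by (simp_all add: p_def x01(3) c_def inner_commute)
  have gs: "grad_sq x1 = R * R / 4 * (1 - c * c)"
    unfolding grad_sq_def z1 U1
    by (simp add: inner_add_left inner_add_right pp n1(1) power2_eq_square algebra_simps)
  have Uc: "U x1 \<ge> R * c" using support[OF n1(2) x01(2)] by (simp add: zx0 c_def)
  have U0: "U x1 > 0" using u[OF x1(1)] .
  have m1a: "m1 \<ge> R / 2 * c" using Uc U1 by simp
  have m1b: "m1 \<ge> - (R / 2 * c)" using U0 U1 by simp
  define \<kappa> where "\<kappa> = (3 / (16 * b)) powr (1 / \<gamma>)"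
  \<comment> \<open>If \<open>x1\<close> is within 60 degrees of the line of the segment, one of its
    ends lies at least R/4 beyond the midpoint in direction \<open>x1\<close>. Otherwise q at
    \<open>x1\<close> is at least 3 R^2 / 16, the gradient bound gives u \<ge> \<kappa> R there, and
    u \<le> 2 m1.\<close>
  have "min (1/4) (\<kappa> / 2) * R \<le> m1"
  proof (cases "\<bar>c\<bar> \<ge> 1/2")
    case True
    have "R / 2 * \<bar>c\<bar> \<le> m1" using m1a m1b by (simp add: abs_if)
    moreover have "R / 2 * (1/2) \<le> R / 2 * \<bar>c\<bar>" using R True by (intro mult_left_mono) auto
    moreover have "min (1/4) (\<kappa> / 2) * R \<le> 1/4 * R" using R by (intro mult_right_mono) auto
    ultimately show ?thesis by simp
  next
    case False
    then have "\<bar>c\<bar> * \<bar>c\<bar> \<le> 1/2 * (1/2)" by (intro mult_mono) auto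
    then have "c * c \<le> 1/4" by (simp add: abs_mult_self_eq)
    then have "R * R / 4 * (3/4) \<le> grad_sq x1" unfolding gs using R by (intro mult_left_mono) auto
    also have "grad_sq x1 \<le> b * R powr (2 - \<gamma>) * U x1 powr \<gamma>"
      using g[OF x1(1)] U0 by (simp add: R_def divide_le_eq)
    also have "R powr (2 - \<gamma>) = R * R / R powr \<gamma>"
      using R by (simp add: powr_diff power2_eq_square powr_numeral)
    finally have "3/16 * R powr \<gamma> \<le> b * U x1 powr \<gamma>"
      using R by (simp add: field_simps)
    then have "3 / (16 * b) * R powr \<gamma> \<le> U x1 powr \<gamma>" using b by (simp add: field_simps)
    then have "(3 / (16 * b) * R powr \<gamma>) powr (1 / \<gamma>) \<le> (U x1 powr \<gamma>) powr (1 / \<gamma>)"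
      using b \<gamma> by (intro powr_mono2) auto
    also have "(3 / (16 * b) * R powr \<gamma>) powr (1 / \<gamma>) = \<kappa> * (R powr \<gamma>) powr (1 / \<gamma>)"
      unfolding \<kappa>_def by (rule powr_mult)
    also have "(R powr \<gamma>) powr (1 / \<gamma>) = R" using R \<gamma> by (simp add: powr_powr)
    also have "(U x1 powr \<gamma>) powr (1 / \<gamma>) = U x1" using U0 \<gamma> by (simp add: powr_powr)
    finally have "\<kappa> * R \<le> U x1" .
    then have "\<kappa> / 2 * R \<le> m1" using U1 m1a by simp
    moreover have "min (1/4) (\<kappa> / 2) * R \<le> \<kappa> / 2 * R" using R by (intro mult_right_mono) auto
    ultimately show ?thesis by simp
  qed
  also have "m1 \<le> U y - p \<bullet> y" unfolding m1_def by (rule x1(2)[OF y])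
  finally show ?thesis by (simp add: \<kappa>_def R_def p_def)
qed

lemma flow_eta_nonneg:
  assumes "\<And>x. x \<in> usphere \<Longrightarrow> \<psi> x > 0" shows "flow_eta k \<alpha> (\<psi> :: 'a \<Rightarrow> real) u \<ge> 0"
  unfolding flow_eta_def
proof (intro divide_nonneg_pos sphere_area_pos Bochner_Integration.integral_nonneg_AE AE_I2)
  fix x :: 'a assume "x \<in> space sphere_measure"
  then have "x \<in> usphere" by (simp add: sphere_measure_def space_scale_measure space_restrict_space)
  from assms[OF this] show "0 \<le> \<psi> x * sigma_radii k u x powr (1 + \<alpha>)" by simp
qed

lemma flow_eta_eq:
  assumes u: "\<And>y. y \<in> usphere \<Longrightarrow> u y = U y"
  shows "flow_eta k \<alpha> \<psi> u = (LINT x|sphere_measure. \<psi> x * sig k (A x) powr (1 + \<alpha>)) / sphere_area TYPE('a)"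
  unfolding flow_eta_def
proof (rule arg_cong[where f="\<lambda>r. r / _"], rule Bochner_Integration.integral_cong[OF refl])
  fix x :: 'a assume "x \<in> space sphere_measure"
  then have x: "x \<in> usphere" by (simp add: sphere_measure_def space_scale_measure space_restrict_space)
  have "sigma_radii k u x = sig k (A x)" by (rule sigma_radii_sig[OF u x])
  then show "\<psi> x * sigma_radii k u x powr (1 + \<alpha>) = \<psi> x * sig k (A x) powr (1 + \<alpha>)" by simp
qed

text \<open>Minkowski's identities about \<open>p\<close> bound the integral of \<sigma>_k below by
  \<open>s\<close> times the total mass. The tangent of x^(1+\<alpha>) at this same \<open>s\<close>
  converts this into a bound for the integral of the power without loss.\<close>

lemma flow_eta_ge:
  assumes u: "\<And>y. y \<in> usphere \<Longrightarrow> u y = U y" and k: "k \<le> DIM('a) - 1" and \<alpha>: "\<alpha> > 0"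
    and \<psi>: "continuous_on usphere \<psi>" "\<And>x. x \<in> usphere \<Longrightarrow> m \<le> \<psi> x" and m: "m > 0"
    and \<rho>: "\<rho> > 0" "\<And>y. y \<in> usphere \<Longrightarrow> \<rho> \<le> U y - p \<bullet> y"
  shows "m * bump_integral (\<lambda>_::'a. 1) / sphere_area TYPE('a) * \<rho> powr (real k * (1 + \<alpha>)) \<le> flow_eta k \<alpha> \<psi> u"
proof -
  interpret T: homogeneous_C3 "\<lambda>y. U y - p \<bullet> y" "\<lambda>y. z y - p" A B by (rule translate)
  have eta: "flow_eta k \<alpha> \<psi> u = (LINT x|sphere_measure. \<psi> x * sig k (A x) powr (1 + \<alpha>)) / sphere_area TYPE('a)"
    by (rule flow_eta_eq[OF u])
  define s where "s = real ((DIM('a) - 1) choose k) * \<rho> ^ k"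
  have ch: "real ((DIM('a) - 1) choose k) \<ge> 1" using k by (simp add: Suc_leI)
  have s: "s > 0" unfolding s_def by (intro mult_pos_pos zero_less_power \<rho>(1)) (use ch in linarith)
  let ?one = "bump_integral (\<lambda>_::'a. 1)" and ?sg = "\<lambda>x. sig k (A x)"
  have L: "s * ?one \<le> bump_integral ?sg"
    unfolding s_def by (rule T.bump_integral_sig_ge[OF \<rho>(2) less_imp_le[OF \<rho>(1)] sig_nonneg k])
  have sr: "\<rho> ^ k \<le> s" unfolding s_def using ch \<rho> by (simp add: mult_le_cancel_right1)
  have c1: "continuous_on usphere (\<lambda>x. (1 + \<alpha>) * s powr \<alpha> * ?sg x + - (\<alpha> * s powr (1 + \<alpha>)) * 1)"
    by (intro continuous_intros continuous_sig)
  have c2: "continuous_on usphere (\<lambda>x. \<psi> x * ?sg x powr (1 + \<alpha>))"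
    using sig_pos[OF _ k] by (intro continuous_intros continuous_sig \<psi>) force
  have n2: "0 \<le> \<psi> x * ?sg x powr (1 + \<alpha>)" if "x \<in> usphere" for x using \<psi>(2)[OF that] m by simp
  have "m * (s powr (1 + \<alpha>) * ?one) = m * ((1 + \<alpha>) * s powr \<alpha> * (s * ?one) + - (\<alpha> * s powr (1 + \<alpha>)) * ?one)"
    using s by (simp add: powr_add algebra_simps)
  also have "\<dots> \<le> m * ((1 + \<alpha>) * s powr \<alpha> * bump_integral ?sg + - (\<alpha> * s powr (1 + \<alpha>)) * ?one)"
    using L m \<alpha> by (intro mult_left_mono add_right_mono) auto
  also have "\<dots> = m * bump_integral (\<lambda>x. (1 + \<alpha>) * s powr \<alpha> * ?sg x + - (\<alpha> * s powr (1 + \<alpha>)) * 1)"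
    by (subst bump_integral_add) (intro continuous_intros continuous_sig, intro continuous_intros, simp only: bump_integral_cmult)
  also have "\<dots> = bump_integral (\<lambda>x. m * ((1 + \<alpha>) * s powr \<alpha> * ?sg x + - (\<alpha> * s powr (1 + \<alpha>)) * 1))"
    by (rule bump_integral_cmult[symmetric])
  also have "\<dots> \<le> bump_integral (\<lambda>x. \<psi> x * ?sg x powr (1 + \<alpha>))"
  proof (rule bump_integral_mono[OF continuous_on_mult[OF continuous_on_const c1] c2])
    fix x :: 'a assume x: "x \<in> usphere"
    have "(1 + \<alpha>) * s powr \<alpha> * ?sg x + - (\<alpha> * s powr (1 + \<alpha>)) * 1 \<le> ?sg x powr (1 + \<alpha>)"
      using powr_ge_tangent[OF sig_pos[OF x k] s \<alpha>] by simp
    then have "m * ((1 + \<alpha>) * s powr \<alpha> * ?sg x + - (\<alpha> * s powr (1 + \<alpha>)) * 1) \<le> m * ?sg x powr (1 + \<alpha>)"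
      using m by (intro mult_left_mono) auto
    also have "\<dots> \<le> \<psi> x * ?sg x powr (1 + \<alpha>)" using \<psi>(2)[OF x] by (intro mult_right_mono) auto
    finally show "m * ((1 + \<alpha>) * s powr \<alpha> * ?sg x + - (\<alpha> * s powr (1 + \<alpha>)) * 1) \<le> \<psi> x * ?sg x powr (1 + \<alpha>)" .
  qed
  also have "\<dots> \<le> (LINT x|sphere_measure. \<psi> x * ?sg x powr (1 + \<alpha>))"
    by (rule bump_integral_le_sphere[OF c2 n2])
  finally have 1: "m * (s powr (1 + \<alpha>) * ?one) \<le> (LINT x|sphere_measure. \<psi> x * ?sg x powr (1 + \<alpha>))" .
  have "\<rho> powr (real k * (1 + \<alpha>)) = (\<rho> ^ k) powr (1 + \<alpha>)" using \<rho>(1) by (simp add: powr_powr flip: powr_realpow)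
  also have "\<dots> \<le> s powr (1 + \<alpha>)" using sr \<rho>(1) \<alpha> by (intro powr_mono2) auto
  finally have "m * (\<rho> powr (real k * (1 + \<alpha>)) * ?one) \<le> m * (s powr (1 + \<alpha>) * ?one)"
    using m bump_integral_1_pos[where 'a='a] by (intro mult_left_mono mult_right_mono) auto
  then have "m * (\<rho> powr (real k * (1 + \<alpha>)) * ?one) \<le> (LINT x|sphere_measure. \<psi> x * ?sg x powr (1 + \<alpha>))"
    using 1 by linarith
  then have "m * (\<rho> powr (real k * (1 + \<alpha>)) * ?one) / sphere_area TYPE('a) \<le> flow_eta k \<alpha> \<psi> u"
    unfolding eta using sphere_area_pos[where 'a='a] by (intro divide_right_mono) auto
  then show ?thesis by (simp add: mult_ac)
qed

lemma flow_eta_le: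
  assumes u: "\<And>y. y \<in> usphere \<Longrightarrow> u y = U y" and k: "k \<le> DIM('a) - 1"
    and \<psi>: "continuous_on usphere \<psi>" "\<And>x. x \<in> usphere \<Longrightarrow> 0 \<le> \<psi> x"
    and M: "\<And>x. x \<in> usphere \<Longrightarrow> \<psi> x * sig k (A x) powr (1 + \<alpha>) \<le> M"
  shows "flow_eta k \<alpha> \<psi> u \<le> M"
proof -
  have c2: "continuous_on usphere (\<lambda>x. \<psi> x * sig k (A x) powr (1 + \<alpha>))"
    using sig_pos[OF _ k] by (intro continuous_intros continuous_sig \<psi>) force
  have n2: "0 \<le> \<psi> x * sig k (A x) powr (1 + \<alpha>)" if "x \<in> usphere" for x using \<psi>(2)[OF that] by simp
  have "(LINT x|sphere_measure. \<psi> x * sig k (A x) powr (1 + \<alpha>)) \<le> (LINT x|(sphere_measure :: 'a measure). M)"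
    by (rule sphere_integral_mono[OF c2 n2 continuous_on_const M])
  also have "\<dots> = M * sphere_area TYPE('a)" unfolding sphere_area_integral by simp
  finally have "(LINT x|sphere_measure. \<psi> x * sig k (A x) powr (1 + \<alpha>)) \<le> M * sphere_area TYPE('a)" .
  moreover have "flow_eta k \<alpha> \<psi> u = (LINT x|sphere_measure. \<psi> x * sig k (A x) powr (1 + \<alpha>)) / sphere_area TYPE('a)"
    by (rule flow_eta_eq[OF u])
  ultimately show ?thesis using sphere_area_pos[where 'a='a] by (simp add: divide_le_eq)
qed

end

section \<open>The support function of a uniformly convex hypersurface\<close>

context convex_embedding
begin

definition pos_vec :: "'a \<Rightarrow> 'a" where
  "pos_vec y = F (inv_into usphere (outward_normal F) (sgn y))"

definition hess :: "'a \<Rightarrow> 'a \<Rightarrow>\<^sub>L 'a" where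
  "hess y = blin (frechet_derivative pos_vec (at y))"

definition hess_deriv :: "'a \<Rightarrow> 'a \<Rightarrow>\<^sub>L ('a \<Rightarrow>\<^sub>L 'a)" where
  "hess_deriv y = blin (frechet_derivative hess (at y))"

text \<open>Monotonicity of the position vector makes the Hessian nonnegative. A nonnegative
  symmetric form vanishes only on its kernel, which is radial by \<open>DZ_kernel\<close>; so the
  form is positive on nonzero tangent vectors.\<close>

sublocale support: definite_C3 "support_fun (F ` usphere)" pos_vec hess hess_deriv
proof -
  interpret C: open_convex_family "\<lambda>t. F" UNIV
    by unfold_locales (auto simp: smooth_on_constant_family[OF smooth] emb dim2)
  have Z: "C.Z (y, 0) = pos_vec y" for y by (simp add: C.Z_def pos_vec_def C.gauss_inv_def)
  have o: "open (- {0::'a})" by auto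
  have Cz: "Cm_on m (- {0}) pos_vec" for m
  proof -
    have "Cm_on m (- {0}) (\<lambda>y. C.Z (y, 0))"
      by (rule Cm_on_compose[OF o C.open_dom _ _ C.Cm_Z]) (auto intro!: Cm_on_Pair Cm_on_id Cm_on_const)
    then show ?thesis by (simp add: Z del: Cm_on.simps)
  qed
  have U: "support_fun (F ` usphere) y = pos_vec y \<bullet> y" if "y \<noteq> 0" for y
    using C.support_fun_eq[of 0 y] that by (simp add: Z)
  have dU: "(support_fun (F ` usphere) has_derivative (\<lambda>v. pos_vec y \<bullet> v)) (at y)" if y: "y \<noteq> 0" for y
  proof (rule has_derivative_transform_within_open[OF _ o])
    show "((\<lambda>y. C.U (y, 0)) has_derivative (\<lambda>v. pos_vec y \<bullet> v)) (at y)"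
      using C.U_space_deriv[of 0 y] y by (simp add: Z)
    show "C.U (x, 0) = support_fun (F ` usphere) x" if "x \<in> - {0}" for x
      using that by (simp add: C.U_support)
  qed (use y in auto)
  have rad: "pos_vec (c *\<^sub>R y) = pos_vec y" if "c > 0" for c y
    using C.Z_radial[OF that, of y 0] by (simp add: Z)
  interpret h: homogeneous_C3 "support_fun (F ` usphere)" pos_vec hess hess_deriv
    unfolding hess_def[abs_def] hess_deriv_def[abs_def]
    by (rule homogeneous_C3I[OF dU Cz rad U]) auto
  show "definite_C3 (support_fun (F ` usphere)) pos_vec hess hess_deriv"
  proof
    show "pos_vec y \<bullet> x \<le> support_fun (F ` usphere) x" if xy: "x \<noteq> 0" "y \<noteq> 0" for x y
    proof -
      obtain p where "p \<in> usphere" "C.Z (y, 0) = F p" using C.Z_in[of 0 y] xy by auto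
      then show ?thesis using C.Z_max[of 0 p x] xy U[of x] by (simp add: Z)
    qed
    have nonneg: "hess x v \<bullet> v \<ge> 0" if x: "x \<noteq> 0" for x v
    proof (rule ccontr)
      assume neg: "\<not> hess x v \<bullet> v \<ge> 0"
      have "((\<lambda>s. x + s *\<^sub>R v) has_derivative (\<lambda>h. h *\<^sub>R v)) (at 0)" by (auto intro!: derivative_eq_intros)
      from has_derivative_inner_left[OF has_derivative_compose[OF this, of pos_vec "hess x"], of v] h.dz[OF x]
      have "((\<lambda>s. pos_vec (x + s *\<^sub>R v) \<bullet> v) has_real_derivative hess x v \<bullet> v) (at 0)"
        by (simp add: has_field_derivative_def mult_commute_abs blinfun.scaleR_right)
      from DERIV_neg_dec_right[OF this] neg obtain d where d: "d > 0"
        "\<And>s. 0 < s \<Longrightarrow> s < d \<Longrightarrow> pos_vec (x + s *\<^sub>R v) \<bullet> v < pos_vec x \<bullet> v" by auto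
      define b where "b = norm v + 1"
      have v1: "b > 0" "norm v < b" using norm_ge_zero[of v] unfolding b_def by linarith+
      \<comment> \<open>Small enough for the sign of the derivative to show and for x + s v to avoid
        the origin.\<close>
      define s where "s = min (d / 2) (norm x / (2 * b))"
      have s: "0 < s" "s < d" using d x v1 by (auto simp: s_def)
      have "s * norm v \<le> norm x / (2 * b) * norm v" by (intro mult_right_mono) (auto simp: s_def)
      also have "\<dots> < norm x / (2 * b) * b" using x v1 by (intro mult_strict_left_mono) auto
      also have "\<dots> = norm x / 2" using v1 by simp
      also have "\<dots> < norm x" using x by simp
      finally have sv: "norm (s *\<^sub>R v) < norm x" using s by simp
      have "x + s *\<^sub>R v \<noteq> 0"
      proof
        assume "x + s *\<^sub>R v = 0"
        then have "x = - (s *\<^sub>R v)" by (rule eq_neg_iff_add_eq_0[THEN iffD2])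
        then show False using sv by simp
      qed
      from C.Z_monotone[OF UNIV_I this x, of 0]
      have "0 \<le> (pos_vec (x + s *\<^sub>R v) - pos_vec x) \<bullet> (s *\<^sub>R v)" by (simp add: Z)
      then have "0 \<le> s * (pos_vec (x + s *\<^sub>R v) \<bullet> v - pos_vec x \<bullet> v)" by (simp add: inner_diff_left)
      then show False using d(2)[OF s] s by (simp add: zero_le_mult_iff)
    qed
    fix x v :: 'a assume x: "x \<in> usphere" and v: "v \<in> tangent x" "v \<noteq> 0"
    have x0: "x \<noteq> 0" "norm x = 1" using x by auto
    show "hess x v \<bullet> v > 0"
    proof (rule ccontr)
      assume "\<not> hess x v \<bullet> v > 0"
      then have q0: "hess x v \<bullet> v = 0" using nonneg[OF x0(1), of v] by linarith
      define w where "w = hess x v"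
      define a where "a = w \<bullet> w"
      define c where "c = hess x w \<bullet> w"
      have a0: "a \<ge> 0" and c0: "c \<ge> 0" using nonneg[OF x0(1), of w] by (auto simp: a_def c_def)
      \<comment> \<open>On v - s w the form takes the value s (s c - 2 a). The 1 keeps the
        denominator positive, and s c \<le> a makes the value negative unless w = 0.\<close>
      define s where "s = a / (c + 1)"
      have s0: "s \<ge> 0" using a0 c0 by (simp add: s_def)
      have "hess x (v - s *\<^sub>R w) \<bullet> (v - s *\<^sub>R w) = s * (s * c - 2 * a)"
      proof -
        have "w \<bullet> v = 0" using q0 by (simp only: w_def)
        moreover have "hess x w \<bullet> v = a" using h.symA[OF x0(1), of w v] by (simp only: w_def a_def)
        ultimately show ?thesis
          by (simp add: blinfun.diff_right blinfun.scaleR_right inner_diff_left inner_diff_right w_def[symmetric]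
            a_def[symmetric] c_def[symmetric] algebra_simps)
      qed
      then have sn: "0 \<le> s * (s * c - 2 * a)" using nonneg[OF x0(1), of "v - s *\<^sub>R w"] by simp
      have sc: "s * c \<le> a"
      proof -
        have "s * (c + 1) = a" using c0 by (simp add: s_def)
        then show ?thesis using s0 by (simp add: distrib_left)
      qed
      have "a \<le> 0"
      proof (rule ccontr)
        assume "\<not> a \<le> 0"
        then have "s > 0" "s * c - 2 * a < 0" using c0 sc by (auto simp: s_def)
        then have "s * (s * c - 2 * a) < 0" by (rule mult_pos_neg)
        then show False using sn by linarith
      qed
      then have "w = 0" unfolding a_def using inner_gt_zero_iff[of w] by linarith
      have xd: "(x, 0) \<in> (- {0}) \<times> (UNIV::real set)" using x0 by simp
      have "((\<lambda>y. C.Z (y, 0)) has_derivative (\<lambda>v. frechet_derivative C.Z (at (x, 0)) (v, 0))) (at x)"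
        by (rule partial_fst_has_derivative) (rule C.Z_deriv[OF xd])
      then have "(pos_vec has_derivative (\<lambda>v. frechet_derivative C.Z (at (x, 0)) (v, 0))) (at x)" by (simp add: Z)
      from fun_cong[OF has_derivative_unique[OF this h.dz[OF x0(1)]], of v]
      have "frechet_derivative C.Z (at (x, 0)) (v, 0) = 0" using \<open>w = 0\<close> by (simp add: w_def)
      from C.DZ_kernel[OF xd this] obtain r where "v = r *\<^sub>R x" by auto
      then show False using v x0 by (auto simp: tangent_def)
    qed
  qed
qed

lemma norm_sph_grad:
  assumes x: "x \<in> usphere"
  shows "(norm (sph_grad (support_fun (F ` usphere)) x))\<^sup>2 = support.grad_sq x"
proof -
  have x1: "norm x = 1" "x \<noteq> 0" "sgn x = x" "x \<bullet> x = 1" using x by (auto simp: sgn_of_sphere dot_square_norm)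
  have "sph_grad (support_fun (F ` usphere)) (sgn x) = pos_vec x - (pos_vec x \<bullet> sgn x) *\<^sub>R sgn x"
    by (rule support.sph_grad_eq[OF refl x1(2)])
  then have g: "sph_grad (support_fun (F ` usphere)) x = pos_vec x - (pos_vec x \<bullet> x) *\<^sub>R x" by (simp only: x1(3))
  have c: "x \<bullet> pos_vec x = pos_vec x \<bullet> x" by (rule inner_commute)
  have "(pos_vec x - (pos_vec x \<bullet> x) *\<^sub>R x) \<bullet> (pos_vec x - (pos_vec x \<bullet> x) *\<^sub>R x) = pos_vec x \<bullet> pos_vec x - (pos_vec x \<bullet> x)\<^sup>2"
    by (simp add: inner_diff_left inner_diff_right x1(4) c power2_eq_square)
  then show ?thesis unfolding g support.grad_sq_def support.U_z[OF x1(2)]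
    by (simp add: dot_square_norm)
qed

lemma continuous_pos_vec: "continuous_on usphere pos_vec"
  using Cm_on_continuous[OF support.Cm_z] by (rule continuous_on_subset) auto

lemma continuous_grad_sq: "continuous_on usphere support.grad_sq"
  unfolding support.grad_sq_def[abs_def] by (intro continuous_intros continuous_pos_vec support.continuous_U)

lemma support_pos:
  assumes "0 \<in> interior (convex hull (F ` usphere))" and x: "x \<in> usphere"
  shows "support_fun (F ` usphere) x > 0"
proof -
  obtain e where e: "e > 0" "cball 0 e \<subseteq> convex hull (F ` usphere)"
    using assms(1) by (meson mem_interior_cball)
  have x1: "norm x = 1" "x \<noteq> 0" using x by auto
  have "F p \<bullet> x \<le> support_fun (F ` usphere) x" if "p \<in> usphere" for p
  proof -
    have p: "norm (outward_normal F p) = 1" using norm_outward_normal[OF that] .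
    have "inv_into usphere (outward_normal F) (outward_normal F p) = p"
      using outward_normal_bij that by (simp add: bij_betw_def)
    then have "pos_vec (outward_normal F p) = F p" using p by (simp add: pos_vec_def sgn_of_sphere)
    then show ?thesis using support.support[of x "outward_normal F p"] x1 p by force
  qed
  then have "convex hull (F ` usphere) \<subseteq> {y. x \<bullet> y \<le> support_fun (F ` usphere) x}"
    by (intro hull_minimal convex_halfspace_le) (force simp: inner_commute)
  moreover have "e *\<^sub>R x \<in> cball 0 e" using e x1 by simp
  ultimately have "x \<bullet> (e *\<^sub>R x) \<le> support_fun (F ` usphere) x" using e(2) by blast
  then show ?thesis using e x1 by (simp add: dot_square_norm)
qed

end

section \<open>The flow of the support function\<close>

lemma smooth_on_subset:
  assumes f: "smooth_on S f" and sub: "S' \<subseteq> S"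
  shows "smooth_on S' f"
  unfolding smooth_on_def
proof
  fix x assume "x \<in> S'"
  then have "x \<in> S" using sub by (rule subsetD[rotated])
  with f obtain U g where U: "open U" "x \<in> U" "\<forall>m. Cm_on m U g" "\<forall>y\<in>S \<inter> U. g y = f y"
    unfolding smooth_on_def by (auto simp del: Cm_on.simps)
  have "\<forall>y\<in>S' \<inter> U. g y = f y" using U(4) sub by auto
  then show "\<exists>U g. open U \<and> x \<in> U \<and> (\<forall>m. Cm_on m U g) \<and> (\<forall>y\<in>S' \<inter> U. g y = f y)"
    using U(1-3) by (intro exI conjI)
qed

text \<open>\<psi> is controlled through \<open>m\<close> and \<Lambda>, where \<Lambda> bounds the
  function and its derivative alike; this keeps the constants of the estimate independent of \<psi>
  itself.\<close>

locale flow_solution =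
  fixes k n :: nat and \<alpha> m \<Lambda> :: real and \<psi> :: "'a::euclidean_space \<Rightarrow> real" and T :: ereal and X :: "real \<Rightarrow> 'a \<Rightarrow> 'a"
  assumes dim: "DIM('a) = n + 1" and k: "1 \<le> k" "k \<le> n" and \<alpha>: "\<alpha> > 0"
    and \<psi>_cont: "continuous_on usphere \<psi>" and m: "m > 0" and \<psi>_ge: "\<And>x. x \<in> usphere \<Longrightarrow> m \<le> \<psi> x"
    and \<psi>_le: "\<And>x. x \<in> usphere \<Longrightarrow> \<psi> x \<le> \<Lambda>"
    and \<psi>_deriv: "\<And>x. x \<in> usphere \<Longrightarrow> ((\<lambda>y. \<psi> (sgn y)) has_derivative sph_deriv \<psi> x) (at x)"
    and \<psi>_deriv_le: "\<And>x v. x \<in> usphere \<Longrightarrow> sph_deriv \<psi> x v \<le> \<Lambda> * norm v"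
    and flow: "normalised_flow k \<alpha> \<psi> T X"
begin

abbreviation "I \<equiv> time_interval T"
text \<open>At positive times the derivative in the flow equation is two-sided; the initial time is
  reached by continuity.\<close>

definition Io :: "real set" where "Io = {t. 0 < t \<and> ereal t < T}"

lemma Io_sub: "Io \<subseteq> I" by (auto simp: Io_def time_interval_def)

lemma open_Io: "open Io"
proof -
  have "Io = {0<..} \<inter> {t. ereal t < T}" by (auto simp: Io_def)
  moreover have "open {t. ereal t < T}" by (intro open_Collect_less continuous_intros)
  ultimately show ?thesis by (metis open_Int open_greaterThan)
qed

lemma flow_smooth: "smooth_on (usphere \<times> I) (\<lambda>(p, t). X t p)"
  and flow_convex: "\<And>t. t \<in> I \<Longrightarrow> uniformly_convex_embedding (X t)"
  using flow unfolding normalised_flow_def by blast+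

sublocale fam: convex_family X I
  by unfold_locales (use flow_smooth flow_convex dim k in auto)

sublocale op: open_convex_family X Io
proof unfold_locales
  show "smooth_on (usphere \<times> Io) (\<lambda>(p, t). X t p)"
    by (rule smooth_on_subset[OF flow_smooth]) (use Io_sub in auto)
qed (use flow_convex Io_sub open_Io dim k in auto)

lemma emb: "t \<in> I \<Longrightarrow> convex_embedding (X t)"
  by (rule fam.embedding)

definition u :: "real \<Rightarrow> 'a \<Rightarrow> real" where "u t = support_fun (X t ` usphere)"
definition z :: "real \<Rightarrow> 'a \<Rightarrow> 'a" where "z t = convex_embedding.pos_vec (X t)"
definition A :: "real \<Rightarrow> 'a \<Rightarrow> 'a \<Rightarrow>\<^sub>L 'a" where "A t = convex_embedding.hess (X t)"
definition q :: "real \<Rightarrow> 'a \<Rightarrow> real" where "q t = homogeneous_C3.grad_sq (u t) (z t)"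
definition eta :: "real \<Rightarrow> real" where "eta t = flow_eta k \<alpha> \<psi> (u t)"
text \<open>Constant along rays, so that its Euclidean derivative at a point of the sphere has no
  radial part.\<close>

definition speed :: "real \<Rightarrow> 'a \<Rightarrow> real" where "speed t y = \<psi> (sgn y) * sig k (A t (sgn y)) powr \<alpha>"

lemma definite:
  assumes t: "t \<in> I"
  shows "definite_C3 (u t) (z t) (A t) (convex_embedding.hess_deriv (X t))"
proof -
  interpret convex_embedding "X t" by (rule emb[OF t])
  show ?thesis unfolding u_def z_def A_def by (rule support.definite_C3_axioms)
qed

lemma Z_eq: "fam.Z (y, t) = z t y" "t \<in> I \<Longrightarrow> op.Z (y, t) = z t y"
  if "t \<in> I" for y t
proof -
  interpret convex_embedding "X t" by (rule emb[OF that])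
  show "fam.Z (y, t) = z t y" by (simp add: fam.Z_def fam.gauss_inv_def z_def pos_vec_def)
  show "op.Z (y, t) = z t y" by (simp add: op.Z_def op.gauss_inv_def z_def pos_vec_def)
qed

lemma u_z: "t \<in> I \<Longrightarrow> y \<noteq> 0 \<Longrightarrow> u t y = z t y \<bullet> y"
  using fam.support_fun_eq Z_eq by (simp add: u_def)

lemma q_eq: "t \<in> I \<Longrightarrow> q t y = z t y \<bullet> z t y - (u t y)\<^sup>2"
proof -
  assume t: "t \<in> I"
  interpret definite_C3 "u t" "z t" "A t" "convex_embedding.hess_deriv (X t)" by (rule definite[OF t])
  show ?thesis by (simp add: q_def grad_sq_def)
qed

lemma z_continuous: "continuous_on (usphere \<times> I) (\<lambda>w. z (snd w) (fst w))"
proof -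
  have "continuous_on (usphere \<times> I) fam.Z"
    by (rule continuous_on_subset[OF fam.Z_continuous]) auto
  then show ?thesis by (rule continuous_on_eq) (auto simp: Z_eq)
qed

lemma u_continuous: "continuous_on (usphere \<times> I) (\<lambda>w. u (snd w) (fst w))"
proof -
  have "continuous_on (usphere \<times> I) (\<lambda>w. z (snd w) (fst w) \<bullet> fst w)"
    by (intro continuous_intros z_continuous)
  moreover have "z (snd w) (fst w) \<bullet> fst w = u (snd w) (fst w)" if "w \<in> usphere \<times> I" for w
  proof (rule u_z[symmetric])
    show "snd w \<in> I" "fst w \<noteq> 0" using that by auto
  qed
  ultimately show ?thesis by (rule continuous_on_eq)
qed

lemma q_continuous: "continuous_on (usphere \<times> I) (\<lambda>w. q (snd w) (fst w))"
proof -
  have "continuous_on (usphere \<times> I) (\<lambda>w. z (snd w) (fst w) \<bullet> z (snd w) (fst w) - (u (snd w) (fst w))\<^sup>2)"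
    by (intro continuous_intros z_continuous u_continuous)
  then show ?thesis by (rule continuous_on_eq) (auto simp: q_eq)
qed

lemma \<psi>_pos: "x \<in> usphere \<Longrightarrow> \<psi> x > 0" using \<psi>_ge m by force

lemma eta_nonneg: "t \<in> I \<Longrightarrow> eta t \<ge> 0"
proof -
  assume t: "t \<in> I"
  interpret definite_C3 "u t" "z t" "A t" "convex_embedding.hess_deriv (X t)" by (rule definite[OF t])
  show ?thesis unfolding eta_def by (rule flow_eta_nonneg[OF \<psi>_pos])
qed

lemma speed_nonneg: "y \<noteq> 0 \<Longrightarrow> speed t y \<ge> 0"
  using \<psi>_pos[OF sgn_sphere] by (simp add: speed_def less_imp_le)

text \<open>The flow equation is tested at the parameter point with normal \<open>sgn y\<close>. The
  factor |y| appears because \<open>u\<close> has degree one and \<open>speed\<close> degree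
  zero.\<close>

lemma u_time_derivative:
  assumes t: "t \<in> Io" and y: "y \<noteq> 0"
  shows "((\<lambda>s. u s y) has_real_derivative (norm y * speed t y - eta t * u t y)) (at t)"
    and "((\<lambda>s. op.U (y, s)) has_real_derivative (norm y * speed t y - eta t * u t y)) (at t)"
proof -
  have tI: "t \<in> I" using t Io_sub by blast
  interpret definite_C3 "u t" "z t" "A t" "convex_embedding.hess_deriv (X t)" by (rule definite[OF tI])
  have s: "sgn y \<in> usphere" using y by (rule sgn_sphere)
  define p where "p = op.gauss_inv t (sgn y)"
  have p: "p \<in> usphere" "outward_normal (X t) p = sgn y"
    unfolding p_def by (rule op.gauss_inv_sphere[OF t s], rule op.normal_gauss_inv[OF t s])
  have Xp: "X t p = z t y" using Z_eq(2)[OF tI tI, of y] by (simp add: op.Z_def p_def)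
  define V where "V = (\<psi> (sgn y) * sigma_radii k (u t) (sgn y) powr \<alpha>) *\<^sub>R sgn y - eta t *\<^sub>R X t p"
  have "((\<lambda>s. X s p) has_vector_derivative V) (at t within I)"
    using flow tI p unfolding normalised_flow_def Let_def V_def u_def eta_def by metis
  then have "((\<lambda>s. X s p) has_vector_derivative V) (at t within Io)"
    by (rule has_vector_derivative_within_subset[OF _ Io_sub])
  then have "((\<lambda>s. X s p) has_vector_derivative V) (at t)"
    using at_within_open[OF t open_Io] by simp
  from op.U_time_deriv[OF t y this[unfolded p_def]]
  have d: "((\<lambda>s. op.U (y, s)) has_real_derivative V \<bullet> y) (at t)" .
  have "sigma_radii k (u t) (sgn y) = sig k (A t (sgn y))" by (rule sigma_radii_sig[OF refl s])
  moreover have "sgn y \<bullet> y = norm y" using y by (simp add: sgn_div_norm dot_square_norm power2_eq_square)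
  ultimately have V: "V \<bullet> y = norm y * speed t y - eta t * u t y"
    using u_z[OF tI y] by (simp add: V_def inner_diff_left speed_def Xp)
  show d': "((\<lambda>s. op.U (y, s)) has_real_derivative (norm y * speed t y - eta t * u t y)) (at t)"
    using d V by simp
  show "((\<lambda>s. u s y) has_real_derivative (norm y * speed t y - eta t * u t y)) (at t)"
    by (rule has_field_derivative_transform_within_open[OF d' open_Io t]) (simp add: op.U_support[OF _ y] u_def)
qed

text \<open>The gradient of the speed is the time derivative of the position vector: mixed derivatives of the
  support function commute.\<close>

lemma speed_differentiable:
  assumes t: "t \<in> Io" and x: "x \<in> usphere"
  obtains F' z' where "(speed t has_derivative F') (at x)" "((\<lambda>s. z s x) has_vector_derivative z') (at t)"
    "\<And>v. z' \<bullet> v = (x \<bullet> v) * speed t x + F' v - eta t * (z t x \<bullet> v)"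
proof -
  have tI: "t \<in> I" using t Io_sub by blast
  interpret definite_C3 "u t" "z t" "A t" "convex_embedding.hess_deriv (X t)" by (rule definite[OF tI])
  have x1: "norm x = 1" "x \<noteq> 0" "sgn x = x" "x \<bullet> x = 1" using x by (auto simp: sgn_of_sphere dot_square_norm)
  have w: "(x, t) \<in> (- {0}) \<times> Io" using x1 t by simp
  \<comment> \<open>The time derivative of the support function, smooth in space and time; the speed
    inherits its differentiability.\<close>
  define g where "g w = frechet_derivative op.U (at w) (0, 1)" for w
  have g: "g (y, t) = norm y * speed t y - eta t * u t y" if y: "y \<noteq> 0" for y
  proof -
    have wy: "(y, t) \<in> (- {0}) \<times> Io" using y t by simp
    have "((\<lambda>s. op.U (y, s)) has_derivative (\<lambda>s. frechet_derivative op.U (at (y, t)) (0, s))) (at t)"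
      by (rule partial_snd_has_derivative[OF Cm_on_has_derivative[OF op.Cm_U wy]])
    moreover have "((\<lambda>s. op.U (y, s)) has_derivative (*) (norm y * speed t y - eta t * u t y)) (at t)"
      using u_time_derivative(2)[OF t y] by (simp add: has_field_derivative_def)
    ultimately have "frechet_derivative op.U (at (y, t)) (0, 1) = (norm y * speed t y - eta t * u t y) * 1"
      by (rule fun_cong[OF has_derivative_unique])
    then show ?thesis by (simp add: g_def)
  qed
  define z' where "z' = frechet_derivative op.Z (at (x, t)) (0, 1)"
  have gz: "frechet_derivative g (at (x, t)) (v, 0) = z' \<bullet> v" for v
  proof -
    have "frechet_derivative g (at (x, t)) (v, 0) = frechet_derivative (\<lambda>w. frechet_derivative op.U (at w) (v, 0)) (at (x, t)) (0, 1)"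
      unfolding g_def by (rule frechet_derivative_symmetric[OF op.open_dom w op.Cm_U])
    also have "\<dots> = z' \<bullet> v"
    proof -
      have "((\<lambda>w. op.Z w \<bullet> v) has_derivative (\<lambda>h. frechet_derivative op.Z (at (x, t)) h \<bullet> v)) (at (x, t))"
        by (intro has_derivative_inner_left op.Z_deriv w)
      then have "((\<lambda>w. frechet_derivative op.U (at w) (v, 0)) has_derivative (\<lambda>h. frechet_derivative op.Z (at (x, t)) h \<bullet> v)) (at (x, t))"
      proof (rule has_derivative_transform_within_open[OF _ op.open_dom w])
        fix w :: "'a \<times> real" assume w: "w \<in> (- {0}) \<times> Io"
        show "op.Z w \<bullet> v = frechet_derivative op.U (at w) (v, 0)"
          using fun_cong[OF frechet_derivative_at[OF op.U_deriv[OF w]], of "(v, 0)"] by simp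
      qed
      from fun_cong[OF frechet_derivative_at[OF this], of "(0, 1)"] show ?thesis by (simp add: z'_def)
    qed
    finally show ?thesis .
  qed
  have Cg: "Cm_on (Suc 0) ((- {0}) \<times> Io) g"
    unfolding g_def by (rule Cm_on_Suc_frechet[OF op.Cm_U])
  have dg: "((\<lambda>y. g (y, t)) has_derivative (\<lambda>v. z' \<bullet> v)) (at x)"
    using partial_fst_has_derivative[OF Cm_on_has_derivative[OF Cg w]] by (simp add: gz)
  have di: "((\<lambda>y. inverse (norm y)) has_derivative (\<lambda>v. - (x \<bullet> v))) (at x)"
  proof (rule has_derivative_eq_rhs[OF Deriv.has_derivative_inverse[OF _ has_derivative_norm[OF x1(2)]]])
    show "norm x \<noteq> 0" using x1 by simp
    show "(\<lambda>h. - (inverse (norm x) * (h \<bullet> sgn x) * inverse (norm x))) = (\<lambda>v. - (x \<bullet> v))"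
      by (simp add: x1 fun_eq_iff inner_commute)
  qed
  \<comment> \<open>The evolution equation is solved for the speed, \<open>eta t\<close> being
    constant in space.\<close>
  have "((\<lambda>y. (g (y, t) + eta t * u t y) * inverse (norm y)) has_derivative
     (\<lambda>v. (g (x, t) + eta t * u t x) * (- (x \<bullet> v)) + (z' \<bullet> v + eta t * (z t x \<bullet> v)) * inverse (norm x))) (at x)"
    by (intro has_derivative_mult has_derivative_add dg has_derivative_mult_right dU x1 di)
  then have "(speed t has_derivative
     (\<lambda>v. (g (x, t) + eta t * u t x) * (- (x \<bullet> v)) + (z' \<bullet> v + eta t * (z t x \<bullet> v)) * inverse (norm x))) (at x)"
    by (rule has_derivative_transform_within_open[of _ _ _ _ "- {0}"]) (use x1 in \<open>auto simp: g field_simps\<close>)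
  moreover have "((\<lambda>s. z s x) has_vector_derivative z') (at t)"
  proof -
    note d = partial_snd_has_derivative[OF op.Z_deriv[OF w]]
    have "frechet_derivative op.Z (at (x, t)) (0, s) = s *\<^sub>R z'" for s
      using linear_scale[OF has_derivative_linear[OF op.Z_deriv[OF w]], of s "(0, 1)"] by (simp add: z'_def)
    then have "((\<lambda>s. op.Z (x, s)) has_vector_derivative z') (at t)" using d by (simp add: has_vector_derivative_def)
    then show ?thesis
      by (rule has_vector_derivative_transform_within_open[OF _ open_Io t]) (use Z_eq Io_sub in auto)
  qed
  ultimately show ?thesis
    by (rule that) (simp add: g[OF x1(2)] x1 algebra_simps)
qed

text \<open>Joint continuity in space and time, which the Hessians at single times do not give; it
  bounds the normalising factor on compact time intervals.\<close>

lemma hess_continuous: "continuous_on (usphere \<times> Io) (\<lambda>w. A (snd w) (fst w))"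
proof -
  have C: "Cm_on 0 ((- {0}) \<times> Io) (\<lambda>w. blin (\<lambda>v. frechet_derivative op.Z (at w) (v, 0)))"
    by (rule Cm_on_blin[OF op.open_dom Cm_on_Suc_frechet[OF op.Cm_Z]])
  have A_eq: "A t y = blin (\<lambda>v. frechet_derivative op.Z (at (y, t)) (v, 0))" if t: "t \<in> Io" and y: "y \<noteq> 0" for t y
  proof -
    have tI: "t \<in> I" using t Io_sub by blast
    have "((\<lambda>y. op.Z (y, t)) has_derivative (\<lambda>v. frechet_derivative op.Z (at (y, t)) (v, 0))) (at y)"
      by (rule partial_fst_has_derivative[OF op.Z_deriv]) (use t y in simp)
    then have "(z t has_derivative (\<lambda>v. frechet_derivative op.Z (at (y, t)) (v, 0))) (at y)"
      using Z_eq(2)[OF tI tI] by simp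
    from frechet_derivative_at[OF this] show ?thesis
      unfolding A_def z_def convex_embedding.hess_def[OF emb[OF tI]] by simp
  qed
  have e: "blin (\<lambda>v. frechet_derivative op.Z (at w) (v, 0)) = A (snd w) (fst w)" if "w \<in> usphere \<times> Io" for w
  proof -
    obtain y t where w: "w = (y, t)" by (cases w)
    then have "t \<in> Io" "y \<noteq> 0" using that by auto
    from A_eq[OF this] show ?thesis by (simp add: w)
  qed
  have "continuous_on (usphere \<times> Io) (\<lambda>w. blin (\<lambda>v. frechet_derivative op.Z (at w) (v, 0)))"
    by (rule continuous_on_subset[OF Cm_on_continuous[OF C]]) auto
  then show ?thesis by (rule continuous_on_eq) (rule e)
qed

lemma continuous_sig_op: "continuous_on UNIV (sig k :: ('a \<Rightarrow>\<^sub>L 'a) \<Rightarrow> real)"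
proof -
  have "sig k differentiable (at B)" for B :: "'a \<Rightarrow>\<^sub>L 'a"
    using newton_differentiable(2)[of "\<lambda>B. B" B k] by (simp add: eta_contract_eq)
  then show ?thesis
    by (intro continuous_at_imp_continuous_on ballI differentiable_imp_continuous_within)
qed

text \<open>This bound is the rate of the exponential weight in
  \<open>support_stays_positive\<close>.\<close>

lemma eta_locally_bounded:
  assumes ab: "{a..b} \<subseteq> Io"
  obtains H where "\<And>t. t \<in> {a..b} \<Longrightarrow> eta t \<le> H"
proof -
  let ?K = "usphere \<times> {a..b}"
  let ?f = "\<lambda>w. \<psi> (fst w) * sig k (A (snd w) (fst w)) powr (1 + \<alpha>)"
  have kd: "k \<le> DIM('a) - 1" using k dim by simp
  have pos: "sig k (A t x) > 0" if "t \<in> I" "x \<in> usphere" for t x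
  proof -
    interpret definite_C3 "u t" "z t" "A t" "convex_embedding.hess_deriv (X t)" by (rule definite[OF that(1)])
    show ?thesis by (rule sig_pos[OF that(2) kd])
  qed
  have cA: "continuous_on ?K (\<lambda>w. A (snd w) (fst w))"
    by (rule continuous_on_subset[OF hess_continuous]) (use ab in auto)
  have cs: "continuous_on ?K (\<lambda>w. sig k (A (snd w) (fst w)))"
    by (rule continuous_on_compose2[OF continuous_sig_op cA]) auto
  have c\<psi>: "continuous_on ?K (\<lambda>w. \<psi> (fst w))"
    by (rule continuous_on_compose2[OF \<psi>_cont]) (auto intro!: continuous_intros)
  have ps: "0 < sig k (A (snd w) (fst w))" if "w \<in> ?K" for w
  proof (rule pos)
    have "snd w \<in> {a..b}" using that by auto
    then show "snd w \<in> I" using ab Io_sub by blast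
  qed (use that in auto)
  have "continuous_on ?K ?f"
    by (intro continuous_on_mult c\<psi> continuous_on_powr cs continuous_on_const ballI) (use ps in force)
  then have "bounded (?f ` ?K)"
    by (intro compact_imp_bounded compact_continuous_image compact_Times) auto
  then obtain H where H: "\<And>w. w \<in> ?K \<Longrightarrow> \<bar>?f w\<bar> \<le> H" unfolding bounded_iff by force
  show ?thesis
  proof (rule that)
    fix t assume t: "t \<in> {a..b}"
    then have tI: "t \<in> I" using ab Io_sub by blast
    interpret definite_C3 "u t" "z t" "A t" "convex_embedding.hess_deriv (X t)" by (rule definite[OF tI])
    show "eta t \<le> H" unfolding eta_def
    proof (rule flow_eta_le[OF refl kd \<psi>_cont])
      show "0 \<le> \<psi> x" if "x \<in> usphere" for x using \<psi>_pos[OF that] by simp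
      show "\<psi> x * sig k (A t x) powr (1 + \<alpha>) \<le> H" if "x \<in> usphere" for x
        using H[of "(x, t)"] that t by auto
    qed
  qed
qed

end

section \<open>The gradient estimate\<close>

text \<open>The superlevel set is compact, so its time coordinate attains a minimum.\<close>

lemma first_time:
  fixes f :: "'a::euclidean_space \<times> real \<Rightarrow> real"
  assumes cont: "continuous_on (usphere \<times> {0..t1}) f" and w: "x1 \<in> usphere" "0 \<le> t1" "f (x1, t1) \<ge> c"
  obtains t0 x0 where "t0 \<in> {0..t1}" "x0 \<in> usphere" "f (x0, t0) \<ge> c"
    "\<forall>s\<in>{0..<t0}. \<forall>x\<in>usphere. f (x, s) < c"
proof -
  let ?S = "usphere \<times> {0..t1}"
  define K where "K = ?S \<inter> f -` {c..}"
  have cS: "compact ?S" by (intro compact_Times) auto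
  have "closed K" unfolding K_def by (intro continuous_closed_preimage[OF cont] compact_imp_closed[OF cS]) auto
  then have "compact K" using compact_Int_closed[OF cS, of K] by (simp add: K_def Int_absorb1)
  moreover have "(x1, t1) \<in> K" using w by (simp add: K_def)
  then have "K \<noteq> {}" by blast
  moreover have "continuous_on K snd" by (intro continuous_intros)
  ultimately have "\<exists>w0\<in>K. \<forall>w\<in>K. snd w0 \<le> snd w" by (rule continuous_attains_inf)
  then obtain w0 where w0: "w0 \<in> K" "\<And>w. w \<in> K \<Longrightarrow> snd w0 \<le> snd w" by blast
  show ?thesis
  proof (rule that[of "snd w0" "fst w0"])
    show "snd w0 \<in> {0..t1}" "fst w0 \<in> usphere" "f (fst w0, snd w0) \<ge> c" using w0(1) by (auto simp: K_def)
    show "\<forall>s\<in>{0..<snd w0}. \<forall>x\<in>usphere. f (x, s) < c"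
    proof (intro ballI)
      fix s and x :: 'a assume s: "s \<in> {0..<snd w0}" "x \<in> usphere"
      have "snd w0 \<le> t1" using w0(1) by (auto simp: K_def)
      then have "(x, s) \<in> ?S" using s by simp
      show "f (x, s) < c"
      proof (rule ccontr)
        assume "\<not> f (x, s) < c"
        then have "(x, s) \<in> K" using \<open>(x, s) \<in> ?S\<close> by (simp add: K_def)
        from w0(2)[OF this] show False using s by simp
      qed
    qed
  qed
qed

text \<open>The power of the inradius, relative to the maximum of the support function (\<open>inradius_ge\<close>), that
  bounds the normalising factor from below.\<close>

definition fill :: "nat \<Rightarrow> nat \<Rightarrow> real \<Rightarrow> real \<Rightarrow> real" where
  "fill n k \<alpha> b = (min (1/4) ((3 / (16 * b)) powr (real n + 2) / 2)) powr (real k * (1 + \<alpha>))"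

context flow_solution
begin

lemma interval_subset: "t \<in> I \<Longrightarrow> {0..t} \<subseteq> I"
  by (auto simp: time_interval_def intro: le_less_trans[of "ereal _" "ereal t"])

lemma Io_I: "t \<in> I \<Longrightarrow> 0 < t \<Longrightarrow> t \<in> Io"
  by (auto simp: Io_def time_interval_def)

text \<open>The speed is nonnegative, so u_t \<ge> - \<eta> u. With \<eta> bounded by H, the
  function u e^(H t) cannot decrease up to a first zero of \<open>u\<close>.\<close>

lemma support_stays_positive:
  assumes init: "0 \<in> interior (convex hull (X 0 ` usphere))" and t: "t \<in> I" and x: "x \<in> usphere"
  shows "u t x > 0"
proof (rule ccontr)
  assume neg: "\<not> u t x > 0"
  have t0: "0 \<le> t" using t by (simp add: time_interval_def)
  have "continuous_on (usphere \<times> {0..t}) (\<lambda>w. - u (snd w) (fst w))"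
    by (intro continuous_on_minus continuous_on_subset[OF u_continuous] Sigma_mono interval_subset[OF t]) auto
  moreover have "- u (snd (x, t)) (fst (x, t)) \<ge> 0" using neg by simp
  ultimately obtain \<tau> y where \<tau>: "\<tau> \<in> {0..t}" "y \<in> usphere" "- u (snd (y, \<tau>)) (fst (y, \<tau>)) \<ge> 0"
    and before': "\<forall>s\<in>{0..<\<tau>}. \<forall>x\<in>usphere. - u (snd (x, s)) (fst (x, s)) < 0"
    by (rule first_time[OF _ x t0])
  have before: "u s x > 0" if "0 \<le> s" "s < \<tau>" "x \<in> usphere" for s x using before' that by simp
  have \<tau>I: "\<tau> \<in> I" using \<tau> interval_subset[OF t] by blast
  have "0 \<in> I" using interval_subset[OF t] t0 by auto
  interpret convex_embedding "X 0" by (rule emb[OF \<open>0 \<in> I\<close>])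
  have "u 0 y > 0" unfolding u_def by (rule support_pos[OF init \<tau>(2)])
  then have \<tau>0: "\<tau> > 0" using \<tau> by (cases "\<tau> = 0") auto
  \<comment> \<open>Starting at \<tau>/2 keeps the interval inside \<open>Io\<close>, where
    \<open>u\<close> is differentiable in time.\<close>
  have sub: "{\<tau>/2..\<tau>} \<subseteq> Io" using interval_subset[OF \<tau>I] \<tau>0 by (auto intro!: Io_I)
  obtain H where H: "\<And>s. s \<in> {\<tau>/2..\<tau>} \<Longrightarrow> eta s \<le> H" using eta_locally_bounded[OF sub] by blast
  have y1: "norm y = 1" "y \<noteq> 0" using \<tau>(2) by auto
  have d: "((\<lambda>s. u s y * exp (H * s)) has_real_derivative (speed s y + (H - eta s) * u s y) * exp (H * s)) (at s)"
    if s: "s \<in> Io" for s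
    by (rule derivative_eq_intros u_time_derivative(1)[OF s y1(2)] refl | simp add: y1 algebra_simps)+
  have "u (\<tau>/2) y * exp (H * (\<tau>/2)) \<le> u \<tau> y * exp (H * \<tau>)"
  proof (rule DERIV_nonneg_imp_increasing_open[where f="\<lambda>s. u s y * exp (H * s)"])
    fix s assume s: "\<tau>/2 < s" "s < \<tau>"
    have "s \<in> Io" using sub s by auto
    moreover have "0 \<le> (speed s y + (H - eta s) * u s y) * exp (H * s)"
      using speed_nonneg[OF y1(2)] H[of s] before[of s y] s \<tau>0 \<tau>(2) by (intro mult_nonneg_nonneg add_nonneg_nonneg) auto
    ultimately show "\<exists>r. ((\<lambda>s. u s y * exp (H * s)) has_real_derivative r) (at s) \<and> 0 \<le> r" using d by blast
  next
    show "continuous_on {\<tau>/2..\<tau>} (\<lambda>s. u s y * exp (H * s))"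
      using d sub by (intro continuous_at_imp_continuous_on ballI) (metis DERIV_isCont subsetD)
  qed (use \<tau>0 in auto)
  moreover have "u (\<tau>/2) y * exp (H * (\<tau>/2)) > 0" using before[of "\<tau>/2" y] \<tau>0 \<tau>(2) by simp
  moreover have "u \<tau> y * exp (H * \<tau>) \<le> 0" using \<tau>(3) by (simp add: mult_nonpos_nonneg)
  ultimately show False by linarith
qed

text \<open>The quotient at \<open>x\<close> was never larger before, yet
  \<open>gradient_estimate_at_max\<close> makes its time derivative negative.\<close>

lemma no_first_gradient_maximum:
  assumes t: "t \<in> Io" and x: "x \<in> usphere" and pos: "\<And>s y. s \<in> I \<Longrightarrow> y \<in> usphere \<Longrightarrow> u s y > 0"
    and \<gamma>: "\<gamma> = 1 / (real n + 2)"
    and max: "\<And>y. y \<in> usphere \<Longrightarrow> q t y / u t y powr \<gamma> \<le> q t x / u t x powr \<gamma>"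
    and big: "q t x \<ge> (6 * real n + 9) * (u t x)\<^sup>2" "q t x \<ge> (2 * \<Lambda> / (m * \<gamma>))\<^sup>2 * (u t x)\<^sup>2"
    and past: "\<And>s. 0 < s \<Longrightarrow> s < t \<Longrightarrow> q s x / u s x powr \<gamma> \<le> q t x / u t x powr \<gamma>"
  shows False
proof -
  have tI: "t \<in> I" using t Io_sub by blast
  have x1: "norm x = 1" "x \<noteq> 0" "sgn x = x" "x \<bullet> x = 1" using x by (auto simp: sgn_of_sphere dot_square_norm)
  interpret definite_C3 "u t" "z t" "A t" "convex_embedding.hess_deriv (X t)" by (rule definite[OF tI])
  have q: "grad_sq y = q t y" for y by (simp add: q_def)
  obtain F' z' where F': "(speed t has_derivative F') (at x)"
    and z': "((\<lambda>s. z s x) has_vector_derivative z') (at t)"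
    "\<And>v. z' \<bullet> v = (x \<bullet> v) * speed t x + F' v - eta t * (z t x \<bullet> v)"
    using speed_differentiable[OF t x] by blast
  have u0: "u t x > 0" by (rule pos[OF tI x])
  have "\<Lambda> \<ge> 0" using \<psi>_le[OF x] \<psi>_pos[OF x] by linarith
  have est: "2 * F' (z t x - u t x *\<^sub>R x) / q t x - 2 * eta t - \<gamma> * (speed t x - eta t * u t x) / u t x < 0"
    unfolding q[symmetric]
  proof (rule gradient_estimate_at_max[where k=k and n=n and \<psi>'="sph_deriv \<psi> x" and m=m and \<Lambda>=\<Lambda> and \<alpha>=\<alpha> and \<psi>=\<psi>])
    show "n = DIM('a) - 1" using dim by simp
    show "grad_sq x \<ge> (6 * real n + 9) * (u t x)\<^sup>2" "grad_sq x \<ge> (2 * \<Lambda> / (m * \<gamma>))\<^sup>2 * (u t x)\<^sup>2"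
      using big by (simp_all add: q)
  qed (rule speed_def | fact k x definite[OF x] pos[OF tI] \<gamma> max[folded q] m \<psi>_ge[OF x] \<open>\<Lambda> \<ge> 0\<close> \<alpha> eta_nonneg[OF tI] \<psi>_deriv[OF x] \<psi>_deriv_le[OF x] F')+
  have lin: "F' (a - b) = F' a - F' b" "F' (r *\<^sub>R a) = r * F' a" for a b r
    using linear_diff[OF has_derivative_linear[OF F']] linear_scale[OF has_derivative_linear[OF F']] by auto
  \<comment> \<open>The speed is constant along rays, so its derivative does not distinguish
    \<open>z\<close> from its tangential part.\<close>
  have Fx: "F' x = 0"
  proof (rule ray_derivative[OF _ x1(2), where f="speed t"])
    show "((\<lambda>y. speed t (sgn y)) has_derivative F') (at x)"
    proof (rule has_derivative_transform_within_open[OF F', of "- {0}"])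
      show "speed t y = speed t (sgn y)" if "y \<in> - {0}" for y
        using that sgn_of_sphere[of "sgn y"] norm_sgn[of y] by (simp add: speed_def)
    qed (use x1 in auto)
  qed
  define N where "N = 2 * F' (z t x) - 2 * eta t * q t x"
  define v where "v = speed t x - eta t * u t x"
  have du: "((\<lambda>s. u s x) has_real_derivative v) (at t)"
    using u_time_derivative(1)[OF t x1(2)] by (simp add: x1 v_def)
  \<comment> \<open>The undifferentiated speed cancels between the two parts of q, leaving its
    derivative along the position vector and - 2 \<eta> q.\<close>
  have dq: "((\<lambda>s. q s x) has_real_derivative N) (at t)"
  proof -
    have xz: "x \<bullet> z t x = u t x" using u_z[OF tI x1(2)] by (simp add: inner_commute)
    have "((\<lambda>s. z s x \<bullet> z s x) has_derivative (\<lambda>h. z t x \<bullet> (h *\<^sub>R z') + (h *\<^sub>R z') \<bullet> z t x)) (at t)"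
      using has_derivative_inner[OF z'(1)[unfolded has_vector_derivative_def] z'(1)[unfolded has_vector_derivative_def]] .
    then have "((\<lambda>s. z s x \<bullet> z s x) has_real_derivative 2 * (z' \<bullet> z t x)) (at t)"
      by (rule has_derivative_imp_has_field_derivative) (simp add: inner_commute[of "z t x"])
    from DERIV_diff[OF this DERIV_power[OF du, of 2]]
    have "((\<lambda>s. z s x \<bullet> z s x - (u s x)\<^sup>2) has_real_derivative 2 * (z' \<bullet> z t x) - 2 * (v * u t x)) (at t)"
      by (simp add: mult_ac)
    moreover have "2 * (z' \<bullet> z t x) - 2 * (v * u t x) = N"
      by (simp add: z'(2) xz N_def v_def q_eq[OF tI] power2_eq_square algebra_simps)
    ultimately have "((\<lambda>s. z s x \<bullet> z s x - (u s x)\<^sup>2) has_real_derivative N) (at t)" by simp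
    then show ?thesis
      by (rule has_field_derivative_transform_within_open[OF _ open_Io t]) (use q_eq Io_sub in auto)
  qed
  have "(6 * real n + 9) * (u t x)\<^sup>2 > 0" using u0 by (intro mult_pos_pos) auto
  then have q0: "q t x > 0" using big(1) by linarith
  define W where "W = u t x powr (- \<gamma>)"
  have W: "W > 0" using u0 by (simp add: W_def)
  have "((\<lambda>s. q s x * u s x powr (- \<gamma>)) has_real_derivative N * W + (W * (0 * ln (u t x) + v * (- \<gamma>) / u t x)) * q t x) (at t)"
    unfolding W_def by (intro DERIV_mult dq DERIV_powr du u0 DERIV_const)
  moreover have "N * W + (W * (0 * ln (u t x) + v * (- \<gamma>) / u t x)) * q t x
      = (q t x * W) * (2 * F' (z t x - u t x *\<^sub>R x) / q t x - 2 * eta t - \<gamma> * v / u t x)"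
    using q0 u0 by (simp add: lin Fx N_def field_simps)
  ultimately have "((\<lambda>s. q s x * u s x powr (- \<gamma>)) has_real_derivative
      (q t x * W) * (2 * F' (z t x - u t x *\<^sub>R x) / q t x - 2 * eta t - \<gamma> * v / u t x)) (at t)" by simp
  from DERIV_neg_dec_left[OF this mult_pos_neg[OF mult_pos_pos[OF q0 W] est[folded v_def]]]
  obtain d where d: "d > 0" "\<And>h. 0 < h \<Longrightarrow> h < d \<Longrightarrow> q t x * u t x powr (- \<gamma>) < q (t - h) x * u (t - h) x powr (- \<gamma>)"
    by auto
  have t0: "t > 0" using t by (simp add: Io_def)
  define h where "h = min d t / 2"
  have h: "0 < h" "h < d" "h < t" using d(1) t0 by (auto simp: h_def)
  then show False using d(2)[of h] past[of "t - h"] by (simp add: powr_minus divide_inverse)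
qed

text \<open>The inradius makes \<eta> u at least of order R^(k\<alpha>+k+1), against a speed of
  order R^(k\<alpha>). As R \<ge> 1, one surplus factor R, made large by \<open>R2\<close>, already
  decides.\<close>

lemma no_first_support_maximum:
  assumes t: "t \<in> Io" and x: "x \<in> usphere" and pos: "\<And>y. y \<in> usphere \<Longrightarrow> u t y > 0"
    and \<gamma>: "\<gamma> = 1 / (real n + 2)" and b: "b > 0"
    and max: "\<And>y. y \<in> usphere \<Longrightarrow> u t y \<le> u t x"
    and grad: "\<And>y. y \<in> usphere \<Longrightarrow> q t y / u t y powr \<gamma> \<le> b * u t x powr (2 - \<gamma>)"
    and R1: "u t x \<ge> 1"
    and R2: "m * bump_integral (\<lambda>_::'a. 1) / sphere_area TYPE('a) * fill n k \<alpha> b * u t x > \<Lambda> * real (n choose k) powr \<alpha>"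
    and past: "\<And>s. 0 < s \<Longrightarrow> s < t \<Longrightarrow> u s x \<le> u t x"
  shows False
proof -
  have tI: "t \<in> I" using t Io_sub by blast
  have x1: "norm x = 1" "x \<noteq> 0" "sgn x = x" using x by (auto simp: sgn_of_sphere)
  interpret definite_C3 "u t" "z t" "A t" "convex_embedding.hess_deriv (X t)" by (rule definite[OF tI])
  define R where "R = u t x"
  have R: "R \<ge> 1" using R1 by (simp add: R_def)
  have n: "DIM('a) - 1 = n" using dim by simp
  define \<kappa> where "\<kappa> = min (1/4) ((3 / (16 * b)) powr (real n + 2) / 2)"
  have \<kappa>0: "\<kappa> > 0" using b by (simp add: \<kappa>_def)
  define r where "r = real k * \<alpha>"
  define c0 where "c0 = m * bump_integral (\<lambda>_::'a. 1) / sphere_area TYPE('a) * fill n k \<alpha> b"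
  have c00: "c0 > 0" unfolding c0_def fill_def \<kappa>_def[symmetric]
    using \<kappa>0 m bump_integral_1_pos[where 'a='a] sphere_area_pos[where 'a='a] by (intro mult_pos_pos divide_pos_pos) auto
  have "m * bump_integral (\<lambda>_::'a. 1) / sphere_area TYPE('a) * (\<kappa> * R) powr (real k * (1 + \<alpha>)) \<le> eta t"
    unfolding eta_def
  proof (rule flow_eta_ge[OF refl _ \<alpha> \<psi>_cont \<psi>_ge m])
    show "\<kappa> * R \<le> u t y - ((u t x / 2) *\<^sub>R x) \<bullet> y" if y: "y \<in> usphere" for y
    proof -
      have g: "grad_sq y / u t y powr \<gamma> \<le> b * u t x powr (2 - \<gamma>)" if "y \<in> usphere" for y
        using grad[OF that] by (simp add: q_def)
      have "\<gamma> > 0" using \<gamma> by simp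
      from inradius_ge[OF x max pos this b g y] show ?thesis by (simp add: \<kappa>_def R_def \<gamma>)
    qed
  qed (use k n \<kappa>0 R in auto)
  moreover have "(\<kappa> * R) powr (real k * (1 + \<alpha>)) = fill n k \<alpha> b * (R powr r * R ^ k)"
    using R by (simp add: powr_mult fill_def \<kappa>_def r_def powr_add powr_realpow distrib_left mult_ac)
  ultimately have "c0 * (R powr r * R ^ k) \<le> eta t" by (simp add: c0_def mult_ac)
  moreover have "c0 * (R powr r * 1) \<le> c0 * (R powr r * R ^ k)"
    using c00 R by (intro mult_left_mono) auto
  ultimately have "c0 * R powr r \<le> eta t" by simp
  then have eta: "c0 * R powr r * R \<le> eta t * R" using R by (intro mult_right_mono) auto
  have "speed t x = \<psi> x * sig k (A t x) powr \<alpha>" by (simp add: speed_def x1)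
  also have "\<dots> \<le> \<Lambda> * (real (n choose k) * R ^ k) powr \<alpha>"
  proof (intro mult_mono \<psi>_le[OF x] powr_mono2)
    show "sig k (A t x) \<le> real (n choose k) * R ^ k" using sig_le_at_max[OF x max, of k, unfolded n] by (simp add: R_def)
    show "0 \<le> \<Lambda>" using \<psi>_le[OF x] \<psi>_pos[OF x] by linarith
  qed (use \<alpha> sig_nonneg[OF x] in auto)
  also have "(real (n choose k) * R ^ k) powr \<alpha> = real (n choose k) powr \<alpha> * R powr r"
    using R by (simp add: powr_mult r_def powr_powr flip: powr_realpow)
  finally have "speed t x \<le> (\<Lambda> * real (n choose k) powr \<alpha>) * R powr r" by (simp add: mult_ac)
  also have "\<dots> < (c0 * R) * R powr r" using R2 R by (intro mult_strict_right_mono) (auto simp: c0_def R_def)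
  also have "\<dots> \<le> eta t * R" using eta by (simp add: mult_ac)
  finally have neg: "speed t x - eta t * u t x < 0" by (simp add: R_def)
  have "((\<lambda>s. u s x) has_real_derivative speed t x - eta t * u t x) (at t)"
    using u_time_derivative(1)[OF t x1(2)] by (simp add: x1)
  from DERIV_neg_dec_left[OF this neg]
  obtain d where d: "d > 0" "\<And>h. 0 < h \<Longrightarrow> h < d \<Longrightarrow> u t x < u (t - h) x" by auto
  have t0: "t > 0" using t by (simp add: Io_def)
  define h where "h = min d t / 2"
  have h: "0 < h" "h < d" "h < t" using d(1) t0 by (auto simp: h_def)
  then show False using d(2)[of h] past[of "t - h"] by simp
qed

text \<open>As \<open>C\<close> exceeds all initial values, the first time is positive; as it
  exceeds b R^(2-\<gamma>), a maximum attained by the competitor has u > R. In the other case the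
  two lower bounds on \<open>b\<close> supply the two conditions \<open>big\<close> of
  \<open>no_first_gradient_maximum\<close>.\<close>

lemma gradient_bound:
  assumes init: "0 \<in> interior (convex hull (X 0 ` usphere))" and \<gamma>: "\<gamma> = 1 / (real n + 2)"
    and b: "b \<ge> 6 * real n + 9" "b \<ge> (2 * \<Lambda> / (m * \<gamma>))\<^sup>2"
    and R: "R \<ge> 1" "m * bump_integral (\<lambda>_::'a. 1) / sphere_area TYPE('a) * fill n k \<alpha> b * R \<ge> \<Lambda> * real (n choose k) powr \<alpha>"
    and C: "\<And>x. x \<in> usphere \<Longrightarrow> q 0 x / u 0 x powr \<gamma> < C" "\<And>x. x \<in> usphere \<Longrightarrow> b * u 0 x powr (2 - \<gamma>) < C"
      "b * R powr (2 - \<gamma>) < C"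
    and t: "t \<in> I" and x: "x \<in> usphere"
  shows "q t x / u t x powr \<gamma> \<le> C"
proof (rule ccontr)
  assume neg: "\<not> q t x / u t x powr \<gamma> \<le> C"
  have t0: "0 \<le> t" using t by (simp add: time_interval_def)
  have pos: "u s y > 0" if "s \<in> I" "y \<in> usphere" for s y by (rule support_stays_positive[OF init that])
  have b0: "b > 0" using b(1) by linarith
  have \<gamma>1: "0 < \<gamma>" "\<gamma> < 1" using \<gamma> by auto
  define \<phi> where "\<phi> s y = q s y / u s y powr \<gamma>" for s y
  define \<beta> where "\<beta> s y = b * u s y powr (2 - \<gamma>)" for s y
  define f where "f w = max (\<phi> (snd w) (fst w)) (\<beta> (snd w) (fst w))" for w
  have pw: "u (snd w) (fst w) \<noteq> 0" if "w \<in> usphere \<times> I" for w using pos[of "snd w" "fst w"] that by force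
  have "continuous_on (usphere \<times> I) f"
    unfolding f_def \<phi>_def \<beta>_def using pw
    by (intro continuous_on_max continuous_on_divide continuous_on_mult continuous_on_const continuous_on_powr u_continuous q_continuous) auto
  then have "continuous_on (usphere \<times> {0..t}) f"
    by (rule continuous_on_subset) (use interval_subset[OF t] in auto)
  moreover have "f (x, t) \<ge> C" using neg by (simp add: f_def \<phi>_def)
  ultimately obtain \<tau> y where \<tau>: "\<tau> \<in> {0..t}" "y \<in> usphere" "f (y, \<tau>) \<ge> C"
    and before: "\<forall>s\<in>{0..<\<tau>}. \<forall>x\<in>usphere. f (x, s) < C"
    by (rule first_time[OF _ x t0])
  have \<tau>I: "\<tau> \<in> I" using \<tau> interval_subset[OF t] by blast
  have "\<tau> \<noteq> 0" using \<tau>(3) C(1,2)[OF \<tau>(2)] by (auto simp: f_def \<phi>_def \<beta>_def)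
  then have \<tau>0: "\<tau> > 0" using \<tau>(1) by auto
  have \<tau>o: "\<tau> \<in> Io" by (rule Io_I[OF \<tau>I \<tau>0])
  have "continuous_on usphere (\<lambda>y. f (y, \<tau>))"
    by (rule continuous_on_compose2[OF \<open>continuous_on (usphere \<times> I) f\<close>]) (use \<tau>I in \<open>auto intro!: continuous_intros\<close>)
  then obtain x0 where x0: "x0 \<in> usphere" "\<And>y. y \<in> usphere \<Longrightarrow> f (y, \<tau>) \<le> f (x0, \<tau>)"
    using continuous_attains_sup[of usphere "\<lambda>y. f (y, \<tau>)"] \<tau>(2) by auto
  have fC: "f (x0, \<tau>) \<ge> C" using x0(2)[OF \<tau>(2)] \<tau>(3) by simp
  have u0: "u \<tau> x0 > 0" by (rule pos[OF \<tau>I x0(1)])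
  have past: "\<phi> s x0 < C" "\<beta> s x0 < C" if "0 < s" "s < \<tau>" for s
    using before x0(1) that by (auto simp: f_def)
  have mono: "v \<le> w" if "b * v powr (2 - \<gamma>) \<le> b * w powr (2 - \<gamma>)" "w \<ge> 0" "v \<ge> 0" for v w
  proof (rule ccontr)
    assume "\<not> v \<le> w"
    then have "w powr (2 - \<gamma>) < v powr (2 - \<gamma>)" using that \<gamma>1 by (intro powr_less_mono2) auto
    then show False using that(1) b0 by simp
  qed
  show False
  proof (cases "\<beta> \<tau> x0 \<le> \<phi> \<tau> x0")
    case True
    then have f0: "f (x0, \<tau>) = \<phi> \<tau> x0" by (simp add: f_def)
    have "b * (u \<tau> x0 powr (2 - \<gamma>) * u \<tau> x0 powr \<gamma>) \<le> q \<tau> x0"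
      using True u0 by (simp add: \<phi>_def \<beta>_def le_divide_eq mult_ac)
    moreover have "u \<tau> x0 powr (2 - \<gamma>) * u \<tau> x0 powr \<gamma> = (u \<tau> x0)\<^sup>2"
      using u0 by (simp add: powr_numeral flip: powr_add)
    ultimately have bq: "b * (u \<tau> x0)\<^sup>2 \<le> q \<tau> x0" by simp
    show False
    proof (rule no_first_gradient_maximum[OF \<tau>o x0(1) pos \<gamma>])
      show "(6 * real n + 9) * (u \<tau> x0)\<^sup>2 \<le> q \<tau> x0" "(2 * \<Lambda> / (m * \<gamma>))\<^sup>2 * (u \<tau> x0)\<^sup>2 \<le> q \<tau> x0"
        using bq mult_right_mono[OF b(1), of "(u \<tau> x0)\<^sup>2"] mult_right_mono[OF b(2), of "(u \<tau> x0)\<^sup>2"] by auto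
      show "q \<tau> y / u \<tau> y powr \<gamma> \<le> q \<tau> x0 / u \<tau> x0 powr \<gamma>" if "y \<in> usphere" for y
        using x0(2)[OF that] f0 by (simp add: f_def \<phi>_def)
      show "q s x0 / u s x0 powr \<gamma> \<le> q \<tau> x0 / u \<tau> x0 powr \<gamma>" if "0 < s" "s < \<tau>" for s
        using past[OF that] fC f0 by (simp add: \<phi>_def)
    qed
  next
    case False
    then have f0: "f (x0, \<tau>) = \<beta> \<tau> x0" by (simp add: f_def)
    have up: "u \<tau> y \<ge> 0" if "y \<in> usphere" for y using pos[OF \<tau>I that] by simp
    have "R \<le> u \<tau> x0" "R \<noteq> u \<tau> x0"
      using mono[of R "u \<tau> x0"] C(3) fC f0 R(1) u0 by (auto simp: \<beta>_def)
    then have RR: "R < u \<tau> x0" by simp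
    have c0: "m * bump_integral (\<lambda>_::'a. 1) / sphere_area TYPE('a) * fill n k \<alpha> b > 0"
      unfolding fill_def using b0 m bump_integral_1_pos[where 'a='a] sphere_area_pos[where 'a='a]
      by (intro mult_pos_pos divide_pos_pos) (auto simp: min_def)
    show False
    proof (rule no_first_support_maximum[OF \<tau>o x0(1) pos[OF \<tau>I] \<gamma> b0])
      show "u \<tau> y \<le> u \<tau> x0" if "y \<in> usphere" for y
        using mono[OF _ up[OF x0(1)] up[OF that]] x0(2)[OF that] f0 by (simp add: f_def \<beta>_def)
      show "q \<tau> y / u \<tau> y powr \<gamma> \<le> b * u \<tau> x0 powr (2 - \<gamma>)" if "y \<in> usphere" for y
        using x0(2)[OF that] f0 by (simp add: f_def \<phi>_def \<beta>_def)
      show "1 \<le> u \<tau> x0" using R(1) RR by simp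
      show "m * bump_integral (\<lambda>_::'a. 1) / sphere_area TYPE('a) * fill n k \<alpha> b * u \<tau> x0 > \<Lambda> * real (n choose k) powr \<alpha>"
        using mult_strict_left_mono[OF RR c0] R(2) by linarith
      fix s assume s: "0 < s" "s < \<tau>"
      have "s \<in> I" using s interval_subset[OF \<tau>I] by auto
      then have "u s x0 > 0" by (rule pos[OF _ x0(1)])
      then show "u s x0 \<le> u \<tau> x0"
        using mono[of "u s x0" "u \<tau> x0"] past(2)[OF s] fC f0 u0 by (simp add: \<beta>_def)
    qed
  qed
qed

end

section \<open>Uniform bounds for functions on the sphere\<close>

lemma usphere_nonempty: "(usphere :: 'a::euclidean_space set) \<noteq> {}"
  using nonempty_Basis norm_Basis by (metis dist_0_norm empty_iff equals0I mem_sphere)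

lemma smooth_sphere_function:
  fixes \<psi> :: "'a::euclidean_space \<Rightarrow> real"
  assumes \<psi>: "smooth_on usphere \<psi>"
  shows "x \<in> usphere \<Longrightarrow> ((\<lambda>y. \<psi> (sgn y)) has_derivative sph_deriv \<psi> x) (at x)"
    and "x \<in> usphere \<Longrightarrow> sph_deriv \<psi> x v = sph_grad \<psi> x \<bullet> v"
    and "continuous_on usphere (sph_grad \<psi>)"
proof -
  have C: "Cm_on m (- {0}) (\<lambda>y. \<psi> (sgn y))" for m
    by (rule smooth_on_compose[OF \<psi>]) (auto simp: Cm_on_sgn norm_sgn split: if_splits)
  show d: "((\<lambda>y. \<psi> (sgn y)) has_derivative sph_deriv \<psi> x) (at x)" if "x \<in> usphere" for x
  proof -
    have "x \<in> - {0}" using that by auto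
    from Cm_on_has_derivative[OF C this] show ?thesis by (simp add: sph_deriv_def[abs_def])
  qed
  show "sph_deriv \<psi> x v = sph_grad \<psi> x \<bullet> v" if "x \<in> usphere"
    using linear_Basis_expansion[OF has_derivative_linear[OF d[OF that]], of v]
    by (simp add: sph_grad_def inner_sum_left inner_commute[of v] mult.commute)
  have "continuous_on (- {0}) (\<lambda>x. sph_deriv \<psi> x b)" for b
    using Cm_on_continuous[OF Cm_on_Suc_frechet[OF C, where m=0 and v=b]] by (simp add: sph_deriv_def[abs_def])
  then have "continuous_on usphere (\<lambda>x. sph_deriv \<psi> x b)" for b
    by (rule continuous_on_subset) auto
  then show "continuous_on usphere (sph_grad \<psi>)"
    unfolding sph_grad_def[abs_def] by (intro continuous_on_sum continuous_on_scaleR continuous_on_const)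
qed

lemma continuous_on_usphere_bound:
  fixes f :: "'a::euclidean_space \<Rightarrow> real"
  assumes "continuous_on usphere f"
  obtains B where "\<And>x. x \<in> usphere \<Longrightarrow> \<bar>f x\<bar> \<le> B"
proof -
  have "bounded (f ` usphere)" by (intro compact_imp_bounded compact_continuous_image assms) auto
  then obtain B where "\<forall>y\<in>f ` usphere. norm y \<le> B" by (auto simp: bounded_iff)
  then show ?thesis using that[of B] by simp
qed

lemma le_SUP_usphere:
  fixes f :: "'a::euclidean_space \<Rightarrow> real"
  assumes "continuous_on usphere f" "x \<in> usphere" shows "f x \<le> (SUP y\<in>usphere. f y)"
proof (rule cSUP_upper[OF assms(2)])
  have "bounded (f ` usphere)" by (intro compact_imp_bounded compact_continuous_image assms) auto
  then show "bdd_above (f ` usphere)" by (rule bounded_imp_bdd_above)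
qed

lemma C1_norm_bounds:
  fixes \<psi> :: "'a::euclidean_space \<Rightarrow> real"
  assumes \<psi>: "smooth_on usphere \<psi>" and x: "x \<in> usphere"
  shows "\<psi> x \<le> C1_norm \<psi>" "sph_deriv \<psi> x v \<le> C1_norm \<psi> * norm v"
proof -
  have "continuous_on usphere (\<lambda>x. \<bar>\<psi> x\<bar>)" "continuous_on usphere (\<lambda>x. norm (sph_grad \<psi> x))"
    using smooth_on_imp_continuous_on[OF \<psi>] smooth_sphere_function(3)[OF \<psi>] by (auto intro!: continuous_intros)
  from this[THEN le_SUP_usphere, OF x] have le: "\<bar>\<psi> x\<bar> + norm (sph_grad \<psi> x) \<le> C1_norm \<psi>"
    unfolding C1_norm_def by linarith
  then show "\<psi> x \<le> C1_norm \<psi>" using norm_ge_zero[of "sph_grad \<psi> x"] by linarith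
  have "sph_deriv \<psi> x v \<le> norm (sph_grad \<psi> x) * norm v"
    unfolding smooth_sphere_function(2)[OF \<psi> x] by (rule norm_cauchy_schwarz)
  also have "\<dots> \<le> C1_norm \<psi> * norm v" using le by (intro mult_right_mono) auto
  finally show "sph_deriv \<psi> x v \<le> C1_norm \<psi> * norm v" .
qed

lemma INF_usphere:
  fixes \<psi> :: "'a::euclidean_space \<Rightarrow> real"
  assumes \<psi>: "continuous_on usphere \<psi>" and pos: "\<And>x. x \<in> usphere \<Longrightarrow> \<psi> x > 0"
  shows "(INF x\<in>usphere. \<psi> x) > 0" "x \<in> usphere \<Longrightarrow> (INF x\<in>usphere. \<psi> x) \<le> \<psi> x"
proof -
  obtain x0 where x0: "x0 \<in> usphere" "\<And>x. x \<in> usphere \<Longrightarrow> \<psi> x0 \<le> \<psi> x"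
    using continuous_attains_inf[OF compact_sphere usphere_nonempty \<psi>] by blast
  have "(INF x\<in>usphere. \<psi> x) = \<psi> x0" by (rule cInf_eq_minimum) (use x0 in auto)
  then show "(INF x\<in>usphere. \<psi> x) > 0" "x \<in> usphere \<Longrightarrow> (INF x\<in>usphere. \<psi> x) \<le> \<psi> x"
    using x0 pos by auto
qed

theorem lemma3p1:
  fixes M0 :: "'a::euclidean_space set" and n k :: nat and \<alpha> m \<Lambda> :: real
  assumes "DIM('a) = n + 1"
    and "1 \<le> k" and "k \<le> n - 1" and "\<alpha> > 1 / real k"
    and "uniformly_convex_hypersurface M0"
    and "0 \<in> interior (convex hull M0)"
    and "(LINT x|sphere_measure. support_fun M0 x * sigma_radii k (support_fun M0) x) = sphere_area TYPE('a)"
  shows "\<exists>C>0. \<exists>\<gamma>\<in>{0<..<1}. \<forall>(\<psi> :: 'a \<Rightarrow> real) (T :: ereal) (X :: real \<Rightarrow> 'a \<Rightarrow> 'a).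
      smooth_on usphere \<psi> \<and> (\<forall>x\<in>usphere. \<psi> x > 0) \<and>
      (INF x\<in>usphere. \<psi> x) = m \<and> C1_norm \<psi> = \<Lambda> \<and>
      T > 0 \<and> normalised_flow k \<alpha> \<psi> T X \<and> X 0 ` usphere = M0 \<longrightarrow>
      (\<forall>t\<in>time_interval T. \<forall>x\<in>usphere.
         (norm (sph_grad (support_fun (X t ` usphere)) x))\<^sup>2
           / support_fun (X t ` usphere) x powr \<gamma> \<le> C)"
proof -
  obtain F where F: "uniformly_convex_embedding F" "M0 = F ` usphere"
    using assms(5) unfolding uniformly_convex_hypersurface_def by blast
  interpret F: convex_embedding F by unfold_locales (use F assms(1-3) in auto)
  let ?u = "support_fun (F ` usphere)"
  have u0: "?u x > 0" if "x \<in> usphere" for x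
    by (rule F.support_pos[OF _ that]) (use assms(6) F(2) in simp)
  define \<gamma> where "\<gamma> = 1 / (real n + 2)"
  have \<gamma>: "0 < \<gamma>" "\<gamma> < 1" by (auto simp: \<gamma>_def)
  \<comment> \<open>The first entry dominates the lower order terms of the maximum principle, the
    second the derivative of \<psi>.\<close>
  define b where "b = max (6 * real n + 9) ((2 * \<Lambda> / (m * \<gamma>))\<^sup>2)"
  define c where "c = m * bump_integral (\<lambda>_::'a. 1) / sphere_area TYPE('a) * fill n k \<alpha> b"
  \<comment> \<open>Above this size the normalising term outweighs the speed at a maximum of
    \<open>u\<close>. The sign of \<open>c\<close> is settled once some \<psi> with these data is
    given.\<close>
  define R where "R = max 1 (\<Lambda> * real (n choose k) powr \<alpha> / c)"
  have u_nz: "?u x \<noteq> 0" if "x \<in> usphere" for x using u0[OF that] by simp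
  obtain B1 where B1: "\<And>x. x \<in> usphere \<Longrightarrow> \<bar>F.support.grad_sq x / ?u x powr \<gamma>\<bar> \<le> B1"
  proof (rule continuous_on_usphere_bound)
    show "continuous_on usphere (\<lambda>x. F.support.grad_sq x / ?u x powr \<gamma>)"
      using u_nz by (intro continuous_on_divide F.continuous_grad_sq continuous_on_powr F.support.continuous_U continuous_on_const) auto
  qed blast
  obtain B2 where B2: "\<And>x. x \<in> usphere \<Longrightarrow> \<bar>b * ?u x powr (2 - \<gamma>)\<bar> \<le> B2"
  proof (rule continuous_on_usphere_bound)
    show "continuous_on usphere (\<lambda>x. b * ?u x powr (2 - \<gamma>))"
      using u_nz by (intro continuous_on_mult continuous_on_powr F.support.continuous_U continuous_on_const) auto
  qed blast
  \<comment> \<open>All constants are fixed by M0 and the numbers n, k, \<alpha>, m, \<Lambda>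
    before \<psi>, T and X appear. The added 1 gives strict inequalities.\<close>
  define C where "C = max (max 0 (b * R powr (2 - \<gamma>))) (max B1 B2) + 1"
  have "C > 0" by (simp add: C_def)
  moreover have "(norm (sph_grad (support_fun (X t ` usphere)) x))\<^sup>2 / support_fun (X t ` usphere) x powr \<gamma> \<le> C"
    if \<psi>: "smooth_on usphere \<psi>" "\<forall>x\<in>usphere. \<psi> x > 0" and m: "(INF x\<in>usphere. \<psi> x) = m" and \<Lambda>: "C1_norm \<psi> = \<Lambda>"
      and T: "T > 0" and X: "normalised_flow k \<alpha> \<psi> T X" "X 0 ` usphere = M0" and t: "t \<in> time_interval T" and x: "x \<in> usphere"
    for \<psi> :: "'a \<Rightarrow> real" and T X t x
  proof -
    have cont: "continuous_on usphere \<psi>" by (rule smooth_on_imp_continuous_on[OF \<psi>(1)])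
    have pos: "\<psi> x > 0" if "x \<in> usphere" for x using \<psi>(2) that by blast
    have "\<alpha> > 0" using assms(4) by (rule le_less_trans[rotated]) simp
    have inf: "m > 0" "\<And>x. x \<in> usphere \<Longrightarrow> m \<le> \<psi> x"
      unfolding m[symmetric] by (rule INF_usphere(1)[OF cont pos], assumption, rule INF_usphere(2)[OF cont pos])
    have bounds: "\<psi> x \<le> \<Lambda>" "sph_deriv \<psi> x v \<le> \<Lambda> * norm v" if "x \<in> usphere" for x v
      unfolding \<Lambda>[symmetric] by (rule C1_norm_bounds[OF \<psi>(1) that])+
    interpret S: flow_solution k n \<alpha> m \<Lambda> \<psi> T X
    proof
      show "k \<le> n" using assms(3) by simp
    qed (fact assms(1,2) \<open>\<alpha> > 0\<close> cont inf bounds smooth_sphere_function(1)[OF \<psi>(1)] X(1))+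
    have init: "0 \<in> interior (convex hull (X 0 ` usphere))" using assms(6) X(2) by simp
    have q: "S.q t x = (norm (sph_grad (support_fun (X t ` usphere)) x))\<^sup>2"
      if "t \<in> time_interval T" "x \<in> usphere" for t x
    proof -
      interpret E: convex_embedding "X t" by (rule S.emb[OF that(1)])
      show ?thesis unfolding E.norm_sph_grad[OF that(2)] S.q_def S.u_def S.z_def ..
    qed
    have "0 \<in> time_interval T" using T by (simp add: time_interval_def zero_ereal_def)
    have u: "S.u 0 = ?u" by (simp add: S.u_def X(2) F(2))
    \<comment> \<open>The parametrisation \<open>F\<close> and the initial map \<open>X 0\<close>
      may differ, but support function and gradient depend only on their common image.\<close>
    have q0: "S.q 0 x = F.support.grad_sq x" if "x \<in> usphere" for x
      using q[OF \<open>0 \<in> time_interval T\<close> that] F.norm_sph_grad[OF that] by (simp add: X(2) F(2))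
    have "b > 0" by (simp add: b_def)
    have "c > 0" unfolding c_def fill_def
      using \<open>b > 0\<close> inf(1) bump_integral_1_pos[where 'a='a] sphere_area_pos[where 'a='a]
      by (intro mult_pos_pos divide_pos_pos) (auto simp: min_def)
    have "S.q t x / S.u t x powr \<gamma> \<le> C"
    proof (rule S.gradient_bound[OF init \<gamma>_def _ _ _ _ _ _ _ t x])
      show "6 * real n + 9 \<le> b" "(2 * \<Lambda> / (m * \<gamma>))\<^sup>2 \<le> b" by (auto simp: b_def)
      show "1 \<le> R" by (simp add: R_def)
      have "\<Lambda> * real (n choose k) powr \<alpha> / c \<le> R" by (simp add: R_def)
      then show "\<Lambda> * real (n choose k) powr \<alpha> \<le> m * bump_integral (\<lambda>_::'a. 1) / sphere_area TYPE('a) * fill n k \<alpha> b * R"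
        using \<open>c > 0\<close> unfolding c_def[symmetric] by (simp add: divide_le_eq mult.commute)
      show "S.q 0 x / S.u 0 x powr \<gamma> < C" if "x \<in> usphere" for x
        using order_trans[OF abs_ge_self B1[OF that]] by (simp add: q0[OF that] u C_def)
      show "b * S.u 0 x powr (2 - \<gamma>) < C" if "x \<in> usphere" for x
        using order_trans[OF abs_ge_self B2[OF that]] by (simp add: u C_def)
      show "b * R powr (2 - \<gamma>) < C" by (simp add: C_def)
    qed
    then show ?thesis by (simp add: q[OF t x] S.u_def)
  qed
  ultimately show ?thesis using \<gamma> by (intro exI[of _ C] conjI bexI[of _ \<gamma>]) auto
qed

end
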